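(* The injections of curved coalgebras are precisely the strong cofibrations: a morphism $f:C\to C'$ of curved coalgebras is injective if and only if for every curved algebra $A$ the induced dg functor $\mathrm{MC}_{dg}(C',A)\to\mathrm{MC}_{dg}(C,A)$ is a fibration of dg categories.
   Context: Throughout, $k$ is a fixed perfect field, everything is over $k$ and cohomologically $\mathbb Z$-graded, and $[a,b]=ab-(-1)^{|a||b|}ba$. A curved algebra is a unital graded algebra $A$ with a degree $1$ derivation $d$ and an element $h\in A^2$ (the curvature) with $dh=0$ and $d^2(a)=[h,a]$ for all $a$; the zero algebra is allowed. A morphism $A\to B$ is a pair $(f,b)$ with $f$ a graded algebra map and $b\in B^1$ such that $f(da)=d(fa)+[b,fa]$ and $f(h_A)=h_B+db+b^2$; composition is $(g,c)(f,b)=(gf,c+g(b))$. A pseudocompact curved algebra is a cofiltered limit of finite dimensional curved algebras, with the inverse limit topology; a morphism $A\to B$ of pseudocompact curved algebras is a pair $(f,b)$ with $f$ a continuous graded algebra map and $b\in B^1$ such that $f(da)=d(fa)+[b,fa]$ and $f(h_A)=h_B+db+b^2$, and composition is $(g,c)(f,b)=(gf,c+g(b))$. A curved coalgebra is a graded coalgebra $C$ with a degree $1$ coderivation $d$ and a functional $h:C\to k$ of degree $2$ such that $(C^*,d^*,h)$ is a pseudocompact curved algebra; morphisms $C\to D$ are the morphisms $D^*\to C^*$ of pseudocompact curved algebras, so a morphism has an underlying graded coalgebra map. The zero coalgebra is allowed. A morphism of curved coalgebras is an injection if its underlying graded map is injective. MC elements of a curved algebra $A$ are the $x\in A^1$ with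 $h+dx+x^2=0$. The dg category $\mathrm{MC}_{dg}(A)$ has the MC elements as objects, and the complex of morphisms $x\to y$ is the graded space $A$ with differential $a\mapsto da+ya-(-1)^{|a|}ax$; composition is multiplication. A morphism $(f,b)$ acts by $x\mapsto b+f(x)$ on objects and by $f$ on morphisms. Convolution algebra: $\mathrm{Hom}(C,A)=C^*\hat\otimes A=\varprojlim_i C_i^*\otimes A$ ($C_i$ the finite dimensional curved subcoalgebras of $C$), with the usual tensor product differential and curvature $h\otimes1+1\otimes h$. $\mathrm{MC}_{dg}(C,A)=\mathrm{MC}_{dg}(\mathrm{Hom}(C,A))$. A fibration of dg categories is a dg functor $F$ that is surjective on hom-complexes and such that $H^0F$ is an isofibration. *)

theory Defs
  imports
    "HOL-Analysis.Analysis"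
    "HOL-Library.Function_Algebras"
    "HOL-Computational_Algebra.Computational_Algebra"
begin

section \<open>Graded vector spaces\<close>

text \<open>
  The ground field is a type \<open>'k :: field\<close>. Every vector space over it embeds into a space of
  functions \<open>'x \<Rightarrow> 'k\<close>, so vector spaces are rendered as subspaces of function spaces; this makes
  it possible to quantify over all algebras inside a formula: the algebras of type
  \<open>('a, 'k) curved_alg\<close> below are, up to isomorphism, all those of dimension at most that of
  \<open>'a \<Rightarrow> 'k\<close>, so the type \<open>'a\<close> plays the role of a universe. A graded space is a family of
  subspaces whose sum is direct. Graded maps are only evaluated on homogeneous elements: a HOL
  function represents a graded map through its restrictions to the components, and its values
  elsewhere are irrelevant.
\<close>

definition perfect_field :: "'k::field itself \<Rightarrow> bool" where
  "perfect_field (TYPE('k)) \<longleftrightarrow> CHAR('k) = 0 \<or> surj (\<lambda>x::'k. x ^ CHAR('k))"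

definition scl :: "'k::field \<Rightarrow> ('x \<Rightarrow> 'k) \<Rightarrow> 'x \<Rightarrow> 'k" where
  "scl c v = (\<lambda>x. c * v x)"

global_interpretation kvs: vector_space "scl :: 'k::field \<Rightarrow> ('x \<Rightarrow> 'k) \<Rightarrow> 'x \<Rightarrow> 'k"
  by unfold_locales (auto simp: scl_def fun_eq_iff algebra_simps)

type_synonym ('x, 'k) graded = "int \<Rightarrow> ('x \<Rightarrow> 'k) set"

definition graded_space :: "('x, 'k::field) graded \<Rightarrow> bool" where
  "graded_space V \<longleftrightarrow>
     (\<forall>n. kvs.subspace (V n)) \<and>
     (\<forall>N v. finite N \<and> (\<forall>n\<in>N. v n \<in> V n) \<and> (\<Sum>n\<in>N. v n) = 0 \<longrightarrow> (\<forall>n\<in>N. v n = 0))"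

definition finite_dim :: "('x, 'k::field) graded \<Rightarrow> bool" where
  "finite_dim V \<longleftrightarrow> (\<exists>S. finite S \<and> (\<forall>n. V n \<subseteq> kvs.span S))"

definition linear_into ::
  "('x \<Rightarrow> 'k::field) set \<Rightarrow> ('y \<Rightarrow> 'k) set \<Rightarrow> (('x \<Rightarrow> 'k) \<Rightarrow> 'y \<Rightarrow> 'k) \<Rightarrow> bool" where
  "linear_into V W f \<longleftrightarrow>
     (\<forall>v\<in>V. f v \<in> W \<and> (\<forall>c. f (scl c v) = scl c (f v)) \<and> (\<forall>w\<in>V. f (v + w) = f v + f w))"

definition graded_map ::
  "('x, 'k::field) graded \<Rightarrow> ('y, 'k) graded \<Rightarrow> int \<Rightarrow> (('x \<Rightarrow> 'k) \<Rightarrow> 'y \<Rightarrow> 'k) \<Rightarrow> bool" where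
  "graded_map V W d f \<longleftrightarrow> (\<forall>n. linear_into (V n) (W (n + d)) f)"

definition ksign :: "int \<Rightarrow> 'a::ab_group_add \<Rightarrow> 'a" where
  "ksign n a = (if even n then a else - a)"

text \<open>
  Over a field the map from the tensor product of \<open>'x \<Rightarrow> 'k\<close> and \<open>'y \<Rightarrow> 'k\<close> to \<open>'x \<times> 'y \<Rightarrow> 'k\<close>
  sending the tensor of \<open>v\<close> and \<open>w\<close> to \<open>(x, y) \<mapsto> v x * w y\<close> is injective. Hence the tensor product
  of subspaces \<open>V\<close>, \<open>W\<close> is the span of these functions for \<open>v \<in> V\<close>, \<open>w \<in> W\<close>.
\<close>

definition tens :: "('x \<Rightarrow> 'k::field) \<Rightarrow> ('y \<Rightarrow> 'k) \<Rightarrow> 'x \<times> 'y \<Rightarrow> 'k" (infixl "\<otimes>\<^sub>k" 75) where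
  "v \<otimes>\<^sub>k w = (\<lambda>(x, y). v x * w y)"

definition tensor ::
  "('x, 'k::field) graded \<Rightarrow> ('y, 'k) graded \<Rightarrow> ('x \<times> 'y, 'k) graded" where
  "tensor V W n = kvs.span {v \<otimes>\<^sub>k w | p q v w. v \<in> V p \<and> w \<in> W q \<and> p + q = n}"

text \<open>
  The linear map out of the tensor product induced by a family \<open>\<phi>\<close> of bilinear maps, \<open>\<phi> p q\<close> being
  a map on the product of \<open>V p\<close> and \<open>W q\<close>.
\<close>

definition tensor_lift ::
  "('x, 'k::field) graded \<Rightarrow> ('y, 'k) graded \<Rightarrow>
   (int \<Rightarrow> int \<Rightarrow> ('x \<Rightarrow> 'k) \<Rightarrow> ('y \<Rightarrow> 'k) \<Rightarrow> 'z::comm_monoid_add) \<Rightarrow> ('x \<times> 'y \<Rightarrow> 'k) \<Rightarrow> 'z" where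
  "tensor_lift V W \<phi> t =
     (THE z. \<exists>ts. (\<forall>(p, q, v, w) \<in> set ts. v \<in> V p \<and> w \<in> W q) \<and>
        t = sum_list (map (\<lambda>(p, q, v, w). v \<otimes>\<^sub>k w) ts) \<and>
        z = sum_list (map (\<lambda>(p, q, v, w). \<phi> p q v w) ts))"

text \<open>
  The graded dual, in degree \<open>n\<close> the linear functionals on \<open>V (- n)\<close>. As elements of the function
  space \<open>('x \<Rightarrow> 'k) \<Rightarrow> 'k\<close> they are normalized to vanish outside \<open>V (- n)\<close>.
\<close>

definition dual :: "('x, 'k::field) graded \<Rightarrow> ('x \<Rightarrow> 'k, 'k) graded" where
  "dual V n = {\<xi>. (\<forall>v\<in>V (- n). (\<forall>c. \<xi> (scl c v) = c * \<xi> v) \<and> (\<forall>w\<in>V (- n). \<xi> (v + w) = \<xi> v + \<xi> w)) \<and>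
                  (\<forall>v. v \<notin> V (- n) \<longrightarrow> \<xi> v = 0)}"

definition homogeneous :: "('x, 'k) graded \<Rightarrow> ('x \<Rightarrow> 'k) set" where
  "homogeneous V = (\<Union>n. V n)"

definition restr :: "('x, 'k::field) graded \<Rightarrow> (('x \<Rightarrow> 'k) \<Rightarrow> 'k) \<Rightarrow> ('x \<Rightarrow> 'k) \<Rightarrow> 'k" where
  "restr D \<xi> = (\<lambda>c. if c \<in> homogeneous D then \<xi> c else 0)"


section \<open>Curved algebras\<close>

record ('x, 'k) curved_alg =
  car :: "int \<Rightarrow> ('x \<Rightarrow> 'k) set"
  mul :: "('x \<Rightarrow> 'k) \<Rightarrow> ('x \<Rightarrow> 'k) \<Rightarrow> 'x \<Rightarrow> 'k"
  unt :: "'x \<Rightarrow> 'k"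
  dif :: "('x \<Rightarrow> 'k) \<Rightarrow> 'x \<Rightarrow> 'k"
  cur :: "'x \<Rightarrow> 'k"

definition curved_algebra :: "('x, 'k::field) curved_alg \<Rightarrow> bool" where
  "curved_algebra A \<longleftrightarrow>
     graded_space (car A) \<and>
     (\<forall>p q. \<forall>a\<in>car A p. linear_into (car A q) (car A (p + q)) (\<lambda>b. mul A a b)) \<and>
     (\<forall>p q. \<forall>b\<in>car A q. linear_into (car A p) (car A (p + q)) (\<lambda>a. mul A a b)) \<and>
     (\<forall>p q r. \<forall>a\<in>car A p. \<forall>b\<in>car A q. \<forall>c\<in>car A r.
        mul A (mul A a b) c = mul A a (mul A b c)) \<and>
     unt A \<in> car A 0 \<and>
     (\<forall>p. \<forall>a\<in>car A p. mul A (unt A) a = a \<and> mul A a (unt A) = a) \<and>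
     graded_map (car A) (car A) 1 (dif A) \<and>
     (\<forall>p q. \<forall>a\<in>car A p. \<forall>b\<in>car A q.
        dif A (mul A a b) = mul A (dif A a) b + ksign p (mul A a (dif A b))) \<and>
     cur A \<in> car A 2 \<and>
     dif A (cur A) = 0 \<and>
     (\<forall>p. \<forall>a\<in>car A p. dif A (dif A a) = mul A (cur A) a - mul A a (cur A))"

definition curved_hom ::
  "('x, 'k::field) curved_alg \<Rightarrow> ('y, 'k) curved_alg \<Rightarrow> (('x \<Rightarrow> 'k) \<Rightarrow> 'y \<Rightarrow> 'k) \<Rightarrow> ('y \<Rightarrow> 'k) \<Rightarrow> bool"
where
  "curved_hom A B f b \<longleftrightarrow>
     graded_map (car A) (car B) 0 f \<and>
     (\<forall>p q. \<forall>a\<in>car A p. \<forall>a'\<in>car A q. f (mul A a a') = mul B (f a) (f a')) \<and>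
     f (unt A) = unt B \<and>
     b \<in> car B 1 \<and>
     (\<forall>n. \<forall>a\<in>car A n. f (dif A a) = dif B (f a) + (mul B b (f a) - ksign n (mul B (f a) b))) \<and>
     f (cur A) = cur B + dif B b + mul B b b"

definition tensor_alg ::
  "('x, 'k::field) curved_alg \<Rightarrow> ('y, 'k) curved_alg \<Rightarrow> ('x \<times> 'y, 'k) curved_alg" where
  "tensor_alg A B =
     \<lparr> car = tensor (car A) (car B),
       mul = (\<lambda>t u. tensor_lift (car A) (car B) (\<lambda>p q a b.
                tensor_lift (car A) (car B) (\<lambda>p' q' a' b'.
                  ksign (q * p') (mul A a a' \<otimes>\<^sub>k mul B b b')) u) t),
       unt = unt A \<otimes>\<^sub>k unt B,
       dif = tensor_lift (car A) (car B) (\<lambda>p q a b. dif A a \<otimes>\<^sub>k b + ksign p (a \<otimes>\<^sub>k dif B b)),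
       cur = cur A \<otimes>\<^sub>k unt B + unt A \<otimes>\<^sub>k cur B \<rparr>"


section \<open>Cofiltered limits and pseudocompact curved algebras\<close>

text \<open>
  The limit of the algebras \<open>alg i\<close>, \<open>i \<in> I\<close>, along transition maps \<open>tr i j\<close> from \<open>alg j\<close> to
  \<open>alg i\<close> for \<open>le i j\<close>: compatible families with componentwise operations. A family is encoded as
  an uncurried function, \<open>curry F i\<close> being its component at \<open>i\<close>.
\<close>

definition family :: "'i set \<Rightarrow> ('i \<Rightarrow> 'y \<Rightarrow> 'k::field) \<Rightarrow> 'i \<times> 'y \<Rightarrow> 'k" where
  "family I u = (\<lambda>(i, y). if i \<in> I then u i y else 0)"

definition limit_alg ::
  "'i set \<Rightarrow> ('i \<Rightarrow> 'i \<Rightarrow> bool) \<Rightarrow> ('i \<Rightarrow> ('y, 'k::field) curved_alg) \<Rightarrow>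
   ('i \<Rightarrow> 'i \<Rightarrow> ('y \<Rightarrow> 'k) \<Rightarrow> 'y \<Rightarrow> 'k) \<Rightarrow> ('i \<times> 'y, 'k) curved_alg" where
  "limit_alg I le alg tr =
     \<lparr> car = (\<lambda>n. {F. F = family I (curry F) \<and>
                      (\<forall>i\<in>I. curry F i \<in> car (alg i) n) \<and>
                      (\<forall>i\<in>I. \<forall>j\<in>I. le i j \<longrightarrow> tr i j (curry F j) = curry F i)}),
       mul = (\<lambda>F G. family I (\<lambda>i. mul (alg i) (curry F i) (curry G i))),
       unt = family I (\<lambda>i. unt (alg i)),
       dif = (\<lambda>F. family I (\<lambda>i. dif (alg i) (curry F i))),
       cur = family I (\<lambda>i. cur (alg i)) \<rparr>"

definition inverse_system ::
  "'i set \<Rightarrow> ('i \<Rightarrow> 'i \<Rightarrow> bool) \<Rightarrow> ('i \<Rightarrow> ('y, 'k::field) curved_alg) \<Rightarrow>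
   ('i \<Rightarrow> 'i \<Rightarrow> ('y \<Rightarrow> 'k) \<Rightarrow> 'y \<Rightarrow> 'k) \<Rightarrow> bool" where
  "inverse_system I le alg tr \<longleftrightarrow>
     I \<noteq> {} \<and>
     (\<forall>i\<in>I. le i i) \<and>
     (\<forall>i\<in>I. \<forall>j\<in>I. \<forall>l\<in>I. le i j \<and> le j l \<longrightarrow> le i l) \<and>
     (\<forall>i\<in>I. \<forall>j\<in>I. \<exists>l\<in>I. le i l \<and> le j l) \<and>
     (\<forall>i\<in>I. curved_algebra (alg i)) \<and>
     (\<forall>i\<in>I. \<forall>j\<in>I. le i j \<longrightarrow> curved_hom (alg j) (alg i) (tr i j) 0) \<and>
     (\<forall>i\<in>I. \<forall>n. \<forall>a\<in>car (alg i) n. tr i i a = a) \<and>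
     (\<forall>i\<in>I. \<forall>j\<in>I. \<forall>l\<in>I. le i j \<and> le j l \<longrightarrow>
        (\<forall>n. \<forall>a\<in>car (alg l) n. tr i j (tr j l a) = tr i l a))"

text \<open>
  \<open>T n\<close> is the topology of the component of degree \<open>n\<close>. The limit is taken along strict morphisms,
  i.e. pairs \<open>(f, 0)\<close>, indexed by a directed preorder. The types chosen for the indices and for the
  finite dimensional algebras are no restriction: a finite dimensional space embeds into
  \<open>nat \<Rightarrow> 'k\<close>, and after replacing the members of the system by the images of \<open>B\<close> one may index
  them by the kernels of the projections.
\<close>

definition pseudocompact_curved_algebra ::
  "('x, 'k::field) curved_alg \<Rightarrow> (int \<Rightarrow> ('x \<Rightarrow> 'k) topology) \<Rightarrow> bool" where
  "pseudocompact_curved_algebra B T \<longleftrightarrow>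
     curved_algebra B \<and>
     (\<exists>(I :: (int \<Rightarrow> ('x \<Rightarrow> 'k) set) set) le (alg :: _ \<Rightarrow> (nat, 'k) curved_alg) tr \<theta>.
        inverse_system I le alg tr \<and>
        (\<forall>i\<in>I. finite_dim (car (alg i))) \<and>
        curved_hom B (limit_alg I le alg tr) \<theta> 0 \<and>
        (\<forall>n. bij_betw \<theta> (car B n) (car (limit_alg I le alg tr) n)) \<and>
        (\<forall>n. T n = pullback_topology (car B n) (\<lambda>b. restrict (curry (\<theta> b)) I)
                     (product_topology (\<lambda>i. discrete_topology (car (alg i) n)) I)))"

definition pseudocompact_curved_hom ::
  "('x, 'k::field) curved_alg \<Rightarrow> (int \<Rightarrow> ('x \<Rightarrow> 'k) topology) \<Rightarrow>
   ('y, 'k) curved_alg \<Rightarrow> (int \<Rightarrow> ('y \<Rightarrow> 'k) topology) \<Rightarrow>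
   (('x \<Rightarrow> 'k) \<Rightarrow> 'y \<Rightarrow> 'k) \<Rightarrow> ('y \<Rightarrow> 'k) \<Rightarrow> bool" where
  "pseudocompact_curved_hom A S B T f b \<longleftrightarrow>
     curved_hom A B f b \<and> (\<forall>n. continuous_map (S n) (T n) f)"


section \<open>Curved coalgebras\<close>

record ('x, 'k) curved_coalg =
  ccar :: "int \<Rightarrow> ('x \<Rightarrow> 'k) set"
  comul :: "('x \<Rightarrow> 'k) \<Rightarrow> 'x \<times> 'x \<Rightarrow> 'k"
  counit :: "('x \<Rightarrow> 'k) \<Rightarrow> 'k"
  cdif :: "('x \<Rightarrow> 'k) \<Rightarrow> 'x \<Rightarrow> 'k"
  ccur :: "('x \<Rightarrow> 'k) \<Rightarrow> 'k"

text \<open>The two sides of coassociativity live over \<open>('x \<times> 'x) \<times> 'x\<close> and \<open>'x \<times> ('x \<times> 'x)\<close>.\<close>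

definition graded_coalgebra :: "('x, 'k::field) curved_coalg \<Rightarrow> bool" where
  "graded_coalgebra C \<longleftrightarrow>
     graded_space (ccar C) \<and>
     graded_map (ccar C) (tensor (ccar C) (ccar C)) 0 (comul C) \<and>
     counit C \<in> dual (ccar C) 0 \<and>
     (\<forall>n. \<forall>c\<in>ccar C n.
        (\<forall>x y z.
           tensor_lift (ccar C) (ccar C) (\<lambda>p q v w. comul C v \<otimes>\<^sub>k w) (comul C c) ((x, y), z) =
           tensor_lift (ccar C) (ccar C) (\<lambda>p q v w. v \<otimes>\<^sub>k comul C w) (comul C c) (x, (y, z))) \<and>
        tensor_lift (ccar C) (ccar C) (\<lambda>p q v w. scl (counit C v) w) (comul C c) = c \<and>
        tensor_lift (ccar C) (ccar C) (\<lambda>p q v w. scl (counit C w) v) (comul C c) = c)"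

definition coderivation :: "('x, 'k::field) curved_coalg \<Rightarrow> bool" where
  "coderivation C \<longleftrightarrow>
     graded_map (ccar C) (ccar C) 1 (cdif C) \<and>
     (\<forall>n. \<forall>c\<in>ccar C n. comul C (cdif C c) =
        tensor_lift (ccar C) (ccar C)
          (\<lambda>p q v w. cdif C v \<otimes>\<^sub>k w + ksign p (v \<otimes>\<^sub>k cdif C w)) (comul C c))"

text \<open>
  All structure maps of the dual are plain transposes: the product of \<open>\<xi>\<close> and \<open>\<zeta>\<close> is
  \<open>c \<mapsto> \<Sum> \<xi> c\<^sub>1 * \<zeta> c\<^sub>2\<close> and the differential of \<open>\<xi>\<close> is \<open>\<xi> \<circ> d\<close>. The Koszul sign is built into the
  coderivation rule and these are again a graded product and a derivation of it. Pairing with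
  Koszul signs instead gives isomorphic algebras, via \<open>\<xi> \<mapsto> (-1)\<^bsup>p (p - 1) / 2\<^esup> \<xi>\<close> in degree \<open>p\<close>,
  after replacing \<open>h\<close> by \<open>- h\<close> and, if the transpose of \<open>d\<close> is taken to be \<open>- (-1)\<^bsup>p\<^esup> \<xi> \<circ> d\<close>, also
  \<open>d\<close> by \<open>- d\<close>.
\<close>

definition dual_alg :: "('x, 'k::field) curved_coalg \<Rightarrow> ('x \<Rightarrow> 'k, 'k) curved_alg" where
  "dual_alg C =
     \<lparr> car = dual (ccar C),
       mul = (\<lambda>\<xi> \<zeta>. restr (ccar C) (\<lambda>c.
                tensor_lift (ccar C) (ccar C) (\<lambda>p q v w. \<xi> v * \<zeta> w) (comul C c))),
       unt = counit C,
       dif = (\<lambda>\<xi>. restr (ccar C) (\<lambda>c. \<xi> (cdif C c))),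
       cur = ccur C \<rparr>"

text \<open>
  The topology of pointwise convergence, with \<open>'k\<close> discrete. By the fundamental theorem on coalgebras
  it is the inverse limit topology of the duals of the finite dimensional curved subcoalgebras.
\<close>

definition dual_topology :: "('x, 'k::field) curved_coalg \<Rightarrow> int \<Rightarrow> (('x \<Rightarrow> 'k) \<Rightarrow> 'k) topology" where
  "dual_topology C n =
     subtopology (product_topology (\<lambda>_. discrete_topology UNIV) UNIV) (dual (ccar C) n)"

definition curved_coalgebra :: "('x, 'k::field) curved_coalg \<Rightarrow> bool" where
  "curved_coalgebra C \<longleftrightarrow>
     graded_coalgebra C \<and> coderivation C \<and> ccur C \<in> dual (ccar C) 2 \<and>
     pseudocompact_curved_algebra (dual_alg C) (dual_topology C)"

text \<open>
  A morphism from \<open>C\<close> to \<open>C'\<close> is a pair \<open>(\<phi>, b)\<close>, \<open>\<phi>\<close> going from the dual of \<open>C'\<close> to the dual of \<open>C\<close>.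
  The underlying graded map is the map \<open>f\<close> from \<open>C\<close> to \<open>C'\<close> whose transpose is \<open>\<phi>\<close>; it is unique.
\<close>

definition curved_coalgebra_hom ::
  "('x, 'k::field) curved_coalg \<Rightarrow> ('y, 'k) curved_coalg \<Rightarrow>
   ((('y \<Rightarrow> 'k) \<Rightarrow> 'k) \<Rightarrow> (('x \<Rightarrow> 'k) \<Rightarrow> 'k)) \<Rightarrow> (('x \<Rightarrow> 'k) \<Rightarrow> 'k) \<Rightarrow> bool" where
  "curved_coalgebra_hom C C' \<phi> b \<longleftrightarrow>
     pseudocompact_curved_hom (dual_alg C') (dual_topology C') (dual_alg C) (dual_topology C) \<phi> b"

definition underlying_map ::
  "('x, 'k::field) curved_coalg \<Rightarrow> ('y, 'k) curved_coalg \<Rightarrow>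
   ((('y \<Rightarrow> 'k) \<Rightarrow> 'k) \<Rightarrow> (('x \<Rightarrow> 'k) \<Rightarrow> 'k)) \<Rightarrow> (('x \<Rightarrow> 'k) \<Rightarrow> 'y \<Rightarrow> 'k) \<Rightarrow> bool" where
  "underlying_map C C' \<phi> f \<longleftrightarrow>
     graded_map (ccar C) (ccar C') 0 f \<and>
     (\<forall>n. \<forall>\<xi>\<in>dual (ccar C') n. \<forall>c\<in>ccar C (- n). \<phi> \<xi> c = \<xi> (f c))"

definition curved_coalgebra_injection ::
  "('x, 'k::field) curved_coalg \<Rightarrow> ('y, 'k) curved_coalg \<Rightarrow>
   ((('y \<Rightarrow> 'k) \<Rightarrow> 'k) \<Rightarrow> (('x \<Rightarrow> 'k) \<Rightarrow> 'k)) \<Rightarrow> bool" where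
  "curved_coalgebra_injection C C' \<phi> \<longleftrightarrow>
     (\<exists>f. underlying_map C C' \<phi> f \<and> (\<forall>n. inj_on f (ccar C n)))"


section \<open>Convolution algebras\<close>

definition fd_subcoalgs :: "('x, 'k::field) curved_coalg \<Rightarrow> ('x, 'k) graded set" where
  "fd_subcoalgs C =
     {D. finite_dim D \<and>
         (\<forall>n. kvs.subspace (D n) \<and> D n \<subseteq> ccar C n) \<and>
         (\<forall>n. \<forall>c\<in>D n. comul C c \<in> tensor D D n \<and> cdif C c \<in> D (n + 1))}"

definition subcoalg :: "('x, 'k::field) curved_coalg \<Rightarrow> ('x, 'k) graded \<Rightarrow> ('x, 'k) curved_coalg" where
  "subcoalg C D = C \<lparr> ccar := D, counit := restr D (counit C), ccur := restr D (ccur C) \<rparr>"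

text \<open>
  The limit over the finite dimensional curved subcoalgebras \<open>D\<close> of \<open>C\<close> of the tensor products of
  the dual of \<open>D\<close> with \<open>A\<close>; for \<open>D \<le> E\<close> (degreewise inclusion) the transition map is restriction of
  functionals tensored with the identity of \<open>A\<close>.
\<close>

definition conv_alg ::
  "('x, 'k::field) curved_coalg \<Rightarrow> ('a, 'k) curved_alg \<Rightarrow>
   (('x, 'k) graded \<times> (('x \<Rightarrow> 'k) \<times> 'a), 'k) curved_alg" where
  "conv_alg C A =
     limit_alg (fd_subcoalgs C) (\<le>) (\<lambda>D. tensor_alg (dual_alg (subcoalg C D)) A)
       (\<lambda>D E. tensor_lift (dual E) (car A) (\<lambda>p q \<xi> a. restr D \<xi> \<otimes>\<^sub>k a))"

text \<open>
  The morphism of convolution algebras induced by \<open>(\<phi>, b)\<close>. By continuity, \<open>\<phi>\<close> followed by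
  restriction to \<open>D\<close> factors through restriction to some \<open>E\<close> in \<open>C'\<close>, as a map \<open>\<psi>\<close> between the duals
  of \<open>E\<close> and \<open>D\<close>; the component at \<open>D\<close> of the induced map is \<open>\<psi>\<close> tensored with the identity of \<open>A\<close>.
\<close>

definition conv_map ::
  "('x, 'k::field) curved_coalg \<Rightarrow> ('y, 'k) curved_coalg \<Rightarrow> ('a, 'k) curved_alg \<Rightarrow>
   ((('y \<Rightarrow> 'k) \<Rightarrow> 'k) \<Rightarrow> (('x \<Rightarrow> 'k) \<Rightarrow> 'k)) \<Rightarrow>
   (('y, 'k) graded \<times> (('y \<Rightarrow> 'k) \<times> 'a) \<Rightarrow> 'k) \<Rightarrow> ('x, 'k) graded \<times> (('x \<Rightarrow> 'k) \<times> 'a) \<Rightarrow> 'k" where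
  "conv_map C C' A \<phi> F = family (fd_subcoalgs C) (\<lambda>D.
     THE t. \<exists>E\<in>fd_subcoalgs C'. \<exists>\<psi>.
       graded_map (dual E) (dual D) 0 \<psi> \<and>
       (\<forall>n. \<forall>\<xi>\<in>dual (ccar C') n. \<psi> (restr E \<xi>) = restr D (\<phi> \<xi>)) \<and>
       t = tensor_lift (dual E) (car A) (\<lambda>p q \<eta> a. \<psi> \<eta> \<otimes>\<^sub>k a) (curry F E))"

definition conv_shift ::
  "('x, 'k::field) curved_coalg \<Rightarrow> ('a, 'k) curved_alg \<Rightarrow> (('x \<Rightarrow> 'k) \<Rightarrow> 'k) \<Rightarrow>
   ('x, 'k) graded \<times> (('x \<Rightarrow> 'k) \<times> 'a) \<Rightarrow> 'k" where
  "conv_shift C A b = family (fd_subcoalgs C) (\<lambda>D. restr D b \<otimes>\<^sub>k unt A)"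


section \<open>Dg categories and fibrations\<close>

text \<open>The extra integer argument of \<open>hdif\<close> is the degree of the morphism it is applied to.\<close>

record ('o, 'y, 'k) dgcat =
  obj :: "'o set"
  hom :: "'o \<Rightarrow> 'o \<Rightarrow> int \<Rightarrow> ('y \<Rightarrow> 'k) set"
  hdif :: "'o \<Rightarrow> 'o \<Rightarrow> int \<Rightarrow> ('y \<Rightarrow> 'k) \<Rightarrow> 'y \<Rightarrow> 'k"
  comp :: "'o \<Rightarrow> 'o \<Rightarrow> 'o \<Rightarrow> ('y \<Rightarrow> 'k) \<Rightarrow> ('y \<Rightarrow> 'k) \<Rightarrow> 'y \<Rightarrow> 'k"
  ident :: "'o \<Rightarrow> 'y \<Rightarrow> 'k"

definition dg_category :: "('o, 'y, 'k::field) dgcat \<Rightarrow> bool" where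
  "dg_category D \<longleftrightarrow>
     (\<forall>x\<in>obj D. \<forall>y\<in>obj D. graded_space (hom D x y) \<and>
        (\<forall>n. linear_into (hom D x y n) (hom D x y (n + 1)) (hdif D x y n)) \<and>
        (\<forall>n. \<forall>a\<in>hom D x y n. hdif D x y (n + 1) (hdif D x y n a) = 0)) \<and>
     (\<forall>x\<in>obj D. \<forall>y\<in>obj D. \<forall>z\<in>obj D. \<forall>m n.
        (\<forall>b\<in>hom D y z m. linear_into (hom D x y n) (hom D x z (m + n)) (\<lambda>a. comp D x y z b a)) \<and>
        (\<forall>a\<in>hom D x y n. linear_into (hom D y z m) (hom D x z (m + n)) (\<lambda>b. comp D x y z b a)) \<and>
        (\<forall>b\<in>hom D y z m. \<forall>a\<in>hom D x y n. hdif D x z (m + n) (comp D x y z b a) =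
           comp D x y z (hdif D y z m b) a + ksign m (comp D x y z b (hdif D x y n a)))) \<and>
     (\<forall>x\<in>obj D. ident D x \<in> hom D x x 0 \<and> hdif D x x 0 (ident D x) = 0) \<and>
     (\<forall>x\<in>obj D. \<forall>y\<in>obj D. \<forall>n. \<forall>a\<in>hom D x y n.
        comp D x x y a (ident D x) = a \<and> comp D x y y (ident D y) a = a) \<and>
     (\<forall>w\<in>obj D. \<forall>x\<in>obj D. \<forall>y\<in>obj D. \<forall>z\<in>obj D. \<forall>l m n.
        \<forall>c\<in>hom D y z l. \<forall>b\<in>hom D x y m. \<forall>a\<in>hom D w x n.
          comp D w x z (comp D x y z c b) a = comp D w y z c (comp D w x y b a))"

definition dg_functor ::
  "('o, 'y, 'k::field) dgcat \<Rightarrow> ('p, 'z, 'k) dgcat \<Rightarrow>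
   ('o \<Rightarrow> 'p) \<Rightarrow> ('o \<Rightarrow> 'o \<Rightarrow> ('y \<Rightarrow> 'k) \<Rightarrow> 'z \<Rightarrow> 'k) \<Rightarrow> bool" where
  "dg_functor D E Fo Fm \<longleftrightarrow>
     dg_category D \<and> dg_category E \<and>
     (\<forall>x\<in>obj D. Fo x \<in> obj E) \<and>
     (\<forall>x\<in>obj D. \<forall>y\<in>obj D.
        graded_map (hom D x y) (hom E (Fo x) (Fo y)) 0 (Fm x y) \<and>
        (\<forall>n. \<forall>a\<in>hom D x y n. Fm x y (hdif D x y n a) = hdif E (Fo x) (Fo y) n (Fm x y a))) \<and>
     (\<forall>x\<in>obj D. Fm x x (ident D x) = ident E (Fo x)) \<and>
     (\<forall>x\<in>obj D. \<forall>y\<in>obj D. \<forall>z\<in>obj D. \<forall>m n. \<forall>b\<in>hom D y z m. \<forall>a\<in>hom D x y n.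
        Fm x z (comp D x y z b a) = comp E (Fo x) (Fo y) (Fo z) (Fm y z b) (Fm x y a))"

record ('o, 'm) cat =
  cobj :: "'o set"
  chom :: "'o \<Rightarrow> 'o \<Rightarrow> 'm set"
  ccomp :: "'o \<Rightarrow> 'o \<Rightarrow> 'o \<Rightarrow> 'm \<Rightarrow> 'm \<Rightarrow> 'm"
  cident :: "'o \<Rightarrow> 'm"

definition iso_in :: "('o, 'm) cat \<Rightarrow> 'o \<Rightarrow> 'o \<Rightarrow> 'm \<Rightarrow> bool" where
  "iso_in P x y g \<longleftrightarrow> g \<in> chom P x y \<and>
     (\<exists>g'\<in>chom P y x. ccomp P x y x g' g = cident P x \<and> ccomp P y x y g g' = cident P y)"

definition isofibration ::
  "('o, 'm) cat \<Rightarrow> ('p, 'n) cat \<Rightarrow> ('o \<Rightarrow> 'p) \<Rightarrow> ('o \<Rightarrow> 'o \<Rightarrow> 'm \<Rightarrow> 'n) \<Rightarrow> bool" where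
  "isofibration P Q Go Gm \<longleftrightarrow>
     (\<forall>x\<in>cobj P. \<forall>y\<in>cobj Q. \<forall>g. iso_in Q (Go x) y g \<longrightarrow>
        (\<exists>x'\<in>cobj P. \<exists>g'. iso_in P x x' g' \<and> Go x' = y \<and> Gm x x' g' = g))"

text \<open>Morphisms of \<open>H0 D\<close> are cohomology classes of degree \<open>0\<close>, as cosets of the coboundaries.\<close>

definition h0_class ::
  "('o, 'y, 'k::field) dgcat \<Rightarrow> 'o \<Rightarrow> 'o \<Rightarrow> ('y \<Rightarrow> 'k) \<Rightarrow> ('y \<Rightarrow> 'k) set" where
  "h0_class D x y a = {a + hdif D x y (- 1) u | u. u \<in> hom D x y (- 1)}"

definition H0 :: "('o, 'y, 'k::field) dgcat \<Rightarrow> ('o, ('y \<Rightarrow> 'k) set) cat" where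
  "H0 D =
     \<lparr> cobj = obj D,
       chom = (\<lambda>x y. h0_class D x y ` {a \<in> hom D x y 0. hdif D x y 0 a = 0}),
       ccomp = (\<lambda>x y z L K. \<Union>b\<in>L. \<Union>a\<in>K. h0_class D x z (comp D x y z b a)),
       cident = (\<lambda>x. h0_class D x x (ident D x)) \<rparr>"

definition H0_map ::
  "('p, 'z, 'k::field) dgcat \<Rightarrow> ('o \<Rightarrow> 'p) \<Rightarrow> ('o \<Rightarrow> 'o \<Rightarrow> ('y \<Rightarrow> 'k) \<Rightarrow> 'z \<Rightarrow> 'k) \<Rightarrow>
   'o \<Rightarrow> 'o \<Rightarrow> ('y \<Rightarrow> 'k) set \<Rightarrow> ('z \<Rightarrow> 'k) set" where
  "H0_map E Fo Fm x y K = (\<Union>a\<in>K. h0_class E (Fo x) (Fo y) (Fm x y a))"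

definition dg_fibration ::
  "('o, 'y, 'k::field) dgcat \<Rightarrow> ('p, 'z, 'k) dgcat \<Rightarrow>
   ('o \<Rightarrow> 'p) \<Rightarrow> ('o \<Rightarrow> 'o \<Rightarrow> ('y \<Rightarrow> 'k) \<Rightarrow> 'z \<Rightarrow> 'k) \<Rightarrow> bool" where
  "dg_fibration D E Fo Fm \<longleftrightarrow>
     dg_functor D E Fo Fm \<and>
     (\<forall>x\<in>obj D. \<forall>y\<in>obj D. \<forall>n. Fm x y ` hom D x y n = hom E (Fo x) (Fo y) n) \<and>
     isofibration (H0 D) (H0 E) Fo (H0_map E Fo Fm)"


section \<open>Maurer-Cartan dg categories\<close>

definition MC :: "('x, 'k::field) curved_alg \<Rightarrow> ('x \<Rightarrow> 'k) set" where
  "MC A = {x \<in> car A 1. cur A + dif A x + mul A x x = 0}"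

definition MC_dg :: "('x, 'k::field) curved_alg \<Rightarrow> ('x \<Rightarrow> 'k, 'x, 'k) dgcat" where
  "MC_dg A =
     \<lparr> obj = MC A,
       hom = (\<lambda>x y. car A),
       hdif = (\<lambda>x y n a. dif A a + mul A y a - ksign n (mul A a x)),
       comp = (\<lambda>x y z b a. mul A b a),
       ident = (\<lambda>x. unt A) \<rparr>"

text \<open>The dg functor of Maurer-Cartan dg categories induced by a morphism \<open>(f, b)\<close>.\<close>

definition MC_obj_map ::
  "(('x \<Rightarrow> 'k) \<Rightarrow> 'y \<Rightarrow> 'k::field) \<Rightarrow> ('y \<Rightarrow> 'k) \<Rightarrow> ('x \<Rightarrow> 'k) \<Rightarrow> 'y \<Rightarrow> 'k" where
  "MC_obj_map f b x = b + f x"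

definition MC_hom_map ::
  "(('x \<Rightarrow> 'k) \<Rightarrow> 'y \<Rightarrow> 'k::field) \<Rightarrow> ('x \<Rightarrow> 'k) \<Rightarrow> ('x \<Rightarrow> 'k) \<Rightarrow> ('x \<Rightarrow> 'k) \<Rightarrow> 'y \<Rightarrow> 'k" where
  "MC_hom_map f x y a = f a"

end

theory Submission
  imports Defs
begin

text \<open>
  Elements of a convolution algebra are graded linear maps. Surjectivity on homs for the
  algebra \<open>k[s]/s\<^sup>2\<close> with \<open>d s = 1\<close>, whose convolution algebras have the Maurer-Cartan element
  \<open>- h s\<close>, yields the extension of every functional along the morphism and hence its injectivity.

  Conversely, linear maps extend along injections, so that surjectivity on homs is clear and an
  isomorphism in \<open>H\<^sup>0\<close> has to be lifted. An arbitrary lift of its data is a homotopy equivalence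
  modulo the ideal of maps vanishing on a subcoalgebra, and by Zorn's lemma it remains to correct
  it on a larger subcoalgebra. For a minimal enlargement the annihilators \<open>I\<close> and \<open>J\<close> have a
  quotient \<open>I/J\<close> without differential ideals in between. Such a quotient is either square zero or
  has a unit. In the first case the obstructions are removed by explicit formulas, in the second
  the given data are replaced by the identity on the corresponding factor.
\<close>

section \<open>Linear algebra\<close>

text \<open>Surjectivity on homs says nothing if the source has no Maurer-Cartan element, and
  \<open>conv_alg C' A\<close> may have none because of the curvature of \<open>C'\<close>. The
  algebra k[s]/s^2 is chosen because it makes the unit exact, so that the curvature becomes a
  coboundary. In the other direction, lifting an isomorphism also changes its target
  \<open>y\<close>; the curvature, the closedness of the morphism and the homotopies have to be
  corrected together. As \<open>A\<close> is arbitrary, finiteness cannot be sought in the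
  convolution algebra. It is found in the dual of \<open>C'\<close>, where I/J embeds into the dual
  of a finite dimensional subcoalgebra, and the resulting alternative is then carried over to
  coefficients in \<open>A\<close>. Quotient algebras are represented by operators on a complement
  of the ideal. In that ring the differential is a commutator with an element \<open>D\<close>, a
  Maurer-Cartan element \<open>x\<close> gives a square root \<open>D + x\<close> of a fixed
  element, and every lifting problem becomes an identity of noncommutative polynomials.\<close>

interpretation kvp: vector_space_pair "scl :: 'k::field => ('x => 'k) => _" "scl :: 'k => ('y => 'k) => _"
 by unfold_locales

text \<open>The identity on a basis of \<open>S\<close> is extended linearly to the whole function
  space with values in \<open>S\<close>. Composing with this total map extends functionals and
  linear maps from \<open>S\<close>, and no complement has to be named.\<close>

lemma projection_exists:
 fixes S :: "('x => 'k::field) set"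
 assumes "kvs.subspace S"
 obtains p :: "('x => 'k) => 'x => 'k"
 where "!!v w. p (v + w) = p v + p w" "!!c v. p (scl c v) = scl c (p v)"
  "!!v. p v : S" "!!v. v : S ==> p v = v"
proof -
 obtain B where B: "B \<subseteq> S" "kvs.independent B" "S \<subseteq> kvs.span B"
  using kvs.basis_exists by metis
 obtain g where g: "Vector_Spaces.linear scl scl g" "ALL x:B. g x = id x" "range g = kvs.span (id ` B)"
  using kvp.linear_independent_extend_subspace[OF B(2), of id] by blast
 have sp: "kvs.span B = S"
  using B kvs.span_minimal[OF B(1) assms] by blast
 have "g v = id v" if "v : S" for v
  using kvp.linear_eq_on[OF g(1) kvs.linear_id, of v B] g(2) that sp by auto
 then show thesis
  using that[of g] kvp.linear_add[OF g(1)] kvp.linear_scale[OF g(1)] g(3) sp by auto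
qed

text \<open>Some coordinate \<open>x\<close> distinguishes \<open>v\<close> from its projection to
  \<open>S\<close>; the functional is that coordinate of the difference, normalized at
  \<open>v\<close>.\<close>

lemma separating_functional:
 fixes S :: "('x => 'k::field) set"
 assumes "kvs.subspace S" "v ~: S"
 obtains l :: "('x => 'k) => 'k"
 where "!!v w. l (v + w) = l v + l w" "!!c v. l (scl c v) = c * l v"
  "!!s. s : S ==> l s = 0" "l v = 1"
proof -
 obtain p where p: "!!v w. p (v + w) = p v + p w" "!!c v. p (scl c v) = scl c (p v)"
  "!!v. p v : S" "!!v. v : S ==> p v = v"
  using projection_exists[OF assms(1)] by metis
 have "p v ~= v"
  using p(3)[of v] assms(2) by auto
 then obtain x where x: "v x ~= p v x" by (metis ext)
 let ?l = "%u. (u x - p u x) / (v x - p v x)"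
 show thesis
  using x by (intro that[of ?l])
   (auto simp: p(1,3,4) p(2)[unfolded scl_def] scl_def add_divide_distrib[symmetric] algebra_simps)
qed

lemma sum_list_fun: "(sum_list fs) x = sum_list (map (%f. f x) fs)" for fs :: "('x => 'k::comm_monoid_add) list"
 by (induction fs) auto

lemma sum_fun: "(sum f A) x = (\<Sum>a\<in>A. f a x)" for f :: "'a => 'x => 'k::comm_monoid_add"
 by (induction A rule: infinite_finite_induct) auto

lemma scl_simps [simp]:
 "scl c (v + w) = scl c v + scl c w" "scl 0 v = 0" "scl c 0 = 0" "scl 1 v = v"
 "scl c (scl d v) = scl (c * d) v" "scl c (- v) = - scl c v" "scl (- c) v = - scl c v"
 "scl c (v - w) = scl c v - scl c w"
 by (auto simp: scl_def fun_eq_iff algebra_simps)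

lemma tens_simps [simp]:
 "(v + v') \<otimes>\<^sub>k w = v \<otimes>\<^sub>k w + v' \<otimes>\<^sub>k w" "v \<otimes>\<^sub>k (w + w') = v \<otimes>\<^sub>k w + v \<otimes>\<^sub>k w'"
 "(- v) \<otimes>\<^sub>k w = - (v \<otimes>\<^sub>k w)" "v \<otimes>\<^sub>k (- w) = - (v \<otimes>\<^sub>k w)"
 "(v - v') \<otimes>\<^sub>k w = v \<otimes>\<^sub>k w - v' \<otimes>\<^sub>k w" "v \<otimes>\<^sub>k (w - w') = v \<otimes>\<^sub>k w - v \<otimes>\<^sub>k w'"
 "scl c v \<otimes>\<^sub>k w = scl c (v \<otimes>\<^sub>k w)" "v \<otimes>\<^sub>k scl c w = scl c (v \<otimes>\<^sub>k w)"
 "0 \<otimes>\<^sub>k w = 0" "v \<otimes>\<^sub>k 0 = 0"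
 by (auto simp: tens_def scl_def fun_eq_iff algebra_simps)

text \<open>The goals of Isar cases are \<open>\<eta>\<close>-expanded, so that these rules would destroy equations between vectors.\<close>

lemmas pointwise = plus_fun_apply zero_fun_apply uminus_apply minus_apply

declare pointwise [simp del]

lemma ksign_simps [simp]:
 "ksign n (a + b) = ksign n a + ksign n b" "ksign n 0 = 0" "ksign n (- a) = - ksign n a"
 "ksign n (a - b) = ksign n a - ksign n b" "ksign n (ksign n a) = a"
 by (auto simp: ksign_def)

lemma ksign_tens [simp]:
 "ksign n v \<otimes>\<^sub>k w = ksign n (v \<otimes>\<^sub>k w)" "v \<otimes>\<^sub>k ksign n w = ksign n (v \<otimes>\<^sub>k w)"
 by (auto simp: ksign_def)

lemma scl_ksign [simp]: "scl c (ksign n v) = ksign n (scl c v)"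
 by (auto simp: ksign_def)

lemma subspaceD:
 assumes "kvs.subspace (S :: ('x => 'k::field) set)"
 shows "0 : S" "!!a b. a : S ==> b : S ==> a + b : S" "!!c a. a : S ==> scl c a : S"
  "!!a. a : S ==> - a : S" "!!a b. a : S ==> b : S ==> a - b : S" "!!n a. a : S ==> ksign n a : S"
 using assms kvs.subspace_neg[OF assms] kvs.subspace_diff[OF assms] by (auto simp: kvs.subspace_def ksign_def)

lemma subspace_sum_list:
 assumes "kvs.subspace (S :: ('x => 'k::field) set)" "!!x. x : set xs ==> f x : S"
 shows "sum_list (map f xs) : S"
 using assms(2) by (induction xs) (auto simp: subspaceD[OF assms(1)])

lemma linear_intoD:
 assumes "linear_into V W f" "v : V"
 shows "f v : W" "!!c. f (scl c v) = scl c (f v)" "!!w. w : V ==> f (v + w) = f v + f w"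
 using assms by (auto simp: linear_into_def)

lemma linear_into_simps:
 assumes "linear_into V W f" "kvs.subspace V"
 shows "f 0 = 0" "!!v. v : V ==> f (- v) = - f v" "!!v w. v : V ==> w : V ==> f (v - w) = f v - f w"
  "!!n v. v : V ==> f (ksign n v) = ksign n (f v)"
proof -
 note V = subspaceD[OF assms(2)] and f = linear_intoD[OF assms(1)]
 show z: "f 0 = 0" using f(2)[OF V(1), of 0] by simp
 show m: "f (- v) = - f v" if "v : V" for v
  using f(2)[OF that, of "-1"] by simp
 show "f (v - w) = f v - f w" if "v : V" "w : V" for v w
  using f(3)[OF that(1) V(4)[OF that(2)]] m[OF that(2)] by simp
 show "f (ksign n v) = ksign n (f v)" if "v : V" for n v
  using m that by (simp add: ksign_def)
qed

lemma graded_spaceD: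
 assumes "graded_space V"
 shows "kvs.subspace (V n)"
  "!!N v. finite N ==> (!!n. n : N ==> v n : V n) ==> (\<Sum>n\<in>N. v n) = 0 ==> n : N ==> v n = 0"
proof -
 show "kvs.subspace (V n)" using assms by (simp add: graded_space_def)
 fix N v assume *: "finite N" "!!n. n : N ==> v n : V n" "(\<Sum>n\<in>N. v n) = 0" "n : N"
 have "finite N & (ALL n:N. v n : V n) & (\<Sum>n\<in>N. v n) = 0" using * by blast
 then have "ALL n:N. v n = 0"
  using assms[unfolded graded_space_def, THEN conjunct2, THEN spec, THEN spec, of N v] by (rule mp[rotated])
 then show "v n = 0" using *(4) by (rule bspec)
qed

lemma graded_space_disjoint:
 assumes "graded_space V" "v : V m" "v : V n" "m ~= n"
 shows "v = 0"
proof -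
 let ?v = "%i. if i = m then v else - v"
 have "?v m = 0"
  using assms(2-4) subspaceD(4)[OF graded_spaceD(1)[OF assms(1)]]
  by (intro graded_spaceD(2)[OF assms(1), of "{m, n}" ?v m]) auto
 then show ?thesis by simp
qed

lemma graded_subspace:
 assumes "graded_space V" "!!n. kvs.subspace (W n)" "!!n. W n \<subseteq> V n"
 shows "graded_space W"
 using assms unfolding graded_space_def by (meson subsetD)

section \<open>Maps out of tensor products\<close>

text \<open>The condition that makes \<open>tensor_lift\<close> single valued. A scalar is moved
  from one factor to the other and not taken out, because the target type carries no
  scalars.\<close>

definition balanced ::
 "('x, 'k::field) graded => ('y, 'k) graded =>
  (int => int => ('x => 'k) => ('y => 'k) => 'z::comm_monoid_add) => bool" where
 "balanced V W \<phi> \<longleftrightarrow> (ALL p q. ALL v:V p. ALL w:W q.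
   (ALL v':V p. \<phi> p q (v + v') w = \<phi> p q v w + \<phi> p q v' w) &
   (ALL w':W q. \<phi> p q v (w + w') = \<phi> p q v w + \<phi> p q v w') &
   (ALL c. \<phi> p q (scl c v) w = \<phi> p q v (scl c w)))"

definition hom_terms :: "('x, 'k) graded => ('y, 'k) graded => (int \<times> int \<times> ('x => 'k) \<times> ('y => 'k)) list => bool"
 where "hom_terms V W ts \<longleftrightarrow> (ALL (p, q, v, w) : set ts. v : V p & w : W q)"

definition term_sum :: "(int => int => ('x => 'k) => ('y => 'k) => 'z::comm_monoid_add) =>
  (int \<times> int \<times> ('x => 'k) \<times> ('y => 'k)) list => 'z"
 where "term_sum \<phi> ts = sum_list (map (%(p, q, v, w). \<phi> p q v w) ts)"

abbreviation tens_sum :: "(int \<times> int \<times> ('x => 'k::field) \<times> ('y => 'k)) list => 'x \<times> 'y => 'k"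
 where "tens_sum \<equiv> term_sum (%p q v w. v \<otimes>\<^sub>k w)"

lemma term_sum_simps [simp]:
 "term_sum \<phi> [] = 0" "term_sum \<phi> ((p, q, v, w) # ts) = \<phi> p q v w + term_sum \<phi> ts"
 "term_sum \<phi> (ts @ us) = term_sum \<phi> ts + term_sum \<phi> us"
 by (auto simp: term_sum_def)

lemma hom_terms_simps [simp]:
 "hom_terms V W []" "hom_terms V W ((p, q, v, w) # ts) \<longleftrightarrow> v : V p & w : W q & hom_terms V W ts"
 "hom_terms V W (ts @ us) \<longleftrightarrow> hom_terms V W ts & hom_terms V W us"
 by (simp_all add: hom_terms_def ball_Un)

text \<open>Induction on the number of terms. If \<open>v1\<close> does not vanish at
  \<open>x\<close>, the relation evaluated at \<open>x\<close> writes \<open>w1\<close> as a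
  combination of the other right factors; substituting it leaves a relation with one term
  less.\<close>

lemma balanced_sum_zero:
 fixes f :: "('x => 'k::field) => ('y => 'k) => 'z::ab_group_add"
 assumes V: "kvs.subspace V" and W: "kvs.subspace W"
  and addl: "!!v v' w. v : V ==> v' : V ==> w : W ==> f (v + v') w = f v w + f v' w"
  and addr: "!!v w w'. v : V ==> w : W ==> w' : W ==> f v (w + w') = f v w + f v w'"
  and bal: "!!c v w. v : V ==> w : W ==> f (scl c v) w = f v (scl c w)"
  and ts: "!!v w. (v, w) : set ts ==> v : V & w : W"
  and zero: "sum_list (map (%(v, w). v \<otimes>\<^sub>k w) ts) = 0"
 shows "sum_list (map (%(v, w). f v w) ts) = 0"
 using ts zero
proof (induction "length ts" arbitrary: ts)
 case 0 then show ?case by simp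
next
 case (Suc n)
 obtain v1 w1 us where tsc: "ts = (v1, w1) # us"
  using Suc.hyps(2) by (cases ts) auto
 have v1: "v1 : V" and w1: "w1 : W" and us: "!!v w. (v, w) : set us ==> v : V & w : W"
  using Suc.prems(1) tsc by auto
 have len: "n = length us" using Suc.hyps(2) tsc by simp
 show ?case
 proof (cases "v1 = 0")
  case True
  have "f 0 w1 = 0"
   using addl[of 0 0 w1] subspaceD(1)[OF V] w1 by simp
  then show ?thesis
   using Suc.hyps(1)[OF len us] Suc.prems(2) tsc True by simp
 next
  case False
  then obtain x where x: "v1 x ~= 0" by (auto simp: fun_eq_iff pointwise)
  \<comment> \<open>Evaluation of the left factors at \<open>x\<close> says that (v1 x) w1 plus the
    sum of the (v x) w is zero; these are the coefficients after solving for
    \<open>w1\<close>.\<close>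
  define c where "c v = - (v x) / v1 x" for v :: "'x => 'k"
  have w1_eq: "w1 = sum_list (map (%(v, w). scl (c v) w) us)"
  proof
   fix y
   have "v1 x * w1 y + sum_list (map (%(v, w). v x * w y) us) = 0"
    using fun_cong[OF Suc.prems(2)[unfolded tsc], of "(x, y)"]
    by (simp add: sum_list_fun tens_def o_def case_prod_unfold pointwise)
   then have "w1 y = sum_list (map (%(v, w). v x * w y) us) * (- 1 / v1 x)"
    using x by (simp add: field_simps eq_neg_iff_add_eq_0)
   also have "... = sum_list (map (%(v, w). c v * w y) us)"
    unfolding sum_list_mult_const[symmetric] by (simp add: c_def case_prod_unfold)
   finally show "w1 y = sum_list (map (%(v, w). scl (c v) w) us) y"
    by (simp add: sum_list_fun o_def case_prod_unfold scl_def)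
  qed
  \<comment> \<open>The term of \<open>v1\<close> is distributed over the left factors of the
    remaining terms.\<close>
  define us' where "us' = map (%(v, w). (v + scl (c v) v1, w)) us"
  have f1: "f v1 (sum_list (map (%(v, w). scl (c v) w) xs)) = sum_list (map (%(v, w). f (scl (c v) v1) w) xs)"
   if "set xs \<subseteq> set us" for xs using that
  proof (induction xs)
   case Nil
   then show ?case using addr[of v1 0 0] subspaceD(1)[OF W] v1 by simp
  next
   case (Cons a xs)
   obtain v w where a: "a = (v, w)" by force
   have "sum_list (map (%(v, w). scl (c v) w) xs) : W"
    using Cons.prems us by (intro subspace_sum_list[OF W]) (auto intro!: subspaceD(3)[OF W])
   then show ?case
    using Cons us subspaceD(3)[OF W] v1 bal[of v1 w "c v"]
    by (auto simp: a addr)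
  qed
  have f2: "sum_list (map (%(v, w). f v w) (map (%(v, w). (v + scl (c v) v1, w)) xs)) =
   sum_list (map (%(v, w). f v w) xs) + sum_list (map (%(v, w). f (scl (c v) v1) w) xs)"
   if "set xs \<subseteq> set us" for xs using that
   using us v1 by (induction xs) (auto simp: addl subspaceD(3)[OF V])
  have t1: "v1 \<otimes>\<^sub>k sum_list (map (%(v, w). scl (c v) w) xs) = sum_list (map (%(v, w). scl (c v) v1 \<otimes>\<^sub>k w) xs)"
   for xs by (induction xs) auto
  have t2: "sum_list (map (%(v, w). v \<otimes>\<^sub>k w) (map (%(v, w). (v + scl (c v) v1, w)) xs)) =
   sum_list (map (%(v, w). v \<otimes>\<^sub>k w) xs) + sum_list (map (%(v, w). scl (c v) v1 \<otimes>\<^sub>k w) xs)" for xs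
   by (induction xs) auto
  have "sum_list (map (%(v, w). v \<otimes>\<^sub>k w) us') = 0"
   using Suc.prems(2) t1[of us] t2[of us] w1_eq by (simp add: us'_def tsc add.commute)
  moreover have "v : V & w : W" if "(v, w) : set us'" for v w
   using that us v1 subspaceD[OF V] by (auto simp: us'_def)
  ultimately have "sum_list (map (%(v, w). f v w) us') = 0"
   using Suc.hyps(1)[of us'] len by (simp add: us'_def)
  then show ?thesis
   using f1[of us] f2[of us] w1_eq by (simp add: us'_def tsc add.commute)
 qed
qed

lemma sum_list_group:
 fixes g :: "'a => 'z::comm_monoid_add"
 assumes "finite N" "!!x. x : set xs ==> h x : N"
 shows "sum_list (map g xs) = (\<Sum>n\<in>N. sum_list (map g (filter (%x. h x = n) xs)))"
 using assms(2)
proof (induction xs)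
 case (Cons x xs)
 have "(\<Sum>n\<in>N. sum_list (map g (filter (%y. h y = n) (x # xs)))) =
  (\<Sum>n\<in>N. (if h x = n then g x else 0) + sum_list (map g (filter (%y. h y = n) xs)))"
  by (intro sum.cong) auto
 also have "... = g x + sum_list (map g xs)"
  using Cons assms(1) by (simp add: sum.distrib)
 finally show ?case by simp
qed simp

lemma graded_list_zero:
 assumes V: "graded_space V" and g: "!!x. x : set xs ==> g x : V (h x)"
  and zero: "sum_list (map g xs) = 0"
 shows "sum_list (map g (filter (%x. h x = n) xs)) = 0"
proof (cases "n : h ` set xs")
 case True
 have "sum_list (map g (filter (%x. h x = m) xs)) : V m" for m
  using g by (intro subspace_sum_list[OF graded_spaceD(1)[OF V]]) auto
 moreover have "(\<Sum>n\<in>h ` set xs. sum_list (map g (filter (%x. h x = n) xs))) = 0"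
  using sum_list_group[of "h ` set xs" xs h g] zero by simp
 ultimately show ?thesis
  using True by (intro graded_spaceD(2)[OF V, of "h ` set xs" "%n. sum_list (map g (filter (%x. h x = n) xs))"]) auto
next
 case False
 then have "filter (%x. h x = n) xs = []" by (auto simp: filter_empty_conv)
 then show ?thesis by simp
qed

lemma tens_sum_apply: "tens_sum ts (x, y) = sum_list (map (%(p, q, v, w). w y * v x) ts)"
 by (simp add: term_sum_def sum_list_fun o_def case_prod_unfold tens_def mult.commute)

text \<open>Fixing the coordinate \<open>y\<close> of the right factor turns the relation into one
  between homogeneous vectors of \<open>V\<close>, which splits by degree. Fixing the left
  coordinate afterwards splits it by the degree in \<open>W\<close>.\<close>

lemma tens_sum_component:
 fixes V :: "('x, 'k::field) graded" and W :: "('y, 'k) graded"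
 assumes V: "graded_space V" and W: "graded_space W" and ts: "hom_terms V W ts" and zero: "tens_sum ts = 0"
 shows "tens_sum (filter (%t. fst t = p & fst (snd t) = q) ts) = 0"
proof -
 have 1: "tens_sum (filter (%t. fst t = p) ts) = 0"
 proof
  fix z :: "'x \<times> 'y"
  obtain x y where z: "z = (x, y)" by force
  have "sum_list (map (%(p, q, v, w). scl (w y) v) ts) = 0"
  proof
   fix x
   show "sum_list (map (%(p, q, v, w). scl (w y) v) ts) x = 0 x"
    using fun_cong[OF zero, of "(x, y)"]
    by (simp add: tens_sum_apply sum_list_fun o_def case_prod_unfold scl_def pointwise)
  qed
  then have "sum_list (map (%(p, q, v, w). scl (w y) v) (filter (%t. fst t = p) ts)) = 0"
   using ts subspaceD(3)[OF graded_spaceD(1)[OF V]]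
   by (intro graded_list_zero[OF V, where h = fst]) (auto simp: hom_terms_def)
  from fun_cong[OF this, of x] show "tens_sum (filter (%t. fst t = p) ts) z = 0 z"
   by (simp add: z tens_sum_apply sum_list_fun o_def case_prod_unfold scl_def pointwise)
 qed
 have ts': "hom_terms V W (filter (%t. fst t = p) ts)"
  using ts by (auto simp: hom_terms_def)
 show ?thesis
 proof
  fix z :: "'x \<times> 'y"
  obtain x y where z: "z = (x, y)" by force
  have "sum_list (map (%(p, q, v, w). scl (v x) w) (filter (%t. fst t = p) ts)) = 0"
  proof
   fix y
   show "sum_list (map (%(p, q, v, w). scl (v x) w) (filter (%t. fst t = p) ts)) y = 0 y"
    using fun_cong[OF 1, of "(x, y)"]
    by (simp add: tens_sum_apply sum_list_fun o_def case_prod_unfold scl_def pointwise mult.commute)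
  qed
  then have "sum_list (map (%(p, q, v, w). scl (v x) w) (filter (%t. fst (snd t) = q) (filter (%t. fst t = p) ts))) = 0"
   using ts' subspaceD(3)[OF graded_spaceD(1)[OF W]]
   by (intro graded_list_zero[OF W, where h = "%t. fst (snd t)"]) (auto simp: hom_terms_def)
  from fun_cong[OF this, of y] show "tens_sum (filter (%t. fst t = p & fst (snd t) = q) ts) z = 0 z"
   by (simp add: z tens_sum_apply sum_list_fun o_def case_prod_unfold scl_def pointwise mult.commute conj_commute)
 qed
qed

lemma balancedD:
 assumes "balanced V W \<phi>" "v : V p" "w : W q"
 shows "!!v'. v' : V p ==> \<phi> p q (v + v') w = \<phi> p q v w + \<phi> p q v' w"
  "!!w'. w' : W q ==> \<phi> p q v (w + w') = \<phi> p q v w + \<phi> p q v w'"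
  "!!c. \<phi> p q (scl c v) w = \<phi> p q v (scl c w)"
 using assms(1)[unfolded balanced_def, THEN spec, THEN spec, THEN bspec, THEN bspec, OF assms(2,3)]
 by simp_all

lemma balanced_graded_zero:
 fixes \<phi> :: "int => int => ('x => 'k::field) => ('y => 'k) => 'z::ab_group_add"
 assumes V: "graded_space V" and W: "graded_space W" and bal: "balanced V W \<phi>"
  and ts: "hom_terms V W ts" and zero: "tens_sum ts = 0"
 shows "term_sum \<phi> ts = 0"
proof -
 let ?h = "%t :: int \<times> int \<times> ('x => 'k) \<times> ('y => 'k). (fst t, fst (snd t))"
 have "sum_list (map (%(p, q, v, w). \<phi> p q v w) (filter (%t. ?h t = n) ts)) = 0" for n
 proof -
  obtain p q where n: "n = (p, q)" by force
  let ?us = "map (%(p, q, v, w). (v, w)) (filter (%t. ?h t = n) ts)"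
  have "sum_list (map (%(v, w). v \<otimes>\<^sub>k w) ?us) = 0"
   using tens_sum_component[OF V W ts zero, of p q]
   by (simp add: n term_sum_def o_def case_prod_unfold)
  then have z: "sum_list (map (%(v, w). v \<otimes>\<^sub>k w) ?us) = 0" .
  have us: "v : V p & w : W q" if "(v, w) : set ?us" for v w
   using that ts by (force simp: n hom_terms_def)
  have "sum_list (map (%(v, w). \<phi> p q v w) ?us) = 0"
   by (rule balanced_sum_zero[OF graded_spaceD(1)[OF V, of p] graded_spaceD(1)[OF W, of q] _ _ _ us z])
    (rule balancedD[OF bal]; assumption)+
  also have "map (%(v, w). \<phi> p q v w) ?us = map (%(p, q, v, w). \<phi> p q v w) (filter (%t. ?h t = n) ts)"
   by (auto simp: n)
  finally show ?thesis .
 qed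
 then show ?thesis
  using sum_list_group[of "?h ` set ts" ts ?h "%(p, q, v, w). \<phi> p q v w"]
  by (simp add: term_sum_def)
qed

lemma balanced_uminus:
 fixes \<phi> :: "int => int => ('x => 'k::field) => ('y => 'k) => 'z::ab_group_add"
 assumes V: "graded_space V" and bal: "balanced V W \<phi>" and v: "v : V p" and w: "w : W q"
 shows "\<phi> p q (- v) w = - \<phi> p q v w"
proof -
 have "\<phi> p q 0 w = 0"
  using balancedD(1)[OF bal, of 0 p w q 0] subspaceD(1)[OF graded_spaceD(1)[OF V]] w by simp
 then show ?thesis
  using balancedD(1)[OF bal v w, of "- v"] subspaceD(4)[OF graded_spaceD(1)[OF V]] v
  by (simp add: eq_neg_iff_add_eq_0 add.commute)
qed

text \<open>If \<open>us\<close> is a second presentation of the same tensor, then \<open>ts\<close>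
  followed by \<open>us\<close> with negated left factors presents 0, and
  \<open>balanced_graded_zero\<close> makes the two values agree. This settles the uniqueness in the
  definite description.\<close>

lemma tensor_lift_sum:
 fixes \<phi> :: "int => int => ('x => 'k::field) => ('y => 'k) => 'z::ab_group_add"
 assumes V: "graded_space V" and W: "graded_space W" and bal: "balanced V W \<phi>"
  and ts: "hom_terms V W ts"
 shows "tensor_lift V W \<phi> (tens_sum ts) = term_sum \<phi> ts"
 unfolding tensor_lift_def
proof (rule the_equality)
 show "EX us. (ALL (p, q, v, w):set us. v : V p & w : W q) &
   tens_sum ts = sum_list (map (%(p, q, v, w). v \<otimes>\<^sub>k w) us) &
   term_sum \<phi> ts = sum_list (map (%(p, q, v, w). \<phi> p q v w) us)"
  using ts by (intro exI[of _ ts]) (simp add: hom_terms_def term_sum_def)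
next
 fix z
 assume "EX us. (ALL (p, q, v, w):set us. v : V p & w : W q) &
   tens_sum ts = sum_list (map (%(p, q, v, w). v \<otimes>\<^sub>k w) us) &
   z = sum_list (map (%(p, q, v, w). \<phi> p q v w) us)"
 then obtain us where us: "hom_terms V W us" "tens_sum ts = tens_sum us" "z = term_sum \<phi> us"
  by (auto simp: hom_terms_def term_sum_def)
 define neg where "neg = map (%(p, q, v, w). (p, q, - v, w)) us"
 have neg: "hom_terms V W neg"
  using us(1) subspaceD(4)[OF graded_spaceD(1)[OF V]] by (auto simp: neg_def hom_terms_def)
 have "tens_sum (map (%(p, q, v, w). (p, q, - v, w)) xs) = - tens_sum xs" for xs :: "(int \<times> int \<times> ('x => 'k) \<times> ('y => 'k)) list"
  by (induction xs) auto
 moreover have "term_sum \<phi> (map (%(p, q, v, w). (p, q, - v, w)) xs) = - term_sum \<phi> xs" if "hom_terms V W xs" for xs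
  using that by (induction xs) (auto simp: balanced_uminus[OF V bal])
 ultimately have "term_sum \<phi> (ts @ neg) = 0"
  using balanced_graded_zero[OF V W bal, of "ts @ neg"] ts neg us by (simp add: neg_def)
 then show "z = term_sum \<phi> ts"
  using us \<open>!!xs. hom_terms V W xs ==> term_sum \<phi> (map (%(p, q, v, w). (p, q, - v, w)) xs) = - term_sum \<phi> xs\<close>[OF us(1)]
  by (simp add: neg_def)
qed

lemma tensor_lift_pure:
 fixes \<phi> :: "int => int => ('x => 'k::field) => ('y => 'k) => 'z::ab_group_add"
 assumes "graded_space V" "graded_space W" "balanced V W \<phi>" "v : V p" "w : W q"
 shows "tensor_lift V W \<phi> (v \<otimes>\<^sub>k w) = \<phi> p q v w"
 using tensor_lift_sum[OF assms(1-3), of "[(p, q, v, w)]"] assms(4,5) by simp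

section \<open>Components of the tensor product and induction over pure tensors\<close>

lemma tensor_subspace [simp]: "kvs.subspace (tensor V W n)"
 by (simp add: tensor_def)

lemma tens_in_tensor: "v : V p ==> w : W q ==> p + q = n ==> v \<otimes>\<^sub>k w : tensor V W n"
 unfolding tensor_def by (rule kvs.span_base) blast

lemma tensor_terms:
 assumes V: "graded_space V" and t: "t : tensor V W n"
 obtains ts where "hom_terms V W ts" "t = tens_sum ts" "!!p q v w. (p, q, v, w) : set ts ==> p + q = n"
proof -
 have "EX ts. hom_terms V W ts & t = tens_sum ts & (ALL (p, q, v, w) : set ts. p + q = n)"
  using t unfolding tensor_def
 proof (induction rule: kvs.span_induct_alt)
  case base
  show ?case by (intro exI[of _ "[]"]) simp
 next
  case (step c x y)
  then obtain p q v w ts where *: "x = v \<otimes>\<^sub>k w" "v : V p" "w : W q" "p + q = n"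
   "hom_terms V W ts" "y = tens_sum ts" "ALL (p, q, v, w) : set ts. p + q = n" by blast
  show ?case
   using * subspaceD(3)[OF graded_spaceD(1)[OF V]]
   by (intro exI[of _ "(p, q, scl c v, w) # ts"]) auto
 qed
 then show thesis using that by blast
qed

lemma hom_terms_tensor:
 assumes "hom_terms V W ts" "!!p q v w. (p, q, v, w) : set ts ==> p + q = n"
 shows "tens_sum ts : tensor V W n"
proof -
 have "(%(p, q, v, w). v \<otimes>\<^sub>k w) x : tensor V W n" if x: "x : set ts" for x
 proof -
  obtain p q v w where e: "x = (p, q, v, w)" by (cases x)
  have "v : V p & w : W q" using assms(1) x unfolding hom_terms_def e by blast
  then show ?thesis using assms(2)[of p q v w] x tens_in_tensor[of v V p w W q n] by (simp add: e)
 qed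
 then show ?thesis
  unfolding term_sum_def by (rule subspace_sum_list[OF tensor_subspace])
qed

lemma tensor_induct [consumes 2, case_names pure add zero]:
 assumes V: "graded_space V" and t: "t : tensor V W n"
  and pure: "!!p q v w. v : V p ==> w : W q ==> p + q = n ==> P (v \<otimes>\<^sub>k w)"
  and add: "!!s t. s : tensor V W n ==> t : tensor V W n ==> P s ==> P t ==> P (s + t)"
  and zero: "P 0"
 shows "P t"
proof -
 obtain ts where ts: "hom_terms V W ts" "t = tens_sum ts" "!!p q v w. (p, q, v, w) : set ts ==> p + q = n"
  using tensor_terms[OF V t] by metis
 have "P (tens_sum ts)" using ts(1,3)
 proof (induction ts)
  case (Cons a ts)
  obtain p q v w where a: "a = (p, q, v, w)" by (cases a)
  have pq: "p + q = n" using Cons.prems(2)[of p q v w] by (simp add: a)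
  have *: "v : V p" "w : W q" "hom_terms V W ts" using Cons.prems(1) by (simp_all add: a)
  have ts: "p + q = n" if "(p, q, v, w) : set ts" for p q v w
   by (rule Cons.prems(2)[of p q v w]) (simp add: that)
  have "P (v \<otimes>\<^sub>k w + tens_sum ts)"
   by (rule add[OF tens_in_tensor[where V = V and W = W and p = p and q = q, OF *(1,2) pq] hom_terms_tensor[OF *(3) ts] pure[OF *(1,2) pq] Cons.IH[OF *(3) ts]])
  then show ?case by (simp add: a)
 qed (simp add: zero)
 then show ?thesis by (simp add: ts)
qed

context
 fixes V :: "('x, 'k::field) graded" and W :: "('y, 'k) graded"
  and \<phi> :: "int => int => ('x => 'k) => ('y => 'k) => 'z::ab_group_add"
 assumes V: "graded_space V" and W: "graded_space W" and bal: "balanced V W \<phi>"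
begin

lemma tensor_lift_add:
 assumes "s : tensor V W m" "t : tensor V W n"
 shows "tensor_lift V W \<phi> (s + t) = tensor_lift V W \<phi> s + tensor_lift V W \<phi> t"
proof -
 obtain ss where s: "hom_terms V W ss" "s = tens_sum ss" using tensor_terms[OF V assms(1)] by metis
 obtain ts where t: "hom_terms V W ts" "t = tens_sum ts" using tensor_terms[OF V assms(2)] by metis
 show ?thesis
  using tensor_lift_sum[OF V W bal, of "ss @ ts"] tensor_lift_sum[OF V W bal] s t by simp
qed

lemma tensor_lift_zero: "tensor_lift V W \<phi> 0 = 0"
 using tensor_lift_sum[OF V W bal, of "[]"] by simp

text \<open>\<open>h\<close> plays the part of multiplication by \<open>c\<close> on a target
  without scalars; what is assumed of it is how such a multiplication behaves along a sum of
  terms.\<close>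

lemma tensor_lift_scl:
 assumes t: "t : tensor V W n"
  and h: "h 0 = 0" "!!p q v w z. v : V p ==> w : W q ==> h (\<phi> p q v w + z) = \<phi> p q (scl c v) w + h z"
 shows "tensor_lift V W \<phi> (scl c t) = h (tensor_lift V W \<phi> t)"
proof -
 obtain ts where ts: "hom_terms V W ts" "t = tens_sum ts" using tensor_terms[OF V t] by metis
 define us where "us = map (%(p, q, v, w). (p, q, scl c v, w)) ts"
 have "hom_terms V W us" "tens_sum us = scl c (tens_sum ts)" "term_sum \<phi> us = h (term_sum \<phi> ts)"
  using ts(1) unfolding us_def
  by (induction ts) (auto simp: h subspaceD(3)[OF graded_spaceD(1)[OF V]])
 then show ?thesis
  by (metis tensor_lift_sum[OF V W bal] ts)
qed

end

lemma tensor_lift_scl_fun: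
 fixes \<phi> :: "int => int => ('x => 'k::field) => ('y => 'k) => 'z => 'k"
 assumes "graded_space V" "graded_space W" "balanced V W \<phi>" "t : tensor V W n"
  "!!p q v w. v : V p ==> w : W q ==> \<phi> p q (scl c v) w = scl c (\<phi> p q v w)"
 shows "tensor_lift V W \<phi> (scl c t) = scl c (tensor_lift V W \<phi> t)"
 using assms(5) by (intro tensor_lift_scl[OF assms(1-4)]) auto

lemma tensor_lift_in:
 fixes \<phi> :: "int => int => ('x => 'k::field) => ('y => 'k) => 'z => 'k"
 assumes "graded_space V" "graded_space W" "balanced V W \<phi>" "t : tensor V W n" "kvs.subspace U"
  "!!p q v w. v : V p ==> w : W q ==> p + q = n ==> \<phi> p q v w : U"
 shows "tensor_lift V W \<phi> t : U"
 using assms(1,4)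
proof (induction rule: tensor_induct)
 case (add s t)
 then show ?case by (simp add: tensor_lift_add[OF assms(1-3)] subspaceD[OF assms(5)])
qed (auto simp: tensor_lift_pure[OF assms(1-3)] tensor_lift_zero[OF assms(1-3)] assms(6) subspaceD[OF assms(5)])

text \<open>The lift of the family that keeps pure tensors of total degree \<open>n\<close> and
  kills the others is the identity in degree \<open>n\<close> and zero in all other degrees. Applied
  to a vanishing sum it isolates one summand.\<close>

lemma graded_space_tensor:
 assumes V: "graded_space V" and W: "graded_space W"
 shows "graded_space (tensor V W)"
 unfolding graded_space_def
proof (intro conjI allI impI ballI)
 fix N v n
 assume *: "finite N & (ALL n:N. v n : tensor V W n) & sum v N = 0" and n: "n : N"
 let ?\<phi> = "%p q v w. if p + q = n then v \<otimes>\<^sub>k w else 0"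
 have bal: "balanced V W ?\<phi>" by (auto simp: balanced_def)
 have 1: "tensor_lift V W ?\<phi> t = (if m = n then t else 0)" if "t : tensor V W m" for t m
  using V that
 proof (induction rule: tensor_induct)
  case (pure p q v w)
  then show ?case by (simp add: tensor_lift_pure[OF V W bal])
 next
  case (add s t)
  then show ?case by (simp add: tensor_lift_add[OF V W bal])
 qed (simp add: tensor_lift_zero[OF V W bal])
 \<comment> \<open>The sum runs through several degrees and is not an element of one component, so
   additivity of the lift is derived from explicit lists of terms.\<close>
 have "tensor_lift V W ?\<phi> (sum v M) = (\<Sum>m\<in>M. if m = n then v m else 0) &
   (EX ts. hom_terms V W ts & sum v M = tens_sum ts)" if "M \<subseteq> N" "finite M" for M
  using that(2,1)
 proof (induction)
  case empty
  then show ?case using tensor_lift_zero[OF V W bal] by (auto intro: exI[of _ "[]"])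
 next
  case (insert m M)
  then obtain ts where ts: "hom_terms V W ts" "sum v M = tens_sum ts" by auto
  have vm: "v m : tensor V W m" using * insert(4) by simp
  obtain us where us: "hom_terms V W us" "v m = tens_sum us"
   using tensor_terms[OF V vm] by metis
  have "tensor_lift V W ?\<phi> (v m + sum v M) = tensor_lift V W ?\<phi> (v m) + tensor_lift V W ?\<phi> (sum v M)"
   using tensor_lift_sum[OF V W bal, of "us @ ts"] tensor_lift_sum[OF V W bal] ts us by simp
  moreover have "hom_terms V W (us @ ts) & v m + sum v M = tens_sum (us @ ts)"
   using ts us by simp
  moreover have "tensor_lift V W ?\<phi> (sum v M) = (\<Sum>m\<in>M. if m = n then v m else 0)"
   using insert(3,4) by blast
  moreover have "sum v (insert m M) = v m + sum v M"
   "(\<Sum>m\<in>insert m M. if m = n then v m else 0) = (if m = n then v m else 0) + (\<Sum>m\<in>M. if m = n then v m else 0)"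
   by (rule sum.insert[OF insert(1,2)])+
  moreover note 1[OF vm]
  ultimately show ?case by (intro conjI exI[of _ "us @ ts"]) (simp_all only: )
 qed
 from this[OF subset_refl] * have "tensor_lift V W ?\<phi> 0 = (\<Sum>m\<in>N. if m = n then v m else 0)" by metis
 then show "v n = 0"
  using tensor_lift_zero[OF V W bal] * n by (simp add: sum.delta)
qed simp

section \<open>Tensor products of curved algebras\<close>

lemma ksign_ksign: "ksign m (ksign n a) = ksign (m + n) a"
 by (auto simp: ksign_def)

lemma ksign_cong: "even (m - n) ==> ksign m a = ksign n a"
 by (auto simp: ksign_def)

lemma ksign_even [simp]: "even n ==> ksign n a = a"
 by (simp add: ksign_def)

lemma curved_algebraD:
 fixes A :: "('a, 'b::field) curved_alg"
 assumes "curved_algebra A"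
 shows "graded_space (car A)"
  "!!p q a. a : car A p ==> linear_into (car A q) (car A (p + q)) (%b. mul A a b)"
  "!!p q b. b : car A q ==> linear_into (car A p) (car A (p + q)) (%a. mul A a b)"
  "!!p q r a b c. a : car A p ==> b : car A q ==> c : car A r ==> mul A (mul A a b) c = mul A a (mul A b c)"
  "unt A : car A 0"
  "!!p a. a : car A p ==> mul A (unt A) a = a" "!!p a. a : car A p ==> mul A a (unt A) = a"
  "!!n. linear_into (car A n) (car A (n + 1)) (dif A)"
  "!!p q a b. a : car A p ==> b : car A q ==>
    dif A (mul A a b) = mul A (dif A a) b + ksign p (mul A a (dif A b))"
  "cur A : car A 2" "dif A (cur A) = 0"
  "!!p a. a : car A p ==> dif A (dif A a) = mul A (cur A) a - mul A a (cur A)"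
  "!!n. kvs.subspace (car A n)"
proof -
 note c1 = assms[unfolded curved_algebra_def graded_map_def]
 note c2 = c1[THEN conjunct2]
 note c3 = c2[THEN conjunct2]
 note c4 = c3[THEN conjunct2]
 note c5 = c4[THEN conjunct2]
 note c6 = c5[THEN conjunct2]
 note c7 = c6[THEN conjunct2]
 note c8 = c7[THEN conjunct2]
 note c9 = c8[THEN conjunct2]
 note c10 = c9[THEN conjunct2]
 note c11 = c10[THEN conjunct2]
 note c1 = c1[THEN conjunct1] and c2 = c2[THEN conjunct1] and c3 = c3[THEN conjunct1] and c4 = c4[THEN conjunct1] and c5 = c5[THEN conjunct1] and c6 = c6[THEN conjunct1] and c7 = c7[THEN conjunct1] and c8 = c8[THEN conjunct1] and c9 = c9[THEN conjunct1] and c10 = c10[THEN conjunct1]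
 show "graded_space (car A)" "unt A : car A 0" "cur A : car A 2" "dif A (cur A) = 0" by (fact c1 c5 c9 c10)+
 show "kvs.subspace (car A n)" for n by (rule graded_spaceD(1)[OF c1])
 fix p q r n :: int and a b c :: "'a => 'b"
 show "linear_into (car A q) (car A (p + q)) (%b. mul A a b)" if "a : car A p" by (rule c2[rule_format, OF that])
 show "linear_into (car A p) (car A (p + q)) (%a. mul A a b)" if "b : car A q" by (rule c3[rule_format, OF that])
 show "mul A (mul A a b) c = mul A a (mul A b c)" if "a : car A p" "b : car A q" "c : car A r"
  by (rule c4[rule_format, OF that])
 show "mul A (unt A) a = a" "mul A a (unt A) = a" if "a : car A p"
  by (rule c6[rule_format, OF that, THEN conjunct1], rule c6[rule_format, OF that, THEN conjunct2])
 show "linear_into (car A n) (car A (n + 1)) (dif A)" by (rule c7[rule_format])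
 show "dif A (mul A a b) = mul A (dif A a) b + ksign p (mul A a (dif A b))" if "a : car A p" "b : car A q"
  by (rule c8[rule_format, OF that])
 show "dif A (dif A a) = mul A (cur A) a - mul A a (cur A)" if "a : car A p"
  by (rule c11[rule_format, OF that])
qed

section \<open>Rules of computation in a curved algebra\<close>

lemma mul_closed: "curved_algebra A ==> a : car A p ==> b : car A q ==> mul A a b : car A (p + q)"
 by (rule linear_intoD(1)[OF curved_algebraD(2)])

lemma mul_add_right: "curved_algebra A ==> a : car A p ==> b : car A q ==> c : car A q ==> mul A a (b + c) = mul A a b + mul A a c"
 by (rule linear_intoD(3)[OF curved_algebraD(2)])

lemma mul_add_left: "curved_algebra A ==> a : car A p ==> b : car A p ==> c : car A q ==> mul A (a + b) c = mul A a c + mul A b c"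
 by (rule linear_intoD(3)[OF curved_algebraD(3)])

lemma mul_scl_right: "curved_algebra A ==> a : car A p ==> b : car A q ==> mul A a (scl c b) = scl c (mul A a b)"
 by (rule linear_intoD(2)[OF curved_algebraD(2)])

lemma mul_scl_left: "curved_algebra A ==> a : car A p ==> b : car A q ==> mul A (scl c a) b = scl c (mul A a b)"
 by (rule linear_intoD(2)[OF curved_algebraD(3)])

lemma mul_ksign_right: "curved_algebra A ==> a : car A p ==> b : car A q ==> mul A a (ksign n b) = ksign n (mul A a b)"
 by (rule linear_into_simps(4)[OF curved_algebraD(2) curved_algebraD(13)])

lemma mul_ksign_left: "curved_algebra A ==> a : car A p ==> b : car A q ==> mul A (ksign n a) b = ksign n (mul A a b)"
 by (rule linear_into_simps(4)[OF curved_algebraD(3) curved_algebraD(13)])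

lemma mul_diff_right: "curved_algebra A ==> a : car A p ==> b : car A q ==> c : car A q ==> mul A a (b - c) = mul A a b - mul A a c"
 by (rule linear_into_simps(3)[OF curved_algebraD(2) curved_algebraD(13)])

lemma mul_diff_left: "curved_algebra A ==> a : car A p ==> b : car A p ==> c : car A q ==> mul A (a - b) c = mul A a c - mul A b c"
 by (rule linear_into_simps(3)[OF curved_algebraD(3) curved_algebraD(13)])

lemma mul_zero_right: "curved_algebra A ==> a : car A p ==> mul A a 0 = 0"
 by (rule linear_into_simps(1)[OF curved_algebraD(2) curved_algebraD(13)])

lemma mul_zero_left: "curved_algebra A ==> a : car A p ==> mul A 0 a = 0"
 by (rule linear_into_simps(1)[OF curved_algebraD(3) curved_algebraD(13)])

lemma dif_closed: "curved_algebra A ==> a : car A p ==> dif A a : car A (p + 1)"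
 by (rule linear_intoD(1)[OF curved_algebraD(8)])

lemma dif_add: "curved_algebra A ==> a : car A p ==> b : car A p ==> dif A (a + b) = dif A a + dif A b"
 by (rule linear_intoD(3)[OF curved_algebraD(8)])

lemma dif_diff: "curved_algebra A ==> a : car A p ==> b : car A p ==> dif A (a - b) = dif A a - dif A b"
 by (rule linear_into_simps(3)[OF curved_algebraD(8) curved_algebraD(13)])

lemma dif_scl: "curved_algebra A ==> a : car A p ==> dif A (scl c a) = scl c (dif A a)"
 by (rule linear_intoD(2)[OF curved_algebraD(8)])

lemma dif_zero: "curved_algebra A ==> dif A 0 = 0"
 by (rule linear_into_simps(1)[OF curved_algebraD(8) curved_algebraD(13)])

lemma dif_unit:
 assumes A: "curved_algebra A"
 shows "dif A (unt A) = 0"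
proof -
 note u = curved_algebraD(5)[OF A]
 have du: "dif A (unt A) : car A (0 + 1)" by (rule dif_closed[OF A u])
 have "dif A (unt A) = dif A (mul A (unt A) (unt A))"
  using curved_algebraD(6)[OF A u] by simp
 also have "... = dif A (unt A) + dif A (unt A)"
  using curved_algebraD(9)[OF A u u] curved_algebraD(6)[OF A du] curved_algebraD(7)[OF A du] by simp
 finally show ?thesis by simp
qed

lemma linear_intoI:
 assumes "!!v. v : V ==> f v : W" "!!v c. v : V ==> f (scl c v) = scl c (f v)"
  "!!v w. v : V ==> w : V ==> f (v + w) = f v + f w"
 shows "linear_into V W f"
 using assms by (simp add: linear_into_def)

lemma curved_algebraI:
 assumes "graded_space (car A)"
  "!!p q a. a : car A p ==> linear_into (car A q) (car A (p + q)) (%b. mul A a b)"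
  "!!p q b. b : car A q ==> linear_into (car A p) (car A (p + q)) (%a. mul A a b)"
  "!!p q r a b c. a : car A p ==> b : car A q ==> c : car A r ==> mul A (mul A a b) c = mul A a (mul A b c)"
  "unt A : car A 0"
  "!!p a. a : car A p ==> mul A (unt A) a = a" "!!p a. a : car A p ==> mul A a (unt A) = a"
  "!!n. linear_into (car A n) (car A (n + 1)) (dif A)"
  "!!p q a b. a : car A p ==> b : car A q ==>
    dif A (mul A a b) = mul A (dif A a) b + ksign p (mul A a (dif A b))"
  "cur A : car A 2" "dif A (cur A) = 0"
  "!!p a. a : car A p ==> dif A (dif A a) = mul A (cur A) a - mul A a (cur A)"
 shows "curved_algebra A"
 unfolding curved_algebra_def graded_map_def by (intro conjI allI ballI) (rule assms; assumption)+

lemma tens_car: "a : car A p ==> b : car B q ==> p + q = n ==> a \<otimes>\<^sub>k b : tensor (car A) (car B) n"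
 by (rule tens_in_tensor)

lemmas tensor_closed [simp] = subspaceD[OF tensor_subspace]

lemmas car_closed = subspaceD[OF curved_algebraD(13)]

context
 fixes A :: "('x, 'k::field) curved_alg" and B :: "('y, 'k) curved_alg"
 assumes A: "curved_algebra A" and B: "curved_algebra B"
begin

private abbreviation "T \<equiv> tensor (car A) (car B)"
private abbreviation "TA \<equiv> tensor_alg A B"

private lemmas gA = curved_algebraD(1)[OF A] and gB = curved_algebraD(1)[OF B]

private abbreviation "pterm p q a b \<equiv> (%p' q' a' b'. ksign (q * p') (mul A a a' \<otimes>\<^sub>k mul B b b'))"

private lemma bal_pterm: "a : car A p ==> b : car B q ==> balanced (car A) (car B) (pterm p q a b)"
 unfolding balanced_def
 by (auto simp: mul_add_right[OF A, of a p] mul_add_right[OF B, of b q] mul_scl_right[OF A, of a p] mul_scl_right[OF B, of b q])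

text \<open>The product is a lift in the left argument of lifts in the right one. The outer family
  is balanced because its values can be computed on one fixed presentation of the right
  argument.\<close>

private lemma bal_outer:
 assumes "hom_terms (car A) (car B) us"
 shows "balanced (car A) (car B) (%p q a b. tensor_lift (car A) (car B) (pterm p q a b) (tens_sum us))"
proof -
 have 1: "term_sum (pterm p q (a + a') b) us = term_sum (pterm p q a b) us + term_sum (pterm p q a' b) us"
  if "a : car A p" "a' : car A p" "b : car B q" for p q a a' b
  using assms that by (induction us) (auto simp: mul_add_left[OF A, of a p])
 have 2: "term_sum (pterm p q a (b + b')) us = term_sum (pterm p q a b) us + term_sum (pterm p q a b') us"
  if "a : car A p" "b' : car B q" "b : car B q" for p q a b b'
  using assms that by (induction us) (auto simp: mul_add_left[OF B, of b q])
 have 3: "term_sum (pterm p q (scl c a) b) us = term_sum (pterm p q a (scl c b)) us"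
  if "a : car A p" "b : car B q" for p q a b c
  using assms that by (induction us) (auto simp: mul_scl_left[OF B, of b q] mul_scl_left[OF A, of a p])
 have L: "tensor_lift (car A) (car B) (pterm p q a b) (tens_sum us) = term_sum (pterm p q a b) us"
  if "a : car A p" "b : car B q" for p q a b
  by (rule tensor_lift_sum[OF gA gB bal_pterm[OF that] assms])
 show ?thesis
  unfolding balanced_def
 proof (intro allI ballI conjI)
  fix p q v w assume v: "v : car A p" and w: "w : car B q"
  show "tensor_lift (car A) (car B) (pterm p q (v + v') w) (tens_sum us) =
   tensor_lift (car A) (car B) (pterm p q v w) (tens_sum us) + tensor_lift (car A) (car B) (pterm p q v' w) (tens_sum us)"
   if v': "v' : car A p" for v'
   unfolding L[OF v w] L[OF v' w] L[OF car_closed(2)[OF A v v'] w] by (rule 1[OF v v' w])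
  show "tensor_lift (car A) (car B) (pterm p q v (w + w')) (tens_sum us) =
   tensor_lift (car A) (car B) (pterm p q v w) (tens_sum us) + tensor_lift (car A) (car B) (pterm p q v w') (tens_sum us)"
   if w': "w' : car B q" for w'
   unfolding L[OF v w] L[OF v w'] L[OF v car_closed(2)[OF B w w']] by (rule 2[OF v w' w])
  show "tensor_lift (car A) (car B) (pterm p q (scl c v) w) (tens_sum us) =
   tensor_lift (car A) (car B) (pterm p q v (scl c w)) (tens_sum us)" for c
   unfolding L[OF car_closed(3)[OF A v] w] L[OF v car_closed(3)[OF B w]] by (rule 3[OF v w])
 qed
qed

private lemma bal_outer': "u : T n ==>
 balanced (car A) (car B) (%p q a b. tensor_lift (car A) (car B) (pterm p q a b) u)"
 using bal_outer tensor_terms[OF gA] by metis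

private lemma mul_T: "mul TA t u =
 tensor_lift (car A) (car B) (%p q a b. tensor_lift (car A) (car B) (pterm p q a b) u) t"
 by (simp add: tensor_alg_def)

lemma car_tensor_alg: "car TA = T"
 by (simp add: tensor_alg_def)

private lemma mul_pure_left: "a : car A p ==> b : car B q ==> u : T n ==>
 mul TA (a \<otimes>\<^sub>k b) u = tensor_lift (car A) (car B) (pterm p q a b) u"
 unfolding mul_T by (rule tensor_lift_pure[OF gA gB bal_outer'])

lemma tensor_mul_pure:
 assumes "a : car A p" "b : car B q" "a' : car A p'" "b' : car B q'"
 shows "mul TA (a \<otimes>\<^sub>k b) (a' \<otimes>\<^sub>k b') = ksign (q * p') (mul A a a' \<otimes>\<^sub>k mul B b b')"
 using mul_pure_left[OF assms(1,2) tens_car[OF assms(3,4) refl]]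
  tensor_lift_pure[OF gA gB bal_pterm[OF assms(1,2)] assms(3,4)] by simp

private lemma mul_add_l: "s : T m ==> t : T m ==> u : T n ==> mul TA (s + t) u = mul TA s u + mul TA t u"
 unfolding mul_T by (rule tensor_lift_add[OF gA gB bal_outer'])

private lemma mul_0_l: "u : T n ==> mul TA 0 u = 0"
 unfolding mul_T by (rule tensor_lift_zero[OF gA gB bal_outer'])

private lemma mul_scl_l:
 assumes "s : T m" "u : T n" shows "mul TA (scl c s) u = scl c (mul TA s u)"
 unfolding mul_T
proof (rule tensor_lift_scl_fun[OF gA gB bal_outer'[OF assms(2)] assms(1)])
 fix p q v w
 assume *: "v : car A p" "w : car B q"
 obtain us where us: "hom_terms (car A) (car B) us" "u = tens_sum us"
  using tensor_terms[OF gA assms(2)] by metis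
 have "term_sum (pterm p q (scl c v) w) us = scl c (term_sum (pterm p q v w) us)"
  using us(1) * by (induction us) (auto simp: mul_scl_left[OF A, of v p])
 then show "tensor_lift (car A) (car B) (pterm p q (scl c v) w) u = scl c (tensor_lift (car A) (car B) (pterm p q v w) u)"
  unfolding us(2) tensor_lift_sum[OF gA gB bal_pterm[OF car_closed(3)[OF A *(1)] *(2)] us(1)]
   tensor_lift_sum[OF gA gB bal_pterm[OF *] us(1)] .
qed

private lemma mul_add_r:
 assumes "s : T m" "t : T n" "u : T n" shows "mul TA s (t + u) = mul TA s t + mul TA s u"
 using gA assms(1)
proof (induction rule: tensor_induct)
 case (pure p q v w)
 then show ?case
  using assms(2,3)
  by (simp add: mul_pure_left[of v p w q _ n] tensor_lift_add[OF gA gB bal_pterm])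
next
 case (add s s')
 then show ?case
  using assms(2,3)
  by (simp add: mul_add_l[of s m s' _ n])
qed (use assms(2,3) subspaceD(2)[OF tensor_subspace] in \<open>simp add: mul_0_l[of _ n]\<close>)

private lemma mul_scl_r:
 assumes "s : T m" "t : T n" shows "mul TA s (scl c t) = scl c (mul TA s t)"
 using gA assms(1)
proof (induction rule: tensor_induct)
 case (pure p q v w)
 have "tensor_lift (car A) (car B) (pterm p q v w) (scl c t) = scl c (tensor_lift (car A) (car B) (pterm p q v w) t)"
  using pure by (intro tensor_lift_scl_fun[OF gA gB bal_pterm assms(2)]) (auto simp: mul_scl_right[OF A, of v p])
 then show ?case
  using pure assms(2) by (simp add: mul_pure_left[of v p w q _ n])
next
 case (add s s')
 then show ?case
  using assms(2)
  by (simp add: mul_add_l[of s m s' _ n])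
qed (use assms(2) subspaceD(3)[OF tensor_subspace] in \<open>simp add: mul_0_l[of _ n]\<close>)

private lemma mul_0_r: "s : T m ==> mul TA s 0 = 0"
 using mul_scl_r[of s m 0 0 0] by simp

private lemma mul_cl:
 assumes "s : T m" "t : T n" shows "mul TA s t : T (m + n)"
 using gA assms(1)
proof (induction rule: tensor_induct)
 case (pure p q a b)
 show ?case using gA assms(2)
 proof (induction rule: tensor_induct)
  case (pure p' q' a' b')
  have "mul A a a' \<otimes>\<^sub>k mul B b b' : T (m + n)"
   using \<open>a : _\<close> \<open>b : _\<close> pure \<open>p + q = m\<close>
   by (intro tens_car[OF mul_closed[OF A] mul_closed[OF B]]) auto
  then show ?case
   using \<open>a : _\<close> \<open>b : _\<close> pure by (simp add: tensor_mul_pure)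
 next
  case (add s t)
  then show ?case
   using mul_add_r[OF tens_car[OF \<open>a : _\<close> \<open>b : _\<close> refl]] by simp
 qed (simp add: mul_0_r[OF tens_car[OF \<open>a : _\<close> \<open>b : _\<close> refl]])
next
 case (add s s')
 then show ?case
  using assms(2) by (simp add: mul_add_l[of s m s' _ n])
qed (simp add: mul_0_l[OF assms(2)])

private lemma lin_r: "s : T m ==> linear_into (T n) (T (m + n)) (%t. mul TA s t)"
 by (intro linear_intoI mul_cl mul_scl_r mul_add_r)

private lemma lin_l: "t : T n ==> linear_into (T m) (T (m + n)) (%s. mul TA s t)"
 by (intro linear_intoI mul_cl mul_scl_l mul_add_l)

private abbreviation "dterm \<equiv> (%p q a b. dif A a \<otimes>\<^sub>k b + ksign p (a \<otimes>\<^sub>k dif B b))"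

private lemma bal_d: "balanced (car A) (car B) dterm"
 unfolding balanced_def
 by (auto simp: dif_add[OF A] dif_add[OF B] dif_scl[OF A] dif_scl[OF B])

private lemma dif_T: "dif TA = tensor_lift (car A) (car B) dterm"
 by (simp add: tensor_alg_def)

lemma tensor_dif_pure:
 assumes "a : car A p" "b : car B q"
 shows "dif TA (a \<otimes>\<^sub>k b) = dif A a \<otimes>\<^sub>k b + ksign p (a \<otimes>\<^sub>k dif B b)"
 unfolding dif_T using tensor_lift_pure[OF gA gB bal_d assms] .

private lemma pure_d_closed:
 assumes "a : car A p" "b : car B q"
 shows "dif A a \<otimes>\<^sub>k b : T (p + q + 1)" "a \<otimes>\<^sub>k dif B b : T (p + q + 1)"
 using tens_car[OF dif_closed[OF A assms(1)] assms(2)] tens_car[OF assms(1) dif_closed[OF B assms(2)]]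
 by (auto simp: algebra_simps)

private lemma lin_d: "linear_into (T n) (T (n + 1)) (dif TA)"
proof (rule linear_intoI)
 fix s t and c :: 'k assume s: "s : T n"
 show "dif TA s : T (n + 1)"
  unfolding dif_T
 proof (rule tensor_lift_in[OF gA gB bal_d s tensor_subspace])
  fix p q v w assume *: "v : car A p" "w : car B q" "p + q = n"
  show "dif A v \<otimes>\<^sub>k w + ksign p (v \<otimes>\<^sub>k dif B w) : T (n + 1)"
   using pure_d_closed[OF *(1,2)] *(3) by simp
 qed
 show "dif TA (scl c s) = scl c (dif TA s)"
  unfolding dif_T by (rule tensor_lift_scl_fun[OF gA gB bal_d s]) (auto simp: dif_scl[OF A])
 show "dif TA (s + t) = dif TA s + dif TA t" if "t : T n"
  unfolding dif_T by (rule tensor_lift_add[OF gA gB bal_d s that])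
qed

private lemmas difD = linear_intoD[OF lin_d] linear_into_simps[OF lin_d tensor_subspace]
private lemmas rD = linear_intoD[OF lin_r] linear_into_simps[OF lin_r tensor_subspace]
private lemmas lD = linear_intoD[OF lin_l] linear_into_simps[OF lin_l tensor_subspace]

lemma tensor_unit_closed: "unt A \<otimes>\<^sub>k unt B : T 0"
 by (rule tens_car[OF curved_algebraD(5)[OF A] curved_algebraD(5)[OF B]]) simp

text \<open>Both sides are additive in each argument, so pure tensors suffice; there both signs have
  the exponent q p' + q p'' + q' p''.\<close>

private lemma assoc:
 assumes s: "s : T l" and t: "t : T m" and u: "u : T n"
 shows "mul TA (mul TA s t) u = mul TA s (mul TA t u)"
 using gA s
proof (induction rule: tensor_induct)
 case (pure p q a b)
 note ab = pure(1,2) and abT = tens_car[OF pure(1,2) refl]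
 show ?case using gA t
 proof (induction rule: tensor_induct)
  case (pure p' q' a' b')
  note ab' = pure(1,2) and abT' = tens_car[OF pure(1,2) refl]
  show ?case using gA u
  proof (induction rule: tensor_induct)
   case (pure p'' q'' a'' b'')
   note ab'' = pure(1,2)
   note c = mul_closed[OF A ab(1) ab'(1)] mul_closed[OF B ab(2) ab'(2)]
    mul_closed[OF A ab'(1) ab''(1)] mul_closed[OF B ab'(2) ab''(2)]
   have "mul TA (mul TA (a \<otimes>\<^sub>k b) (a' \<otimes>\<^sub>k b')) (a'' \<otimes>\<^sub>k b'') =
    ksign (q * p') (ksign ((q + q') * p'') (mul A (mul A a a') a'' \<otimes>\<^sub>k mul B (mul B b b') b''))"
    unfolding tensor_mul_pure[OF ab ab']
    using tensor_mul_pure[OF c(1,2) ab''] lD(7)[OF tens_car[OF ab'' refl] tens_car[OF c(1,2) refl]] by simp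
   also have "... = ksign (q' * p'') (ksign (q * (p' + p'')) (mul A a (mul A a' a'') \<otimes>\<^sub>k mul B b (mul B b' b'')))"
    unfolding ksign_ksign curved_algebraD(4)[OF A ab(1) ab'(1) ab''(1)] curved_algebraD(4)[OF B ab(2) ab'(2) ab''(2)]
    by (rule ksign_cong) (simp add: algebra_simps)
   also have "... = mul TA (a \<otimes>\<^sub>k b) (mul TA (a' \<otimes>\<^sub>k b') (a'' \<otimes>\<^sub>k b''))"
    unfolding tensor_mul_pure[OF ab' ab'']
    using tensor_mul_pure[OF ab c(3,4)] rD(7)[OF abT tens_car[OF c(3,4) refl]] by simp
   finally show ?case .
  next
   case (add u1 u2)
   then show ?case
    using rD(3)[OF mul_cl[OF abT abT'], of u1 n u2] rD(3)[OF abT' add(1,2)]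
     rD(3)[OF abT mul_cl[OF abT' add(1)] mul_cl[OF abT' add(2)]] by simp
  qed (simp add: rD(4)[OF mul_cl[OF abT abT']] rD(4)[OF abT'] rD(4)[OF abT])
 next
  case (add t1 t2)
  then show ?case
   using rD(3)[OF abT add(1,2)] lD(3)[OF u add(1,2)]
    lD(3)[OF u mul_cl[OF abT add(1)] mul_cl[OF abT add(2)]]
    rD(3)[OF abT mul_cl[OF add(1) u] mul_cl[OF add(2) u]] by simp
 qed (simp add: rD(4)[OF abT] lD(4)[OF u])
next
 case (add s1 s2)
 then show ?case
  using lD(3)[OF t add(1,2)] lD(3)[OF u mul_cl[OF add(1) t] mul_cl[OF add(2) t]]
   lD(3)[OF mul_cl[OF t u] add(1,2)] by simp
qed (simp add: lD(4)[OF t] lD(4)[OF u] lD(4)[OF mul_cl[OF t u]])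

private lemma unit_l: "t : T n ==> mul TA (unt A \<otimes>\<^sub>k unt B) t = t"
 using gA
proof (induction rule: tensor_induct)
 case (pure p q v w)
 then show ?case
  using tensor_mul_pure[OF curved_algebraD(5)[OF A] curved_algebraD(5)[OF B] pure(1,2)]
   curved_algebraD(6)[OF A] curved_algebraD(6)[OF B] by simp
next
 case (add s t)
 then show ?case using rD(3)[OF tensor_unit_closed add(1,2)] by simp
qed (simp add: rD(4)[OF tensor_unit_closed])

private lemma unit_r: "t : T n ==> mul TA t (unt A \<otimes>\<^sub>k unt B) = t"
 using gA
proof (induction rule: tensor_induct)
 case (pure p q v w)
 then show ?case
  using tensor_mul_pure[OF pure(1,2) curved_algebraD(5)[OF A] curved_algebraD(5)[OF B]]
   curved_algebraD(7)[OF A] curved_algebraD(7)[OF B] by simp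
next
 case (add s t)
 then show ?case using lD(3)[OF tensor_unit_closed add(1,2)] by simp
qed (simp add: lD(4)[OF tensor_unit_closed])

private lemma leib:
 assumes s: "s : T m" and t: "t : T n"
 shows "dif TA (mul TA s t) = mul TA (dif TA s) t + ksign m (mul TA s (dif TA t))"
 using gA s
proof (induction rule: tensor_induct)
 case (pure p q a b)
 note ab = pure(1,2) and abT = tens_car[OF pure(1,2) refl] and m = pure(3)
 show ?case using gA t
 proof (induction rule: tensor_induct)
  case (pure p' q' a' b')
  note ab' = pure(1,2) and abT' = tens_car[OF pure(1,2) refl]
  note c = mul_closed[OF A ab(1) ab'(1)] mul_closed[OF B ab(2) ab'(2)]
  note da = dif_closed[OF A ab(1)] and db = dif_closed[OF B ab(2)]
   and da' = dif_closed[OF A ab'(1)] and db' = dif_closed[OF B ab'(2)]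
  have 1: "dif TA (mul TA (a \<otimes>\<^sub>k b) (a' \<otimes>\<^sub>k b')) = ksign (q * p')
    ((mul A (dif A a) a' + ksign p (mul A a (dif A a'))) \<otimes>\<^sub>k mul B b b' +
    ksign (p + p') (mul A a a' \<otimes>\<^sub>k (mul B (dif B b) b' + ksign q (mul B b (dif B b')))))"
   unfolding tensor_mul_pure[OF ab ab'] difD(7)[OF tens_car[OF c refl]] tensor_dif_pure[OF c]
    curved_algebraD(9)[OF A ab(1) ab'(1)] curved_algebraD(9)[OF B ab(2) ab'(2)] ..
  have 2: "mul TA (dif TA (a \<otimes>\<^sub>k b)) (a' \<otimes>\<^sub>k b') =
    ksign (q * p') (mul A (dif A a) a' \<otimes>\<^sub>k mul B b b') +
    ksign p (ksign ((q + 1) * p') (mul A a a' \<otimes>\<^sub>k mul B (dif B b) b'))"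
   unfolding tensor_dif_pure[OF ab]
   using lD(3)[OF abT', of "dif A a \<otimes>\<^sub>k b" "p + q + 1" "ksign p (a \<otimes>\<^sub>k dif B b)"]
    lD(7)[OF abT', of "a \<otimes>\<^sub>k dif B b" "p + q + 1"]
    pure_d_closed[OF ab]
    tensor_mul_pure[OF da ab(2) ab'] tensor_mul_pure[OF ab(1) db ab'] by simp
  have 3: "mul TA (a \<otimes>\<^sub>k b) (dif TA (a' \<otimes>\<^sub>k b')) =
    ksign (q * (p' + 1)) (mul A a (dif A a') \<otimes>\<^sub>k mul B b b') +
    ksign p' (ksign (q * p') (mul A a a' \<otimes>\<^sub>k mul B b (dif B b')))"
   unfolding tensor_dif_pure[OF ab']
   using rD(3)[OF abT, of "dif A a' \<otimes>\<^sub>k b'" "p' + q' + 1" "ksign p' (a' \<otimes>\<^sub>k dif B b')"]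
    rD(7)[OF abT, of "a' \<otimes>\<^sub>k dif B b'" "p' + q' + 1"]
    pure_d_closed[OF ab']
    tensor_mul_pure[OF ab da' ab'(2)] tensor_mul_pure[OF ab ab'(1) db'] by simp
  show ?case
   unfolding 1 2 3 m[symmetric]
   by (cases "even p"; cases "even q"; cases "even p'") (simp_all add: ksign_def algebra_simps)
 next
  case (add t1 t2)
  have d: "dif TA t1 : T (n + 1)" "dif TA t2 : T (n + 1)" using difD(1) add by auto
  show ?case
   unfolding rD(3)[OF abT add(1,2)] difD(3)[OF add(1,2)] rD(3)[OF abT d]
    difD(3)[OF mul_cl[OF abT add(1)] mul_cl[OF abT add(2)]] add(3,4)
    rD(3)[OF difD(1)[OF abT] add(1,2)] by simp
 qed (simp add: rD(4)[OF abT] difD(4) rD(4)[OF difD(1)[OF abT]])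
next
 case (add s1 s2)
 have d: "dif TA s1 : T (m + 1)" "dif TA s2 : T (m + 1)" using difD(1) add by auto
 show ?case
  unfolding lD(3)[OF t add(1,2)] difD(3)[OF add(1,2)] lD(3)[OF t d]
   difD(3)[OF mul_cl[OF add(1) t] mul_cl[OF add(2) t]] add(3,4)
   lD(3)[OF difD(1)[OF t] add(1,2)] by simp
qed (simp add: lD(4)[OF t] difD(4) lD(4)[OF difD(1)[OF t]])

private abbreviation "hT \<equiv> cur A \<otimes>\<^sub>k unt B + unt A \<otimes>\<^sub>k cur B"

private lemma cur_cl: "cur A \<otimes>\<^sub>k unt B : T 2" "unt A \<otimes>\<^sub>k cur B : T 2" "hT : T 2"
 using tens_car[OF curved_algebraD(10)[OF A] curved_algebraD(5)[OF B], of 2]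
  tens_car[OF curved_algebraD(5)[OF A] curved_algebraD(10)[OF B], of 2]
 by simp_all

private lemma d_cur: "dif TA hT = 0"
 using tensor_dif_pure[OF curved_algebraD(10)[OF A] curved_algebraD(5)[OF B]]
  tensor_dif_pure[OF curved_algebraD(5)[OF A] curved_algebraD(10)[OF B]]
  difD(3)[OF cur_cl(1,2)] curved_algebraD(11)[OF A] curved_algebraD(11)[OF B] dif_unit[OF A] dif_unit[OF B]
 by simp

private lemma d_d:
 assumes "t : T n" shows "dif TA (dif TA t) = mul TA hT t - mul TA t hT"
 using gA assms
proof (induction rule: tensor_induct)
 case (pure p q a b)
 note ab = pure(1,2) and abT = tens_car[OF pure(1,2) refl]
 note uA = curved_algebraD(5)[OF A] and uB = curved_algebraD(5)[OF B]
  and hA = curved_algebraD(10)[OF A] and hB = curved_algebraD(10)[OF B]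
 \<comment> \<open>The two mixed terms \<open>dif A a\<close> \<otimes> \<open>dif B b\<close> carry
   the signs of \<open>p\<close> and of \<open>p + 1\<close> and cancel.\<close>
 have 1: "dif TA (dif TA (a \<otimes>\<^sub>k b)) = dif A (dif A a) \<otimes>\<^sub>k b + a \<otimes>\<^sub>k dif B (dif B b)"
  unfolding tensor_dif_pure[OF ab]
  using difD(3)[OF pure_d_closed(1)[OF ab] subspaceD(6)[OF tensor_subspace pure_d_closed(2)[OF ab], of p]]
   difD(7)[OF pure_d_closed(2)[OF ab]]
   tensor_dif_pure[OF dif_closed[OF A ab(1)] ab(2)] tensor_dif_pure[OF ab(1) dif_closed[OF B ab(2)]]
  by (simp add: ksign_def)
 have 2: "mul TA hT (a \<otimes>\<^sub>k b) = mul A (cur A) a \<otimes>\<^sub>k b + a \<otimes>\<^sub>k mul B (cur B) b"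
  using lD(3)[OF abT cur_cl(1,2)] tensor_mul_pure[OF hA uB ab] tensor_mul_pure[OF uA hB ab]
   curved_algebraD(6)[OF A ab(1)] curved_algebraD(6)[OF B ab(2)] by simp
 have 3: "mul TA (a \<otimes>\<^sub>k b) hT = mul A a (cur A) \<otimes>\<^sub>k b + a \<otimes>\<^sub>k mul B b (cur B)"
  using rD(3)[OF abT cur_cl(1,2)] tensor_mul_pure[OF ab hA uB] tensor_mul_pure[OF ab uA hB]
   curved_algebraD(7)[OF A ab(1)] curved_algebraD(7)[OF B ab(2)] by simp
 show ?case
  unfolding 1 2 3 curved_algebraD(12)[OF A ab(1)] curved_algebraD(12)[OF B ab(2)] by simp
next
 case (add s t)
 show ?case
  unfolding difD(3)[OF add(1,2)] difD(3)[OF difD(1)[OF add(1)] difD(1)[OF add(2)]] add(3,4)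
   rD(3)[OF cur_cl(3) add(1,2)] lD(3)[OF cur_cl(3) add(1,2)] by simp
qed (simp add: difD(4) rD(4)[OF cur_cl(3)] lD(4)[OF cur_cl(3)])

lemma curved_algebra_tensor_alg: "curved_algebra (tensor_alg A B)"
proof -
 have e: "unt TA = unt A \<otimes>\<^sub>k unt B" "cur TA = hT" by (simp_all add: tensor_alg_def)
 show ?thesis
  by (rule curved_algebraI; unfold car_tensor_alg e)
   (rule graded_space_tensor[OF gA gB] lin_r lin_l assoc tensor_unit_closed unit_l unit_r lin_d leib cur_cl(3) d_cur d_d;
    assumption)+
qed

end

section \<open>Morphisms\<close>

lemma curved_homD:
 assumes "curved_hom A B f b"
 shows "!!n. linear_into (car A n) (car B n) f"
  "!!p q a a'. a : car A p ==> a' : car A q ==> f (mul A a a') = mul B (f a) (f a')"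
  "f (unt A) = unt B" "b : car B 1"
  "!!n a. a : car A n ==> f (dif A a) = dif B (f a) + (mul B b (f a) - ksign n (mul B (f a) b))"
  "f (cur A) = cur B + dif B b + mul B b b"
  "!!n a. a : car A n ==> f a : car B n"
 using assms unfolding curved_hom_def graded_map_def linear_into_def by (auto simp del: ksign_simps)

lemma curved_homI:
 assumes "!!n. linear_into (car A n) (car B n) f"
  "!!p q a a'. a : car A p ==> a' : car A q ==> f (mul A a a') = mul B (f a) (f a')"
  "f (unt A) = unt B" "b : car B 1"
  "!!n a. a : car A n ==> f (dif A a) = dif B (f a) + (mul B b (f a) - ksign n (mul B (f a) b))"
  "f (cur A) = cur B + dif B b + mul B b b"
 shows "curved_hom A B f b"
 using assms unfolding curved_hom_def graded_map_def by auto

lemma balanced_map_tens: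
 assumes "!!n. linear_into (V n) (V' n) f"
 shows "balanced V W (%p q v w. f v \<otimes>\<^sub>k w)"
 unfolding balanced_def using linear_intoD[OF assms] by auto

lemma linear_into_map_tens:
 fixes V :: "('x, 'k::field) graded" and V' :: "('z, 'k) graded" and W :: "('y, 'k) graded"
 assumes V: "graded_space V" and W: "graded_space W" and f: "!!n. linear_into (V n) (V' n) f"
 shows "linear_into (tensor V W n) (tensor V' W n) (tensor_lift V W (%p q v w. f v \<otimes>\<^sub>k w))"
proof (rule linear_intoI)
 note bal = balanced_map_tens[OF f, where W = W]
 fix s t and c :: 'k assume s: "s : tensor V W n"
 show "tensor_lift V W (%p q v w. f v \<otimes>\<^sub>k w) s : tensor V' W n"
  using linear_intoD(1)[OF f] by (intro tensor_lift_in[OF V W bal s]) (auto intro!: tens_in_tensor)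
 show "tensor_lift V W (%p q v w. f v \<otimes>\<^sub>k w) (scl c s) = scl c (tensor_lift V W (%p q v w. f v \<otimes>\<^sub>k w) s)"
  using linear_intoD(2)[OF f] by (intro tensor_lift_scl_fun[OF V W bal s]) auto
 show "tensor_lift V W (%p q v w. f v \<otimes>\<^sub>k w) (s + t) = tensor_lift V W (%p q v w. f v \<otimes>\<^sub>k w) s + tensor_lift V W (%p q v w. f v \<otimes>\<^sub>k w) t"
  if "t : tensor V W n"
  by (rule tensor_lift_add[OF V W bal s that])
qed

lemma curved_hom_tensor:
 assumes A: "curved_algebra A" and A': "curved_algebra A'" and B: "curved_algebra B"
  and f: "curved_hom A A' f b"
 shows "curved_hom (tensor_alg A B) (tensor_alg A' B)
   (tensor_lift (car A) (car B) (%p q v w. f v \<otimes>\<^sub>k w)) (b \<otimes>\<^sub>k unt B)"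
  (is "curved_hom ?T ?T' ?F ?b")
proof -
 note gA = curved_algebraD(1)[OF A] and gA' = curved_algebraD(1)[OF A'] and gB = curved_algebraD(1)[OF B]
 note fD = curved_homD[OF f] and uB = curved_algebraD(5)[OF B] and uA = curved_algebraD(5)[OF A]
 note bal = balanced_map_tens[OF fD(1), where W = "car B"]
 note pure_F = tensor_lift_pure[OF gA gB bal]
 note T = curved_algebra_tensor_alg[OF A B] and T' = curved_algebra_tensor_alg[OF A' B]
 note cT = car_tensor_alg[OF A B] and cT' = car_tensor_alg[OF A' B]
 have lin: "linear_into (car ?T n) (car ?T' n) ?F" for n
  unfolding cT cT' by (rule linear_into_map_tens[OF gA gB fD(1)])
 note FD = linear_intoD[OF lin] linear_into_simps[OF lin curved_algebraD(13)[OF T]]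
 have bc: "?b : car ?T' 1"
  unfolding cT' by (rule tens_car[OF fD(4) uB]) simp
 have inT: "a \<otimes>\<^sub>k x : car ?T (p + q)" if "a : car A p" "x : car B q" for a x p q
  unfolding cT by (rule tens_car[OF that refl])
 have inT': "a \<otimes>\<^sub>k x : car ?T' (p + q)" if "a : car A' p" "x : car B q" for a x p q
  unfolding cT' by (rule tens_car[OF that refl])
 have m: "?F (mul ?T s t) = mul ?T' (?F s) (?F t)" if s: "s : car ?T m" and t: "t : car ?T n" for m n s t
  using gA s[unfolded cT]
 proof (induction rule: tensor_induct)
  case (pure p q a x)
  note ax = pure(1,2)
  show ?case using gA t[unfolded cT]
  proof (induction rule: tensor_induct)
   case (pure p' q' a' x')
   note ax' = pure(1,2)
   show ?case
    unfolding tensor_mul_pure[OF A B ax ax'] pure_F[OF ax] pure_F[OF ax']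
     tensor_mul_pure[OF A' B fD(7)[OF ax(1)] ax(2) fD(7)[OF ax'(1)] ax'(2)]
     FD(7)[OF inT[OF mul_closed[OF A ax(1) ax'(1)] mul_closed[OF B ax(2) ax'(2)]]]
     pure_F[OF mul_closed[OF A ax(1) ax'(1)] mul_closed[OF B ax(2) ax'(2)]]
     fD(2)[OF ax(1) ax'(1)] ..
  next
   case (add t1 t2)
   note c = inT[OF ax] add(1,2)[folded cT]
   show ?case
    unfolding mul_add_right[OF T c] FD(3)[OF c(2,3)] add(3,4)
     FD(3)[OF mul_closed[OF T c(1,2)] mul_closed[OF T c(1,3)]]
     mul_add_right[OF T' FD(1)[OF c(1)] FD(1)[OF c(2)] FD(1)[OF c(3)]] ..
  qed (simp add: mul_zero_right[OF T inT[OF ax]] FD(4) mul_zero_right[OF T' FD(1)[OF inT[OF ax]]])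
 next
  case (add t1 t2)
  note c = add(1,2)[folded cT] t
  show ?case
   unfolding mul_add_left[OF T c] FD(3)[OF c(1,2)] add(3,4)
    FD(3)[OF mul_closed[OF T c(1,3)] mul_closed[OF T c(2,3)]]
    mul_add_left[OF T' FD(1)[OF c(1)] FD(1)[OF c(2)] FD(1)[OF c(3)]] ..
 qed (simp add: mul_zero_left[OF T t] FD(4) mul_zero_left[OF T' FD(1)[OF t]])
 have d: "?F (dif ?T t) = dif ?T' (?F t) + (mul ?T' ?b (?F t) - ksign n (mul ?T' (?F t) ?b))"
  if t: "t : car ?T n" for n t
  using gA t[unfolded cT]
 proof (induction rule: tensor_induct)
  case (pure p q a x)
  note ax = pure(1,2) and da = dif_closed[OF A pure(1)] and dx = dif_closed[OF B pure(2)]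
   and fa = fD(7)[OF pure(1)]
  have s: "dif A a \<otimes>\<^sub>k x : car ?T (p + q + 1)" "a \<otimes>\<^sub>k dif B x : car ?T (p + q + 1)"
   using inT[OF da ax(2)] inT[OF ax(1) dx] by (auto simp: algebra_simps)
  have 1: "?F (dif ?T (a \<otimes>\<^sub>k x)) = f (dif A a) \<otimes>\<^sub>k x + ksign p (f a \<otimes>\<^sub>k dif B x)"
   unfolding tensor_dif_pure[OF A B ax]
   using FD(3)[OF s(1) subspaceD(6)[OF curved_algebraD(13)[OF T] s(2)], of p] FD(7)[OF s(2)]
    pure_F[OF da ax(2)] pure_F[OF ax(1) dx] by simp
  have 2: "mul ?T' ?b (f a \<otimes>\<^sub>k x) = mul A' b (f a) \<otimes>\<^sub>k x"
   using tensor_mul_pure[OF A' B fD(4) uB fa ax(2)] curved_algebraD(6)[OF B ax(2)] by simp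
  \<comment> \<open>Passing the degree 1 element \<open>b\<close> over \<open>x\<close> costs the
    sign of \<open>q\<close>; so the sign of \<open>p + q\<close> in the commutator becomes the sign
    of \<open>p\<close> that belongs to \<open>f a\<close>.\<close>
  have 3: "mul ?T' (f a \<otimes>\<^sub>k x) ?b = ksign q (mul A' (f a) b \<otimes>\<^sub>k x)"
   using tensor_mul_pure[OF A' B fa ax(2) fD(4) uB] curved_algebraD(7)[OF B ax(2)] by simp
  show ?case
   unfolding 1 pure_F[OF ax] 2 3 tensor_dif_pure[OF A' B fa ax(2)] fD(5)[OF ax(1)] pure(3)[symmetric]
   by (cases "even p"; cases "even q") (simp_all add: ksign_def)
 next
  case (add t1 t2)
  note c = add(1,2)[folded cT] note Fc = FD(1)[OF c(1)] FD(1)[OF c(2)]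
  show ?case
   unfolding dif_add[OF T c] FD(3)[OF c] FD(3)[OF dif_closed[OF T c(1)] dif_closed[OF T c(2)]]
    dif_add[OF T' Fc] mul_add_left[OF T' Fc bc] mul_add_right[OF T' bc Fc] add(3,4) by simp
 qed (simp add: dif_zero[OF T] dif_zero[OF T'] FD(4) mul_zero_right[OF T' bc] mul_zero_left[OF T' bc])
 have u: "?F (unt ?T) = unt ?T'"
  using pure_F[OF uA uB] fD(3) by (simp add: tensor_alg_def)
 note hA = curved_algebraD(10)[OF A] and hB = curved_algebraD(10)[OF B]
 have "?F (cur ?T) = f (cur A) \<otimes>\<^sub>k unt B + f (unt A) \<otimes>\<^sub>k cur B"
  using FD(3)[of "cur A \<otimes>\<^sub>k unt B" 2 "unt A \<otimes>\<^sub>k cur B"] inT[OF hA uB] inT[OF uA hB]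
   pure_F[OF hA uB] pure_F[OF uA hB] by (simp add: tensor_alg_def)
 also have "... = cur ?T' + dif ?T' ?b + mul ?T' ?b ?b"
  using tensor_dif_pure[OF A' B fD(4) uB] tensor_mul_pure[OF A' B fD(4) uB fD(4) uB]
   curved_algebraD(6)[OF B uB] dif_unit[OF B] fD(3,6) by (simp add: tensor_alg_def)
 finally show ?thesis
  using lin m u bc d by (intro curved_homI)
qed

section \<open>Graded duals\<close>

lemma homogeneousI: "c : V n ==> c : homogeneous V"
 by (auto simp: homogeneous_def)

lemma homogeneousE: "c : homogeneous V ==> (!!n. c : V n ==> P) ==> P"
 by (auto simp: homogeneous_def)

lemma homogeneous_mono: "D <= E ==> c : homogeneous D ==> c : homogeneous E"
 by (auto simp: homogeneous_def le_fun_def)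

context
 fixes V :: "('x, 'k::field) graded"
 assumes V: "graded_space V"
begin

private lemmas sV = graded_spaceD(1)[OF V]

lemma dual_outside: "\<xi> : dual V n ==> v ~: V (- n) ==> \<xi> v = 0"
 by (simp add: dual_def)

lemma dual_zero: "\<xi> : dual V n ==> \<xi> 0 = 0"
 using subspaceD(1)[OF sV, of "- n"] by (auto simp: dual_def dest!: bspec[where x = 0] spec[where x = 0])

text \<open>An element of \<open>V m\<close> that also lies in \<open>V (- n)\<close> is zero when
  the degrees differ. So a functional can be evaluated at any homogeneous vector, and is linear
  there, without a comparison of degrees.\<close>

lemma dual_other: "\<xi> : dual V n ==> v : V m ==> m ~= - n ==> \<xi> v = 0"
 using dual_outside dual_zero graded_space_disjoint[OF V] by metis

lemma dual_scl: "\<xi> : dual V n ==> v : V m ==> \<xi> (scl c v) = c * \<xi> v"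
 using dual_other[of \<xi> n v m] dual_other[of \<xi> n "scl c v" m] subspaceD(3)[OF sV, of v m c]
 by (cases "m = - n") (auto simp: dual_def)

lemma dual_add: "\<xi> : dual V n ==> v : V m ==> w : V m ==> \<xi> (v + w) = \<xi> v + \<xi> w"
 using dual_other[of \<xi> n v m] dual_other[of \<xi> n w m] dual_other[of \<xi> n "v + w" m] subspaceD(2)[OF sV, of v m w]
 by (cases "m = - n") (auto simp: dual_def)

lemma dual_diff: "\<xi> : dual V n ==> v : V m ==> w : V m ==> \<xi> (v - w) = \<xi> v - \<xi> w"
 using dual_add[of \<xi> n v m "- w"] dual_scl[of \<xi> n w m "-1"] subspaceD(4)[OF sV, of w m] by simp

lemma dualI:
 assumes "!!v c. v : V (- n) ==> \<xi> (scl c v) = c * \<xi> v"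
  "!!v w. v : V (- n) ==> w : V (- n) ==> \<xi> (v + w) = \<xi> v + \<xi> w"
  "!!v. v ~: V (- n) ==> \<xi> v = 0"
 shows "\<xi> : dual V n"
 using assms by (auto simp: dual_def)

lemma dual_subspace: "kvs.subspace (dual V n)"
 unfolding kvs.subspace_def
proof (intro conjI ballI allI)
 show "0 : dual V n" by (rule dualI) (auto simp: pointwise)
next
 fix \<xi> \<zeta> assume *: "\<xi> : dual V n" "\<zeta> : dual V n"
 show "\<xi> + \<zeta> : dual V n"
  using * by (intro dualI) (auto simp: pointwise dual_scl dual_add dual_outside algebra_simps)
next
 fix c \<xi> assume *: "\<xi> : dual V n"
 show "scl c \<xi> : dual V n"
  unfolding scl_def using * by (intro dualI) (auto simp: dual_scl dual_add dual_outside algebra_simps)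
qed

lemma graded_space_dual: "graded_space (dual V)"
 unfolding graded_space_def
proof (intro conjI allI impI ballI dual_subspace)
 fix N \<xi> n
 assume *: "finite N & (ALL n:N. \<xi> n : dual V n) & sum \<xi> N = 0" and n: "n : N"
 show "\<xi> n = 0"
 proof
  fix v
  show "\<xi> n v = 0 v"
  proof (cases "v : V (- n)")
   case True
   have "\<xi> m v = 0" if "m : N - {n}" for m
    using dual_other[of "\<xi> m" m v "- n"] that * True by auto
   then have "(\<Sum>m\<in>N. \<xi> m v) = \<xi> n v"
    using * n by (simp add: sum.remove[of N n])
   then show ?thesis using * by (simp add: sum_fun[symmetric])
  qed (use * n dual_outside in \<open>auto simp: pointwise\<close>)
 qed
qed

lemma dual_separates:
 assumes S: "kvs.subspace S" "S \<subseteq> V m" and v: "v : V m" "v ~: S"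
 obtains \<xi> where "\<xi> : dual V (- m)" "!!s. s : S ==> \<xi> s = 0" "\<xi> v = 1"
proof -
 obtain l where l: "!!v w. l (v + w) = l v + l w" "!!c v. l (scl c v) = c * l v"
  "!!s. s : S ==> l s = 0" "l v = 1"
  using separating_functional[OF S(1) v(2)] by metis
 let ?\<xi> = "%u. if u : V m then l u else 0"
 have "?\<xi> : dual V (- m)"
  using subspaceD[OF sV] by (intro dualI) (auto simp: l)
 then show thesis using that[of ?\<xi>] l(3,4) S(2) v(1) by auto
qed

lemma dual_separates_zero:
 assumes v: "v : V m" "!!\<xi>. \<xi> : dual V (- m) ==> \<xi> v = 0"
 shows "v = 0"
proof (rule ccontr)
 assume "v ~= 0"
 then obtain \<xi> where "\<xi> : dual V (- m)" "\<xi> v = 1"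
  using dual_separates[of "{0}" m v] kvs.subspace_single_0 subspaceD(1)[OF sV] v(1)
  by (metis empty_iff insert_iff singletonD subsetI)
 then show False using v(2) by force
qed

lemma dual_sum_list:
 assumes "\<xi> : dual V n" "!!x. x : set xs ==> g x : V m"
 shows "\<xi> (sum_list (map g xs)) = sum_list (map (%x. \<xi> (g x)) xs)"
 using assms(2)
proof (induction xs)
 case (Cons x xs)
 have "sum_list (map g xs) : V m" using Cons by (intro subspace_sum_list[OF sV]) auto
 then have "\<xi> (g x + sum_list (map g xs)) = \<xi> (g x) + \<xi> (sum_list (map g xs))"
  using Cons by (intro dual_add[OF assms(1), of _ m]) auto
 then show ?case using Cons by simp
qed (simp add: dual_zero[OF assms(1)])

lemma dual_sum:
 assumes "\<xi> : dual V n" "!!x. x : A ==> g x : V m"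
 shows "\<xi> (\<Sum>x\<in>A. scl (r x) (g x)) = (\<Sum>x\<in>A. r x * \<xi> (g x))"
 using assms(2)
proof (induction A rule: infinite_finite_induct)
 case (insert x A)
 have "(\<Sum>x\<in>A. scl (r x) (g x)) : V m"
  using insert by (intro kvs.subspace_sum[OF sV]) (auto intro: subspaceD(3)[OF sV])
 moreover have "scl (r x) (g x) : V m" using insert by (auto intro: subspaceD(3)[OF sV])
 ultimately have "\<xi> (scl (r x) (g x) + (\<Sum>x\<in>A. scl (r x) (g x))) = \<xi> (scl (r x) (g x)) + \<xi> (\<Sum>x\<in>A. scl (r x) (g x))"
  by (rule dual_add[OF assms(1), rotated])
 moreover have "\<xi> (scl (r x) (g x)) = r x * \<xi> (g x)"
  using insert(4) by (intro dual_scl[OF assms(1)]) auto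
 moreover have "\<xi> (\<Sum>x\<in>A. scl (r x) (g x)) = (\<Sum>x\<in>A. r x * \<xi> (g x))" using insert by auto
 ultimately show ?case
  unfolding sum.insert[OF insert(1,2)] by simp
qed (simp_all add: dual_zero[OF assms(1)])

lemma balanced_dual:
 assumes "\<xi> : dual V m" "\<zeta> : dual V n"
 shows "balanced V V (%p q v w. \<xi> v * \<zeta> w)"
 unfolding balanced_def
proof (intro allI ballI conjI)
 fix p q v w assume *: "v : V p" "w : V q"
 show "\<xi> (v + v') * \<zeta> w = \<xi> v * \<zeta> w + \<xi> v' * \<zeta> w" if "v' : V p" for v'
  unfolding dual_add[OF assms(1) *(1) that] by (simp add: algebra_simps)
 show "\<xi> v * \<zeta> (w + w') = \<xi> v * \<zeta> w + \<xi> v * \<zeta> w'" if "w' : V q" for w'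
  unfolding dual_add[OF assms(2) *(2) that] by (simp add: algebra_simps)
 show "\<xi> (scl c v) * \<zeta> w = \<xi> v * \<zeta> (scl c w)" for c
  by (simp add: dual_scl[OF assms(1) *(1)] dual_scl[OF assms(2) *(2)])
qed

context
 fixes D :: "('x, 'k) graded"
 assumes D: "!!n. kvs.subspace (D n)" "!!n. D n \<subseteq> V n"
begin

lemma graded_space_sub: "graded_space D"
 by (rule graded_subspace[OF V D])

lemma restr_dual: "\<xi> : dual V n ==> restr D \<xi> : dual D n"
proof -
 assume x: "\<xi> : dual V n"
 have 1: "restr D \<xi> v = \<xi> v" if "v : D (- n)" for v
  using homogeneousI[of v D] that by (simp add: restr_def)
 have 2: "restr D \<xi> v = 0" if "v ~: D (- n)" for v
 proof (cases "v : homogeneous D")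
  case True
  then obtain m where m: "v : D m" by (rule homogeneousE)
  then have "m ~= - n" using that by auto
  then show ?thesis using dual_other[OF x, of v m] m D(2) by (auto simp: restr_def)
 qed (simp add: restr_def)
 show ?thesis
  unfolding dual_def using 1 2 subspaceD[OF D(1)[of "- n"]] dual_add[OF x, of _ "- n"] dual_scl[OF x, of _ "- n"] D(2)[of "- n"]
  by (auto simp: subset_iff)
qed

lemma linear_into_restr: "linear_into (dual V n) (dual D n) (restr D)"
 by (rule linear_intoI, erule restr_dual) (auto simp: restr_def scl_def fun_eq_iff pointwise)

text \<open>Composition with a projection onto \<open>D (- n)\<close>. A vector from another
  component of \<open>D\<close> can lie in \<open>V (- n)\<close> only if it is zero, so the
  normalization outside the component is respected.\<close>

lemma dual_extend:
 assumes "\<eta> : dual D n"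
 obtains \<xi> where "\<xi> : dual V n" "restr D \<xi> = \<eta>"
proof -
 obtain p where p: "!!v w. p (v + w) = p v + p w" "!!c v. p (scl c v) = scl c (p v)"
  "!!v. p v : D (- n)" "!!v. v : D (- n) ==> p v = v"
  using projection_exists[OF D(1)] by metis
 let ?\<xi> = "%v. if v : V (- n) then \<eta> (p v) else 0"
 have h: "\<eta> (scl c (p v)) = c * \<eta> (p v)" "\<eta> (p v + p w) = \<eta> (p v) + \<eta> (p w)" for c v w
  using assms p(3) by (auto simp: dual_def)
 have "?\<xi> : dual V n"
  using subspaceD[OF sV] by (intro dualI) (auto simp: p(1,2) h)
 moreover have "restr D ?\<xi> v = \<eta> v" for v
 proof (cases "v : D (- n)")
  case True
  then show ?thesis using D(2) by (auto simp: restr_def homogeneousI p(4))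
 next
  case False
  then have z: "\<eta> v = 0" using assms by (simp add: dual_def)
  show ?thesis
  proof (cases "v : homogeneous D & v : V (- n)")
   case True
   then obtain m where "v : D m" by (auto elim: homogeneousE)
   then have "v = 0"
    using graded_space_disjoint[OF V, of v m "- n"] D(2) True False by (metis subsetD)
   then show ?thesis using False subspaceD(1)[OF D(1)] by auto
  qed (auto simp: restr_def z)
 qed
 ultimately show thesis using that[of ?\<xi>] by blast
qed

lemma restr_surj: "restr D ` dual V n = dual D n"
 using restr_dual dual_extend by (metis (mono_tags, lifting) image_iff subsetI subset_antisym image_subsetI)

end

end

lemma restr_restr: "D <= E ==> restr D (restr E \<xi>) = restr D \<xi>"
 using homogeneous_mono by (auto simp: restr_def fun_eq_iff)

lemma restr_zero: "restr D 0 = 0"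
 by (auto simp: restr_def fun_eq_iff pointwise)

section \<open>Finite dimensional graded spaces\<close>

lemma linear_into_sum:
 assumes "linear_into V W f" "kvs.subspace V" "!!x. x : A ==> g x : V"
 shows "f (\<Sum>x\<in>A. scl (r x) (g x)) = (\<Sum>x\<in>A. scl (r x) (f (g x)))"
 using assms(3)
proof (induction A rule: infinite_finite_induct)
 case (insert x A)
 have "(\<Sum>x\<in>A. scl (r x) (g x)) : V"
  using insert by (intro kvs.subspace_sum[OF assms(2)]) (auto intro: subspaceD(3)[OF assms(2)])
 moreover have gx: "g x : V" using insert by auto
 moreover have "scl (r x) (g x) : V" by (rule subspaceD(3)[OF assms(2) gx])
 moreover have "f (\<Sum>x\<in>A. scl (r x) (g x)) = (\<Sum>x\<in>A. scl (r x) (f (g x)))" using insert by auto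
 ultimately show ?case
  unfolding sum.insert[OF insert(1,2)] by (metis linear_intoD(2,3)[OF assms(1)])
qed (simp_all add: linear_into_simps(1)[OF assms(1,2)])

text \<open>Nonzero vectors picked from different degrees are independent because the sum is direct;
  hence their number is bounded by the size of a finite spanning set.\<close>

lemma finite_degrees:
 fixes V :: "('x, 'k::field) graded"
 assumes V: "graded_space V" and fd: "finite_dim V"
 shows "finite {n. V n ~= {0}}"
proof -
 obtain S where S: "finite S" "!!n. V n \<subseteq> kvs.span S"
  using fd by (auto simp: finite_dim_def)
 have "card N <= card S" if N: "N \<subseteq> {n. V n ~= {0}}" "finite N" for N
 proof -
  have "ALL n:N. EX v:V n. v ~= 0"
   using N(1) subspaceD(1)[OF graded_spaceD(1)[OF V]] by blast
  then obtain e where e: "!!n. n : N ==> e n : V n" "!!n. n : N ==> e n ~= 0" by metis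
  have inj: "inj_on e N"
   by (rule inj_onI) (metis e graded_space_disjoint[OF V])
  have "kvs.independent (e ` N)"
  proof (rule kvs.independent_if_scalars_zero)
   fix r x assume z: "(\<Sum>x\<in>e ` N. scl (r x) x) = 0" and x: "x : e ` N"
   then obtain n where n: "n : N" "x = e n" by auto
   have "scl (r (e n)) (e n) = 0"
   proof (rule graded_spaceD(2)[OF V N(2) _ _ n(1), of "%n. scl (r (e n)) (e n)"])
    show "(\<Sum>n\<in>N. scl (r (e n)) (e n)) = 0"
     using z by (simp add: sum.reindex[OF inj] o_def)
   qed (auto intro: subspaceD(3)[OF graded_spaceD(1)[OF V]] e)
   then show "r x = 0" using e(2)[OF n(1)] n(2) by simp
  qed (use N in simp)
  moreover have "e ` N \<subseteq> kvs.span S" using e(1) S(2) by blast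
  ultimately have "card (e ` N) <= card S"
   using kvs.independent_span_bound[OF S(1)] by blast
  then show ?thesis by (simp add: card_image[OF inj])
 qed
 then show ?thesis using finite_if_finite_subsets_card_bdd by blast
qed

lemma finite_dimI:
 assumes fin: "finite {n. V n ~= {0}}" and S: "!!n. EX S. finite S & V n \<subseteq> kvs.span S"
 shows "finite_dim V"
proof -
 obtain T where T: "!!n. finite (T n)" "!!n. V n \<subseteq> kvs.span (T n)" using S by metis
 let ?S = "\<Union>n\<in>{n. V n ~= {0}}. T n"
 have "V n \<subseteq> kvs.span ?S" for n
 proof (cases "V n = {0}")
  case True then show ?thesis using kvs.span_zero by auto
 next
  case False
  then show ?thesis using T(2)[of n] kvs.span_mono[of "T n" ?S] by blast
 qed
 then show ?thesis using fin T(1) unfolding finite_dim_def by (intro exI[of _ ?S]) auto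
qed

lemma finite_basis:
 assumes "finite S" "U \<subseteq> kvs.span S" "kvs.subspace U"
 obtains B where "finite B" "B \<subseteq> U" "kvs.independent B" "kvs.span B = U"
proof -
 obtain B where B: "B \<subseteq> U" "kvs.independent B" "U \<subseteq> kvs.span B"
  using kvs.basis_exists by metis
 then have "finite B" using kvs.independent_span_bound[OF assms(1)] assms(2) by blast
 moreover have "kvs.span B = U" using B kvs.span_minimal[OF B(1) assms(3)] by blast
 ultimately show thesis using that B by blast
qed

text \<open>\<open>P\<close> collects bases of all nonzero components, each vector tagged by its
  degree, and \<open>e\<close> the coordinate functionals. The tag lets a sum over \<open>P\<close>
  be restricted to one degree.\<close>

lemma dual_basis:
 fixes E :: "('x, 'k::field) graded"
 assumes E: "graded_space E" and fd: "finite_dim E"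
 obtains P :: "(int \<times> ('x => 'k)) set" and e :: "int \<times> ('x => 'k) => ('x => 'k) => 'k"
 where "finite P" "!!m b. (m, b) : P ==> b : E m" "!!m b. (m, b) : P ==> e (m, b) : dual E (- m)"
  "!!m v. v : E m ==> v = (\<Sum>x\<in>{x:P. fst x = m}. scl (e x v) (snd x))"
proof -
 obtain S where S: "finite S" "!!n. E n \<subseteq> kvs.span S"
  using fd by (auto simp: finite_dim_def)
 have "EX B. finite B & B \<subseteq> E m & kvs.independent B & kvs.span B = E m" for m
  using finite_basis[OF S(1,2) graded_spaceD(1)[OF E]] by metis
 then obtain B where B: "!!m. finite (B m)" "!!m. B m \<subseteq> E m" "!!m. kvs.independent (B m)" "!!m. kvs.span (B m) = E m"
  by metis
 let ?N = "{m. E m ~= {0}}"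
 let ?P = "Sigma ?N B"
 let ?e = "%(m, b) v. if v : E m then kvs.representation (B m) v b else 0"
 have 1: "?e (m, b) : dual E (- m)" for m b
  using subspaceD[OF graded_spaceD(1)[OF E]] kvs.representation_add[OF B(3)[of m]] kvs.representation_scale[OF B(3)[of m]]
  by (intro dualI[OF E]) (auto simp: B(4))
 have 2: "v = (\<Sum>x\<in>{x:?P. fst x = m}. scl (?e x v) (snd x))" if v: "v : E m" for m v
 proof (cases "E m = {0}")
  case True
  then have e: "{x:?P. fst x = m} = {}" by auto
  show ?thesis using v True unfolding e by simp
 next
  case False
  have e: "{x:?P. fst x = m} = Pair m ` B m" using False by auto
  have "(\<Sum>x\<in>{x:?P. fst x = m}. scl (?e x v) (snd x)) = (\<Sum>b\<in>B m. scl (kvs.representation (B m) v b) b)"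
   unfolding e using v by (subst sum.reindex) (auto simp: inj_on_def)
  also have "... = v"
   using v B by (intro kvs.sum_representation_eq) auto
  finally show ?thesis by simp
 qed
 have 3: "finite ?P" by (intro finite_SigmaI finite_degrees[OF E fd] B(1))
 have 4: "b : E m" if "(m, b) : ?P" for m b using that B(2) by blast
 show thesis by (rule that[of ?P ?e, OF 3 4 1 2])
qed

lemma finite_dim_dual:
 assumes E: "graded_space E" and fd: "finite_dim E"
 shows "finite_dim (dual E)"
proof -
 obtain P e where P: "finite P" "!!m b. (m, b) : P ==> b : E m" "!!m b. (m, b) : P ==> e (m, b) : dual E (- m)"
  "!!m v. v : E m ==> v = (\<Sum>x\<in>{x:P. fst x = m}. scl (e x v) (snd x))"
  by (rule dual_basis[OF E fd]) (rule that)
 have "dual E n \<subseteq> kvs.span (e ` P)" for n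
 proof
  fix \<xi> assume x: "\<xi> : dual E n"
  have "\<xi> = (\<Sum>x\<in>{x:P. fst x = - n}. scl (\<xi> (snd x)) (e x))"
  proof
   fix v
   show "\<xi> v = (\<Sum>x\<in>{x:P. fst x = - n}. scl (\<xi> (snd x)) (e x)) v"
   proof (cases "v : E (- n)")
    case True
    have "\<xi> v = \<xi> (\<Sum>x\<in>{x:P. fst x = - n}. scl (e x v) (snd x))" using P(4)[OF True] by simp
    also have "... = (\<Sum>x\<in>{x:P. fst x = - n}. e x v * \<xi> (snd x))"
     using P(2) by (intro dual_sum[OF E x, of _ _ "- n"]) auto
    finally show ?thesis by (simp add: sum_fun scl_def mult.commute)
   next
    case False
    have "e x v = 0" if "x : P" "fst x = - n" for x
     using P(3)[of "- n" "snd x"] that False by (cases x) (auto simp: dual_def)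
    then show ?thesis using False x by (auto simp: sum_fun scl_def dual_def)
   qed
  qed
  also have "... : kvs.span (e ` P)"
   by (intro kvs.span_sum kvs.span_scale kvs.span_base) auto
  finally show "\<xi> : kvs.span (e ` P)" .
 qed
 then show ?thesis unfolding finite_dim_def using P(1) by blast
qed

text \<open>
 Over a finite dimensional \<open>E\<close>, the tensor product of the dual of \<open>E\<close> with \<open>W\<close> consists of the
 graded linear maps from \<open>E\<close> to \<open>W\<close>, an element \<open>u\<close> being the map \<open>v \<mapsto> u (v, _)\<close>.
\<close>

lemma tensor_dual_linear:
 assumes E: "graded_space E" and W: "graded_space W" and u: "u : tensor (dual E) W n"
 shows "linear_into (E m) (W (m + n)) (curry u)" "v ~: homogeneous E ==> curry u v = 0"
proof -
 note gd = graded_space_dual[OF E] and sW = subspaceD[OF graded_spaceD(1)[OF W]]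
 have cpure: "curry (\<xi> \<otimes>\<^sub>k w) v = scl (\<xi> v) w" for \<xi> w v
  by (auto simp: tens_def scl_def fun_eq_iff)
 have cadd: "curry (s + t) v = curry s v + curry t v" for s t :: "('a => 'b) \<times> 'c => 'b" and v
  by (auto simp: fun_eq_iff pointwise)
 have czero: "curry 0 v = 0" for v :: "'a => 'b"
  by (auto simp: fun_eq_iff pointwise)
 show "linear_into (E m) (W (m + n)) (curry u)" using gd u
 proof (induction rule: tensor_induct)
  case (pure p q \<xi> w)
  show ?case
  proof (rule linear_intoI)
   fix v c assume v: "v : E m"
   show "curry (\<xi> \<otimes>\<^sub>k w) v : W (m + n)"
   proof (cases "m = - p")
    case True
    then have "m + n = q" using pure(3) by simp
    then show ?thesis using sW(3)[OF pure(2)] by (simp add: cpure)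
   next
    case False
    then show ?thesis using dual_other[OF E pure(1) v] sW(1) by (simp add: cpure)
   qed
   show "curry (\<xi> \<otimes>\<^sub>k w) (scl c v) = scl c (curry (\<xi> \<otimes>\<^sub>k w) v)"
    using dual_scl[OF E pure(1) v] by (auto simp: fun_eq_iff tens_def scl_def)
   show "curry (\<xi> \<otimes>\<^sub>k w) (v + v') = curry (\<xi> \<otimes>\<^sub>k w) v + curry (\<xi> \<otimes>\<^sub>k w) v'" if "v' : E m" for v'
    using dual_add[OF E pure(1) v that] by (auto simp: fun_eq_iff tens_def pointwise algebra_simps)
  qed
 next
  case (add s t)
  then show ?case
   unfolding linear_into_def cadd
   using sW(2) by (auto simp: algebra_simps)
 next
  case zero
  show ?case unfolding linear_into_def czero using sW(1) by simp
 qed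
 show "curry u v = 0" if v: "v ~: homogeneous E" using gd u
 proof (induction rule: tensor_induct)
  case (pure p q \<xi> w)
  have "\<xi> v = 0" using dual_outside[OF E pure(1)] v homogeneousI by blast
  then show ?case by (simp add: cpure)
 qed (simp_all only: cadd czero add_0_left)
qed

text \<open>The map is the finite sum of the coordinate functionals tensored with the values of
  \<open>t\<close> at the basis vectors. The value 0 off the homogeneous elements matches the
  normalization of functionals.\<close>

lemma linear_tensor_dual:
 fixes E :: "('x, 'k::field) graded" and W :: "('y, 'k) graded"
 assumes E: "graded_space E" and fd: "finite_dim E" and t: "!!m. linear_into (E m) (W (m + n)) t"
 shows "(%(v, y). if v : homogeneous E then t v y else 0) : tensor (dual E) W n" (is "?u : _")
proof -
 obtain P e where P: "finite P" "!!m b. (m, b) : P ==> b : E m" "!!m b. (m, b) : P ==> e (m, b) : dual E (- m)"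
  "!!m v. v : E m ==> v = (\<Sum>x\<in>{x:P. fst x = m}. scl (e x v) (snd x))"
  by (rule dual_basis[OF E fd]) (rule that)
 have "?u = (\<Sum>x\<in>P. e x \<otimes>\<^sub>k t (snd x))"
 proof
  fix z :: "('x => 'k) \<times> 'y"
  obtain v y where z: "z = (v, y)" by force
  show "?u z = (\<Sum>x\<in>P. e x \<otimes>\<^sub>k t (snd x)) z"
  proof (cases "v : homogeneous E")
   case True
   then obtain m where v: "v : E m" by (rule homogeneousE)
   have 0: "e x v = 0" if "x : P" "fst x ~= m" for x
    using dual_other[OF E P(3)[of "fst x" "snd x"] v] that by auto
   have "t v = t (\<Sum>x\<in>{x:P. fst x = m}. scl (e x v) (snd x))" using P(4)[OF v] by simp
   also have "... = (\<Sum>x\<in>{x:P. fst x = m}. scl (e x v) (t (snd x)))"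
    using P(2) by (intro linear_into_sum[OF t[of m] graded_spaceD(1)[OF E]]) auto
   finally have "t v y = (\<Sum>x\<in>{x:P. fst x = m}. e x v * t (snd x) y)"
    by (simp add: sum_fun scl_def)
   also have "... = (\<Sum>x\<in>P. e x v * t (snd x) y)"
    by (rule sum.mono_neutral_left[OF P(1)]) (auto simp: 0)
   finally show ?thesis using True by (simp add: z sum_fun tens_def)
  next
   case False
   have "e x v = 0" if "x : P" for x
    using dual_outside[OF E P(3)[of "fst x" "snd x"]] that False homogeneousI by (metis prod.collapse)
   then show ?thesis using False by (simp add: z sum_fun tens_def)
  qed
 qed
 also have "... : tensor (dual E) W n"
 proof (rule kvs.subspace_sum[OF tensor_subspace])
  fix x assume "x : P"
  then have "e x : dual E (- fst x)" "t (snd x) : W (fst x + n)"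
   using P(3)[of "fst x" "snd x"] linear_intoD(1)[OF t P(2)[of "fst x" "snd x"]] by auto
  then show "e x \<otimes>\<^sub>k t (snd x) : tensor (dual E) W n"
   by (rule tens_in_tensor) simp
 qed
 finally show ?thesis .
qed

lemma tensor_dual_eqI:
 fixes u u' :: "('x => 'k::field) \<times> 'y => 'k"
 assumes E: "graded_space E" and W: "graded_space W" and u: "u : tensor (dual E) W n" "u' : tensor (dual E) W n'"
  and eq: "!!v. v : homogeneous E ==> curry u v = curry u' v"
 shows "u = u'"
proof
 fix z :: "('x => 'k) \<times> 'y"
 obtain v y where z: "z = (v, y)" by force
 have "curry u v = curry u' v"
  using eq tensor_dual_linear(2)[OF E W u(1)] tensor_dual_linear(2)[OF E W u(2)] by (cases "v : homogeneous E") auto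
 from fun_cong[OF this, of y] show "u z = u' z" by (simp add: z)
qed

section \<open>Subcoalgebras and annihilators\<close>

text \<open>A column of a tensor is its value at a fixed right coordinate \<open>y\<close>, a vector
  of the left space. If all columns lie in \<open>X\<close>, projecting the left factors to
  \<open>X\<close> changes no column; so the tensor has a presentation with left factors in
  \<open>X\<close>.\<close>

lemma tens_sum_project:
 fixes V X :: "('x, 'k::field) graded" and ts :: "(int \<times> int \<times> ('x => 'k) \<times> ('y => 'k)) list"
 assumes X: "!!p. kvs.subspace (X p)"
  and col: "!!p y. sum_list (map (%(p, q, v, w). scl (w y) v) (filter (%t. fst t = p) ts)) : X p"
 obtains \<pi> where "!!p v. \<pi> p v : X p" "tens_sum (map (%(p, q, v, w). (p, q, \<pi> p v, w)) ts) = tens_sum ts"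
proof -
 have "EX f. (ALL v w. f (v + w) = f v + f w) & (ALL c v. f (scl c v) = scl c (f v)) &
  (ALL v. f v : X p) & (ALL v:X p. f v = v)" for p
  using projection_exists[OF X, of p] by metis
 then obtain \<pi> where \<pi>: "!!p v w. \<pi> p (v + w) = \<pi> p v + \<pi> p w" "!!p c v. \<pi> p (scl c v) = scl c (\<pi> p v)"
  "!!p v. \<pi> p v : X p" "!!p v. v : X p ==> \<pi> p v = v"
  by metis
 have \<pi>0: "\<pi> p 0 = 0" for p using \<pi>(2)[of p 0 0] by simp
 have eq: "tens_sum (map (%(p, q, v, w). (p, q, \<pi> p v, w)) ts) (x, y) = tens_sum ts (x, y)" for x y
 proof -
  let ?g = "%(p, q, v, w). scl (w y) v :: 'x => 'k"
  let ?F = "%p. filter (%t. fst t = p) ts"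
  have "sum_list (map (%(p, q, v, w). scl (w y) (\<pi> p v)) (?F p)) = \<pi> p (sum_list (map ?g (?F p)))" for p
  proof -
   have "sum_list (map (%(p, q, v, w). scl (w y) (\<pi> p v)) us) = \<pi> p (sum_list (map ?g us))"
    if "ALL t:set us. fst t = p" for us :: "(int \<times> int \<times> ('x => 'k) \<times> ('y => 'k)) list"
    using that by (induction us) (auto simp: \<pi>0 \<pi>(1,2))
   then show ?thesis by simp
  qed
  then have "sum_list (map (%(p, q, v, w). scl (w y) (\<pi> p v)) (?F p)) = sum_list (map ?g (?F p))" for p
   using \<pi>(4)[OF col[where p = p and y = y]] by metis
  then have "sum_list (map (%(p, q, v, w). scl (w y) (\<pi> p v)) ts) = sum_list (map ?g ts)"
   using sum_list_group[of "fst ` set ts" ts fst ?g]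
    sum_list_group[of "fst ` set ts" ts fst "%(p, q, v, w). scl (w y) (\<pi> p v)"] by simp
  from fun_cong[OF this, of x] show ?thesis
   by (simp add: tens_sum_apply sum_list_fun o_def case_prod_unfold scl_def)
 qed
 have "tens_sum (map (%(p, q, v, w). (p, q, \<pi> p v, w)) ts) = tens_sum ts"
 proof
  fix z show "tens_sum (map (%(p, q, v, w). (p, q, \<pi> p v, w)) ts) z = tens_sum ts z"
   by (cases z) (simp only: eq)
 qed
 then show thesis using that \<pi>(3) by blast
qed

definition perp :: "('x, 'k::field) graded => ('x => 'k, 'k) graded => ('x, 'k) graded" where
 "perp V K m = {c : V m. ALL \<xi>:K (- m). \<xi> c = 0}"

lemma perp_subset: "perp V K m \<subseteq> V m"
 by (auto simp: perp_def)

lemma perp_subspace: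
 assumes V: "graded_space V" and K: "!!n. K n \<subseteq> dual V n"
 shows "kvs.subspace (perp V K m)"
 unfolding kvs.subspace_def
proof (intro conjI ballI allI)
 note sV = subspaceD[OF graded_spaceD(1)[OF V, of m]]
 show "0 : perp V K m" using sV(1) K dual_zero[OF V] by (auto simp: perp_def subset_iff)
 fix x y c assume x: "x : perp V K m"
 show "x + y : perp V K m" if y: "y : perp V K m"
 proof -
  have "\<xi> (x + y) = 0" if "\<xi> : K (- m)" for \<xi>
   using dual_add[OF V subsetD[OF K that], of x m y] that x y by (auto simp: perp_def)
  then show ?thesis using x y sV(2) by (auto simp: perp_def)
 qed
 have "\<xi> (scl c x) = 0" if "\<xi> : K (- m)" for \<xi>
  using dual_scl[OF V subsetD[OF K that], of x m c] that x by (auto simp: perp_def)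
 then show "scl c x : perp V K m" using x sV(3) by (auto simp: perp_def)
qed

text \<open>Contracting the left factor with \<xi> in \<open>K\<close> gives a vector killed by all
  functionals, hence zero. Its coordinate at \<open>y\<close> is the value of \<xi> at the column,
  so the columns lie in the annihilator of \<open>K\<close>.\<close>

lemma perp_column:
 fixes V :: "('x, 'k::field) graded"
 assumes V: "graded_space V" and K: "!!n. K n \<subseteq> dual V n"
  and ts: "hom_terms V V ts" "!!p q v w. (p, q, v, w) : set ts ==> p + q = n"
  and zero: "!!p q \<xi> \<zeta>. \<xi> : K p ==> \<zeta> : dual V q ==> term_sum (%p q v w. \<xi> v * \<zeta> w) ts = 0"
 shows "sum_list (map (%(p, q, v, w). scl (w y) v) (filter (%t. fst t = p) ts)) : perp V K p"
proof -
 note sV = graded_spaceD(1)[OF V]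
 let ?F = "filter (%t. fst t = p) ts"
 have tsD: "v : V p" "w : V q" "q = n - p" if "(p, q, v, w) : set ts" for p q v w
  using bspec[OF ts(1)[unfolded hom_terms_def] that] ts(2)[OF that] by auto
 have colV: "(%(p, q, v, w). scl (w y) v) x : V p" if "x : set ?F" for x
 proof -
  obtain p' q v w where e: "x = (p', q, v, w)" by (cases x)
  then show ?thesis using that tsD(1)[of p' q v w] subspaceD(3)[OF sV, of v p] by auto
 qed
 have "\<xi> (sum_list (map (%(p, q, v, w). scl (w y) v) ?F)) = 0" if x: "\<xi> : K (- p)" for \<xi>
 proof -
  have x': "\<xi> : dual V (- p)" using K x by blast
  let ?u = "sum_list (map (%(p, q, v, w). scl (\<xi> v) w) ?F)"
  have uV: "(%(p, q, v, w). scl (\<xi> v) w) x : V (n - p)" if "x : set ?F" for x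
  proof -
   obtain p' q v w where e: "x = (p', q, v, w)" by (cases x)
   then show ?thesis using that tsD(2,3)[of p' q v w] subspaceD(3)[OF sV, of w q] by auto
  qed
  have "?u = 0"
  proof (rule dual_separates_zero[OF V subspace_sum_list[OF sV uV]])
   fix \<zeta> assume z: "\<zeta> : dual V (- (n - p))"
   have "\<zeta> ?u = sum_list (map (%x. \<zeta> ((%(p, q, v, w). scl (\<xi> v) w) x)) ?F)"
    by (rule dual_sum_list[OF V z uV])
   also have "... = sum_list (map (%(p, q, v, w). \<xi> v * \<zeta> w) ?F)"
   proof (rule arg_cong[where f = sum_list], rule map_cong[OF refl])
    fix x assume x': "x : set ?F"
    obtain p' q v w where e: "x = (p', q, v, w)" by (cases x)
    show "\<zeta> ((%(p, q, v, w). scl (\<xi> v) w) x) = (%(p, q, v, w). \<xi> v * \<zeta> w) x"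
     using x' tsD(2)[of p' q v w] dual_scl[OF V z, of w q] by (auto simp: e)
   qed
   also have "... = term_sum (%p q v w. \<xi> v * \<zeta> w) ts"
   proof -
    have "\<xi> v = 0" if "(p', q, v, w) : set ts" "p' ~= p" for p' q v w
     using dual_other[OF V x' tsD(1)[OF that(1)]] that(2) by simp
    then have "sum_list (map (%(p, q, v, w). \<xi> v * \<zeta> w) (filter (%t. fst t = p) us)) = term_sum (%p q v w. \<xi> v * \<zeta> w) us"
     if "set us \<subseteq> set ts" for us using that by (induction us) auto
    then show ?thesis by simp
   qed
   also have "... = 0" by (rule zero[OF x z])
   finally show "\<zeta> ?u = 0" .
  qed
  have "\<xi> (sum_list (map (%(p, q, v, w). scl (w y) v) ?F)) = sum_list (map (%x. \<xi> ((%(p, q, v, w). scl (w y) v) x)) ?F)"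
   by (rule dual_sum_list[OF V x' colV])
  also have "... = sum_list (map (%(p, q, v, w). \<xi> v * w y) ?F)"
  proof (rule arg_cong[where f = sum_list], rule map_cong[OF refl])
   fix x assume x'': "x : set ?F"
   obtain p' q v w where e: "x = (p', q, v, w)" by (cases x)
   show "\<xi> ((%(p, q, v, w). scl (w y) v) x) = (%(p, q, v, w). \<xi> v * w y) x"
    using x'' tsD(1)[of p' q v w] dual_scl[OF V x', of v p'] by (auto simp: e)
  qed
  also have "... = ?u y" by (simp add: sum_list_fun o_def case_prod_unfold scl_def)
  finally show ?thesis using \<open>?u = 0\<close> by (simp add: pointwise)
 qed
 moreover have "sum_list (map (%(p, q, v, w). scl (w y) v) ?F) : V p"
  by (rule subspace_sum_list[OF sV colV])
 ultimately show ?thesis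
  unfolding perp_def by blast
qed

lemma tens_sum_swap: "tens_sum (map (%(p, q, v, w). (q, p, w, v)) ts) (y, x) = tens_sum ts (x, y)"
 by (simp add: tens_sum_apply o_def case_prod_unfold mult.commute)

lemma term_sum_swap: "term_sum \<phi> (map (%(p, q, v, w). (q, p, w, v)) ts) = term_sum (%p q v w. \<phi> q p w v) ts"
 by (simp add: term_sum_def o_def case_prod_unfold)

text \<open>With U the annihilator of \<open>K\<close> and V the whole space, this is the identity
  of (U \<otimes> V) \<inter> (V \<otimes> U) with U \<otimes> U: the left factors are projected to
  U first, then the factors are exchanged and the other side is projected. It is the step by which
  ideals of the dual algebra yield subcoalgebras.\<close>

lemma tensor_perp:
 fixes V :: "('x, 'k::field) graded"
 assumes V: "graded_space V" and K: "!!n. K n \<subseteq> dual V n" and t: "t : tensor V V n"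
  and l: "!!p q \<xi> \<zeta>. \<xi> : K p ==> \<zeta> : dual V q ==> tensor_lift V V (%p q v w. \<xi> v * \<zeta> w) t = 0"
  and r: "!!p q \<xi> \<zeta>. \<xi> : dual V p ==> \<zeta> : K q ==> tensor_lift V V (%p q v w. \<xi> v * \<zeta> w) t = 0"
 shows "t : tensor (perp V K) (perp V K) n"
proof -
 obtain ts where ts: "hom_terms V V ts" "t = tens_sum ts" "!!p q v w. (p, q, v, w) : set ts ==> p + q = n"
  using tensor_terms[OF V t] by metis
 have l': "term_sum (%p q v w. \<xi> v * \<zeta> w) ts = 0" if "\<xi> : K p" "\<zeta> : dual V q" for p q \<xi> \<zeta>
 proof -
  have "\<xi> : dual V p" using that K by blast
  then show ?thesis
   using l[OF that] tensor_lift_sum[OF V V balanced_dual[OF V _ that(2)] ts(1)] ts(2) by simp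
 qed
 have r': "term_sum (%p q v w. \<xi> v * \<zeta> w) ts = 0" if "\<xi> : dual V p" "\<zeta> : K q" for p q \<xi> \<zeta>
 proof -
  have "\<zeta> : dual V q" using that K by blast
  then show ?thesis
   using r[OF that] tensor_lift_sum[OF V V balanced_dual[OF V that(1)] ts(1)] ts(2) by simp
 qed
 have colts: "sum_list (map (%(p, q, v, w). scl (w y) v) (filter (%t. fst t = p) ts)) : perp V K p" for p y
  by (rule perp_column[OF V K ts(1) ts(3) l']; assumption)
 obtain \<pi> where \<pi>: "!!p v. \<pi> p v : perp V K p" "tens_sum (map (%(p, q, v, w). (p, q, \<pi> p v, w)) ts) = tens_sum ts"
  by (rule tens_sum_project[OF perp_subspace[OF V K] colts]) (rule that)
 define us where "us = map (%(p, q, v, w). (p, q, \<pi> p v, w)) ts"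
 define sw where "sw = map (%(p, q, v, w). (q, p, w, v)) us"
 have us: "hom_terms V V us" "!!p q v w. (p, q, v, w) : set us ==> p + q = n & v : perp V K p" "tens_sum us = t"
  using ts \<pi> perp_subset[of V K] unfolding us_def hom_terms_def by (fastforce, fastforce, simp)
 have sw: "hom_terms V V sw" "!!p q v w. (p, q, v, w) : set sw ==> p + q = n"
  using us(1,2) unfolding sw_def hom_terms_def by (auto simp: add.commute)
 have s': "term_sum (%p q v w. \<xi> v * \<zeta> w) sw = 0" if "\<xi> : K p" "\<zeta> : dual V q" for p q \<xi> \<zeta>
 proof -
  have x: "\<xi> : dual V p" using that K by blast
  have "term_sum (%p q v w. \<xi> v * \<zeta> w) sw = term_sum (%p q v w. \<zeta> v * \<xi> w) us"
   by (simp add: sw_def term_sum_swap mult.commute)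
  also have "... = tensor_lift V V (%p q v w. \<zeta> v * \<xi> w) t"
   using tensor_lift_sum[OF V V balanced_dual[OF V that(2) x] us(1)] us(3) by simp
  also have "... = 0" by (rule r[OF that(2,1)])
  finally show ?thesis .
 qed
 have colsw: "sum_list (map (%(p, q, v, w). scl (w y) v) (filter (%t. fst t = p) sw)) : perp V K p" for p y
  by (rule perp_column[OF V K sw(1) sw(2) s']; assumption)
 obtain \<rho> where \<rho>: "!!p v. \<rho> p v : perp V K p" "tens_sum (map (%(p, q, v, w). (p, q, \<rho> p v, w)) sw) = tens_sum sw"
  by (rule tens_sum_project[OF perp_subspace[OF V K] colsw]) (rule that)
 define fin where "fin = map (%(p, q, v, w). (p, q, v, \<rho> q w)) us"
 have "fin = map (%(p, q, v, w). (q, p, w, v)) (map (%(p, q, v, w). (p, q, \<rho> p v, w)) sw)"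
  by (auto simp: fin_def sw_def)
 then have "tens_sum fin (x, y) = tens_sum us (x, y)" for x y
  using tens_sum_swap[of "map (%(p, q, v, w). (p, q, \<rho> p v, w)) sw" x y] \<rho>(2) tens_sum_swap[of us y x]
  by (simp add: sw_def)
 then have "tens_sum fin = t" unfolding us(3)[symmetric] by (intro ext) (metis surj_pair)
 moreover have "hom_terms (perp V K) (perp V K) fin" "!!p q v w. (p, q, v, w) : set fin ==> p + q = n"
  using us(2) \<rho>(1) unfolding fin_def hom_terms_def by auto
 ultimately show ?thesis using hom_terms_tensor by metis
qed

section \<open>Strict morphisms and surjective images of curved algebras\<close>

lemma curved_hom_strictD:
 assumes B: "curved_algebra B" and f: "curved_hom A B f 0"
 shows "!!n a. a : car A n ==> f (dif A a) = dif B (f a)" "f (cur A) = cur B"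
 using curved_homD(5,6)[OF f] mul_zero_left[OF B curved_homD(7)[OF f]] mul_zero_right[OF B curved_homD(7)[OF f]]
  dif_zero[OF B] mul_zero_left[OF B car_closed(1)[OF B]] by auto

lemma curved_hom_strictI:
 assumes B: "curved_algebra B"
  and lin: "!!n. linear_into (car A n) (car B n) f"
  and mul: "!!p q a a'. a : car A p ==> a' : car A q ==> f (mul A a a') = mul B (f a) (f a')"
  and unt: "f (unt A) = unt B"
  and dif: "!!n a. a : car A n ==> f (dif A a) = dif B (f a)" and cur: "f (cur A) = cur B"
 shows "curved_hom A B f 0"
proof (rule curved_homI[OF lin mul unt car_closed(1)[OF B]])
 note z = mul_zero_left[OF B linear_intoD(1)[OF lin]] mul_zero_right[OF B linear_intoD(1)[OF lin]]
 show "f (dif A a) = dif B (f a) + (mul B 0 (f a) - ksign n (mul B (f a) 0))" if "a : car A n" for n a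
  using z[OF that] dif[OF that] by simp
 show "f (cur A) = cur B + dif B 0 + mul B 0 0"
  using cur dif_zero[OF B] mul_zero_left[OF B car_closed(1)[OF B, of 0]] by simp
qed

text \<open>Since \<open>g\<close> is onto, each identity for \<psi> is the identity for
  \<open>h\<close> at a preimage. Morphisms between duals of subcoalgebras are obtained in this way
  from morphisms between the full duals.\<close>

lemma curved_hom_factor:
 assumes B: "curved_algebra B" and g: "curved_hom A B g 0" and surj: "!!n. g ` car A n = car B n"
  and h: "curved_hom A B' h b" and lin: "!!n. linear_into (car B n) (car B' n) \<psi>"
  and comm: "!!n a. a : car A n ==> \<psi> (g a) = h a"
  and A: "curved_algebra A"
 shows "curved_hom B B' \<psi> b"
proof (rule curved_homI[OF lin])
 note hD = curved_homD[OF h] and gD = curved_homD[OF g] and gs = curved_hom_strictD[OF B g]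
 have ex: "EX a:car A n. x = g a" if "x : car B n" for x n
  using that unfolding surj[symmetric] by auto
 fix p q n x x'
 show "\<psi> (mul B x x') = mul B' (\<psi> x) (\<psi> x')" if xx: "x : car B p" "x' : car B q"
 proof -
  obtain a a' where a: "a : car A p" "x = g a" "a' : car A q" "x' = g a'" using ex xx by metis
  show ?thesis
   unfolding a(2,4) gD(2)[OF a(1,3), symmetric] comm[OF mul_closed[OF A a(1,3)]] comm[OF a(1)] comm[OF a(3)]
   by (rule hD(2)[OF a(1,3)])
 qed
 show "\<psi> (unt B) = unt B'"
  using comm[OF curved_algebraD(5)[OF A]] gD(3) hD(3) by simp
 show "b : car B' 1" by (rule hD(4))
 show "\<psi> (dif B x) = dif B' (\<psi> x) + (mul B' b (\<psi> x) - ksign n (mul B' (\<psi> x) b))" if x: "x : car B n"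
 proof -
  obtain a where a: "a : car A n" "x = g a" using ex x by metis
  show ?thesis
   unfolding a(2) gs(1)[OF a(1), symmetric] comm[OF dif_closed[OF A a(1)]] comm[OF a(1)] by (rule hD(5)[OF a(1)])
 qed
 show "\<psi> (cur B) = cur B' + dif B' b + mul B' b b"
  using comm[OF curved_algebraD(10)[OF A]] gs(2) hD(6) by simp
qed

text \<open>All axioms are transported along the surjection. The dual of a subcoalgebra is such an
  image under restriction, so its axioms need not be derived from coassociativity.\<close>

lemma curved_algebra_image:
 assumes A: "curved_algebra A" and gB: "graded_space (car B)"
  and lin: "!!n. linear_into (car A n) (car B n) g" and surj: "!!n. g ` car A n = car B n"
  and mul: "!!p q a a'. a : car A p ==> a' : car A q ==> g (mul A a a') = mul B (g a) (g a')"
  and unt: "g (unt A) = unt B"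
  and dif: "!!n a. a : car A n ==> g (dif A a) = dif B (g a)" and cur: "g (cur A) = cur B"
 shows "curved_algebra B"
proof (rule curved_algebraI[OF gB])
 have ex: "EX a:car A n. x = g a" if "x : car B n" for x n
  using that unfolding surj[symmetric] by auto
 note gD = linear_intoD[OF lin] linear_into_simps[OF lin curved_algebraD(13)[OF A]]
 have sc: "scl c (g a) = g (scl c a)" if "a : car A n" for a n c using gD(2)[OF that] by simp
 have ad: "g a + g a' = g (a + a')" if "a : car A n" "a' : car A n" for a a' n using gD(3)[OF that] by simp
 fix p q r n x y z
 show "linear_into (car B q) (car B (p + q)) (%y. mul B x y)" if "x : car B p"
 proof -
  obtain a where a: "a : car A p" "x = g a" using ex \<open>x : _\<close> by metis
  have m: "mul B x (g b) = g (mul A a b)" if "b : car A m" for b m by (simp add: a mul[OF a(1) that])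
  show ?thesis
  proof (rule linear_intoI)
   fix v w c assume "v : car B q"
   then obtain b where b: "b : car A q" "v = g b" using ex by metis
   show "mul B x v : car B (p + q)" unfolding b m[OF b(1)] by (rule gD(1)[OF mul_closed[OF A a(1) b(1)]])
   show "mul B x (scl c v) = scl c (mul B x v)"
    unfolding b(2) sc[OF b(1)] m[OF b(1)] m[OF car_closed(3)[OF A b(1)]] mul_scl_right[OF A a(1) b(1)]
    by (rule gD(2)[OF mul_closed[OF A a(1) b(1)]])
   assume "w : car B q"
   then obtain b' where b': "b' : car A q" "w = g b'" using ex by metis
   show "mul B x (v + w) = mul B x v + mul B x w"
    unfolding b(2) b'(2) ad[OF b(1) b'(1)] m[OF b(1)] m[OF b'(1)] m[OF car_closed(2)[OF A b(1) b'(1)]]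
     mul_add_right[OF A a(1) b(1) b'(1)]
    by (rule gD(3)[OF mul_closed[OF A a(1) b(1)] mul_closed[OF A a(1) b'(1)]])
  qed
 qed
 show "linear_into (car B p) (car B (p + q)) (%x. mul B x y)" if "y : car B q"
 proof -
  obtain a where a: "a : car A q" "y = g a" using ex \<open>y : _\<close> by metis
  have m: "mul B (g b) y = g (mul A b a)" if "b : car A m" for b m by (simp add: a mul[OF that a(1)])
  show ?thesis
  proof (rule linear_intoI)
   fix v w c assume "v : car B p"
   then obtain b where b: "b : car A p" "v = g b" using ex by metis
   show "mul B v y : car B (p + q)" unfolding b m[OF b(1)] by (rule gD(1)[OF mul_closed[OF A b(1) a(1)]])
   show "mul B (scl c v) y = scl c (mul B v y)"
    unfolding b(2) sc[OF b(1)] m[OF b(1)] m[OF car_closed(3)[OF A b(1)]] mul_scl_left[OF A b(1) a(1)]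
    by (rule gD(2)[OF mul_closed[OF A b(1) a(1)]])
   assume "w : car B p"
   then obtain b' where b': "b' : car A p" "w = g b'" using ex by metis
   show "mul B (v + w) y = mul B v y + mul B w y"
    unfolding b(2) b'(2) ad[OF b(1) b'(1)] m[OF b(1)] m[OF b'(1)] m[OF car_closed(2)[OF A b(1) b'(1)]]
     mul_add_left[OF A b(1) b'(1) a(1)]
    by (rule gD(3)[OF mul_closed[OF A b(1) a(1)] mul_closed[OF A b'(1) a(1)]])
  qed
 qed
 show "mul B (mul B x y) z = mul B x (mul B y z)" if xyz: "x : car B p" "y : car B q" "z : car B r"
 proof -
  obtain a where a: "a : car A p" "x = g a" using ex xyz(1) by metis
  obtain b where b: "b : car A q" "y = g b" using ex xyz(2) by metis
  obtain c where c: "c : car A r" "z = g c" using ex xyz(3) by metis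
  show ?thesis
   unfolding a(2) b(2) c(2) mul[OF a(1) b(1), symmetric] mul[OF b(1) c(1), symmetric]
    mul[OF mul_closed[OF A a(1) b(1)] c(1), symmetric] mul[OF a(1) mul_closed[OF A b(1) c(1)], symmetric]
    curved_algebraD(4)[OF A a(1) b(1) c(1)] ..
 qed
 note u = curved_algebraD(5)[OF A] and h = curved_algebraD(10)[OF A]
 show "unt B : car B 0" using gD(1)[OF u] unt by simp
 show "cur B : car B 2" using gD(1)[OF h] cur by simp
 show "dif B (cur B) = 0"
  using dif[OF h] cur curved_algebraD(11)[OF A] gD(4) by simp
 show "mul B (unt B) x = x" "mul B x (unt B) = x" if "x : car B p"
 proof -
  obtain a where a: "a : car A p" "x = g a" using ex \<open>x : _\<close> by metis
  show "mul B (unt B) x = x"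
   unfolding a(2) unt[symmetric] mul[OF u a(1), symmetric] curved_algebraD(6)[OF A a(1)] ..
  show "mul B x (unt B) = x"
   unfolding a(2) unt[symmetric] mul[OF a(1) u, symmetric] curved_algebraD(7)[OF A a(1)] ..
 qed
 show "linear_into (car B n) (car B (n + 1)) (dif B)"
 proof (rule linear_intoI)
  fix v w c assume "v : car B n"
  then obtain b where b: "b : car A n" "v = g b" using ex by metis
  show "dif B v : car B (n + 1)" unfolding b dif[OF b(1), symmetric] by (rule gD(1)[OF dif_closed[OF A b(1)]])
  show "dif B (scl c v) = scl c (dif B v)"
   unfolding b(2) sc[OF b(1)] dif[OF b(1), symmetric] dif[OF car_closed(3)[OF A b(1)], symmetric] dif_scl[OF A b(1)]
   by (rule gD(2)[OF dif_closed[OF A b(1)]])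
  assume "w : car B n"
  then obtain b' where b': "b' : car A n" "w = g b'" using ex by metis
  show "dif B (v + w) = dif B v + dif B w"
   unfolding b(2) b'(2) ad[OF b(1) b'(1)] dif[OF b(1), symmetric] dif[OF b'(1), symmetric]
    dif[OF car_closed(2)[OF A b(1) b'(1)], symmetric] dif_add[OF A b(1) b'(1)]
   by (rule gD(3)[OF dif_closed[OF A b(1)] dif_closed[OF A b'(1)]])
 qed
 show "dif B (mul B x y) = mul B (dif B x) y + ksign p (mul B x (dif B y))" if xy: "x : car B p" "y : car B q"
 proof -
  obtain a where a: "a : car A p" "x = g a" using ex xy(1) by metis
  obtain b where b: "b : car A q" "y = g b" using ex xy(2) by metis
  note da = dif_closed[OF A a(1)] and db = dif_closed[OF A b(1)]
  have m2: "mul A a (dif A b) : car A (p + 1 + q)"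
   using mul_closed[OF A a(1) db] by (simp add: algebra_simps)
  show ?thesis
   unfolding a(2) b(2) mul[OF a(1) b(1), symmetric] dif[OF mul_closed[OF A a(1) b(1)], symmetric]
    dif[OF a(1), symmetric] dif[OF b(1), symmetric] mul[OF da b(1), symmetric] mul[OF a(1) db, symmetric]
    curved_algebraD(9)[OF A a(1) b(1)] gD(7)[OF m2, symmetric]
   by (rule gD(3)[OF mul_closed[OF A da b(1)] car_closed(6)[OF A m2]])
 qed
 show "dif B (dif B x) = mul B (cur B) x - mul B x (cur B)" if x: "x : car B p"
 proof -
  obtain a where a: "a : car A p" "x = g a" using ex x by metis
  have m2: "mul A a (cur A) : car A (2 + p)"
   using mul_closed[OF A a(1) h] by (simp add: algebra_simps)
  show ?thesis
   unfolding a(2) dif[OF a(1), symmetric] dif[OF dif_closed[OF A a(1)], symmetric] cur[symmetric]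
    mul[OF h a(1), symmetric] mul[OF a(1) h, symmetric] curved_algebraD(12)[OF A a(1)]
   by (rule gD(6)[OF mul_closed[OF A h a(1)] m2])
 qed
qed

section \<open>Limits\<close>

lemma curry_family: "i : I ==> curry (family I u) i = u i"
 by (auto simp: family_def fun_eq_iff)

lemma family_cong: "(!!i. i : I ==> u i = v i) ==> family I u = family I v"
 by (auto simp: family_def fun_eq_iff)

lemma curry_plus: "curry (F + G) i = curry F i + curry G i"
 by (auto simp: fun_eq_iff pointwise)

lemma curry_scl: "curry (scl c F) i = scl c (curry F i)"
 by (auto simp: fun_eq_iff scl_def)

lemma curry_zero: "curry 0 i = 0"
 by (auto simp: fun_eq_iff pointwise)

lemma curry_minus: "curry (F - G) i = curry F i - curry G i"
 by (auto simp: fun_eq_iff pointwise)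

lemma curry_ksign: "curry (ksign n F) i = ksign n (curry F i)"
 by (auto simp: fun_eq_iff pointwise ksign_def)

lemma curry_sum: "curry (sum F N) i = (\<Sum>n\<in>N. curry (F n) i)"
 by (induction N rule: infinite_finite_induct) (simp_all only: curry_zero curry_plus sum.insert sum.infinite sum.empty not_False_eq_True)

lemma family_plus: "family I u + family I v = family I (%i. u i + v i)"
 by (auto simp: family_def fun_eq_iff pointwise)

lemma family_diff: "family I u - family I v = family I (%i. u i - v i)"
 by (auto simp: family_def fun_eq_iff pointwise)

lemma family_scl: "scl c (family I u) = family I (%i. scl c (u i))"
 by (auto simp: family_def fun_eq_iff scl_def)

lemma family_ksign: "ksign n (family I u) = family I (%i. ksign n (u i))"
 by (auto simp: family_def fun_eq_iff pointwise ksign_def)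

lemma family_zero: "family I (%i. 0) = 0"
 by (auto simp: family_def fun_eq_iff pointwise)

context
 fixes I :: "'i set" and le and alg :: "'i => ('y, 'k::field) curved_alg" and tr
 assumes alg: "!!i. i : I ==> curved_algebra (alg i)"
  and tr: "!!i j. i : I ==> j : I ==> le i j ==> curved_hom (alg j) (alg i) (tr i j) 0"
begin

private abbreviation "L \<equiv> limit_alg I le alg tr"

lemma limit_carI:
 assumes "!!i. i : I ==> u i : car (alg i) n"
  "!!i j. i : I ==> j : I ==> le i j ==> tr i j (u j) = u i"
 shows "family I u : car L n"
proof -
 have "family I u = family I (curry (family I u))"
  by (rule family_cong) (simp add: curry_family)
 then show ?thesis using assms by (simp add: limit_alg_def curry_family)
qed

lemma limit_carD:
 assumes "F : car L n"
 shows "F = family I (curry F)" "!!i. i : I ==> curry F i : car (alg i) n"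
  "!!i j. i : I ==> j : I ==> le i j ==> tr i j (curry F j) = curry F i"
proof -
 have *: "F = family I (curry F) & (ALL i:I. curry F i : car (alg i) n) &
   (ALL i:I. ALL j:I. le i j --> tr i j (curry F j) = curry F i)"
  using assms unfolding limit_alg_def by simp
 show "F = family I (curry F)" by (rule *[THEN conjunct1])
 show "curry F i : car (alg i) n" if "i : I" for i
  by (rule bspec[OF *[THEN conjunct2, THEN conjunct1] that])
 show "tr i j (curry F j) = curry F i" if "i : I" "j : I" "le i j" for i j
  using *[THEN conjunct2, THEN conjunct2] that by simp
qed

lemma limit_eqI:
 assumes "F : car L n" "G : car L m" "!!i. i : I ==> curry F i = curry G i"
 shows "F = G"
 using limit_carD(1)[OF assms(1)] limit_carD(1)[OF assms(2)] family_cong[of I "curry F" "curry G"] assms(3) by simp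

private lemma trD:
 assumes "i : I" "j : I" "le i j"
 shows "!!n. linear_into (car (alg j) n) (car (alg i) n) (tr i j)"
  "!!p q a a'. a : car (alg j) p ==> a' : car (alg j) q ==> tr i j (mul (alg j) a a') = mul (alg i) (tr i j a) (tr i j a')"
  "tr i j (unt (alg j)) = unt (alg i)"
  "!!n a. a : car (alg j) n ==> tr i j (dif (alg j) a) = dif (alg i) (tr i j a)"
  "tr i j (cur (alg j)) = cur (alg i)"
 using curved_homD(1-3)[OF tr[OF assms]] curved_hom_strictD[OF alg[OF assms(1)] tr[OF assms]] by blast+

lemma limit_subspace: "kvs.subspace (car L n)"
 unfolding kvs.subspace_def
proof (intro conjI ballI allI)
 have "family I (%i. 0) : car L n"
  by (rule limit_carI)
   (simp_all add: car_closed(1)[OF alg] linear_into_simps(1)[OF trD(1) curved_algebraD(13)[OF alg]])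
 then show "0 : car L n" by (simp add: family_zero)
 fix F G c assume F: "F : car L n"
 note FD = limit_carD[OF F]
 have "family I (%i. scl c (curry F i)) : car L n"
  by (rule limit_carI) (simp_all add: car_closed(3)[OF alg FD(2)] linear_intoD(2)[OF trD(1) FD(2)] FD(3))
 then show "scl c F : car L n" by (subst FD(1)) (simp add: family_scl)
 assume G: "G : car L n"
 note GD = limit_carD[OF G]
 have "family I (%i. curry F i + curry G i) : car L n"
  by (rule limit_carI) (simp_all add: car_closed(2)[OF alg FD(2) GD(2)] linear_intoD(3)[OF trD(1) FD(2) GD(2)] FD(3) GD(3))
 then show "F + G : car L n" by (subst FD(1), subst GD(1)) (simp add: family_plus)
qed

lemma limit_graded: "graded_space (car L)"
 unfolding graded_space_def
proof (intro conjI allI impI ballI limit_subspace)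
 fix N F n
 assume *: "finite N & (ALL n:N. F n : car L n) & sum F N = 0" and n: "n : N"
 have F: "F n : car L n" using * n by blast
 have "curry (F n) i = curry 0 i" if i: "i : I" for i
 proof -
  have "curry (F n) i = 0"
  proof (rule graded_spaceD(2)[OF curved_algebraD(1)[OF alg[OF i]] _ _ _ n, of "%n. curry (F n) i"])
   show "curry (F m) i : car (alg i) m" if "m : N" for m
    using limit_carD(2)[of "F m" m i] * that i by blast
   show "(\<Sum>n\<in>N. curry (F n) i) = 0" using * by (simp add: curry_sum[symmetric] curry_zero)
  qed (use * in blast)
  then show ?thesis by (simp add: curry_zero)
 qed
 then show "F n = 0" by (rule limit_eqI[OF F subspaceD(1)[OF limit_subspace]])
qed

lemma limit_mul: "mul L F G = family I (%i. mul (alg i) (curry F i) (curry G i))"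
 by (simp add: limit_alg_def)

lemma limit_dif: "dif L F = family I (%i. dif (alg i) (curry F i))"
 by (simp add: limit_alg_def)

lemma limit_unt: "unt L = family I (%i. unt (alg i))"
 by (simp add: limit_alg_def)

lemma limit_cur: "cur L = family I (%i. cur (alg i))"
 by (simp add: limit_alg_def)

lemma limit_mul_closed: "F : car L p ==> G : car L q ==> mul L F G : car L (p + q)"
 unfolding limit_mul
 by (rule limit_carI) (simp_all add: mul_closed[OF alg limit_carD(2) limit_carD(2)] trD(2)[OF _ _ _ limit_carD(2) limit_carD(2)] limit_carD(3))

lemma limit_dif_closed: "F : car L p ==> dif L F : car L (p + 1)"
 unfolding limit_dif
 by (rule limit_carI) (simp_all add: dif_closed[OF alg limit_carD(2)] trD(4)[OF _ _ _ limit_carD(2)] limit_carD(3))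

lemma curved_algebra_limit: "curved_algebra L"
proof (rule curved_algebraI[OF limit_graded])
 note D = limit_carD(2)
 fix p q r n F G H
 show "linear_into (car L q) (car L (p + q)) (%G. mul L F G)" if F: "F : car L p"
 proof (rule linear_intoI)
  fix v w c assume v: "v : car L q"
  show "mul L F v : car L (p + q)" by (rule limit_mul_closed[OF F v])
  show "mul L F (scl c v) = scl c (mul L F v)"
   unfolding limit_mul family_scl by (rule family_cong) (simp add: curry_scl mul_scl_right[OF alg D[OF F] D[OF v]])
  show "mul L F (v + w) = mul L F v + mul L F w" if w: "w : car L q"
   unfolding limit_mul family_plus by (rule family_cong) (simp add: curry_plus mul_add_right[OF alg D[OF F] D[OF v] D[OF w]])
 qed
 show "linear_into (car L p) (car L (p + q)) (%F. mul L F G)" if G: "G : car L q"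
 proof (rule linear_intoI)
  fix v w c assume v: "v : car L p"
  show "mul L v G : car L (p + q)" by (rule limit_mul_closed[OF v G])
  show "mul L (scl c v) G = scl c (mul L v G)"
   unfolding limit_mul family_scl by (rule family_cong) (simp add: curry_scl mul_scl_left[OF alg D[OF v] D[OF G]])
  show "mul L (v + w) G = mul L v G + mul L w G" if w: "w : car L p"
   unfolding limit_mul family_plus by (rule family_cong) (simp add: curry_plus mul_add_left[OF alg D[OF v] D[OF w] D[OF G]])
 qed
 show "mul L (mul L F G) H = mul L F (mul L G H)" if "F : car L p" "G : car L q" "H : car L r"
  unfolding limit_mul by (rule family_cong) (simp add: curry_family curved_algebraD(4)[OF alg D[OF that(1)] D[OF that(2)] D[OF that(3)]])
 show "unt L : car L 0"
  unfolding limit_unt by (rule limit_carI) (simp_all add: curved_algebraD(5)[OF alg] trD(3))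
 show "cur L : car L 2"
  unfolding limit_cur by (rule limit_carI) (simp_all add: curved_algebraD(10)[OF alg] trD(5))
 show "mul L (unt L) F = F" if F: "F : car L p"
 proof -
  have "mul L (unt L) F = family I (curry F)"
   unfolding limit_mul limit_unt by (rule family_cong) (simp add: curry_family curved_algebraD(6)[OF alg D[OF F]])
  then show ?thesis using limit_carD(1)[OF F] by simp
 qed
 show "mul L F (unt L) = F" if F: "F : car L p"
 proof -
  have "mul L F (unt L) = family I (curry F)"
   unfolding limit_mul limit_unt by (rule family_cong) (simp add: curry_family curved_algebraD(7)[OF alg D[OF F]])
  then show ?thesis using limit_carD(1)[OF F] by simp
 qed
 show "linear_into (car L n) (car L (n + 1)) (dif L)"
 proof (rule linear_intoI)
  fix v w c assume v: "v : car L n"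
  show "dif L v : car L (n + 1)" by (rule limit_dif_closed[OF v])
  show "dif L (scl c v) = scl c (dif L v)"
   unfolding limit_dif family_scl by (rule family_cong) (simp add: curry_scl dif_scl[OF alg D[OF v]])
  show "dif L (v + w) = dif L v + dif L w" if w: "w : car L n"
   unfolding limit_dif family_plus by (rule family_cong) (simp add: curry_plus dif_add[OF alg D[OF v] D[OF w]])
 qed
 show "dif L (mul L F G) = mul L (dif L F) G + ksign p (mul L F (dif L G))" if "F : car L p" "G : car L q"
  unfolding limit_dif limit_mul family_ksign family_plus
  by (rule family_cong) (simp add: curry_family curved_algebraD(9)[OF alg D[OF that(1)] D[OF that(2)]])
 show "dif L (cur L) = 0"
  unfolding limit_dif limit_cur family_zero[of I, symmetric]
  by (rule family_cong) (simp add: curry_family curved_algebraD(11)[OF alg])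
 show "dif L (dif L F) = mul L (cur L) F - mul L F (cur L)" if "F : car L p"
  unfolding limit_dif limit_mul limit_cur family_diff
  by (rule family_cong) (simp add: curry_family curved_algebraD(12)[OF alg D[OF that]])
qed

end

section \<open>Curved coalgebras and their subcoalgebras\<close>

definition gsum :: "('y, 'k::field) graded => ('y, 'k) graded => ('y, 'k) graded" where
 "gsum D E n = {d + e |d e. d : D n & e : E n}"

lemma gsum_upper:
 assumes "!!n. kvs.subspace (D n)" "!!n. kvs.subspace (E n)"
 shows "D <= gsum D E" "E <= gsum D E"
proof -
 have "d : gsum D E n" if "d : D n" for d n
  unfolding gsum_def using that subspaceD(1)[OF assms(2)] by (intro CollectI exI[of _ d] exI[of _ 0]) simp
 moreover have "d : gsum D E n" if "d : E n" for d n
  unfolding gsum_def using that subspaceD(1)[OF assms(1)] by (intro CollectI exI[of _ 0] exI[of _ d]) simp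
 ultimately show "D <= gsum D E" "E <= gsum D E" by (auto simp: le_fun_def)
qed

lemma tensor_mono:
 assumes "D <= E" "D' <= E'"
 shows "tensor D D' n \<subseteq> tensor E E' n"
 unfolding tensor_def
proof (rule kvs.span_mono, rule subsetI)
 fix t assume "t : {v \<otimes>\<^sub>k w |p q v w. v : D p & w : D' q & p + q = n}"
 then obtain p q v w where "t = v \<otimes>\<^sub>k w" "v : D p" "w : D' q" "p + q = n" by blast
 moreover have "v : E p" "w : E' q" using le_funD[OF assms(1)] le_funD[OF assms(2)] calculation by blast+
 ultimately show "t : {v \<otimes>\<^sub>k w |p q v w. v : E p & w : E' q & p + q = n}" by blast
qed

lemma restr_at: "c : D n ==> restr D \<xi> c = \<xi> c"
 by (auto simp: restr_def homogeneous_def)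

lemma dual_alg_simps [simp]:
 "car (dual_alg C) = dual (ccar C)" "unt (dual_alg C) = counit C" "cur (dual_alg C) = ccur C"
 by (simp_all add: dual_alg_def)

lemma subcoalg_simps [simp]:
 "ccar (subcoalg C D) = D" "comul (subcoalg C D) = comul C" "cdif (subcoalg C D) = cdif C"
 "counit (subcoalg C D) = restr D (counit C)" "ccur (subcoalg C D) = restr D (ccur C)"
 by (simp_all add: subcoalg_def)

lemma dual_mul_apply: "c : ccar C n ==>
  mul (dual_alg C) \<xi> \<zeta> c = tensor_lift (ccar C) (ccar C) (%p q v w. \<xi> v * \<zeta> w) (comul C c)"
 by (simp add: dual_alg_def restr_at)

lemma dual_mul_outside: "c ~: homogeneous (ccar C) ==> mul (dual_alg C) \<xi> \<zeta> c = 0"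
 by (simp add: dual_alg_def restr_def)

lemma dual_dif_apply: "c : ccar C n ==> dif (dual_alg C) \<xi> c = \<xi> (cdif C c)"
 by (simp add: dual_alg_def restr_at)

lemma dual_dif_outside: "c ~: homogeneous (ccar C) ==> dif (dual_alg C) \<xi> c = 0"
 by (simp add: dual_alg_def restr_def)

text \<open>As in \<open>fd_subcoalgs\<close>, but of arbitrary dimension: the lifting starts from
  the image of the morphism and passes through possibly infinite dimensional subcoalgebras.\<close>

definition subcoalgebra :: "('x, 'k::field) curved_coalg => ('x, 'k) graded => bool" where
 "subcoalgebra C D \<longleftrightarrow> (ALL n. kvs.subspace (D n) & D n \<subseteq> ccar C n) &
   (ALL n. ALL c:D n. comul C c : tensor D D n & cdif C c : D (n + 1))"

lemma subcoalgebraD: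
 assumes "subcoalgebra C D"
 shows "!!n. kvs.subspace (D n)" "!!n. D n \<subseteq> ccar C n"
  "!!n c. c : D n ==> comul C c : tensor D D n" "!!n c. c : D n ==> cdif C c : D (n + 1)"
 using assms by (auto simp: subcoalgebra_def)

lemma fd_subcoalgs_iff: "D : fd_subcoalgs C \<longleftrightarrow> subcoalgebra C D & finite_dim D"
 by (auto simp: fd_subcoalgs_def subcoalgebra_def)

definition ann :: "('x, 'k::field) graded => ('x, 'k) graded => ('x => 'k, 'k) graded" where
 "ann V M n = {\<xi> : dual V n. ALL c:M (- n). \<xi> c = 0}"

lemma curved_coalgebraD:
 assumes "curved_coalgebra C"
 shows "graded_space (ccar C)" "!!n. linear_into (ccar C n) (tensor (ccar C) (ccar C) n) (comul C)"
  "!!n. linear_into (ccar C n) (ccar C (n + 1)) (cdif C)" "ccur C : dual (ccar C) 2" "counit C : dual (ccar C) 0"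
  "curved_algebra (dual_alg C)" "pseudocompact_curved_algebra (dual_alg C) (dual_topology C)"
 using assms unfolding curved_coalgebra_def graded_coalgebra_def coderivation_def graded_map_def
  pseudocompact_curved_algebra_def by (auto simp del: dual_alg_simps)

context
 fixes C :: "('x, 'k::field) curved_coalg"
 assumes C: "curved_coalgebra C"
begin

private abbreviation "V1 \<equiv> ccar C"
private abbreviation "R1 \<equiv> dual_alg C"
private lemmas coalg1 = curved_coalgebraD[OF C]
private lemmas graded_V1 = coalg1(1)

lemma subcoalgebra_graded: "subcoalgebra C D ==> graded_space D"
 by (rule graded_subspace[OF graded_V1 subcoalgebraD(1,2)])

text \<open>For \<open>c\<close> in \<open>D\<close> the element \<open>comul C c\<close> has a
  presentation with factors in \<open>D\<close>. The same list of terms computes the lift over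
  \<open>D\<close> and the lift over the whole coalgebra, and on it the functionals agree with their
  restrictions.\<close>

lemma restr_mul:
 assumes D: "subcoalgebra C D" and x: "\<xi> : dual V1 p" and z: "\<zeta> : dual V1 q"
 shows "restr D (mul R1 \<xi> \<zeta>) = mul (dual_alg (subcoalg C D)) (restr D \<xi>) (restr D \<zeta>)"
proof
 fix c
 note DD = subcoalgebraD[OF D] and gD = subcoalgebra_graded[OF D]
 show "restr D (mul R1 \<xi> \<zeta>) c = mul (dual_alg (subcoalg C D)) (restr D \<xi>) (restr D \<zeta>) c"
 proof (cases "c : homogeneous D")
  case True
  then obtain n where c: "c : D n" by (rule homogeneousE)
  obtain ts where ts: "hom_terms D D ts" "comul C c = tens_sum ts"
   using tensor_terms[OF gD DD(3)[OF c]] by metis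
  have ts': "hom_terms V1 V1 ts" using ts(1) DD(2) unfolding hom_terms_def by fastforce
  have "restr D (mul R1 \<xi> \<zeta>) c = term_sum (%p q v w. \<xi> v * \<zeta> w) ts"
   unfolding restr_at[where D = D, OF c] dual_mul_apply[OF subsetD[OF DD(2) c]] ts(2)
   by (rule tensor_lift_sum[OF graded_V1 graded_V1 balanced_dual[OF graded_V1 x z] ts'])
  also have "... = term_sum (%p q v w. restr D \<xi> v * restr D \<zeta> w) ts"
   using ts(1) by (induction ts) (auto simp: restr_at)
  also have "... = mul (dual_alg (subcoalg C D)) (restr D \<xi>) (restr D \<zeta>) c"
   using dual_mul_apply[of c "subcoalg C D" n] c
    tensor_lift_sum[OF gD gD balanced_dual[OF gD restr_dual[where D = D, OF graded_V1 DD(1,2) x] restr_dual[where D = D, OF graded_V1 DD(1,2) z]] ts(1)]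
   by (simp add: ts(2))
  finally show ?thesis .
 qed (use dual_mul_outside[of c "subcoalg C D"] in \<open>simp add: restr_def\<close>)
qed

lemma restr_dif:
 assumes D: "subcoalgebra C D"
 shows "restr D (dif R1 \<xi>) = dif (dual_alg (subcoalg C D)) (restr D \<xi>)"
proof
 fix c
 note DD = subcoalgebraD[OF D]
 show "restr D (dif R1 \<xi>) c = dif (dual_alg (subcoalg C D)) (restr D \<xi>) c"
 proof (cases "c : homogeneous D")
  case True
  then obtain n where c: "c : D n" by (rule homogeneousE)
  then have c': "c : V1 n" using DD(2) by blast
  show ?thesis
   using dual_dif_apply[of c "subcoalg C D" n] c dual_dif_apply[OF c']
   by (simp add: restr_at[where D = D, OF c] restr_at[where D = D, OF DD(4)[OF c]])
 qed (use dual_dif_outside[of c "subcoalg C D"] in \<open>simp add: restr_def\<close>)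
qed

lemma subcoalgebra_dual_algebra:
 assumes D: "subcoalgebra C D"
 shows "curved_algebra (dual_alg (subcoalg C D))"
proof (rule curved_algebra_image[OF coalg1(6), where g = "restr D"])
 note DD = subcoalgebraD[OF D]
 show "graded_space (car (dual_alg (subcoalg C D)))"
  using graded_space_dual[OF subcoalgebra_graded[OF D]] by simp
 show "linear_into (car R1 n) (car (dual_alg (subcoalg C D)) n) (restr D)" for n
  using linear_into_restr[where D = D, OF graded_V1 DD(1,2)] by simp
 show "restr D ` car R1 n = car (dual_alg (subcoalg C D)) n" for n
  using restr_surj[where D = D, OF graded_V1 DD(1,2)] by simp
qed (use restr_mul[OF D] restr_dif[OF D] in simp_all)

lemma restr_hom:
 assumes D: "subcoalgebra C D"
 shows "curved_hom R1 (dual_alg (subcoalg C D)) (restr D) 0"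
 using linear_into_restr[where D = D, OF graded_V1 subcoalgebraD(1,2)[OF D]] restr_mul[OF D] restr_dif[OF D]
 by (intro curved_hom_strictI[OF subcoalgebra_dual_algebra[OF D]]) simp_all

lemma restr_sub_surj:
 assumes D: "subcoalgebra C D"
 shows "restr D ` car R1 n = car (dual_alg (subcoalg C D)) n"
 using restr_surj[where D = D, OF graded_V1 subcoalgebraD(1,2)[OF D]] by simp

lemma restr_hom_sub:
 assumes D: "subcoalgebra C D" and E: "subcoalgebra C E" and le: "D <= E"
 shows "curved_hom (dual_alg (subcoalg C E)) (dual_alg (subcoalg C D)) (restr D) 0"
proof (rule curved_hom_factor[OF subcoalgebra_dual_algebra[OF E] restr_hom[OF E] restr_sub_surj[OF E] restr_hom[OF D] _ _ coalg1(6)])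
 show "linear_into (car (dual_alg (subcoalg C E)) n) (car (dual_alg (subcoalg C D)) n) (restr D)" for n
  using linear_into_restr[where D = D, OF subcoalgebra_graded[OF E] subcoalgebraD(1)[OF D]] le by (simp add: le_fun_def)
qed (simp add: restr_restr[OF le])

lemma perp_subcoalgebra:
 assumes K: "!!n. K n \<subseteq> dual V1 n"
  and l: "!!p q \<xi> \<zeta>. \<xi> : K p ==> \<zeta> : dual V1 q ==> mul R1 \<xi> \<zeta> : K (p + q)"
  and r: "!!p q \<xi> \<zeta>. \<xi> : dual V1 p ==> \<zeta> : K q ==> mul R1 \<xi> \<zeta> : K (p + q)"
  and d: "!!p \<xi>. \<xi> : K p ==> dif R1 \<xi> : K (p + 1)"
 shows "subcoalgebra C (perp V1 K)"
 unfolding subcoalgebra_def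
proof (intro conjI allI ballI perp_subspace[OF graded_V1 K] perp_subset)
 fix n c assume c: "c : perp V1 K n"
 then have cV: "c : V1 n" using perp_subset by blast
 have z: "tensor_lift V1 V1 (%p q v w. \<xi> v * \<zeta> w) (comul C c) = 0" if "mul R1 \<xi> \<zeta> : K m" for \<xi> \<zeta> m
 proof (cases "m = - n")
  case True
  then show ?thesis using c that by (simp add: perp_def dual_mul_apply[OF cV, symmetric])
 next
  case False
  then have "mul R1 \<xi> \<zeta> c = 0" using that K by (intro dual_other[OF graded_V1 _ cV, of _ m]) auto
  then show ?thesis by (simp add: dual_mul_apply[OF cV])
 qed
 show "comul C c : tensor (perp V1 K) (perp V1 K) n"
  by (rule tensor_perp[OF graded_V1 K linear_intoD(1)[OF coalg1(2) cV]]) (rule z, (rule l r), assumption+)+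
 have "\<xi> (cdif C c) = 0" if "\<xi> : K (- (n + 1))" for \<xi>
 proof -
  have "dif R1 \<xi> : K (- n)" using d[OF that] by simp
  then have "dif R1 \<xi> c = 0" using c by (auto simp: perp_def)
  then show ?thesis by (simp add: dual_dif_apply[OF cV])
 qed
 then show "cdif C c : perp V1 K (n + 1)"
  using linear_intoD(1)[OF coalg1(3) cV] by (auto simp: perp_def)
qed

lemma ann_iff: "subcoalgebra C M ==> \<xi> : ann V1 M n \<longleftrightarrow> \<xi> : dual V1 n & restr M \<xi> = 0"
proof -
 assume M: "subcoalgebra C M"
 show ?thesis
 proof
  assume x: "\<xi> : ann V1 M n"
  then have x': "\<xi> : dual V1 n" by (simp add: ann_def)
  have "restr M \<xi> c = 0" for c
  proof (cases "c : homogeneous M")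
   case True
   then obtain m where c: "c : M m" by (rule homogeneousE)
   then have "\<xi> c = 0"
    using x dual_other[OF graded_V1 x', of c m] subcoalgebraD(2)[OF M] by (cases "m = - n") (auto simp: ann_def)
   then show ?thesis by (simp add: restr_def)
  qed (simp add: restr_def)
  then show "\<xi> : dual V1 n & restr M \<xi> = 0" using x' by (auto simp: fun_eq_iff pointwise)
 next
  assume x: "\<xi> : dual V1 n & restr M \<xi> = 0"
  have "\<xi> c = 0" if "c : M (- n)" for c
   using restr_at[where D = M, OF that, of \<xi>] x by (simp add: pointwise)
  then show "\<xi> : ann V1 M n" using x by (simp add: ann_def)
 qed
qed

lemma ann_ideal:
 assumes M: "subcoalgebra C M"
 shows "!!n. ann V1 M n \<subseteq> dual V1 n" "!!n. kvs.subspace (ann V1 M n)"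
  "!!p q \<xi> \<zeta>. \<xi> : ann V1 M p ==> \<zeta> : dual V1 q ==> mul R1 \<xi> \<zeta> : ann V1 M (p + q)"
  "!!p q \<xi> \<zeta>. \<xi> : dual V1 p ==> \<zeta> : ann V1 M q ==> mul R1 \<xi> \<zeta> : ann V1 M (p + q)"
  "!!p \<xi>. \<xi> : ann V1 M p ==> dif R1 \<xi> : ann V1 M (p + 1)"
proof -
 note iff = ann_iff[OF M] and S = subcoalgebra_dual_algebra[OF M] and rd = restr_dual[where D = M, OF graded_V1 subcoalgebraD(1,2)[OF M]]
 note lin = linear_intoD[OF linear_into_restr[where D = M, OF graded_V1 subcoalgebraD(1,2)[OF M]]]
 fix n p q :: int and \<xi> \<zeta>
 note sd = subspaceD[OF dual_subspace[OF graded_V1, of n]]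
 show "ann V1 M n \<subseteq> dual V1 n" by (auto simp: ann_def)
 show "kvs.subspace (ann V1 M n)"
  unfolding kvs.subspace_def
  using sd(1,2,3) lin(2,3)[of _ n] by (auto simp: iff restr_zero)
 show "mul R1 \<xi> \<zeta> : ann V1 M (p + q)" if "\<xi> : ann V1 M p" "\<zeta> : dual V1 q"
  using that mul_closed[OF coalg1(6), of \<xi> p \<zeta> q] restr_mul[OF M, of \<xi> p \<zeta> q] mul_zero_left[OF S, of "restr M \<zeta>" q] rd[of \<zeta> q]
  by (simp add: iff)
 show "mul R1 \<xi> \<zeta> : ann V1 M (p + q)" if "\<xi> : dual V1 p" "\<zeta> : ann V1 M q"
  using that mul_closed[OF coalg1(6), of \<xi> p \<zeta> q] restr_mul[OF M, of \<xi> p \<zeta> q] mul_zero_right[OF S, of "restr M \<xi>" p] rd[of \<xi> p]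
  by (simp add: iff)
 show "dif R1 \<xi> : ann V1 M (p + 1)" if "\<xi> : ann V1 M p"
  using that dif_closed[OF coalg1(6), of \<xi> p] restr_dif[OF M, of \<xi>] dif_zero[OF S] by (simp add: iff)
qed

text \<open>Functionals separate a vector from a subspace, so nothing outside \<open>M\<close> is
  killed by all of \<open>ann\<close>. Passing to annihilators loses nothing on the side of the
  coalgebra.\<close>

lemma perp_ann:
 assumes M: "!!n. kvs.subspace (M n)" "!!n. M n \<subseteq> V1 n"
 shows "perp V1 (ann V1 M) = M"
proof
 fix m
 show "perp V1 (ann V1 M) m = M m"
 proof
  show "M m \<subseteq> perp V1 (ann V1 M) m" using M(2) by (auto simp: perp_def ann_def)
  show "perp V1 (ann V1 M) m \<subseteq> M m"
  proof (rule subsetI, rule ccontr)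
   fix c assume c: "c : perp V1 (ann V1 M) m" "c ~: M m"
   then obtain \<xi> where x: "\<xi> : dual V1 (- m)" "!!s. s : M m ==> \<xi> s = 0" "\<xi> c = 1"
    using dual_separates[OF graded_V1 M(1,2) _ c(2)] perp_subset by (metis subsetD)
   then show False using c(1) by (auto simp: perp_def ann_def)
  qed
 qed
qed

text \<open>Instead of intersecting tensor products, the intersection is recognized as what is
  killed by the union of the two annihilating ideals.\<close>

lemma subcoalgebra_Int:
 assumes M: "subcoalgebra C M" and N: "subcoalgebra C N"
 shows "subcoalgebra C (%n. M n \<inter> N n)"
proof -
 let ?K = "%n. ann V1 M n \<union> ann V1 N n"
 have "subcoalgebra C (perp V1 ?K)"
 proof (rule perp_subcoalgebra)
  show "?K n \<subseteq> dual V1 n" for n using ann_ideal(1)[OF M] ann_ideal(1)[OF N] by simp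
  show "mul R1 \<xi> \<zeta> : ?K (p + q)" if "\<xi> : ?K p" "\<zeta> : dual V1 q" for p q \<xi> \<zeta>
   using that(1) ann_ideal(3)[OF M _ that(2)] ann_ideal(3)[OF N _ that(2)] by auto
  show "mul R1 \<xi> \<zeta> : ?K (p + q)" if "\<xi> : dual V1 p" "\<zeta> : ?K q" for p q \<xi> \<zeta>
   using that(2) ann_ideal(4)[OF M that(1)] ann_ideal(4)[OF N that(1)] by auto
  show "dif R1 \<xi> : ?K (p + 1)" if "\<xi> : ?K p" for p \<xi>
   using that ann_ideal(5)[OF M] ann_ideal(5)[OF N] by auto
 qed
 moreover have "perp V1 ?K m = M m \<inter> N m" for m
 proof -
  have "perp V1 ?K m = perp V1 (ann V1 M) m \<inter> perp V1 (ann V1 N) m"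
   by (auto simp: perp_def)
  then show ?thesis
   using fun_cong[OF perp_ann[of M, OF subcoalgebraD(1,2)[OF M]], of m]
    fun_cong[OF perp_ann[of N, OF subcoalgebraD(1,2)[OF N]], of m] by simp
 qed
 then have "perp V1 ?K = (%n. M n \<inter> N n)" by (rule ext)
 ultimately show ?thesis by simp
qed

lemma subcoalgebra_sum:
 assumes M: "subcoalgebra C M" and N: "subcoalgebra C N"
 shows "subcoalgebra C (gsum M N)"
 unfolding subcoalgebra_def
proof (intro conjI allI ballI)
 note MD = subcoalgebraD[OF M] and ND = subcoalgebraD[OF N]
 have up: "M <= gsum M N" "N <= gsum M N" using gsum_upper[of M N] MD(1) ND(1) by auto
 fix n
 show sub: "kvs.subspace (gsum M N n)" for n unfolding gsum_def by (rule kvs.subspace_sums[OF MD(1) ND(1)])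
 show "gsum M N n \<subseteq> V1 n"
  unfolding gsum_def using MD(2) ND(2) subspaceD(2)[OF graded_spaceD(1)[OF graded_V1]] by blast
 fix c assume "c : gsum M N n"
 then obtain a b where c: "c = a + b" "a : M n" "b : N n" by (auto simp: gsum_def)
 have "comul C a : tensor (gsum M N) (gsum M N) n" "comul C b : tensor (gsum M N) (gsum M N) n"
  using tensor_mono[OF up(1) up(1)] tensor_mono[OF up(2) up(2)] MD(3)[OF c(2)] ND(3)[OF c(3)] by blast+
 moreover have "comul C c = comul C a + comul C b"
  unfolding c(1) using c MD(2) ND(2) by (intro linear_intoD(3)[OF coalg1(2)]) auto
 ultimately show "comul C c : tensor (gsum M N) (gsum M N) n" by simp
 have "cdif C c = cdif C a + cdif C b"
  unfolding c(1) using c MD(2) ND(2) by (intro linear_intoD(3)[OF coalg1(3)]) auto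
 then show "cdif C c : gsum M N (n + 1)"
  using MD(4)[OF c(2)] ND(4)[OF c(3)] by (auto simp: gsum_def)
qed

lemma fd_directed:
 assumes "D : fd_subcoalgs C" "E : fd_subcoalgs C"
 obtains F where "F : fd_subcoalgs C" "D <= F" "E <= F"
proof -
 have D: "subcoalgebra C D" "finite_dim D" and E: "subcoalgebra C E" "finite_dim E"
  using assms by (auto simp: fd_subcoalgs_iff)
 obtain S T where ST: "finite S" "!!n. D n \<subseteq> kvs.span S" "finite T" "!!n. E n \<subseteq> kvs.span T"
  using D(2) E(2) unfolding finite_dim_def by auto
 have "gsum D E n \<subseteq> kvs.span (S \<union> T)" for n
  using ST(2)[of n] ST(4)[of n] kvs.span_mono[of S "S \<union> T"] kvs.span_mono[of T "S \<union> T"]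
  by (auto simp: gsum_def subset_iff intro!: kvs.span_add)
 then have "finite_dim (gsum D E)" unfolding finite_dim_def using ST(1,3) by blast
 then show thesis
  using that[of "gsum D E"] subcoalgebra_sum[OF D(1) E(1)] gsum_upper[of D E, OF subcoalgebraD(1)[OF D(1)] subcoalgebraD(1)[OF E(1)]]
  by (simp add: fd_subcoalgs_iff)
qed

end

section \<open>Consequences of the topology\<close>

lemma linear_into_image_subspace:
 assumes f: "linear_into U W f" and U: "kvs.subspace U"
 shows "kvs.subspace (f ` U)"
 unfolding kvs.subspace_def
proof (intro conjI ballI allI)
 note fD = linear_intoD[OF f] and UD = subspaceD[OF U]
 show "0 : f ` U" using linear_into_simps(1)[OF f U] UD(1) by (metis imageI)
 show "x + y : f ` U" if "x : f ` U" "y : f ` U" for x y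
  using that fD(3) UD(2) by (metis (no_types, lifting) imageE imageI)
 show "scl c x : f ` U" if "x : f ` U" for c x
  using that fD(2) UD(3) by (metis (no_types, lifting) imageE imageI)
qed

text \<open>Elimination of one functional at a time: on the kernel of \<open>l q\<close> the
  remaining ones suffice, and one vector \<open>u\<close> with \<open>l q u\<close> = 1 determines
  the coefficient of \<open>l q\<close>.\<close>

lemma functional_combination:
 fixes U :: "('z => 'k::field) set" and l :: "'q => ('z => 'k) => 'k"
 assumes "finite Q" "kvs.subspace U"
  and l: "!!q u v. u : U ==> v : U ==> l q (u + v) = l q u + l q v" "!!q u c. u : U ==> l q (scl c u) = c * l q u"
  and L: "!!u v. u : U ==> v : U ==> L (u + v) = L u + L v" "!!u c. u : U ==> L (scl c u) = c * L u"
  and zero: "!!u. u : U ==> (!!q. q : Q ==> l q u = 0) ==> L u = 0"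
 shows "EX r. ALL u:U. L u = (\<Sum>q\<in>Q. r q * l q u)"
 using assms
proof (induction Q arbitrary: U rule: finite_induct)
 case empty
 then show ?case by simp
next
 case (insert q Q)
 note U = subspaceD[OF insert.prems(1)] and lq = insert.prems(2,3) and LL = insert.prems(4,5)
 let ?U = "{u : U. l q u = 0}"
 have l0: "l q 0 = 0" using lq(2)[OF U(1), of q 0] by simp
 have "kvs.subspace ?U"
  using U(1-3) l0 by (auto simp: kvs.subspace_def lq)
 moreover have "L u = 0" if "u : ?U" "!!q'. q' : Q ==> l q' u = 0" for u
  using that by (intro insert.prems(6)) auto
 ultimately have "EX r. ALL u:?U. L u = (\<Sum>q\<in>Q. r q * l q u)"
  using lq LL by (intro insert.IH) auto
 then obtain r where r: "!!u. u : ?U ==> L u = (\<Sum>q\<in>Q. r q * l q u)" by blast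
 show ?case
 proof (cases "ALL u:U. l q u = 0")
  case True
  then have "ALL u:U. L u = (\<Sum>x\<in>insert q Q. r x * l x u)"
   using r insert.hyps by simp
  then show ?thesis by blast
 next
  case False
  then obtain w where w: "w : U" "l q w ~= 0" by blast
  define u where "u = scl (1 / l q w) w"
  have u: "u : U" "l q u = 1" using w U(3) lq(2) by (auto simp: u_def)
  \<comment> \<open>The coefficient of \<open>l q\<close> is what the combination of the other
    functionals misses at \<open>u\<close>.\<close>
  define s where "s = L u - (\<Sum>x\<in>Q. r x * l x u)"
  have "L v = (\<Sum>x\<in>insert q Q. (r(q := s)) x * l x v)" if v: "v : U" for v
  proof -
   let ?c = "- l q v"
   have cu: "scl ?c u : U" by (rule U(3)[OF u(1)])
   have "l q (v + scl ?c u) = 0"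
    unfolding lq(1)[OF v cu] lq(2)[OF u(1)] u(2) by simp
   then have mem: "v + scl ?c u : ?U" using U(2)[OF v cu] by simp
   have "L v + ?c * L u = (\<Sum>x\<in>Q. r x * (l x v + ?c * l x u))"
    using r[OF mem] unfolding lq(1)[OF v cu] lq(2)[OF u(1)] LL(1)[OF v cu] LL(2)[OF u(1)] .
   also have "... = (\<Sum>x\<in>Q. r x * l x v) + ?c * (\<Sum>x\<in>Q. r x * l x u)"
    by (simp add: sum_distrib_left sum.distrib[symmetric] algebra_simps)
   finally have "L v = l q v * s + (\<Sum>x\<in>Q. r x * l x v)"
    by (simp add: s_def algebra_simps)
   moreover have "(\<Sum>x\<in>Q. (r(q := s)) x * l x v) = (\<Sum>x\<in>Q. r x * l x v)"
    using insert.hyps by (intro sum.cong) auto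
   ultimately show ?thesis using insert.hyps by simp
  qed
  then show ?thesis by blast
 qed
qed

lemma nonzero_element: "S ~= {0} ==> 0 : S ==> EX c:S. c ~= 0"
 by blast

lemma finite_support_sum:
 fixes g :: "'x => 'k::field"
 assumes "finite B" "!!b. b ~: B ==> g b = 0"
 shows "g = (\<Sum>b\<in>B. scl (g b) (%b'. if b' = b then 1 else 0))"
proof
 fix x
 have "(\<Sum>b\<in>B. scl (g b) (%b'. if b' = b then 1 else 0)) x = (\<Sum>b\<in>B. if x = b then g b else 0)"
  unfolding sum_fun by (rule sum.cong) (auto simp: scl_def)
 then show "g x = (\<Sum>b\<in>B. scl (g b) (%b'. if b' = b then 1 else 0)) x"
  using assms by (simp add: sum.delta)
qed

lemma product_neighbourhood:
 assumes "openin (product_topology X I) U" "u : U"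
 obtains W where "finite {i : I. W i ~= topspace (X i)}" "u : Pi\<^sub>E I W" "Pi\<^sub>E I W \<subseteq> U"
proof -
 have "EX W. finite {i : I. W i ~= topspace (X i)} & (ALL i:I. openin (X i) (W i)) & u : Pi\<^sub>E I W & Pi\<^sub>E I W \<subseteq> U"
  by (rule bspec[OF assms(1)[unfolded openin_product_topology_alt] assms(2)])
 then show thesis using that by blast
qed

lemma openin_evaluation: "openin (product_topology (%_. discrete_topology UNIV) UNIV) {g. g c : S}"
proof -
 let ?T = "product_topology (%_. discrete_topology UNIV) UNIV"
 have "continuous_map ?T (discrete_topology UNIV) (%g. g c)"
  by (rule continuous_map_product_projection[of c UNIV "%_. discrete_topology UNIV"]) simp
 then have "openin ?T {g : topspace ?T. g c : S}"
  by (rule openin_continuous_map_preimage) simp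
 then show ?thesis by (simp add: PiE_UNIV_domain)
qed

lemma openin_dual_topology: "openin (dual_topology C n) {\<xi> : dual (ccar C) n. \<xi> c = 0}"
proof -
 have "{\<xi> : dual (ccar C) n. \<xi> c = 0} = {g. g c : {0}} \<inter> dual (ccar C) n" by auto
 then show ?thesis
  unfolding dual_topology_def openin_subtopology using openin_evaluation[of c "{0}"] by (intro exI conjI)
qed

lemma topspace_dual_topology: "topspace (dual_topology C n) = dual (ccar C) n"
 by (simp add: dual_topology_def)

context
 fixes C :: "('x, 'k::field) curved_coalg"
 assumes C: "curved_coalgebra C"
begin

private abbreviation "V4 \<equiv> ccar C"
private abbreviation "R4 \<equiv> dual_alg C"
private lemmas coalg4 = curved_coalgebraD[OF C]
private lemmas graded_V4 = coalg4(1)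

text \<open>The annihilator of the kernel of \<open>F\<close> is paired without degeneration with
  the image of \<open>F\<close> in the finite dimensional \<open>W\<close>. So its components are
  finite dimensional, and they are nonzero only opposite to nonzero degrees of
  \<open>W\<close>.\<close>

lemma finite_dim_perp:
 fixes F :: "(('x => 'k) => 'k) => 'y => 'k" and W :: "('y, 'k) graded"
 assumes W: "graded_space W" "finite_dim W" and F: "!!n. linear_into (dual V4 n) (W n) F"
 shows "finite_dim (perp V4 (%n. {\<xi> : dual V4 n. F \<xi> = 0}))" (is "finite_dim (perp V4 ?K)")
proof (rule finite_dimI)
 let ?D = "perp V4 ?K"
 have K: "?K n \<subseteq> dual V4 n" for n by auto
 have sub: "kvs.subspace (?D m)" for m by (rule perp_subspace[OF graded_V4 K])
 have "- m : {n. W n ~= {0}}" if ne: "?D m ~= {0}" for m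
 proof -
  obtain c where c: "c : ?D m" "c ~= 0" using nonzero_element[OF ne subspaceD(1)[OF sub[of m]]] by (elim bexE) (rule that)
  then obtain \<xi> where x: "\<xi> : dual V4 (- m)" "\<xi> c ~= 0"
   using dual_separates_zero[OF graded_V4, of c m] c(1) perp_subset[of V4 ?K m] by (meson subsetD)
  then have "F \<xi> ~= 0" using c(1) by (auto simp: perp_def)
  then show ?thesis using linear_intoD(1)[OF F x(1)] by auto
 qed
 then have "{m. ?D m ~= {0}} \<subseteq> uminus ` {n. W n ~= {0}}"
  by (intro subsetI) (rule image_eqI[where x = "- _"], rule minus_minus[symmetric], simp)
 then show "finite {m. ?D m ~= {0}}"
  using finite_degrees[OF W] finite_subset by blast
 fix m
 obtain S where S: "finite S" "!!n. W n \<subseteq> kvs.span S" using W(2) by (auto simp: finite_dim_def)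
 note FD = linear_intoD[OF F] and sd = subspaceD[OF dual_subspace[OF graded_V4, of "- m"]]
 have F0: "F 0 = 0" by (rule linear_into_simps(1)[OF F dual_subspace[OF graded_V4]])
 have subF: "kvs.subspace (F ` dual V4 (- m))" by (rule linear_into_image_subspace[OF F dual_subspace[OF graded_V4]])
 have "F ` dual V4 (- m) \<subseteq> kvs.span S" using FD(1) S(2) by blast
 then obtain B where B: "finite B" "B \<subseteq> F ` dual V4 (- m)" "kvs.span B = F ` dual V4 (- m)"
  by (rule finite_basis[OF S(1) _ subF]) (rule that)
 obtain g where g: "!!b. b : B ==> g b : dual V4 (- m)" "!!b. b : B ==> F (g b) = b"
 proof (rule that[of "inv_into (dual V4 (- m)) F"])
  fix b assume "b : B"
  then have "b : F ` dual V4 (- m)" using B(2) by blast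
  then show "inv_into (dual V4 (- m)) F b : dual V4 (- m)" "F (inv_into (dual V4 (- m)) F b) = b"
   by (rule inv_into_into, rule f_inv_into_f)
 qed
 have comb: "EX r. F \<xi> = F (\<Sum>b\<in>B. scl (r b) (g b))" if x: "\<xi> : dual V4 (- m)" for \<xi>
 proof -
  have "F \<xi> : kvs.span B" using B(3) x by blast
  then obtain r where r: "F \<xi> = (\<Sum>b\<in>B. scl (r b) b)"
   unfolding kvs.span_finite[OF B(1)] by (elim rangeE) (rule that)
  have "F (\<Sum>b\<in>B. scl (r b) (g b)) = (\<Sum>b\<in>B. scl (r b) (F (g b)))"
   by (rule linear_into_sum[OF F dual_subspace[OF graded_V4] g(1)])
  also have "... = (\<Sum>b\<in>B. scl (r b) b)" by (rule sum.cong) (simp_all add: g(2))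
  finally show ?thesis using r by (intro exI[of _ r]) simp
 qed
 obtain p where p: "!!v w. p (v + w) = p v + p w" "!!c v. p (scl c v) = scl c (p v)"
  "!!v. p v : ?D m" "!!v. v : ?D m ==> p v = v"
  by (rule projection_exists[OF sub[of m]]) (rule that)
 \<comment> \<open>\<Phi> evaluates finitely many functionals whose images span the image of
   \<open>F\<close>. Every functional is a combination of them up to the kernel of \<open>F\<close>,
   which makes \<Phi> injective on the annihilator. The projection \<open>p\<close> makes it linear
   on the whole function space.\<close>
 define \<Phi> where "\<Phi> v = (%b. if b : B then g b (p v) else 0)" for v
 have pV: "p v : V4 m" for v using p(3) perp_subset by blast
 have lin: "Vector_Spaces.linear scl scl \<Phi>"
 proof (rule Vector_Spaces.linear.intro)
  show "module_hom scl scl \<Phi>"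
   unfolding module_hom_def module_hom_axioms_def
   using dual_add[OF graded_V4 g(1) pV pV] dual_scl[OF graded_V4 g(1) pV]
   by (auto simp: \<Phi>_def fun_eq_iff pointwise p scl_def[of _ "%b. if b : B then _ b else _"] kvs.module_axioms)
 qed (rule kvs.vector_space_axioms)+
 have inj: "v = 0" if v: "v : ?D m" "\<Phi> v = 0" for v
 proof (rule dual_separates_zero[OF graded_V4, of v m])
  show vV: "v : V4 m" using v(1) perp_subset by blast
  fix \<xi> assume x: "\<xi> : dual V4 (- m)"
  then obtain r where r: "F \<xi> = F (\<Sum>b\<in>B. scl (r b) (g b))" using comb by blast
  let ?s = "\<Sum>b\<in>B. scl (r b) (g b)"
  have s: "?s : dual V4 (- m)"
   using g(1) by (intro kvs.subspace_sum[OF dual_subspace[OF graded_V4]]) (auto intro: sd(3))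
  have "F (\<xi> - ?s) = 0" using linear_into_simps(3)[OF F dual_subspace[OF graded_V4] x s] r by simp
  then have "(\<xi> - ?s) v = 0" using v(1) sd(5)[OF x s] by (auto simp: perp_def)
  moreover have "g b v = 0" if "b : B" for b
   using fun_cong[OF v(2), of b] that p(4)[OF v(1)] by (simp add: \<Phi>_def pointwise)
  ultimately show "\<xi> v = 0" by (simp add: pointwise sum_fun scl_def)
 qed
 obtain Bs where Bs: "Bs \<subseteq> ?D m" "kvs.independent Bs" "?D m \<subseteq> kvs.span Bs"
  by (rule kvs.basis_exists[of "?D m"]) (rule that)
 have sp: "kvs.span Bs \<subseteq> ?D m" by (rule kvs.span_minimal[OF Bs(1) sub])
 have inj_on: "inj_on \<Phi> (kvs.span Bs)"
 proof (rule inj_onI)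
  fix v w assume vw: "v : kvs.span Bs" "w : kvs.span Bs" "\<Phi> v = \<Phi> w"
  have "\<Phi> (v - w) = 0" using kvp.linear_diff[OF lin, of v w] vw(3) by simp
  moreover have "v - w : ?D m" by (rule subspaceD(5)[OF sub subsetD[OF sp vw(1)] subsetD[OF sp vw(2)]])
  ultimately have "v - w = 0" using inj by blast
  then show "v = w" by simp
 qed
 have "kvs.independent (\<Phi> ` Bs)"
  by (rule kvp.linear_independent_injective_image[OF lin Bs(2) inj_on])
 moreover have "\<Phi> v : kvs.span ((%b b'. if b' = b then 1 else 0) ` B)" for v
 proof -
  have "\<Phi> v = (\<Sum>b\<in>B. scl (\<Phi> v b) (%b'. if b' = b then 1 else 0))"
   by (rule finite_support_sum[OF B(1)]) (simp add: \<Phi>_def)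
  then show ?thesis
   by (metis (no_types, lifting) kvs.span_sum kvs.span_scale kvs.span_base imageI)
 qed
 ultimately have "finite (\<Phi> ` Bs)"
  using kvs.independent_span_bound[of "(%b b'. if b' = b then 1 else 0) ` B" "\<Phi> ` Bs"] B(1) by blast
 then have "finite Bs"
  using finite_imageD inj_on inj_on_subset kvs.span_superset by metis
 then show "EX S. finite S & ?D m \<subseteq> kvs.span S" using Bs(3) by blast
qed

text \<open>
 The fundamental theorem on coalgebras for curved coalgebras: the kernels of the projections of the
 pseudocompact dual onto its finite dimensional quotients have finite dimensional annihilators, and
 the functionals vanishing at \<open>c\<close> form a neighbourhood of \<open>0\<close>, which contains such a kernel.
\<close>

lemma fd_subcoalg_exists:
 assumes c: "c : V4 m"
 obtains D where "D : fd_subcoalgs C" "c : D m"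
proof -
 obtain I :: "(int => (('x => 'k) => 'k) set) set" and le and alg :: "_ => (nat, 'k) curved_alg" and tr \<theta>
  where sys: "inverse_system I le alg tr" and fd: "!!i. i : I ==> finite_dim (car (alg i))"
   and hom: "curved_hom R4 (limit_alg I le alg tr) \<theta> 0"
   and T: "!!n. dual_topology C n = pullback_topology (car R4 n) (%b. restrict (curry (\<theta> b)) I)
           (product_topology (%i. discrete_topology (car (alg i) n)) I)"
  using coalg4(7) unfolding pseudocompact_curved_algebra_def by blast
 let ?L = "limit_alg I le alg tr"
 have alg: "!!i. i : I ==> curved_algebra (alg i)"
  and tr: "!!i j. i : I ==> j : I ==> le i j ==> curved_hom (alg j) (alg i) (tr i j) 0"
  and dir: "!!i j. i : I ==> j : I ==> EX l:I. le i l & le j l" and ne: "I ~= {}"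
  and refl: "!!i. i : I ==> le i i"
  and trans: "!!i j l. i : I ==> j : I ==> l : I ==> le i j ==> le j l ==> le i l"
  using sys unfolding inverse_system_def by blast+
 have L: "curved_algebra ?L" by (intro curved_algebra_limit alg tr)
 have limD2: "curry F i : car (alg i) n" if "F : car ?L n" "i : I" for F i n
  by (intro limit_carD(2)[where I = I and le = le and alg = alg and tr = tr] alg tr that)
 have limD3: "tr i j (curry F j) = curry F i" if "F : car ?L n" "i : I" "j : I" "le i j" for F i j n
  by (rule limit_carD(3)[where I = I and le = le and alg = alg and tr = tr]) (rule alg tr that; assumption?)+
 note hD = curved_homD[OF hom, unfolded dual_alg_simps] and hs = curved_hom_strictD[OF L hom, unfolded dual_alg_simps]
 have lim_mul: "mul ?L F G = family I (%i. mul (alg i) (curry F i) (curry G i))"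
  and lim_dif: "dif ?L F = family I (%i. dif (alg i) (curry F i))" for F G
  by (simp_all add: limit_alg_def)
 have comp: "curry (\<theta> \<xi>) i : car (alg i) n" if "\<xi> : dual V4 n" "i : I" for \<xi> i n
  by (rule limD2[OF hD(7)[OF that(1)] that(2)])
 have upper: "EX j:I. ALL i:J. le i j" if "finite J" "J \<subseteq> I" for J
  using that
 proof (induction J rule: finite_induct)
  case empty
  then show ?case using ne by auto
 next
  case (insert i J)
  then obtain j where j: "j : I" "ALL i:J. le i j" by auto
  then obtain l where "l : I" "le i l" "le j l" using dir[of i j] insert.prems by auto
  then show ?case using j trans insert.prems by blast
 qed
 let ?O = "{\<xi> : dual V4 (- m). \<xi> c = 0}"
 let ?f = "%b. restrict (curry (\<theta> b)) I"
 have "openin (pullback_topology (car R4 (- m)) ?f (product_topology (%i. discrete_topology (car (alg i) (- m))) I)) ?O"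
  using openin_dual_topology[of C "- m" c] T by simp
 then obtain U where U: "openin (product_topology (%i. discrete_topology (car (alg i) (- m))) I) U"
  and O: "?O = ?f -` U \<inter> dual V4 (- m)"
  unfolding openin_pullback_topology by auto
 have z: "0 : dual V4 (- m)" using subspaceD(1)[OF dual_subspace[OF graded_V4]] .
 have "?f 0 : U" using O z by (auto simp: pointwise)
 obtain W where W: "finite {i : I. W i ~= topspace (discrete_topology (car (alg i) (- m)))}" "?f 0 : Pi\<^sub>E I W" "Pi\<^sub>E I W \<subseteq> U"
  by (rule product_neighbourhood[OF U \<open>?f 0 : U\<close>]) (rule that)
 \<comment> \<open>A basic neighbourhood constrains finitely many coordinates. One index
   \<open>j\<close> lies above all of them, and since the transition maps are linear, a vanishing
   coordinate at \<open>j\<close> forces those coordinates to vanish.\<close>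
 obtain j where j: "j : I" "ALL i:{i : I. W i ~= topspace (discrete_topology (car (alg i) (- m)))}. le i j"
  using upper[OF W(1)] by auto
 let ?K = "%n. {\<xi> : dual V4 n. curry (\<theta> \<xi>) j = 0}"
 let ?D = "perp V4 ?K"
 have lin: "linear_into (dual V4 n) (car (alg j) n) (%\<xi>. curry (\<theta> \<xi>) j)" for n
  using linear_intoD(2,3)[OF hD(1)] comp[OF _ j(1)] by (intro linear_intoI) (auto simp: curry_scl curry_plus)
 have "subcoalgebra C ?D"
 proof (rule perp_subcoalgebra[OF C])
  show "?K n \<subseteq> dual V4 n" for n by auto
  have m: "curry (\<theta> (mul R4 \<xi> \<zeta>)) j = mul (alg j) (curry (\<theta> \<xi>) j) (curry (\<theta> \<zeta>) j)"
   if "\<xi> : dual V4 p" "\<zeta> : dual V4 q" for \<xi> \<zeta> p q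
   using hD(2)[OF that] curry_family[OF j(1)] by (simp add: lim_mul)
  show "mul R4 \<xi> \<zeta> : ?K (p + q)" if "\<xi> : ?K p" "\<zeta> : dual V4 q" for p q \<xi> \<zeta>
   using that m[of \<xi> p \<zeta> q] mul_closed[OF coalg4(6), of \<xi> p \<zeta> q] mul_zero_left[OF alg[OF j(1)] comp[OF that(2) j(1)]] by simp
  show "mul R4 \<xi> \<zeta> : ?K (p + q)" if "\<xi> : dual V4 p" "\<zeta> : ?K q" for p q \<xi> \<zeta>
   using that m[of \<xi> p \<zeta> q] mul_closed[OF coalg4(6), of \<xi> p \<zeta> q] mul_zero_right[OF alg[OF j(1)] comp[OF that(1) j(1)]] by simp
  show "dif R4 \<xi> : ?K (p + 1)" if "\<xi> : ?K p" for p \<xi>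
   using that hs(1)[of \<xi> p] dif_closed[OF coalg4(6), of \<xi> p] dif_zero[OF alg[OF j(1)]]
   by (simp add: lim_dif curry_family[OF j(1)])
 qed
 moreover have "finite_dim ?D"
  by (rule finite_dim_perp[OF curved_algebraD(1)[OF alg[OF j(1)]] fd[OF j(1)] lin])
 moreover have "c : ?D m"
 proof -
  have "\<xi> c = 0" if x: "\<xi> : dual V4 (- m)" "curry (\<theta> \<xi>) j = 0" for \<xi>
  proof -
   have "?f \<xi> : Pi\<^sub>E I W"
   proof (rule PiE_I)
    fix i assume i: "i : I"
    show "?f \<xi> i : W i"
    proof (cases "W i = topspace (discrete_topology (car (alg i) (- m)))")
     case True
     then show ?thesis using comp[OF x(1) i] i by simp
    next
     case False
     then have le: "le i j" using j(2) i by blast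
     have "curry (\<theta> \<zeta>) i = tr i j (curry (\<theta> \<zeta>) j)" if "\<zeta> : dual V4 (- m)" for \<zeta>
      using limD3[OF hD(7)[OF that] i j(1) le] by simp
     moreover have "curry (\<theta> 0) j = 0"
      by (rule linear_into_simps(1)[OF lin dual_subspace[OF graded_V4]])
     ultimately have "?f \<xi> i = ?f 0 i" using x z i by simp
     then show ?thesis using W(2) i by (metis PiE_mem)
    qed
   qed simp
   then have "\<xi> : ?O" using W(3) O x(1) by blast
   then show ?thesis by simp
  qed
  then show ?thesis using c by (auto simp: perp_def)
 qed
 ultimately show thesis using that fd_subcoalgs_iff by blast
qed

lemma fd_subcoalg_homogeneous:
 assumes "c : homogeneous V4"
 obtains D where "D : fd_subcoalgs C" "c : homogeneous D"
 using assms fd_subcoalg_exists homogeneousI by (metis homogeneousE)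

lemma fd_upper:
 assumes "finite S" "S \<subseteq> homogeneous V4"
 obtains D where "D : fd_subcoalgs C" "!!n c. c : S ==> c : V4 n ==> c : D n"
proof -
 have "EX D:fd_subcoalgs C. S \<subseteq> homogeneous D" using assms
 proof (induction S rule: finite_induct)
  case empty
  obtain D where "D : fd_subcoalgs C" using fd_subcoalg_exists[OF subspaceD(1)[OF graded_spaceD(1)[OF graded_V4]]] by metis
  then show ?case by auto
 next
  case (insert c S)
  then obtain D where D: "D : fd_subcoalgs C" "S \<subseteq> homogeneous D" by auto
  obtain E where E: "E : fd_subcoalgs C" "c : homogeneous E"
   using fd_subcoalg_homogeneous insert.prems by blast
  obtain F where "F : fd_subcoalgs C" "D <= F" "E <= F" using fd_directed[OF C D(1) E(1)] by metis
  then show ?case using D E homogeneous_mono by (metis insert_subset subset_iff)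
 qed
 then obtain D where D: "D : fd_subcoalgs C" "S \<subseteq> homogeneous D" by blast
 have "c : D n" if c: "c : S" "c : V4 n" for c n
 proof -
  obtain m where m: "c : D m" using D(2) c(1) by (auto elim: homogeneousE)
  have sD: "subcoalgebra C D" using D(1) fd_subcoalgs_iff by blast
  show ?thesis
  proof (cases "m = n")
   case False
   then have "c = 0"
    using graded_space_disjoint[OF graded_V4, of c m n] m c(2) subcoalgebraD(2)[OF sD] by blast
   then show ?thesis using subspaceD(1)[OF subcoalgebraD(1)[OF sD]] by simp
  qed (use m in simp)
 qed
 then show thesis using that D(1) by blast
qed

end

text \<open>The pointwise topology makes every continuous functional on the dual an evaluation.\<close>

lemma underlying_map_exists:
 fixes C :: "('x, 'k::field) curved_coalg" and C' :: "('y, 'k) curved_coalg"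
 assumes C: "curved_coalgebra C" and C': "curved_coalgebra C'" and hom: "curved_coalgebra_hom C C' \<phi> b"
 obtains f where "underlying_map C C' \<phi> f"
proof -
 note gV = curved_coalgebraD(1)[OF C] and gV' = curved_coalgebraD(1)[OF C']
 have \<phi>: "curved_hom (dual_alg C') (dual_alg C) \<phi> b" and cont: "!!n. continuous_map (dual_topology C' n) (dual_topology C n) \<phi>"
  using hom by (auto simp: curved_coalgebra_hom_def pseudocompact_curved_hom_def)
 note \<phi>D = curved_homD[OF \<phi>, unfolded dual_alg_simps]
 have ex: "EX c':ccar C' m. ALL \<xi>:dual (ccar C') (- m). \<phi> \<xi> c = \<xi> c'" if c: "c : ccar C m" for c m
 proof -
  let ?U = "dual (ccar C') (- m)"
  have sU: "kvs.subspace ?U" by (rule dual_subspace[OF gV'])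
  have "openin (dual_topology C' (- m)) {\<xi> : topspace (dual_topology C' (- m)). \<phi> \<xi> : {\<eta> : dual (ccar C) (- m). \<eta> c = 0}}"
   by (rule openin_continuous_map_preimage[OF cont openin_dual_topology])
  from this[unfolded topspace_dual_topology, unfolded dual_topology_def openin_subtopology]
  obtain W where W: "openin (product_topology (%_. discrete_topology UNIV) UNIV) W"
   and eq: "{\<xi> : ?U. \<phi> \<xi> : {\<eta> : dual (ccar C) (- m). \<eta> c = 0}} = W \<inter> ?U"
   by (elim exE conjE) (rule that)
  have z: "(0 :: ('y => 'k) => 'k) : ?U" by (rule subspaceD(1)[OF sU])
  have "\<phi> 0 = 0" by (rule linear_into_simps(1)[OF \<phi>D(1) sU])
  then have "0 : {\<xi> : ?U. \<phi> \<xi> : {\<eta> : dual (ccar C) (- m). \<eta> c = 0}}"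
   using z subspaceD(1)[OF dual_subspace[OF gV]] by (simp add: pointwise)
  then have "0 : W" using eq by blast
  obtain X where X: "finite {i : UNIV. X i ~= topspace (discrete_topology (UNIV :: 'k set))}"
    "0 : Pi\<^sub>E UNIV X" "Pi\<^sub>E UNIV X \<subseteq> W"
   by (rule product_neighbourhood[OF W \<open>0 : W\<close>]) (rule that)
  \<comment> \<open>\<open>Q\<close> collects the points at which the neighbourhood restricts the
    value. Points outside \<open>ccar C' m\<close> can be left out, because functionals of this
    degree vanish there.\<close>
  define Q where "Q = {i. X i ~= UNIV} \<inter> ccar C' m"
  have finQ: "finite Q" using X(1) by (simp add: Q_def)
  have van: "\<phi> \<xi> c = 0" if x: "\<xi> : ?U" "!!q. q : Q ==> \<xi> q = 0" for \<xi>
  proof -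
   have "\<xi> i : X i" for i
   proof (cases "X i = UNIV")
    case False
    have "\<xi> i = 0"
     using x False dual_outside[OF gV' x(1), of i] by (cases "i : ccar C' m") (auto simp: Q_def)
    moreover have "0 i : X i" using X(2) by (auto simp: PiE_iff)
    ultimately show ?thesis by (simp add: pointwise)
   qed simp
   then have "\<xi> : W" using X(3) by (auto simp: PiE_UNIV_domain)
   then show ?thesis using eq x(1) by blast
  qed
  \<comment> \<open>Evaluation at \<open>c\<close> after \<phi> vanishes on the common kernel of the
    evaluations at \<open>Q\<close>, so it is a combination of them; the same combination of the
    points themselves is the image of \<open>c\<close>.\<close>
  have "EX r. ALL \<xi>:?U. \<phi> \<xi> c = (\<Sum>q\<in>Q. r q * \<xi> q)"
  proof (rule functional_combination[OF finQ sU, where l = "%q \<xi>. \<xi> q" and L = "%\<xi>. \<phi> \<xi> c"])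
  qed (use van linear_intoD(2,3)[OF \<phi>D(1), of _ "- m"] in \<open>auto simp: pointwise scl_def[of _ "_ :: ('y => 'k) => 'k"] scl_def[of _ "_ :: ('x => 'k) => 'k"]\<close>)
  then obtain r where r: "!!\<xi>. \<xi> : ?U ==> \<phi> \<xi> c = (\<Sum>q\<in>Q. r q * \<xi> q)" by blast
  let ?c = "\<Sum>q\<in>Q. scl (r q) q"
  have "?c : ccar C' m"
   by (intro kvs.subspace_sum[OF graded_spaceD(1)[OF gV']] subspaceD(3)[OF graded_spaceD(1)[OF gV']]) (simp add: Q_def)
  moreover have "\<phi> \<xi> c = \<xi> ?c" if x: "\<xi> : ?U" for \<xi>
   using r[OF x] dual_sum[OF gV' x, of Q "%q. q" m r] by (simp add: Q_def)
  ultimately show ?thesis by blast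
 qed
 \<comment> \<open>One function has to serve all degrees, so the degree is quantified inside the
   choice. A vector with two degrees is 0, and then its image is 0 as well.\<close>
 define f where "f c = (SOME c'. EX m. c : ccar C m & c' : ccar C' m & (ALL \<xi>:dual (ccar C') (- m). \<phi> \<xi> c = \<xi> c'))" for c
 have f: "f c : ccar C' m & (ALL \<xi>:dual (ccar C') (- m). \<phi> \<xi> c = \<xi> (f c))" if c: "c : ccar C m" for c m
 proof -
  have "EX c'. EX m. c : ccar C m & c' : ccar C' m & (ALL \<xi>:dual (ccar C') (- m). \<phi> \<xi> c = \<xi> c')"
   using ex[OF c] c by blast
  from someI_ex[OF this, folded f_def]
  obtain n where n: "c : ccar C n" "f c : ccar C' n" "!!\<xi>. \<xi> : dual (ccar C') (- n) ==> \<phi> \<xi> c = \<xi> (f c)"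
   by blast
  show ?thesis
  proof (cases "m = n")
   case False
   then have c0: "c = 0" using graded_space_disjoint[OF gV c n(1)] by simp
   have "\<phi> \<xi> c = 0" if "\<xi> : dual (ccar C') k" for \<xi> k
    using dual_zero[OF gV linear_intoD(1)[OF \<phi>D(1) that]] c0 by simp
   moreover have "f c = 0"
    by (rule dual_separates_zero[OF gV' n(2)]) (use n(3) calculation in force)
   ultimately show ?thesis
    using subspaceD(1)[OF graded_spaceD(1)[OF gV']] dual_zero[OF gV'] by auto
  qed (use n in simp)
 qed
 have "linear_into (ccar C m) (ccar C' m) f" for m
 proof (rule linear_intoI)
  note s = subspaceD[OF graded_spaceD(1)[OF gV, of m]] and s' = subspaceD[OF graded_spaceD(1)[OF gV', of m]]
  fix v w c assume v: "v : ccar C m"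
  show "f v : ccar C' m" using f[OF v] by simp
  have x: "\<phi> \<xi> : dual (ccar C) (- m)" if "\<xi> : dual (ccar C') (- m)" for \<xi>
   by (rule linear_intoD(1)[OF \<phi>D(1) that])
  have "f (scl c v) - scl c (f v) = 0"
  proof (rule dual_separates_zero[OF gV'])
   show "f (scl c v) - scl c (f v) : ccar C' m" by (rule s'(5)[OF f[OF s(3)[OF v], THEN conjunct1] s'(3)[OF f[OF v, THEN conjunct1]]])
   fix \<xi> assume xi: "\<xi> : dual (ccar C') (- m)"
   have "\<xi> (f (scl c v)) = c * \<xi> (f v)"
    using f[OF s(3)[OF v]] f[OF v] xi dual_scl[OF gV x[OF xi] v] by simp
   then show "\<xi> (f (scl c v) - scl c (f v)) = 0"
    using dual_diff[OF gV' xi, of "f (scl c v)" m "scl c (f v)"] dual_scl[OF gV' xi, of "f v" m c] f[OF v] f[OF s(3)[OF v]] s'(3)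
    by simp
  qed
  then show "f (scl c v) = scl c (f v)" by simp
  assume w: "w : ccar C m"
  have "f (v + w) - (f v + f w) = 0"
  proof (rule dual_separates_zero[OF gV'])
   show "f (v + w) - (f v + f w) : ccar C' m" by (rule s'(5)[OF f[OF s(2)[OF v w], THEN conjunct1] s'(2)[OF f[OF v, THEN conjunct1] f[OF w, THEN conjunct1]]])
   fix \<xi> assume xi: "\<xi> : dual (ccar C') (- m)"
   have "\<xi> (f (v + w)) = \<xi> (f v) + \<xi> (f w)"
    using f[OF s(2)[OF v w]] f[OF v] f[OF w] xi dual_add[OF gV x[OF xi] v w] by simp
   then show "\<xi> (f (v + w) - (f v + f w)) = 0"
    using dual_diff[OF gV' xi, of "f (v + w)" m "f v + f w"] dual_add[OF gV' xi, of "f v" m "f w"] f[OF v] f[OF w] f[OF s(2)[OF v w]] s'(2)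
    by simp
  qed
  then show "f (v + w) = f v + f w" by simp
 qed
 moreover have "\<phi> \<xi> c = \<xi> (f c)" if "\<xi> : dual (ccar C') n" "c : ccar C (- n)" for \<xi> n c
  using f[OF that(2)] that(1) by simp
 ultimately have "underlying_map C C' \<phi> f"
  unfolding underlying_map_def graded_map_def by simp
 then show thesis by (rule that)
qed

section \<open>Convolution algebras\<close>

definition conv_part :: "('x, 'k::field) curved_coalg => ('a, 'k) curved_alg => ('x, 'k) graded =>
  (('x => 'k) \<times> 'a, 'k) curved_alg" where
 "conv_part C A D = tensor_alg (dual_alg (subcoalg C D)) A"

definition map_dual :: "('a, 'k::field) curved_alg => ('x, 'k) graded => ((('x => 'k) => 'k) => ('y => 'k) => 'k) =>
  (('x => 'k) \<times> 'a => 'k) => ('y => 'k) \<times> 'a => 'k" where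
 "map_dual A E \<psi> = tensor_lift (dual E) (car A) (%p q \<xi> a. \<psi> \<xi> \<otimes>\<^sub>k a)"

lemma conv_alg_limit: "conv_alg C A = limit_alg (fd_subcoalgs C) (<=) (conv_part C A) (%D E. map_dual A E (restr D))"
 by (simp add: conv_alg_def conv_part_def[abs_def] map_dual_def)

lemma linear_into_comp: "linear_into U V f ==> linear_into V W g ==> linear_into U W (%v. g (f v))"
 by (simp add: linear_into_def)

lemma curry_tens: "curry (\<xi> \<otimes>\<^sub>k w) v = scl (\<xi> v) w"
 by (auto simp: tens_def scl_def fun_eq_iff)

context
 fixes A :: "('a, 'k::field) curved_alg"
 assumes A: "curved_algebra A"
begin

private lemmas graded_A1 = curved_algebraD(1)[OF A]

lemma map_dual_pure:
 assumes "graded_space E" "!!n. linear_into (dual E n) (dual D n) \<psi>" "\<eta> : dual E p" "a : car A q"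
 shows "map_dual A E \<psi> (\<eta> \<otimes>\<^sub>k a) = \<psi> \<eta> \<otimes>\<^sub>k a"
 unfolding map_dual_def
 by (rule tensor_lift_pure[OF graded_space_dual[OF assms(1)] graded_A1 balanced_map_tens[OF assms(2)] assms(3,4)])

lemma map_dual_linear:
 assumes "graded_space E" "!!n. linear_into (dual E n) (dual D n) \<psi>"
 shows "linear_into (tensor (dual E) (car A) n) (tensor (dual D) (car A) n) (map_dual A E \<psi>)"
 unfolding map_dual_def by (rule linear_into_map_tens[OF graded_space_dual[OF assms(1)] graded_A1 assms(2)])

lemma map_dual_cong:
 assumes E: "graded_space E" and f: "!!n. linear_into (dual E n) (dual D n) \<psi>" "!!n. linear_into (dual E n) (dual D n) \<psi>'"
  and eq: "!!n \<eta>. \<eta> : dual E n ==> \<psi> \<eta> = \<psi>' \<eta>" and t: "t : tensor (dual E) (car A) n"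
 shows "map_dual A E \<psi> t = map_dual A E \<psi>' t"
 using graded_space_dual[OF E] t
proof (induction rule: tensor_induct)
 case (pure p q v w)
 show ?case
  unfolding map_dual_pure[OF E f(1) pure(1,2)] map_dual_pure[OF E f(2) pure(1,2)] eq[OF pure(1)] ..
next
 case (add s t)
 show ?case
  unfolding linear_intoD(3)[OF map_dual_linear[OF E f(1)] add(1,2)] linear_intoD(3)[OF map_dual_linear[OF E f(2)] add(1,2)]
   add(3,4) ..
next
 case zero
 show ?case
  using linear_into_simps(1)[OF map_dual_linear[OF E f(1)] tensor_subspace]
   linear_into_simps(1)[OF map_dual_linear[OF E f(2)] tensor_subspace] by simp
qed

lemma map_dual_compose:
 assumes E: "graded_space E" and E2: "graded_space E2" and f: "!!n. linear_into (dual E2 n) (dual E n) \<rho>"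
   "!!n. linear_into (dual E n) (dual D n) \<psi>"
  and t: "t : tensor (dual E2) (car A) n"
 shows "map_dual A E \<psi> (map_dual A E2 \<rho> t) = map_dual A E2 (%\<zeta>. \<psi> (\<rho> \<zeta>)) t"
 using graded_space_dual[OF E2] t
proof (induction rule: tensor_induct)
 have g: "linear_into (dual E2 n) (dual D n) (%\<zeta>. \<psi> (\<rho> \<zeta>))" for n
  by (rule linear_into_comp[OF f])
 note l = map_dual_linear[OF E2 f(1)] map_dual_linear[OF E f(2)] map_dual_linear[OF E2 g]
 {
  case (pure p q v w)
  show ?case
   unfolding map_dual_pure[OF E2 f(1) pure(1,2)] map_dual_pure[OF E f(2) linear_intoD(1)[OF f(1) pure(1)] pure(2)]
    map_dual_pure[OF E2 g pure(1,2)] ..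
 next
  case (add s t)
  show ?case
   unfolding linear_intoD(3)[OF l(1) add(1,2)] linear_intoD(3)[OF l(3) add(1,2)]
    linear_intoD(3)[OF l(2) linear_intoD(1)[OF l(1) add(1)] linear_intoD(1)[OF l(1) add(2)]] add(3,4) ..
 next
  case zero
  show ?case
   using linear_into_simps(1)[OF l(1) tensor_subspace] linear_into_simps(1)[OF l(2) tensor_subspace]
    linear_into_simps(1)[OF l(3) tensor_subspace] by simp
 }
qed

text \<open>With tensors read as linear maps, \<psi> tensored with the identity is composition with
  the map of which \<psi> is the transpose.\<close>

lemma map_dual_transpose:
 assumes E: "graded_space E" and f: "!!n. linear_into (dual E n) (dual D n) \<psi>"
  and eq: "!!n \<eta>. \<eta> : dual E n ==> \<psi> \<eta> c = \<eta> c'" and t: "t : tensor (dual E) (car A) n"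
 shows "curry (map_dual A E \<psi> t) c = curry t c'"
 using graded_space_dual[OF E] t
proof (induction rule: tensor_induct)
 case (pure p q v w)
 show ?case unfolding map_dual_pure[OF E f pure(1,2)] curry_tens eq[OF pure(1)] ..
next
 case (add s t)
 show ?case unfolding linear_intoD(3)[OF map_dual_linear[OF E f] add(1,2)] curry_plus add(3,4) ..
next
 case zero
 show ?case
  unfolding linear_into_simps(1)[OF map_dual_linear[OF E f] tensor_subspace] curry_zero ..
qed

end

text \<open>The linear map from \<open>C\<close> to \<open>A\<close> that corresponds to
  \<open>F\<close>. The chosen subcoalgebra does not matter, by \<open>ev_eq\<close>. These maps
  replace compatible families of tensors by functions on the coalgebra.\<close>

definition ev :: "('x, 'k::field) curved_coalg => (('x, 'k) graded \<times> (('x => 'k) \<times> 'a) => 'k) => ('x => 'k) => 'a => 'k" where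
 "ev C F c = curry (curry F (SOME D. D : fd_subcoalgs C & c : homogeneous D)) c"

text \<open>The tensor of \<xi> and \<open>a\<close> as an element of the completed tensor product;
  as a map it sends \<open>c\<close> to the multiple of \<open>a\<close> by
  \<open>\<xi> c\<close>.\<close>

definition emb :: "('x, 'k::field) curved_coalg => (('x => 'k) => 'k) => ('a => 'k) =>
  (('x, 'k) graded \<times> (('x => 'k) \<times> 'a) => 'k)" where
 "emb C \<xi> a = family (fd_subcoalgs C) (%D. restr D \<xi> \<otimes>\<^sub>k a)"

lemma conv_shift_emb: "conv_shift C A b = emb C b (unt A)"
 by (simp add: conv_shift_def emb_def)

context
 fixes C :: "('x, 'k::field) curved_coalg" and A :: "('a, 'k) curved_alg"
 assumes C: "curved_coalgebra C" and A: "curved_algebra A"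
begin

private abbreviation "V \<equiv> ccar C"
private abbreviation "R \<equiv> dual_alg C"
private abbreviation "I \<equiv> fd_subcoalgs C"
private abbreviation "B \<equiv> conv_alg C A"
private lemmas coalg2 = curved_coalgebraD[OF C]
private lemmas graded_V2 = coalg2(1)
private lemmas graded_A2 = curved_algebraD(1)[OF A]

private lemma sub2: "D : I ==> subcoalgebra C D"
 by (simp add: fd_subcoalgs_iff)

private lemma graded_D2: "D : I ==> graded_space D"
 by (rule subcoalgebra_graded[OF C sub2])

private lemma dualD_algebra: "D : I ==> curved_algebra (dual_alg (subcoalg C D))"
 by (rule subcoalgebra_dual_algebra[OF C sub2])

lemma conv_part_algebra: "D : I ==> curved_algebra (conv_part C A D)"
 unfolding conv_part_def by (rule curved_algebra_tensor_alg[OF dualD_algebra A])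

lemma car_conv_part: "D : I ==> car (conv_part C A D) = tensor (dual D) (car A)"
 using car_tensor_alg[OF dualD_algebra A] by (simp add: conv_part_def)

lemma restr_part_linear: "D : I ==> E : I ==> D <= E ==> linear_into (dual E n) (dual D n) (restr D)"
 using curved_homD(1)[OF restr_hom_sub[OF C sub2 sub2]] by simp

lemma conv_part_hom:
 assumes "D : I" "E : I" "D <= E"
 shows "curved_hom (conv_part C A E) (conv_part C A D) (map_dual A E (restr D)) 0"
 using curved_hom_tensor[OF dualD_algebra[OF assms(2)] dualD_algebra[OF assms(1)] A restr_hom_sub[OF C sub2[OF assms(1)] sub2[OF assms(2)] assms(3)]]
 by (simp add: conv_part_def map_dual_def)

lemma conv_algebra: "curved_algebra B"
 unfolding conv_alg_limit by (intro curved_algebra_limit conv_part_algebra conv_part_hom)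

lemma conv_carD:
 assumes F: "F : car B n"
 shows "F = family I (curry F)" "!!D. D : I ==> curry F D : tensor (dual D) (car A) n"
  "!!D E. D : I ==> E : I ==> D <= E ==> map_dual A E (restr D) (curry F E) = curry F D"
proof -
 note F' = F[unfolded conv_alg_limit]
 show "F = family I (curry F)"
  by (rule limit_carD(1)[where I = I and alg = "conv_part C A" and le = "(<=)" and tr = "%D E. map_dual A E (restr D)", OF _ _ F'])
   (rule conv_part_algebra conv_part_hom; assumption)+
 show "curry F D : tensor (dual D) (car A) n" if "D : I" for D
  unfolding car_conv_part[OF that, symmetric]
  by (rule limit_carD(2)[where I = I and alg = "conv_part C A" and le = "(<=)" and tr = "%D E. map_dual A E (restr D)", OF _ _ F' that])
   (rule conv_part_algebra conv_part_hom; assumption)+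
 show "map_dual A E (restr D) (curry F E) = curry F D" if "D : I" "E : I" "D <= E" for D E
  by (rule limit_carD(3)[where I = I and alg = "conv_part C A" and le = "(<=)" and tr = "%D E. map_dual A E (restr D)", OF _ _ F' that])
   (rule conv_part_algebra conv_part_hom; assumption)+
qed

text \<open>The transition maps restrict linear maps to smaller subcoalgebras, so compatibility of a
  family of tensors amounts to agreement of the corresponding maps.\<close>

lemma conv_carI:
 assumes u: "!!D. D : I ==> u D : tensor (dual D) (car A) n"
  "!!D E c. D : I ==> E : I ==> D <= E ==> c : homogeneous D ==> curry (u E) c = curry (u D) c"
 shows "family I u : car B n"
 unfolding conv_alg_limit
proof (rule limit_carI)
 show "u D : car (conv_part C A D) n" if "D : I" for D
  unfolding car_conv_part[OF that] by (rule u(1)[OF that])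
 show "map_dual A E (restr D) (u E) = u D" if DE: "D : I" "E : I" "D <= E" for D E
 proof (rule tensor_dual_eqI[OF graded_D2[OF DE(1)] graded_A2 _ u(1)[OF DE(1)]])
  note lin = restr_part_linear[OF DE]
  show "map_dual A E (restr D) (u E) : tensor (dual D) (car A) n"
   by (rule linear_intoD(1)[OF map_dual_linear[OF A graded_D2[OF DE(2)] lin] u(1)[OF DE(2)]])
  fix c assume c: "c : homogeneous D"
  have "curry (map_dual A E (restr D) (u E)) c = curry (u E) c"
   by (rule map_dual_transpose[OF A graded_D2[OF DE(2)] lin _ u(1)[OF DE(2)]]) (use c in \<open>simp add: restr_def\<close>)
  then show "curry (map_dual A E (restr D) (u E)) c = curry (u D) c"
   using u(2)[OF DE c] by simp
 qed
qed (rule conv_part_algebra conv_part_hom; assumption)+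

lemma conv_component_restrict:
 assumes F: "F : car B n" and DE: "D : I" "E : I" "D <= E" and c: "c : homogeneous D"
 shows "curry (curry F D) c = curry (curry F E) c"
 unfolding conv_carD(3)[OF F DE, symmetric]
 by (rule map_dual_transpose[OF A graded_D2[OF DE(2)] restr_part_linear[OF DE] _ conv_carD(2)[OF F DE(2)]])
  (use c in \<open>simp add: restr_def\<close>)

lemma ev_eq:
 assumes F: "F : car B n" and D: "D : I" "c : homogeneous D"
 shows "ev C F c = curry (curry F D) c"
proof -
 let ?D = "SOME D. D : I & c : homogeneous D"
 have D': "?D : I" "c : homogeneous ?D"
  using someI[of "%D. D : I & c : homogeneous D" D] D by auto
 obtain E where E: "E : I" "?D <= E" "D <= E" by (rule fd_directed[OF C D'(1) D(1)])
 show ?thesis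
  unfolding ev_def using conv_component_restrict[OF F D'(1) E(1,2) D'(2)] conv_component_restrict[OF F D(1) E(1,3) D(2)] by simp
qed

lemma ev_linear:
 assumes F: "F : car B n"
 shows "linear_into (V m) (car A (m + n)) (ev C F)"
proof (rule linear_intoI)
 fix v w c assume v: "v : V m"
 obtain D where D: "D : I" "v : D m" by (rule fd_subcoalg_exists[OF C v])
 note lin = tensor_dual_linear(1)[OF graded_D2 graded_A2 conv_carD(2)[OF F]]
 have e: "ev C F v = curry (curry F D) v" by (rule ev_eq[OF F D(1) homogeneousI[where V = D, OF D(2)]])
 show "ev C F v : car A (m + n)"
  unfolding e by (rule linear_intoD(1)[OF lin[OF D(1,1)] D(2)])
 have cv: "scl c v : D m" by (rule subspaceD(3)[OF graded_spaceD(1)[OF graded_D2[OF D(1)]] D(2)])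
 show "ev C F (scl c v) = scl c (ev C F v)"
  unfolding e ev_eq[OF F D(1) homogeneousI[where V = D, OF cv]] by (rule linear_intoD(2)[OF lin[OF D(1,1)] D(2)])
 assume w: "w : V m"
 obtain D' where D': "D' : I" "w : D' m" by (rule fd_subcoalg_exists[OF C w])
 obtain E where E: "E : I" "D <= E" "D' <= E" by (rule fd_directed[OF C D(1) D'(1)])
 have vw: "v : E m" "w : E m" using D(2) D'(2) E(2,3) by (auto simp: le_fun_def)
 have s: "v + w : E m" by (rule subspaceD(2)[OF graded_spaceD(1)[OF graded_D2[OF E(1)]] vw])
 show "ev C F (v + w) = ev C F v + ev C F w"
  unfolding ev_eq[OF F E(1) homogeneousI[where V = E, OF s]] ev_eq[OF F E(1) homogeneousI[where V = E, OF vw(1)]]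
   ev_eq[OF F E(1) homogeneousI[where V = E, OF vw(2)]]
  by (rule linear_intoD(3)[OF lin[OF E(1,1)] vw])
qed

lemma conv_eqI:
 assumes F: "F : car B n" and G: "G : car B m" and eq: "!!c. c : homogeneous V ==> ev C F c = ev C G c"
 shows "F = G"
proof -
 have "curry F D = curry G D" if D: "D : I" for D
 proof (rule tensor_dual_eqI[OF graded_D2[OF D] graded_A2 conv_carD(2)[OF F D] conv_carD(2)[OF G D]])
  fix c assume c: "c : homogeneous D"
  then have "c : homogeneous V"
   using subcoalgebraD(2)[OF sub2[OF D]] by (auto simp: homogeneous_def)
  then show "curry (curry F D) c = curry (curry G D) c"
   using eq ev_eq[OF F D c] ev_eq[OF G D c] by simp
 qed
 then show ?thesis
  using conv_carD(1)[OF F] conv_carD(1)[OF G] family_cong[of I "curry F" "curry G"] by simp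
qed

text \<open>Together with \<open>ev_linear\<close> and \<open>conv_eqI\<close> this identifies the
  component of degree \<open>n\<close> with the graded linear maps of degree \<open>n\<close> from
  \<open>C\<close> to \<open>A\<close>. Extension problems for elements thereby become extension
  problems for linear maps.\<close>

lemma conv_build:
 assumes t: "!!m. linear_into (V m) (car A (m + n)) t"
 obtains F where "F : car B n" "!!c. c : homogeneous V ==> ev C F c = t c"
proof -
 let ?u = "%D (v, y). if v : homogeneous D then t v y else 0"
 have F: "family I ?u : car B n"
 proof (rule conv_carI)
  fix D assume D: "D : I"
  have "linear_into (D m) (car A (m + n)) t" for m
   using t[of m] subcoalgebraD(2)[OF sub2[OF D], of m] by (auto simp: linear_into_def)
  then show "?u D : tensor (dual D) (car A) n"
   using D by (intro linear_tensor_dual[OF graded_D2[OF D]]) (auto simp: fd_subcoalgs_iff)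
 next
  fix D E c assume "D : I" "E : I" "D <= E" "c : homogeneous D"
  then show "curry (?u E) c = curry (?u D) c"
   using homogeneous_mono[of D E c] by (auto simp: fun_eq_iff)
 qed
 have "ev C (family I ?u) c = t c" if c: "c : homogeneous V" for c
 proof -
  obtain D where D: "D : I" "c : homogeneous D" by (rule fd_subcoalg_homogeneous[OF C c])
  show ?thesis
   unfolding ev_eq[OF F D] curry_family[OF D(1)] using D(2) by (auto simp: fun_eq_iff)
 qed
 then show thesis using that F by blast
qed

lemma ev_diff: "ev C (F - G) c = ev C F c - ev C G c"
 by (simp add: ev_def curry_minus)

lemma ev_plus: "ev C (F + G) c = ev C F c + ev C G c"
 by (simp add: ev_def curry_plus)

lemma ev_scl: "ev C (scl r F) c = scl r (ev C F c)"
 by (simp add: ev_def curry_scl)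

lemma ev_zero: "ev C 0 c = 0"
 by (simp add: ev_def curry_zero)

lemma emb_closed:
 assumes "\<xi> : dual V p" "a : car A q"
 shows "emb C \<xi> a : car B (p + q)"
 unfolding emb_def
proof (rule conv_carI)
 show "restr D \<xi> \<otimes>\<^sub>k a : tensor (dual D) (car A) (p + q)" if "D : I" for D
  by (rule tens_in_tensor[where V = "dual D" and W = "car A", OF restr_dual[where D = D, OF graded_V2 subcoalgebraD(1,2)[OF sub2[OF that]] assms(1)] assms(2) refl])
 show "curry (restr E \<xi> \<otimes>\<^sub>k a) c = curry (restr D \<xi> \<otimes>\<^sub>k a) c"
  if "D : I" "E : I" "D <= E" "c : homogeneous D" for D E c
  using homogeneous_mono[OF that(3,4)] that(4) by (simp add: curry_tens restr_def)
qed

lemma ev_emb: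
 assumes "\<xi> : dual V p" "a : car A q" "c : homogeneous V"
 shows "ev C (emb C \<xi> a) c = scl (\<xi> c) a"
proof -
 obtain D where D: "D : I" "c : homogeneous D" by (rule fd_subcoalg_homogeneous[OF C assms(3)])
 show ?thesis
  unfolding ev_eq[OF emb_closed[OF assms(1,2)] D] using D by (simp add: emb_def curry_family curry_tens restr_def)
qed

private lemma B_simps:
 "mul B F G = family I (%D. mul (conv_part C A D) (curry F D) (curry G D))"
 "dif B F = family I (%D. dif (conv_part C A D) (curry F D))"
 "unt B = family I (%D. unt (conv_part C A D))" "cur B = family I (%D. cur (conv_part C A D))"
 by (simp_all add: conv_alg_limit limit_alg_def)

lemma conv_mul_component: "D : I ==> curry (mul B F G) D = mul (conv_part C A D) (curry F D) (curry G D)"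
 and conv_dif_component: "D : I ==> curry (dif B F) D = dif (conv_part C A D) (curry F D)"
 and conv_unt_component: "D : I ==> curry (unt B) D = unt (conv_part C A D)"
 and conv_cur_component: "D : I ==> curry (cur B) D = cur (conv_part C A D)"
 by (simp_all add: B_simps curry_family)

lemma emb_mul:
 assumes "\<xi> : dual V p" "a : car A q" "\<zeta> : dual V p'" "b : car A q'"
 shows "mul B (emb C \<xi> a) (emb C \<zeta> b) = ksign (q * p') (emb C (mul R \<xi> \<zeta>) (mul A a b))"
 unfolding B_simps emb_def family_ksign
proof (rule family_cong)
 fix D assume D: "D : I"
 have r: "restr D \<xi> : car (dual_alg (subcoalg C D)) p" "restr D \<zeta> : car (dual_alg (subcoalg C D)) p'"
  using restr_dual[where D = D, OF graded_V2 subcoalgebraD(1,2)[OF sub2[OF D]]] assms(1,3) by auto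
 show "mul (conv_part C A D) (curry (family I (%D. restr D \<xi> \<otimes>\<^sub>k a)) D) (curry (family I (%D. restr D \<zeta> \<otimes>\<^sub>k b)) D) =
  ksign (q * p') (restr D (mul R \<xi> \<zeta>) \<otimes>\<^sub>k mul A a b)"
  unfolding curry_family[OF D] conv_part_def tensor_mul_pure[OF dualD_algebra[OF D] A r(1) assms(2) r(2) assms(4)]
   restr_mul[OF C sub2[OF D] assms(1,3)] ..
qed

lemma emb_dif:
 assumes "\<xi> : dual V p" "a : car A q"
 shows "dif B (emb C \<xi> a) = emb C (dif R \<xi>) a + ksign p (emb C \<xi> (dif A a))"
 unfolding B_simps emb_def family_ksign family_plus
proof (rule family_cong)
 fix D assume D: "D : I"
 have r: "restr D \<xi> : car (dual_alg (subcoalg C D)) p"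
  using restr_dual[where D = D, OF graded_V2 subcoalgebraD(1,2)[OF sub2[OF D]] assms(1)] by simp
 show "dif (conv_part C A D) (curry (family I (%D. restr D \<xi> \<otimes>\<^sub>k a)) D) =
  restr D (dif R \<xi>) \<otimes>\<^sub>k a + ksign p (restr D \<xi> \<otimes>\<^sub>k dif A a)"
  unfolding curry_family[OF D] conv_part_def tensor_dif_pure[OF dualD_algebra[OF D] A r assms(2)]
   restr_dif[OF C sub2[OF D]] ..
qed

lemma emb_cur: "cur B = emb C (ccur C) (unt A) + emb C (counit C) (cur A)"
 by (simp add: B_simps emb_def conv_part_def tensor_alg_def family_plus)

end

section \<open>The morphism of convolution algebras\<close>

lemma underlying_mapD:
 assumes "underlying_map C C' \<phi> f"
 shows "!!n. linear_into (ccar C n) (ccar C' n) f"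
  "!!n \<xi> c. \<xi> : dual (ccar C') n ==> c : ccar C (- n) ==> \<phi> \<xi> c = \<xi> (f c)"
proof -
 show "linear_into (ccar C n) (ccar C' n) f" for n
  using assms unfolding underlying_map_def graded_map_def by simp
 show "\<phi> \<xi> c = \<xi> (f c)" if "\<xi> : dual (ccar C') n" "c : ccar C (- n)" for n \<xi> c
  using assms that unfolding underlying_map_def by blast
qed

context
 fixes C :: "('x, 'k::field) curved_coalg" and C' :: "('y, 'k) curved_coalg" and A :: "('a, 'k) curved_alg"
  and \<phi> b f
 assumes C: "curved_coalgebra C" and C': "curved_coalgebra C'" and A: "curved_algebra A"
  and hom: "curved_hom (dual_alg C') (dual_alg C) \<phi> b" and f: "underlying_map C C' \<phi> f"
begin

private lemmas graded_V3 = curved_coalgebraD(1)[OF C] and graded_V3' = curved_coalgebraD(1)[OF C'] and graded_A3 = curved_algebraD(1)[OF A]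
private lemmas umap = underlying_mapD[OF f]
private lemmas phiD = curved_homD[OF hom, unfolded dual_alg_simps]

private lemma sub3: "D : fd_subcoalgs C ==> subcoalgebra C D" and sub3': "E : fd_subcoalgs C' ==> subcoalgebra C' E"
 by (simp_all add: fd_subcoalgs_iff)

lemma transpose_homogeneous:
 assumes "\<xi> : dual (ccar C') n" "c : ccar C m"
 shows "\<phi> \<xi> c = \<xi> (f c)"
proof (cases "m = - n")
 case True
 then show ?thesis using umap(2)[OF assms(1)] assms(2) by simp
next
 case False
 then show ?thesis
  using dual_other[OF graded_V3 phiD(7)[OF assms(1)] assms(2)] dual_other[OF graded_V3' assms(1) linear_intoD(1)[OF umap(1) assms(2)]]
  by simp
qed

text \<open>Only the images of a finite homogeneous basis of \<open>D\<close> have to be enclosed in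
  a finite dimensional subcoalgebra. This supplies the \<open>E\<close> over which the component at
  \<open>D\<close> of the induced map is computed.\<close>

lemma image_in_fd:
 assumes D: "D : fd_subcoalgs C"
 obtains E where "E : fd_subcoalgs C'" "!!m c. c : D m ==> f c : E m"
proof -
 have fd: "finite_dim D" and sD: "subcoalgebra C D" using D by (auto simp: fd_subcoalgs_iff)
 note graded_D3 = subcoalgebra_graded[OF C sD]
 obtain P e where P: "finite P" "!!m b. (m, b) : P ==> b : D m" "!!m b. (m, b) : P ==> e (m, b) : dual D (- m)"
  "!!m v. v : D m ==> v = (\<Sum>x\<in>{x:P. fst x = m}. scl (e x v) (snd x))"
  by (rule dual_basis[OF graded_D3 fd]) (rule that)
 have fP: "f (snd x) : ccar C' (fst x)" if "x : P" for x
  using P(2)[of "fst x" "snd x"] that subcoalgebraD(2)[OF sD] linear_intoD(1)[OF umap(1)] by (metis prod.collapse subsetD)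
 obtain E where E: "E : fd_subcoalgs C'" "!!n c. c : (%x. f (snd x)) ` P ==> c : ccar C' n ==> c : E n"
 proof (rule fd_upper[OF C', of "(%x. f (snd x)) ` P"])
  show "(%x. f (snd x)) ` P \<subseteq> homogeneous (ccar C')" using fP homogeneousI by blast
 qed (use P(1) in auto)
 have "f c : E m" if c: "c : D m" for m c
 proof -
  have lin: "linear_into (D m) (ccar C' m) f"
   using umap(1)[of m] subcoalgebraD(2)[OF sD, of m] by (auto simp: linear_into_def)
  have "f c = f (\<Sum>x\<in>{x:P. fst x = m}. scl (e x c) (snd x))" using P(4)[OF c] by simp
  also have "... = (\<Sum>x\<in>{x:P. fst x = m}. scl (e x c) (f (snd x)))"
   using P(2) by (intro linear_into_sum[OF lin graded_spaceD(1)[OF graded_D3]]) auto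
  also have "... : E m"
  proof (rule kvs.subspace_sum[OF subcoalgebraD(1)[OF sub3'[OF E(1)]]])
   fix x assume x: "x : {x:P. fst x = m}"
   then have "f (snd x) : E m" using E(2)[of "f (snd x)" m] fP[of x] by auto
   then show "scl (e x c) (f (snd x)) : E m" by (rule subspaceD(3)[OF subcoalgebraD(1)[OF sub3'[OF E(1)]]])
  qed
  finally show ?thesis .
 qed
 then show thesis using that E(1) by blast
qed

text \<open>The transpose of \<open>f\<close> as a map from \<open>D\<close> to a subcoalgebra
  containing its image; it is the witness for \<psi> in \<open>conv_map\<close>.\<close>

definition transp :: "('x, 'k) graded => (('y => 'k) => 'k) => ('x => 'k) => 'k" where
 "transp D \<eta> = (%c. if c : homogeneous D then \<eta> (f c) else 0)"

context
 fixes D E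
 assumes D: "D : fd_subcoalgs C" and E: "E : fd_subcoalgs C'" and fDE: "!!m c. c : D m ==> f c : E m"
begin

private lemma graded_D3: "graded_space D" and graded_E3: "graded_space E"
 by (rule subcoalgebra_graded[OF C sub3[OF D]], rule subcoalgebra_graded[OF C' sub3'[OF E]])

lemma transp_restr:
 assumes \<xi>: "\<xi> : dual (ccar C') n"
 shows "transp D (restr E \<xi>) = restr D (\<phi> \<xi>)"
proof
 fix c
 show "transp D (restr E \<xi>) c = restr D (\<phi> \<xi>) c"
 proof (cases "c : homogeneous D")
  case True
  then obtain m where c: "c : D m" by (rule homogeneousE)
  have "\<phi> \<xi> c = \<xi> (f c)"
   by (rule transpose_homogeneous[OF \<xi>]) (use c subcoalgebraD(2)[OF sub3[OF D]] in blast)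
  then show ?thesis using True restr_at[where D = E, OF fDE[OF c]] by (simp add: transp_def restr_def[of D])
 qed (simp add: transp_def restr_def)
qed

lemma transp_linear: "linear_into (dual E n) (dual D n) (transp D)"
proof (rule linear_intoI)
 fix \<eta> \<zeta> c assume h: "\<eta> : dual E n"
 obtain \<xi> where \<xi>: "\<xi> : dual (ccar C') n" "restr E \<xi> = \<eta>"
  by (rule dual_extend[where D = E, OF graded_V3' subcoalgebraD(1,2)[OF sub3'[OF E]] h])
 show "transp D \<eta> : dual D n"
  unfolding \<xi>(2)[symmetric] transp_restr[OF \<xi>(1)]
  by (rule restr_dual[where D = D, OF graded_V3 subcoalgebraD(1,2)[OF sub3[OF D]] phiD(7)[OF \<xi>(1)]])
qed (auto simp: transp_def fun_eq_iff scl_def pointwise)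

text \<open>Composed with the restriction to \<open>E\<close> it is \<phi> followed by the
  restriction to \<open>D\<close>, a morphism with shift \<open>restr D b\<close>, and this factors
  over the surjective restriction to \<open>E\<close>.\<close>

lemma transp_hom: "curved_hom (dual_alg (subcoalg C' E)) (dual_alg (subcoalg C D)) (transp D) (restr D b)"
proof (rule curved_hom_factor[OF subcoalgebra_dual_algebra[OF C' sub3'[OF E]] restr_hom[OF C' sub3'[OF E]] restr_sub_surj[OF C' sub3'[OF E]]
   _ _ _ curved_coalgebraD(6)[OF C']])
 note DA = subcoalgebra_dual_algebra[OF C sub3[OF D]] and rD = restr_hom[OF C sub3[OF D]]
 note rs = curved_homD[OF rD] curved_hom_strictD[OF DA rD]
 note R = curved_coalgebraD(6)[OF C] and hD = curved_homD[OF hom]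
 note radd = linear_intoD(3)[OF rs(1)] and rdiff = linear_into_simps(3)[OF rs(1) curved_algebraD(13)[OF R]]
  and rsign = linear_into_simps(4)[OF rs(1) curved_algebraD(13)[OF R]]
 show "curved_hom (dual_alg C') (dual_alg (subcoalg C D)) (%\<xi>. restr D (\<phi> \<xi>)) (restr D b)"
 proof (rule curved_homI)
  show "linear_into (car (dual_alg C') n) (car (dual_alg (subcoalg C D)) n) (%\<xi>. restr D (\<phi> \<xi>))" for n
   by (rule linear_into_comp[OF hD(1) rs(1)])
  show "restr D (\<phi> (mul (dual_alg C') a a')) = mul (dual_alg (subcoalg C D)) (restr D (\<phi> a)) (restr D (\<phi> a'))"
   if "a : car (dual_alg C') p" "a' : car (dual_alg C') q" for a a' p q
   unfolding hD(2)[OF that] by (rule rs(2)[OF hD(7)[OF that(1)] hD(7)[OF that(2)]])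
  show "restr D (\<phi> (unt (dual_alg C'))) = unt (dual_alg (subcoalg C D))" unfolding hD(3) by (rule rs(3))
  show "restr D b : car (dual_alg (subcoalg C D)) 1" by (rule rs(7)[OF hD(4)])
  show "restr D (\<phi> (dif (dual_alg C') a)) = dif (dual_alg (subcoalg C D)) (restr D (\<phi> a)) +
   (mul (dual_alg (subcoalg C D)) (restr D b) (restr D (\<phi> a)) - ksign n (mul (dual_alg (subcoalg C D)) (restr D (\<phi> a)) (restr D b)))"
   if a: "a : car (dual_alg C') n" for a n
  proof -
   note fa = hD(7)[OF a]
   have c: "mul (dual_alg C) b (\<phi> a) : car (dual_alg C) (n + 1)" "mul (dual_alg C) (\<phi> a) b : car (dual_alg C) (n + 1)"
    using mul_closed[OF R hD(4) fa] mul_closed[OF R fa hD(4)] by (simp_all add: add.commute)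
   note sc = car_closed(6)[OF R c(2), of n]
   show ?thesis
    unfolding hD(5)[OF a] radd[OF dif_closed[OF R fa] car_closed(5)[OF R c(1) sc]] rdiff[OF c(1) sc] rsign[OF c(2)]
     rs(2)[OF hD(4) fa] rs(2)[OF fa hD(4)] rs(8)[OF fa] ..
  qed
  have c: "dif (dual_alg C) b : car (dual_alg C) 2" "mul (dual_alg C) b b : car (dual_alg C) 2"
   using dif_closed[OF R hD(4)] mul_closed[OF R hD(4) hD(4)] by simp_all
  note h = curved_algebraD(10)[OF R]
  show "restr D (\<phi> (cur (dual_alg C'))) = cur (dual_alg (subcoalg C D)) + dif (dual_alg (subcoalg C D)) (restr D b) +
   mul (dual_alg (subcoalg C D)) (restr D b) (restr D b)"
   unfolding hD(6) radd[OF car_closed(2)[OF R h c(1)] c(2)] radd[OF h c(1)] rs(2)[OF hD(4) hD(4)] rs(8)[OF hD(4)] rs(9) ..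
 qed
 show "linear_into (car (dual_alg (subcoalg C' E)) n) (car (dual_alg (subcoalg C D)) n) (transp D)" for n
  using transp_linear by simp
qed (use transp_restr in simp)

text \<open>For the uniqueness, two choices of a subcoalgebra and of \<psi> are compared over a
  subcoalgebra \<open>G\<close> containing both. Every functional on \<open>G\<close> is restricted
  from \<open>C'\<close>, and on such functionals both composites are \<phi> followed by restriction
  to \<open>D\<close>.\<close>

lemma conv_map_component:
 assumes F: "F : car (conv_alg C' A) n"
 shows "curry (conv_map C C' A \<phi> F) D = map_dual A E (transp D) (curry F E)"
 unfolding conv_map_def curry_family[OF D] map_dual_def[symmetric]
proof (rule the_equality)
 show "EX E':fd_subcoalgs C'. EX \<psi>. graded_map (dual E') (dual D) 0 \<psi> &
    (ALL n. ALL \<xi>:dual (ccar C') n. \<psi> (restr E' \<xi>) = restr D (\<phi> \<xi>)) & map_dual A E (transp D) (curry F E) = map_dual A E' \<psi> (curry F E')"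
  using E transp_linear transp_restr by (intro bexI[of _ E] exI[of _ "transp D"]) (auto simp: graded_map_def)
next
 fix t
 assume "EX E':fd_subcoalgs C'. EX \<psi>. graded_map (dual E') (dual D) 0 \<psi> &
    (ALL n. ALL \<xi>:dual (ccar C') n. \<psi> (restr E' \<xi>) = restr D (\<phi> \<xi>)) & t = map_dual A E' \<psi> (curry F E')"
 then obtain E' \<psi> where E': "E' : fd_subcoalgs C'" and \<psi>g: "graded_map (dual E') (dual D) 0 \<psi>"
  and \<psi>r: "ALL n. ALL \<xi>:dual (ccar C') n. \<psi> (restr E' \<xi>) = restr D (\<phi> \<xi>)"
  and t: "t = map_dual A E' \<psi> (curry F E')"
  by blast
 have \<psi>: "!!n. linear_into (dual E' n) (dual D n) \<psi>"
  "!!n \<xi>. \<xi> : dual (ccar C') n ==> \<psi> (restr E' \<xi>) = restr D (\<phi> \<xi>)"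
  using \<psi>g \<psi>r by (simp add: graded_map_def, blast)
 note gE' = subcoalgebra_graded[OF C' sub3'[OF E']]
 obtain G where G: "G : fd_subcoalgs C'" "E <= G" "E' <= G" by (rule fd_directed[OF C' E E'])
 note gG = subcoalgebra_graded[OF C' sub3'[OF G(1)]]
 note FG = conv_carD(2)[OF C' A F G(1)]
 note rE = restr_part_linear[OF C' A E G(1,2)] and rE' = restr_part_linear[OF C' A E' G(1,3)]
 have l: "linear_into (dual G n) (dual D n) (%\<zeta>. \<psi>' (\<rho> \<zeta>))"
  if "!!n. linear_into (dual G n) (dual H n) \<rho>" "!!n. linear_into (dual H n) (dual D n) \<psi>'" for H \<rho> \<psi>' n
  by (rule linear_into_comp[OF that])
 have "t = map_dual A G (%\<zeta>. \<psi> (restr E' \<zeta>)) (curry F G)"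
  unfolding t conv_carD(3)[OF C' A F E' G(1,3), symmetric] by (rule map_dual_compose[OF A gE' gG rE' \<psi>(1) FG])
 also have "... = map_dual A G (%\<zeta>. transp D (restr E \<zeta>)) (curry F G)"
 proof (rule map_dual_cong[OF A gG l[OF rE' \<psi>(1)] l[OF rE transp_linear] _ FG])
  fix n \<eta> assume "\<eta> : dual G n"
  then obtain \<xi> where \<xi>: "\<xi> : dual (ccar C') n" "restr G \<xi> = \<eta>"
   by (rule dual_extend[where D = G, OF graded_V3' subcoalgebraD(1,2)[OF sub3'[OF G(1)]]])
  show "\<psi> (restr E' \<eta>) = transp D (restr E \<eta>)"
   unfolding \<xi>(2)[symmetric] restr_restr[OF G(2)] restr_restr[OF G(3)] \<psi>(2)[OF \<xi>(1)] transp_restr[OF \<xi>(1)] ..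
 qed
 also have "... = map_dual A E (transp D) (curry F E)"
  unfolding conv_carD(3)[OF C' A F E G(1,2), symmetric]
  by (rule map_dual_compose[OF A graded_E3 gG rE transp_linear FG, symmetric])
 finally show "t = map_dual A E (transp D) (curry F E)" .
qed

lemma conv_map_component_apply:
 assumes F: "F : car (conv_alg C' A) n" and c: "c : homogeneous D"
 shows "curry (curry (conv_map C C' A \<phi> F) D) c = ev C' F (f c)"
proof -
 obtain m where m: "c : D m" using c by (rule homogeneousE)
 have "curry (map_dual A E (transp D) (curry F E)) c = curry (curry F E) (f c)"
  by (rule map_dual_transpose[OF A graded_E3 transp_linear _ conv_carD(2)[OF C' A F E]]) (simp add: transp_def c)
 also have "... = ev C' F (f c)"
  by (rule ev_eq[OF C' A F E homogeneousI[where V = E, OF fDE[OF m]], symmetric])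
 finally show ?thesis unfolding conv_map_component[OF F] .
qed

lemma conv_part_transp_hom:
 "curved_hom (conv_part C' A E) (conv_part C A D) (map_dual A E (transp D)) (restr D b \<otimes>\<^sub>k unt A)"
 using curved_hom_tensor[OF subcoalgebra_dual_algebra[OF C' sub3'[OF E]] subcoalgebra_dual_algebra[OF C sub3[OF D]] A transp_hom]
 by (simp add: conv_part_def map_dual_def)

end

lemma conv_map_closed:
 assumes F: "F : car (conv_alg C' A) n"
 shows "conv_map C C' A \<phi> F : car (conv_alg C A) n"
proof -
 have "conv_map C C' A \<phi> F = family (fd_subcoalgs C) (curry (conv_map C C' A \<phi> F))"
  unfolding conv_map_def by (rule family_cong) (simp only: curry_family)
 also have "... : car (conv_alg C A) n"
 proof (rule conv_carI[OF C A])
  fix D assume D: "D : fd_subcoalgs C"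
  obtain E where E: "E : fd_subcoalgs C'" "!!m c. c : D m ==> f c : E m" by (rule image_in_fd[OF D]) (rule that)
  have e: "curry (conv_map C C' A \<phi> F) D = map_dual A E (transp D) (curry F E)"
   by (rule conv_map_component[OF D E F])
  have "linear_into (tensor (dual E) (car A) n) (tensor (dual D) (car A) n) (map_dual A E (transp D))"
   by (rule map_dual_linear[OF A subcoalgebra_graded[OF C' sub3'[OF E(1)]] transp_linear[OF D E]])
  from linear_intoD(1)[OF this conv_carD(2)[OF C' A F E(1)]]
  show "curry (conv_map C C' A \<phi> F) D : tensor (dual D) (car A) n" by (simp only: e)
 next
  fix D G c assume DG: "D : fd_subcoalgs C" "G : fd_subcoalgs C" "D <= G" and c: "c : homogeneous D"
  obtain E where E: "E : fd_subcoalgs C'" "!!m c. c : D m ==> f c : E m" by (rule image_in_fd[OF DG(1)]) (rule that)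
  obtain E2 where E2: "E2 : fd_subcoalgs C'" "!!m c. c : G m ==> f c : E2 m" by (rule image_in_fd[OF DG(2)]) (rule that)
  show "curry (curry (conv_map C C' A \<phi> F) G) c = curry (curry (conv_map C C' A \<phi> F) D) c"
   using conv_map_component_apply[OF DG(1) E F c] conv_map_component_apply[OF DG(2) E2 F homogeneous_mono[OF DG(3) c]] by simp
 qed
 finally show ?thesis .
qed

text \<open>The formula by which the kernel and the image of the induced map are determined.\<close>

lemma ev_conv_map:
 assumes F: "F : car (conv_alg C' A) n" and c: "c : homogeneous (ccar C)"
 shows "ev C (conv_map C C' A \<phi> F) c = ev C' F (f c)"
proof -
 obtain D where D: "D : fd_subcoalgs C" "c : homogeneous D" by (rule fd_subcoalg_homogeneous[OF C c])
 obtain E where E: "E : fd_subcoalgs C'" "!!m c. c : D m ==> f c : E m" by (rule image_in_fd[OF D(1)]) (rule that)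
 show ?thesis
  unfolding ev_eq[OF C A conv_map_closed[OF F] D] by (rule conv_map_component_apply[OF D(1) E F D(2)])
qed

text \<open>Each axiom is an equality in the limit and is tested at one component \<open>D\<close>.
  There the map is a transpose tensored with the identity for a suitable \<open>E\<close>, a
  morphism by \<open>conv_part_transp_hom\<close>.\<close>

lemma conv_map_hom: "curved_hom (conv_alg C' A) (conv_alg C A) (conv_map C C' A \<phi>) (conv_shift C A b)"
proof -
 let ?B' = "conv_alg C' A" and ?B = "conv_alg C A" and ?f = "conv_map C C' A \<phi>" and ?b = "conv_shift C A b"
 note B' = conv_algebra[OF C' A] and B = conv_algebra[OF C A]
 have shift: "curry ?b D = restr D b \<otimes>\<^sub>k unt A" if "D : fd_subcoalgs C" for D
  unfolding conv_shift_def by (rule curry_family[OF that])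
 have b: "?b : car ?B 1"
  unfolding conv_shift_emb using emb_closed[OF C A phiD(4) curved_algebraD(5)[OF A]] by simp
 have eqI: "F = G" if "F : car ?B n" "G : car ?B n" "!!D. D : fd_subcoalgs C ==> curry F D = curry G D" for F G n
  using conv_carD(1)[OF C A that(1)] conv_carD(1)[OF C A that(2)] family_cong[of "fd_subcoalgs C" "curry F" "curry G"] that(3) by simp
 have comp: "EX E:fd_subcoalgs C'. curved_hom (conv_part C' A E) (conv_part C A D) (map_dual A E (transp D)) (restr D b \<otimes>\<^sub>k unt A) &
  (ALL n. ALL F:car ?B' n. curry F E : car (conv_part C' A E) n & curry (?f F) D = map_dual A E (transp D) (curry F E))"
  if D: "D : fd_subcoalgs C" for D
 proof -
  obtain E where E: "E : fd_subcoalgs C'" "!!m c. c : D m ==> f c : E m" by (rule image_in_fd[OF D]) (rule that)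
  show ?thesis
   using E(1) conv_part_transp_hom[OF D E] conv_map_component[OF D E] conv_carD(2)[OF C' A _ E(1)]
   by (intro bexI[of _ E]) (auto simp: car_conv_part[OF C' A E(1)])
 qed
 note fc = conv_map_closed
 show ?thesis
 proof (rule curved_homI[OF _ _ _ b])
  show "linear_into (car ?B' n) (car ?B n) ?f" for n
  proof (rule linear_intoI)
   fix F G c assume F: "F : car ?B' n"
   show "?f F : car ?B n" by (rule fc[OF F])
   show "?f (scl c F) = scl c (?f F)"
   proof (rule eqI[OF fc[OF car_closed(3)[OF B' F]] car_closed(3)[OF B fc[OF F]]])
    fix D assume "D : fd_subcoalgs C"
    from comp[OF this] obtain E where E: "curved_hom (conv_part C' A E) (conv_part C A D) (map_dual A E (transp D)) (restr D b \<otimes>\<^sub>k unt A)"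
     "!!n F. F : car ?B' n ==> curry F E : car (conv_part C' A E) n" "!!n F. F : car ?B' n ==> curry (?f F) D = map_dual A E (transp D) (curry F E)" by blast
    show "curry (?f (scl c F)) D = curry (scl c (?f F)) D"
     unfolding E(3)[OF car_closed(3)[OF B' F]] curry_scl E(3)[OF F] by (rule linear_intoD(2)[OF curved_homD(1)[OF E(1)] E(2)[OF F]])
   qed
   assume G: "G : car ?B' n"
   show "?f (F + G) = ?f F + ?f G"
   proof (rule eqI[OF fc[OF car_closed(2)[OF B' F G]] car_closed(2)[OF B fc[OF F] fc[OF G]]])
    fix D assume "D : fd_subcoalgs C"
    from comp[OF this] obtain E where E: "curved_hom (conv_part C' A E) (conv_part C A D) (map_dual A E (transp D)) (restr D b \<otimes>\<^sub>k unt A)"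
     "!!n F. F : car ?B' n ==> curry F E : car (conv_part C' A E) n" "!!n F. F : car ?B' n ==> curry (?f F) D = map_dual A E (transp D) (curry F E)" by blast
    show "curry (?f (F + G)) D = curry (?f F + ?f G) D"
     unfolding E(3)[OF car_closed(2)[OF B' F G]] curry_plus E(3)[OF F] E(3)[OF G]
     by (rule linear_intoD(3)[OF curved_homD(1)[OF E(1)] E(2)[OF F] E(2)[OF G]])
   qed
  qed
  show "?f (mul ?B' F G) = mul ?B (?f F) (?f G)" if F: "F : car ?B' p" and G: "G : car ?B' q" for F G p q
  proof (rule eqI[OF fc[OF mul_closed[OF B' F G]] mul_closed[OF B fc[OF F] fc[OF G]]])
   fix D assume D: "D : fd_subcoalgs C"
   from comp[OF this] obtain E where E: "curved_hom (conv_part C' A E) (conv_part C A D) (map_dual A E (transp D)) (restr D b \<otimes>\<^sub>k unt A)"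
    "!!n F. F : car ?B' n ==> curry F E : car (conv_part C' A E) n" "!!n F. F : car ?B' n ==> curry (?f F) D = map_dual A E (transp D) (curry F E)"
    "E : fd_subcoalgs C'" by blast
   show "curry (?f (mul ?B' F G)) D = curry (mul ?B (?f F) (?f G)) D"
    unfolding E(3)[OF mul_closed[OF B' F G]] conv_mul_component[OF C A D] conv_mul_component[OF C' A E(4)] E(3)[OF F] E(3)[OF G]
    by (rule curved_homD(2)[OF E(1) E(2)[OF F] E(2)[OF G]])
  qed
  show "?f (unt ?B') = unt ?B"
  proof (rule eqI[OF fc[OF curved_algebraD(5)[OF B']] curved_algebraD(5)[OF B]])
   fix D assume D: "D : fd_subcoalgs C"
   from comp[OF this] obtain E where E: "curved_hom (conv_part C' A E) (conv_part C A D) (map_dual A E (transp D)) (restr D b \<otimes>\<^sub>k unt A)"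
    "!!n F. F : car ?B' n ==> curry (?f F) D = map_dual A E (transp D) (curry F E)" "E : fd_subcoalgs C'" by blast
   show "curry (?f (unt ?B')) D = curry (unt ?B) D"
    unfolding E(2)[OF curved_algebraD(5)[OF B']] conv_unt_component[OF C A D] conv_unt_component[OF C' A E(3)] by (rule curved_homD(3)[OF E(1)])
  qed
  show "?f (dif ?B' F) = dif ?B (?f F) + (mul ?B ?b (?f F) - ksign n (mul ?B (?f F) ?b))" if F: "F : car ?B' n" for F n
  proof (rule eqI[OF fc[OF dif_closed[OF B' F]]])
   have "mul ?B ?b (?f F) : car ?B (n + 1)" "mul ?B (?f F) ?b : car ?B (n + 1)"
    using mul_closed[OF B b fc[OF F]] mul_closed[OF B fc[OF F] b] by (simp_all add: add.commute)
   then show "dif ?B (?f F) + (mul ?B ?b (?f F) - ksign n (mul ?B (?f F) ?b)) : car ?B (n + 1)"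
    by (intro car_closed(2)[OF B] car_closed(5)[OF B] car_closed(6)[OF B] dif_closed[OF B] fc[OF F])
   fix D assume D: "D : fd_subcoalgs C"
   from comp[OF this] obtain E where E: "curved_hom (conv_part C' A E) (conv_part C A D) (map_dual A E (transp D)) (restr D b \<otimes>\<^sub>k unt A)"
    "!!n F. F : car ?B' n ==> curry F E : car (conv_part C' A E) n" "!!n F. F : car ?B' n ==> curry (?f F) D = map_dual A E (transp D) (curry F E)"
    "E : fd_subcoalgs C'" by blast
   show "curry (?f (dif ?B' F)) D = curry (dif ?B (?f F) + (mul ?B ?b (?f F) - ksign n (mul ?B (?f F) ?b))) D"
    unfolding E(3)[OF dif_closed[OF B' F]] curry_plus curry_minus curry_ksign conv_mul_component[OF C A D] conv_dif_component[OF C A D]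
     conv_dif_component[OF C' A E(4)] shift[OF D] E(3)[OF F]
    by (rule curved_homD(5)[OF E(1) E(2)[OF F]])
  qed
  show "?f (cur ?B') = cur ?B + dif ?B ?b + mul ?B ?b ?b"
  proof (rule eqI[OF fc[OF curved_algebraD(10)[OF B']]])
   have "dif ?B ?b : car ?B 2" "mul ?B ?b ?b : car ?B 2"
    using dif_closed[OF B b] mul_closed[OF B b b] by simp_all
   then show "cur ?B + dif ?B ?b + mul ?B ?b ?b : car ?B 2"
    by (intro car_closed(2)[OF B] curved_algebraD(10)[OF B])
   fix D assume D: "D : fd_subcoalgs C"
   from comp[OF this] obtain E where E: "curved_hom (conv_part C' A E) (conv_part C A D) (map_dual A E (transp D)) (restr D b \<otimes>\<^sub>k unt A)"
    "!!n F. F : car ?B' n ==> curry (?f F) D = map_dual A E (transp D) (curry F E)" "E : fd_subcoalgs C'" by blast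
   show "curry (?f (cur ?B')) D = curry (cur ?B + dif ?B ?b + mul ?B ?b ?b) D"
    unfolding E(2)[OF curved_algebraD(10)[OF B']] curry_plus conv_mul_component[OF C A D] conv_dif_component[OF C A D] conv_cur_component[OF C A D]
     conv_cur_component[OF C' A E(3)] shift[OF D]
    by (rule curved_homD(6)[OF E(1)])
  qed
 qed
qed

end

section \<open>Graded rings with an inner derivation\<close>

text \<open>
 The derivation is the graded commutator with an element \<open>D\<close> of an ambient ring, whose square is the
 curvature up to an element commuting with \<open>G\<close>. A Maurer-Cartan element \<open>x\<close> then amounts to
 \<open>(D + x)\<^sup>2 = Z\<close>, and the differentials of the Maurer-Cartan dg category are graded commutators
 with \<open>D + x\<close> and \<open>D + y\<close>. The unit \<open>u\<close> of \<open>G\<close> need not be that of the ambient ring.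
\<close>

locale graded_ring =
 fixes G :: "int => 'r::ring_1 set" and u D h Z :: 'r
 assumes G_zero: "!!n. 0 : G n" and G_add: "!!n a b. a : G n ==> b : G n ==> a + b : G n"
  and G_uminus: "!!n a. a : G n ==> - a : G n"
  and G_mult: "!!p q a b. a : G p ==> b : G q ==> a * b : G (p + q)"
  and u: "u : G 0" and ul: "!!n a. a : G n ==> u * a = a" and ur: "!!n a. a : G n ==> a * u = a"
  and uD: "u * D = D" "D * u = D"
  and d_even: "!!n a. even n ==> a : G n ==> D * a - a * D : G (n + 1)"
  and d_odd: "!!n a. odd n ==> a : G n ==> D * a + a * D : G (n + 1)"
  and DD: "D * D = h + Z" and h: "h : G 2" and Z: "!!n a. a : G n ==> Z * a = a * Z" and ZD: "Z * D = D * Z"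
begin

definition gd :: "int => 'r => 'r" where
 "gd n a = (if even n then D * a - a * D else D * a + a * D)"

text \<open>The two-sided differential graded ideals. Scalars are absent because the ring is
  abstract; in the application the scalar multiples of the unit are elements of
  \<open>G 0\<close>.\<close>

definition dgi :: "(int => 'r set) => bool" where
 "dgi K \<longleftrightarrow> (ALL n. K n \<subseteq> G n & 0 : K n & (ALL a:K n. - a : K n & gd n a : K (n + 1) & (ALL b:K n. a + b : K n) &
   (ALL q. ALL r:G q. a * r : K (n + q) & r * a : K (q + n))))"

lemma dgiI:
 assumes "!!n. K n \<subseteq> G n" "!!n. 0 : K n" "!!n a. a : K n ==> - a : K n"
  "!!n a. a : K n ==> gd n a : K (n + 1)" "!!n a b. a : K n ==> b : K n ==> a + b : K n"
  "!!n q a r. a : K n ==> r : G q ==> a * r : K (n + q)" "!!n q a r. a : K n ==> r : G q ==> r * a : K (q + n)"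
 shows "dgi K"
 using assms unfolding dgi_def by simp

lemma dgiD:
 assumes "dgi K"
 shows "!!n a. a : K n ==> a : G n" "!!n. 0 : K n" "!!n a. a : K n ==> - a : K n"
  "!!n a. a : K n ==> gd n a : K (n + 1)" "!!n a b. a : K n ==> b : K n ==> a + b : K n"
  "!!n q a r. a : K n ==> r : G q ==> a * r : K (n + q)" "!!n q a r. a : K n ==> r : G q ==> r * a : K (q + n)"
  "!!n a b. a : K n ==> b : K n ==> a - b : K n"
proof -
 note * = assms[unfolded dgi_def, THEN spec]
 show 1: "a : G n" if "a : K n" for n a using *[of n] that by blast
 show "0 : K n" for n using *[of n] by blast
 show 3: "- a : K n" if "a : K n" for n a using *[of n] that by blast
 show "gd n a : K (n + 1)" if "a : K n" for n a using *[of n] that by blast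
 show 5: "a + b : K n" if "a : K n" "b : K n" for n a b using *[of n] that by blast
 show "a * r : K (n + q)" "r * a : K (q + n)" if "a : K n" "r : G q" for n q a r using *[of n] that by blast+
 show "a - b : K n" if "a : K n" "b : K n" for n a b
  using 5[OF that(1) 3[OF that(2)]] by simp
qed

lemma gd_mult: "gd (p + q) (a * b) = gd p a * b + (if even p then a * gd q b else - (a * gd q b))"
 by (auto simp: gd_def algebra_simps)

lemma gd_closed: "a : G n ==> gd n a : G (n + 1)"
 using d_even d_odd by (auto simp: gd_def)

lemma gd_add: "gd n (a + b) = gd n a + gd n b" and gd_uminus: "gd n (- a) = - gd n a" and gd_zero: "gd n 0 = 0"
 and gd_diff: "gd n (a - b) = gd n a - gd n b"
 by (auto simp: gd_def algebra_simps)

lemma gd_gd: "a : G n ==> gd (n + 1) (gd n a) = h * a - a * h"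
proof -
 assume a: "a : G n"
 have "gd (n + 1) (gd n a) = D * D * a - a * (D * D)"
  by (auto simp: gd_def algebra_simps)
 also have "... = h * a - a * h" using Z[OF a] by (simp add: DD algebra_simps)
 finally show ?thesis .
qed

lemma G_diff: "a : G n ==> b : G n ==> a - b : G n"
 using G_add[of a n "- b"] G_uminus by simp

subsection \<open>The Jacobson radical and minimal ideals\<close>

definition invertible :: "'r => bool" where
 "invertible a \<longleftrightarrow> (EX t:G 0. a * t = u & t * a = u)"

text \<open>If \<open>t\<close> is the inverse of 1 - ab, then 1 + b t a is the inverse of 1 -
  ba.\<close>

lemma invertible_swap:
 assumes a: "a : G p" and b: "b : G (- p)" and inv: "invertible (u - a * b)"
 shows "invertible (u - b * a)"
proof -
 obtain t where t: "t : G 0" "(u - a * b) * t = u" "t * (u - a * b) = u"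
  using inv by (auto simp: invertible_def)
 have t1: "a * b * t = t - u" "t * (a * b) = t - u"
  using t(2,3) ul[OF t(1)] ur[OF t(1)] by (simp_all add: algebra_simps)
 have "b * (a * b * t) * a = b * (t - u) * a" "b * (t * (a * b)) * a = b * (t - u) * a"
  unfolding t1 by (rule refl)+
 then have t2: "b * a * (b * t * a) = b * t * a - b * a" "b * t * a * (b * a) = b * t * a - b * a"
  using ur[OF b] by (simp_all add: algebra_simps)
 have bta: "b * t * a : G 0" and ba: "b * a : G 0"
  using G_mult[OF G_mult[OF b t(1)] a] G_mult[OF b a] by simp_all
 show ?thesis
  unfolding invertible_def
 proof (intro bexI conjI)
  show "u + b * t * a : G 0" by (rule G_add[OF u bta])
  show "(u - b * a) * (u + b * t * a) = u"
   using t2(1) ul[OF u] ul[OF bta] ur[OF ba] by (simp add: algebra_simps)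
  show "(u + b * t * a) * (u - b * a) = u"
   using t2(2) ul[OF u] ur[OF bta] ul[OF ba] by (simp add: algebra_simps)
 qed
qed

lemma invertible_mult:
 assumes "invertible a" "invertible b" "a : G 0" "b : G 0"
 shows "invertible (a * b)"
proof -
 obtain s t where s: "s : G 0" "a * s = u" "s * a = u" and t: "t : G 0" "b * t = u" "t * b = u"
  using assms(1,2) by (auto simp: invertible_def)
 have "a * b * (t * s) = a * (b * t) * s" "t * s * (a * b) = t * (s * a) * b" by (simp_all add: mult.assoc)
 then show ?thesis
  unfolding invertible_def using s t ur[OF assms(3)] ur[OF t(1)] G_mult[OF t(1) s(1)] by (intro bexI[of _ "t * s"]) auto
qed

lemma invertible_nilpotent:
 assumes a: "a : G 0" and nil: "a ^ Suc m = 0"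
 shows "invertible (u - a)"
proof -
 \<comment> \<open>The geometric series. The exponents start at 1, because \<open>a ^ 0\<close> is
   the unit of the ambient ring and not \<open>u\<close>.\<close>
 have "EX t:G 0. (u - a) * t = u - a ^ Suc m & t * (u - a) = u - a ^ Suc m" for m
 proof (induction m)
  case 0
  then show ?case using u ul[OF u] ul[OF a] ur[OF a] by (intro bexI[of _ u]) (simp_all add: algebra_simps)
 next
  case (Suc m)
  then obtain t where t: "t : G 0" "(u - a) * t = u - a ^ Suc m" "t * (u - a) = u - a ^ Suc m" by blast
  have "(u - a) * a = a * (u - a)" using ul[OF a] ur[OF a] by (simp add: algebra_simps)
  then have "(u - a) * (a * t) = a * (u - a ^ Suc m)" using t(2) by (metis mult.assoc)
  moreover have "a * t * (u - a) = a * (u - a ^ Suc m)" using t(3) by (simp add: mult.assoc)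
  moreover have "(u - a) * u = u - a" "u * (u - a) = u - a" using ul[OF u] ur[OF a] ul[OF a] by (simp_all add: algebra_simps)
  moreover have "a * (u - a ^ Suc m) = a - a ^ Suc (Suc m)" using ur[OF a] by (simp add: algebra_simps)
  moreover have "u + a * t : G 0" using G_add[OF u] G_mult[OF a t(1)] by simp
  ultimately show ?case by (intro bexI[of _ "u + a * t"]) (simp_all add: distrib_left distrib_right)
 qed
 from this[of m] show ?thesis using nil by (simp add: invertible_def)
qed

text \<open>The part of the graded Jacobson radical of \<open>G\<close> that lies in
  \<open>K\<close>, described by quasi-regularity.\<close>

definition radical :: "(int => 'r set) => int => 'r set" where
 "radical K n = {z : K n. ALL r:G (- n). invertible (u - z * r)}"

lemma radical_ideal:
 assumes K: "dgi K"
 shows "!!n. 0 : radical K n" "!!n a. a : radical K n ==> - a : radical K n"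
  "!!n a b. a : radical K n ==> b : radical K n ==> a + b : radical K n"
  "!!n q a r. a : radical K n ==> r : G q ==> a * r : radical K (n + q)"
  "!!n q a r. a : radical K n ==> r : G q ==> r * a : radical K (q + n)"
proof -
 note KD = dgiD[OF K]
 have iu: "invertible u" unfolding invertible_def using u ul[OF u] by blast
 fix n q a b r
 show "0 : radical K n" using KD(2) iu by (simp add: radical_def)
 show "- a : radical K n" if "a : radical K n"
 proof -
  have "invertible (u - - a * r)" if "r : G (- n)" for r
   using \<open>a : _\<close> G_uminus[OF that] by (auto simp: radical_def dest!: bspec[of _ _ "- r"])
  then show ?thesis using that KD(3) by (simp add: radical_def)
 qed
 show "a * r : radical K (n + q)" if "a : radical K n" "r : G q"
 proof -
  have "invertible (u - a * r * s)" if "s : G (- (n + q))" for s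
  proof -
   have "r * s : G (- n)" using G_mult[OF \<open>r : _\<close> that] by simp
   then show ?thesis using \<open>a : _\<close> by (simp add: radical_def mult.assoc)
  qed
  then show ?thesis using that KD(6) by (simp add: radical_def)
 qed
 show "r * a : radical K (q + n)" if ar: "a : radical K n" "r : G q"
 proof -
  have "invertible (u - r * a * s)" if s: "s : G (- (q + n))" for s
  proof -
   have "s * r : G (- n)" using G_mult[OF s ar(2)] by simp
   then have i: "invertible (u - (a * s) * r)" using ar(1) by (simp add: radical_def mult.assoc)
   have "a * s : G (- q)" using G_mult[OF KD(1)[of a n] s] ar(1) by (simp add: radical_def)
   from invertible_swap[OF this _ i] show ?thesis using ar(2) by (simp add: mult.assoc)
  qed
  then show ?thesis using ar KD(7) by (simp add: radical_def)
 qed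
 show "a + b : radical K n" if ab: "a : radical K n" "b : radical K n"
 proof -
  have aG: "a : G n" "b : G n" using ab KD(1) by (auto simp: radical_def)
  have "invertible (u - (a + b) * r)" if r: "r : G (- n)" for r
  proof -
   have i: "invertible (u - a * r)" using ab(1) r by (simp add: radical_def)
   then obtain t where t: "t : G 0" "(u - a * r) * t = u" by (auto simp: invertible_def)
   have br: "b * r : G 0" and ar: "a * r : G 0" using G_mult[OF aG(2) r] G_mult[OF aG(1) r] by simp_all
   have "r * t : G (- n)" using G_mult[OF r t(1)] by simp
   then have "invertible (u - (b * r) * t)" using ab(2) by (simp add: radical_def mult.assoc)
   then have j: "invertible (u - t * (b * r))" by (rule invertible_swap[of _ 0, rotated 2]) (use br t(1) in simp_all)
   have tbr: "t * (b * r) : G 0" using G_mult[OF t(1) br] by simp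
   \<comment> \<open>With \<open>t\<close> inverse to 1 - ar, the factorization 1 - (a + b) r = (1 -
     ar)(1 - t b r) reduces the sum to two invertible factors.\<close>
   have "(u - a * r) * (u - t * (b * r)) = (u - a * r) * u - ((u - a * r) * t) * (b * r)"
    by (simp add: algebra_simps)
   also have "... = u - (a + b) * r"
    unfolding t(2) using ul[OF br] ur[OF ar] ul[OF u] by (simp add: algebra_simps)
   finally show ?thesis
    using invertible_mult[OF i j G_diff[OF u ar] G_diff[OF u tbr]] by simp
  qed
  then show ?thesis using ab KD(5) by (simp add: radical_def)
 qed
qed

text \<open>A common notion for both sides, so that a single length function \<mu> controls chains
  of left and of right ideals. Only the action of \<open>G 0\<close> is demanded: it contains the
  scalars, which is what counting dimensions requires.\<close>

definition left_or_right_module :: "(int => 'r set) => bool" where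
 "left_or_right_module W \<longleftrightarrow> (ALL n. 0 : W n & (ALL a:W n. ALL b:W n. a + b : W n)) &
   ((ALL n. ALL a:W n. ALL r:G 0. a * r : W n) | (ALL n. ALL a:W n. ALL r:G 0. r * a : W n))"

text \<open>
 The descending chains of the one-sided ideals generated by the powers of \<open>a\<close> stop. From
 \<open>x = x\<^sup>2 s = t x\<^sup>2\<close> for a power \<open>x\<close> of \<open>a\<close>, the idempotent is \<open>x s = t x\<close>.
\<close>

lemma fitting_idempotent:
 fixes \<mu> :: "(int => 'r set) => nat"
 assumes K: "dgi K"
  and \<mu>: "!!W W'. left_or_right_module W ==> left_or_right_module W' ==> (!!n. W n \<subseteq> W' n) ==> (!!n. W' n \<subseteq> K n) ==>
    W ~= W' ==> \<mu> W < \<mu> W'"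
  and a: "a : K 0"
 obtains m s where "s : G 0" "a ^ Suc m * s * (a ^ Suc m * s) = a ^ Suc m * s" "a ^ Suc m * (a ^ Suc m * s) = a ^ Suc m"
  "a ^ Suc m : K 0"
proof -
 note KD = dgiD[OF K]
 have aG: "a : G 0" by (rule KD(1)[OF a])
 have pK: "a ^ Suc j : K 0" for j
 proof (induction j)
  case (Suc j)
  then show ?case using KD(7)[OF Suc aG] by simp
 qed (use a in simp)
 have pG: "a ^ Suc j : G 0" for j by (rule KD(1)[OF pK])
 have stable: "EX i. ALL j>=i. W j = W i"
  if W: "!!i. left_or_right_module (W i)" "!!i n. W (Suc i) n \<subseteq> W i n" "!!i n. W i n \<subseteq> K n" for W
 proof -
  obtain i where i: "!!j. \<mu> (W i) <= \<mu> (W j)" using ex_has_least_nat[of "%_. True" 0 "%i. \<mu> (W i)"] by blast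
  have "W j = W i" if "i <= j" for j
  proof (rule ccontr)
   assume ne: "W j ~= W i"
   have "W j n \<subseteq> W i n" for n using lift_Suc_antimono_le[of "%i. W i n", OF W(2) that] .
   then have "\<mu> (W j) < \<mu> (W i)" by (intro \<mu> W ne)
   then show False using i[of j] by simp
  qed
  then show ?thesis by blast
 qed
 let ?R = "%i (n::int). if n = 0 then {a ^ Suc i * r |r. r : G 0} else {0}"
 let ?L = "%i (n::int). if n = 0 then {r * a ^ Suc i |r. r : G 0} else {0}"
 have mod1: "left_or_right_module (?R i)" for i
  unfolding left_or_right_module_def
 proof (intro conjI allI ballI disjI1)
  fix n b c r
  show "0 : ?R i n" using G_zero by (auto intro!: exI[of _ 0])
  show "b + c : ?R i n" if "b : ?R i n" "c : ?R i n"
   using that G_add by (auto simp: distrib_left[symmetric] simp del: power_Suc split: if_splits)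
  show "b * r : ?R i n" if "b : ?R i n" "r : G 0"
   using that G_mult[of _ 0 r 0] by (auto simp: mult.assoc simp del: power_Suc split: if_splits)
 qed
 have dec1: "?R (Suc i) n \<subseteq> ?R i n" for i n
  using G_mult[OF aG, of _ 0] by (auto simp: power_Suc2[of a "Suc i"] mult.assoc simp del: power_Suc)
 have sub1: "?R i n \<subseteq> K n" for i n using KD(6)[OF pK, of _ 0] KD(2) by (auto simp del: power_Suc)
 obtain i1 where i1: "ALL j>=i1. ?R j = ?R i1" by (rule exE[OF stable[of ?R, OF mod1 dec1 sub1]]) (rule that)
 have mod2: "left_or_right_module (?L i)" for i
  unfolding left_or_right_module_def
 proof (intro conjI allI ballI disjI2)
  fix n b c r
  show "0 : ?L i n" using G_zero by (auto intro!: exI[of _ 0])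
  show "b + c : ?L i n" if "b : ?L i n" "c : ?L i n"
   using that G_add by (auto simp: distrib_right[symmetric] simp del: power_Suc split: if_splits)
  show "r * b : ?L i n" if "b : ?L i n" "r : G 0"
   using that G_mult[of r 0 _ 0] by (auto simp: mult.assoc[symmetric] simp del: power_Suc split: if_splits)
 qed
 have dec2: "?L (Suc i) n \<subseteq> ?L i n" for i n
  using G_mult[OF _ aG, of _ 0] by (auto simp: power_Suc[of a "Suc i"] mult.assoc[symmetric] simp del: power_Suc)
 have sub2: "?L i n \<subseteq> K n" for i n using KD(7)[OF pK, of _ 0] KD(2) by (auto simp del: power_Suc)
 obtain i2 where i2: "ALL j>=i2. ?L j = ?L i2" by (rule exE[OF stable[of ?L, OF mod2 dec2 sub2]]) (rule that)
 \<comment> \<open>From \<open>m\<close> on both chains are constant, and \<open>x * x\<close> is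
   the power with index \<open>Suc (m + m)\<close>; so \<open>x\<close> and its square generate the
   same left and the same right ideal.\<close>
 define m x where "m = i1 + i2" and "x = a ^ Suc m"
 have xK: "x : K 0" and xG: "x : G 0" using pK pG by (simp_all add: x_def del: power_Suc)
 have xx: "a ^ Suc (Suc (m + m)) = x * x" unfolding x_def by (simp only: power_add[symmetric] add_Suc add_Suc_right)
 have "?R m = ?R (Suc (m + m))" "?L m = ?L (Suc (m + m))"
  using i1[rule_format, of m] i1[rule_format, of "Suc (m + m)"] i2[rule_format, of m] i2[rule_format, of "Suc (m + m)"]
  by (simp_all add: m_def)
 from this[THEN fun_cong, of 0]
 have eq: "{x * r |r. r : G 0} = {x * x * r |r. r : G 0}" "{r * x |r. r : G 0} = {r * (x * x) |r. r : G 0}"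
  unfolding xx x_def[symmetric] by simp_all
 have "x : {x * r |r. r : G 0}" "x : {r * x |r. r : G 0}" using ur[OF xG] ul[OF xG] u by force+
 then obtain s t where s: "s : G 0" "x * x * s = x" and t: "t : G 0" "t * (x * x) = x"
  unfolding eq by auto
 have tx: "t * x = x * s"
 proof -
  have "t * x = t * (x * x * s)" by (simp add: s(2))
  also have "... = t * (x * x) * s" by (simp add: mult.assoc)
  finally show ?thesis by (simp add: t(2))
 qed
 have "x * s * (x * s) = t * (x * x) * s" by (simp add: mult.assoc flip: tx)
 then have "x * s * (x * s) = x * s" by (simp add: t(2))
 moreover have "x * (x * s) = x" using s(2) by (simp add: mult.assoc)
 ultimately show thesis using that[of s m] s(1) xK unfolding x_def by blast
qed

text \<open>
 A minimal differential ideal of finite length is either square zero or unital. The argument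
 compares it with the Jacobson radical \<open>Q\<close>: the elements of \<open>Q\<close> with differential in \<open>Q\<close> form a
 differential ideal, because the square of the derivation is inner.
\<close>

lemma minimal_ideal_dichotomy:
 fixes \<mu> :: "(int => 'r set) => nat"
 assumes K: "dgi K"
  and min: "!!X. dgi X ==> (!!n. X n \<subseteq> K n) ==> (ALL n. X n \<subseteq> {0}) | (ALL n. X n = K n)"
  and \<mu>: "!!W W'. left_or_right_module W ==> left_or_right_module W' ==> (!!n. W n \<subseteq> W' n) ==> (!!n. W' n \<subseteq> K n) ==>
    W ~= W' ==> \<mu> W < \<mu> W'"
 shows "(ALL p q. ALL a:K p. ALL b:K q. a * b = 0) | (EX e:K 0. ALL n. ALL z:K n. e * z = z & z * e = z)"
proof -
 note KD = dgiD[OF K]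
 \<comment> \<open>The right annihilator of \<open>e\<close> in \<open>K 0\<close>, a right module.
   An idempotent for which it is as small as possible is the candidate for the unit.\<close>
 let ?U = "%e n. if n = 0 then {z : K 0. e * z = 0} else {0}"
 let ?Q = "radical K"
 note QD = radical_ideal[OF K]
 have QK: "a : K n" if "a : ?Q n" for a n using that by (simp add: radical_def)
 have U_module: "left_or_right_module (?U e)" for e
  unfolding left_or_right_module_def using KD(2,5) KD(6)[of _ 0 _ 0] by (auto simp: distrib_left mult.assoc[symmetric])
 obtain e where e: "e : K 0" "e * e = e" and e_min: "!!e'. e' : K 0 ==> e' * e' = e' ==> \<mu> (?U e) <= \<mu> (?U e')"
 proof -
  have "EX e. (e : K 0 & e * e = e) & (ALL e'. e' : K 0 & e' * e' = e' --> \<mu> (?U e) <= \<mu> (?U e'))"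
   using ex_has_least_nat[of "%e. e : K 0 & e * e = e" 0 "%e. \<mu> (?U e)"] KD(2) by simp
  then show thesis using that by blast
 qed
 have eG: "e : G 0" by (rule KD(1)[OF e(1)])
 have no_idem: "f = 0" if f: "f : K 0" "f * f = f" "e * f = 0" for f
 proof (rule ccontr)
  assume "f ~= 0"
  \<comment> \<open>This is an idempotent with e e' = e and e' f = f, so its right annihilator is
    properly contained in that of \<open>e\<close>.\<close>
  define e' where "e' = e + f - f * e"
  have fe: "f * e : K 0" using KD(6)[OF f(1) eG] by simp
  have e'K: "e' : K 0" unfolding e'_def by (intro KD(5,8) e(1) f(1) fe)
  have r: "f * (f * b) = f * b" "e * (f * b) = 0" "e * (e * b) = e * b" for b
   using f(2,3) e(2) by (simp_all add: mult.assoc[symmetric])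
  have "e' * e' = e'" unfolding e'_def using f e(2) by (simp add: algebra_simps r)
  then have le: "\<mu> (?U e) <= \<mu> (?U e')" by (rule e_min[OF e'K])
  have ee': "e * e' = e" unfolding e'_def using f(3) e(2) by (simp add: algebra_simps r)
  have "?U e' n \<subseteq> ?U e n" for n
  proof -
   have "e * z = 0" if "e' * z = 0" for z
   proof -
    have "e * z = e * (e' * z)" by (simp add: ee' mult.assoc[symmetric])
    then show ?thesis using that by simp
   qed
   then show ?thesis by auto
  qed
  moreover have "?U e n \<subseteq> K n" for n using KD(2) by auto
  moreover have "f : ?U e 0" "f ~: ?U e' 0"
   using f \<open>f ~= 0\<close> by (auto simp: e'_def algebra_simps r)
  then have "?U e' ~= ?U e" by metis
  ultimately have "\<mu> (?U e') < \<mu> (?U e)" by (intro \<mu> U_module)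
  then show False using le by simp
 qed
 \<comment> \<open>What \<open>e\<close> kills by left multiplication lies in the radical: for a = z
   r the Fitting idempotent is killed by \<open>e\<close> as well, hence it is zero, and then
   \<open>a\<close> is nilpotent.\<close>
 have U_Q: "z : ?Q n" if z: "z : K n" "e * z = 0" for z n
 proof -
  have "invertible (u - z * r)" if r: "r : G (- n)" for r
  proof -
   define a where "a = z * r"
   have aK: "a : K 0" using KD(6)[OF z(1) r] by (simp add: a_def)
   have ea: "e * a = 0" using z(2) by (simp add: a_def mult.assoc[symmetric])
   have aG: "a : G 0" by (rule KD(1)[OF aK])
   obtain m s where s: "s : G 0" "a ^ Suc m * s * (a ^ Suc m * s) = a ^ Suc m * s" "a ^ Suc m * (a ^ Suc m * s) = a ^ Suc m"
    "a ^ Suc m : K 0"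
    by (rule fitting_idempotent[OF K \<mu> aK])
   define f where "f = a ^ Suc m * s"
   have fK: "f : K 0" unfolding f_def using KD(6)[OF s(4) s(1)] by simp
   have "f * f = f" using s(2) by (simp only: f_def)
   moreover have "e * f = 0" using ea by (simp add: f_def mult.assoc[symmetric])
   ultimately have "f = 0" using no_idem[OF fK] by blast
   then have "a ^ Suc m = 0" using s(3) unfolding f_def by simp
   then show ?thesis using invertible_nilpotent[OF aG] by (simp add: a_def)
  qed
  then show ?thesis using z(1) by (simp add: radical_def)
 qed
 define P where "P n = {a : ?Q n. gd n a : ?Q (n + 1)}" for n
 have Pdgi: "dgi P"
 proof (rule dgiI)
  fix n q a b r
  show "P n \<subseteq> G n" using QK KD(1) by (auto simp: P_def)
  show "0 : P n" using QD(1) by (simp add: P_def gd_zero)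
  show "- a : P n" if "a : P n" using that QD(2) by (simp add: P_def gd_uminus)
  show "a + b : P n" if "a : P n" "b : P n" using that QD(3) by (simp add: P_def gd_add)
  show "gd n a : P (n + 1)" if a: "a : P n"
  proof -
   have aQ: "a : ?Q n" and aG: "a : G n" using a QK KD(1) by (auto simp: P_def)
   have "h * a + - (a * h) : ?Q (n + 1 + 1)"
    using QD(3)[OF QD(5)[OF aQ h] QD(2)[OF QD(4)[OF aQ h, unfolded add.commute[of n]]]] by (simp add: add.commute)
   then show ?thesis using a by (simp add: P_def gd_gd[OF aG])
  qed
  show "a * r : P (n + q)" if ar: "a : P n" "r : G q"
  proof -
   have aQ: "a : ?Q n" "gd n a : ?Q (n + 1)" using ar by (auto simp: P_def)
   have "gd n a * r : ?Q (n + q + 1)" "a * gd q r : ?Q (n + q + 1)"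
    using QD(4)[OF aQ(2) ar(2)] QD(4)[OF aQ(1) gd_closed[OF ar(2)]] by (simp_all add: algebra_simps)
   then show ?thesis using QD(4)[OF aQ(1) ar(2)] QD(2,3) by (simp add: P_def gd_mult)
  qed
  show "r * a : P (q + n)" if ar: "a : P n" "r : G q"
  proof -
   have aQ: "a : ?Q n" "gd n a : ?Q (n + 1)" using ar by (auto simp: P_def)
   have "gd q r * a : ?Q (q + n + 1)" "r * gd n a : ?Q (q + n + 1)"
    using QD(5)[OF aQ(2) ar(2)] QD(5)[OF aQ(1) gd_closed[OF ar(2)]] by (simp_all add: algebra_simps)
   then show ?thesis using QD(5)[OF aQ(1) ar(2)] QD(2,3) by (simp add: P_def gd_mult)
  qed
 qed
 have "(ALL n. P n \<subseteq> {0}) | (ALL n. P n = K n)"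
  by (rule min[OF Pdgi]) (auto simp: P_def radical_def)
 then show ?thesis
 proof
  assume P0: "ALL n. P n \<subseteq> {0}"
  \<comment> \<open>The differential of p - e p is (dp - e dp) - (de) p. The first part is killed by
    \<open>e\<close> and the second lies in the ideal \<open>?Q\<close>, so p - e p belongs to
    \<open>P\<close>, which is zero.\<close>
  have eQ: "e * p = p" if p: "p : ?Q n" for p n
  proof -
   have pG: "p : G n" and pK: "p : K n" using p QK KD(1) by auto
   have dK: "gd n p : K (n + 1)" by (rule KD(4)[OF pK])
   have edK: "gd 0 e : G 1" using gd_closed[OF eG] by simp
   have "gd n (p - e * p) = (gd n p - e * gd n p) + - (gd 0 e * p)"
    using gd_mult[of 0 n e p] by (simp add: gd_diff)
   moreover have "gd n p - e * gd n p : ?Q (n + 1)"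
   proof (rule U_Q)
    show "gd n p - e * gd n p : K (n + 1)" using KD(8)[OF dK] KD(7)[OF dK eG] by simp
    show "e * (gd n p - e * gd n p) = 0" using e(2) by (simp add: algebra_simps mult.assoc[symmetric])
   qed
   moreover have "gd 0 e * p : ?Q (n + 1)" using QD(5)[OF p edK] by (simp add: add.commute)
   ultimately have "gd n (p - e * p) : ?Q (n + 1)" using QD(3)[OF _ QD(2)] by metis
   moreover have "p + - (e * p) : ?Q n" using QD(3)[OF p QD(2)[OF QD(5)[OF p eG, simplified]]] .
   ultimately have "p - e * p : P n" by (simp add: P_def)
   then have "p - e * p = 0" using P0 by blast
   then show ?thesis by simp
  qed
  have el: "e * z = z" if z: "z : K n" for z n
  proof -
   have e0: "e * (z - e * z) = 0" using e(2) by (simp add: algebra_simps mult.assoc[symmetric])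
   have "z - e * z : ?Q n"
    by (rule U_Q[OF _ e0]) (use KD(8)[OF z] KD(7)[OF z eG] in simp)
   then have "e * (z - e * z) = z - e * z" by (rule eQ)
   then show ?thesis using e0 by simp
  qed
  \<comment> \<open>The elements of \<open>K\<close> annihilating \<open>K\<close> by left
    multiplication. Since \<open>e\<close> is a left unit, all z - z e are among them; so if
    \<open>A\<close> is zero, \<open>e\<close> is also a right unit, and if \<open>A\<close> is
    everything, \<open>K\<close> has square zero.\<close>
  define A where "A n = {z : K n. ALL m. ALL w:K m. z * w = 0}" for n
  have "dgi A"
  proof (rule dgiI)
   fix n q a b r
   show "gd n a : A (n + 1)" if a: "a : A n"
   proof -
    have "gd n a * w = 0" if w: "w : K m" for w m
    proof -
     have "a * w = 0" "a * gd m w = 0" using a w KD(4)[OF w] by (auto simp: A_def)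
     then show ?thesis using gd_mult[of n m a w] by (simp add: gd_zero split: if_splits)
    qed
    then show ?thesis using a KD(4) by (simp add: A_def)
   qed
   show "a * r : A (n + q)" if "a : A n" "r : G q"
   proof -
    have "a * (r * w) = 0" if "w : K m" for m w
     using \<open>a : A n\<close> KD(7)[OF that \<open>r : G q\<close>] by (auto simp: A_def)
    then show ?thesis using that KD(6) by (simp add: A_def mult.assoc)
   qed
   show "r * a : A (q + n)" if "a : A n" "r : G q"
    using that KD(7) by (auto simp: A_def mult.assoc)
  qed (use KD in \<open>auto simp: A_def distrib_right\<close>)
  then have "(ALL n. A n \<subseteq> {0}) | (ALL n. A n = K n)" by (rule min) (auto simp: A_def)
  then show ?thesis
  proof
   assume A0: "ALL n. A n \<subseteq> {0}"
   have "z * e = z" if z: "z : K n" for z n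
   proof -
    have "(z - z * e) * w = 0" if "w : K m" for w m
     using el[OF that] by (simp add: algebra_simps)
    moreover have "z - z * e : K n" using KD(8)[OF z] KD(6)[OF z eG] by simp
    ultimately have "z - z * e : A n" by (simp add: A_def)
    then have "z - z * e = 0" using A0 by blast
    then show ?thesis by simp
   qed
   then show ?thesis using el e(1) by blast
  next
   assume "ALL n. A n = K n"
   then have "a * b = 0" if "a : K p" "b : K q" for a b p q
    using that by (auto simp: A_def)
   then show ?thesis by blast
  qed
 next
  assume PK: "ALL n. P n = K n"
  then have KQ: "a : ?Q n" if "a : K n" for a n using that by (auto simp: P_def)
  show ?thesis
  proof (cases "EX n. EX w:K n. w ~= 0")
   case False
   then have "a * b = 0" if "a : K p" "b : K q" for a b p q using that by (metis mult_zero_left)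
   then show ?thesis by blast
  next
   case True
   \<comment> \<open>The left ideal generated by a vector of \<open>K\<close>, paired with its
     degree. A nonzero generator whose ideal is as small as possible is chosen.\<close>
   let ?L = "%x n. {r * snd x |r. r : G (n - fst x)}"
   have L_module: "left_or_right_module (?L x)" for x
    unfolding left_or_right_module_def
   proof (intro conjI allI ballI disjI2)
    fix n a b r
    show "0 : ?L x n" using G_zero by (auto intro!: exI[of _ 0])
    show "a + b : ?L x n" if "a : ?L x n" "b : ?L x n"
     using that G_add distrib_right by (smt (verit, ccfv_threshold) mem_Collect_eq)
    show "r * a : ?L x n" if "a : ?L x n" "r : G 0"
     using that G_mult[of r 0 _ "n - fst x"] by (auto simp: mult.assoc[symmetric])
   qed
   obtain n\<^sub>0 w where w: "w : K n\<^sub>0" "w ~= 0"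
    and w_min: "!!n' w'. w' : K n' ==> w' ~= 0 ==> \<mu> (?L (n\<^sub>0, w)) <= \<mu> (?L (n', w'))"
   proof -
    obtain n1 w1 where "w1 : K n1" "w1 ~= 0" using True by blast
    then have "EX x. (snd x : K (fst x) & snd x ~= 0) & (ALL y. snd y : K (fst y) & snd y ~= 0 --> \<mu> (?L x) <= \<mu> (?L y))"
     using ex_has_least_nat[of "%x. snd x : K (fst x) & snd x ~= 0" "(n1, w1)" "%x. \<mu> (?L x)"] by simp
    then obtain x where x: "snd x : K (fst x)" "snd x ~= 0" "!!y. snd y : K (fst y) ==> snd y ~= 0 ==> \<mu> (?L x) <= \<mu> (?L y)"
     by blast
    show thesis
    proof (rule that[of "snd x" "fst x"])
     show "\<mu> (?L (fst x, snd x)) <= \<mu> (?L (n', w'))" if "w' : K n'" "w' ~= 0" for n' w'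
      using x(3)[of "(n', w')"] that by simp
    qed (use x in auto)
   qed
   have wG: "w : G n\<^sub>0" by (rule KD(1)[OF w(1)])
   \<comment> \<open>Nakayama's argument: otherwise p w generates the same ideal as \<open>w\<close>
     by minimality, so w = r p w, whereas 1 - r p is invertible because \<open>K\<close> lies in the
     radical.\<close>
   have pw: "p * w = 0" if p: "p : K k" for p k
   proof (rule ccontr)
    assume ne: "p * w ~= 0"
    have pG: "p : G k" by (rule KD(1)[OF p])
    have pwK: "p * w : K (k + n\<^sub>0)" by (rule KD(7)[OF w(1) pG])
    have "?L (k + n\<^sub>0, p * w) n \<subseteq> ?L (n\<^sub>0, w) n" for n
    proof
     fix y assume "y : ?L (k + n\<^sub>0, p * w) n"
     then obtain r where r: "y = r * (p * w)" "r : G (n - (k + n\<^sub>0))" by auto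
     have "r * p : G (n - n\<^sub>0)" using G_mult[OF r(2) pG] by simp
     then show "y : ?L (n\<^sub>0, w) n" using r(1) by (auto simp: mult.assoc[symmetric])
    qed
    moreover have "?L (n\<^sub>0, w) n \<subseteq> K n" for n
     using KD(7)[OF w(1), of _ "n - n\<^sub>0"] by auto
    ultimately have "?L (k + n\<^sub>0, p * w) = ?L (n\<^sub>0, w)"
     using \<mu>[OF L_module L_module, of "(k + n\<^sub>0, p * w)" "(n\<^sub>0, w)"] w_min[OF pwK ne] by (meson not_less)
    moreover have "w : ?L (n\<^sub>0, w) n\<^sub>0" using ul[OF wG] u by (auto intro!: exI[of _ u])
    ultimately have "w : ?L (k + n\<^sub>0, p * w) n\<^sub>0" by metis
    then obtain r where r: "r : G (- k)" "w = r * (p * w)" by auto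
    have "invertible (u - p * r)" using KQ[OF p] r(1) by (simp add: radical_def)
    then have "invertible (u - r * p)" by (rule invertible_swap[OF pG r(1)])
    then obtain t where t: "t : G 0" "t * (u - r * p) = u" by (auto simp: invertible_def)
    have "(u - r * p) * w = 0" using ul[OF wG] by (simp add: left_diff_distrib mult.assoc flip: r(2))
    moreover have "u * w = t * ((u - r * p) * w)" by (simp only: mult.assoc[symmetric] t(2))
    ultimately show False using ul[OF wG] w(2) by simp
   qed
   \<comment> \<open>The element \<open>w\<close> is killed by left multiplication with all of
     \<open>K\<close>, so this differential ideal is not zero and equals \<open>K\<close> by
     minimality.\<close>
   define A where "A n = {z : K n. ALL m. ALL w:K m. w * z = 0}" for n
   have "dgi A"
   proof (rule dgiI)
    fix n q a b r
    show "gd n a : A (n + 1)" if a: "a : A n"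
    proof -
     have "w * gd n a = 0" if w: "w : K m" for w m
     proof -
      have "w * a = 0" "gd m w * a = 0" using a w KD(4)[OF w] by (auto simp: A_def)
      then show ?thesis using gd_mult[of m n w a] by (simp add: gd_zero split: if_splits)
     qed
     then show ?thesis using a KD(4) by (simp add: A_def)
    qed
    show "a * r : A (n + q)" if "a : A n" "r : G q"
     using that KD(6) by (auto simp: A_def mult.assoc[symmetric])
    show "r * a : A (q + n)" if "a : A n" "r : G q"
    proof -
     have "w * r * a = 0" if "w : K m" for m w
      using \<open>a : A n\<close> KD(6)[OF that \<open>r : G q\<close>] by (auto simp: A_def)
     then show ?thesis using that KD(7) by (simp add: A_def mult.assoc)
    qed
   qed (use KD in \<open>auto simp: A_def distrib_left\<close>)
   then have "(ALL n. A n \<subseteq> {0}) | (ALL n. A n = K n)" by (rule min) (auto simp: A_def)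
   moreover have "w : A n\<^sub>0" using w(1) pw by (simp add: A_def)
   ultimately have "ALL n. A n = K n" using w(2) by blast
   then have "a * b = 0" if "a : K p" "b : K q" for a b p q
    using that by (auto simp: A_def)
   then show ?thesis by blast
  qed
 qed
qed

subsection \<open>Lifting homotopy equivalences\<close>

text \<open>
 Modulo \<open>K\<close>, \<open>g\<close> is a closed morphism from \<open>x\<close> to \<open>y\<close> with right homotopy inverse \<open>(g', v)\<close> and
 left homotopy inverse \<open>(g'', w)\<close>. Keeping the two inverses apart makes the lifting problems for
 them independent, so that no higher coherences are needed.
\<close>

definition equivalence_mod ::
 "(int => 'r set) => 'r => 'r => 'r => 'r => 'r => 'r => 'r => bool" where
 "equivalence_mod K x y g g' v g'' w \<longleftrightarrow>
   (D + y) * (D + y) - Z : K 2 & (D + y) * g - g * (D + x) : K 1 &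
   (D + x) * g' - g' * (D + y) : K 1 & g * g' - u - ((D + y) * v + v * (D + y)) : K 0 &
   (D + x) * g'' - g'' * (D + y) : K 1 & g'' * g - u - ((D + x) * w + w * (D + x)) : K 0"

definition degrees_ok :: "'r => 'r => 'r => 'r => 'r => 'r => bool" where
 "degrees_ok y g g' v g'' w \<longleftrightarrow> y : G 1 & g : G 0 & g' : G 0 & v : G (- 1) & g'' : G 0 & w : G (- 1)"

definition lifted ::
 "(int => 'r set) => 'r => 'r => 'r => 'r => 'r => 'r => 'r => 'r => 'r => 'r => 'r => 'r => 'r => bool" where
 "lifted K x y g g' v g'' w y' l l' t l'' s \<longleftrightarrow>
   y' - y : K 1 & l - g : K 0 & l' - g' : K 0 & t - v : K (- 1) & l'' - g'' : K 0 & s - w : K (- 1) &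
   equivalence_mod (%_. {0}) x y' l l' t l'' s"

context
 fixes K :: "int => 'r set" and x :: 'r
 assumes K: "dgi K" and x: "x : G 1" and xMC: "(D + x) * (D + x) = Z"
begin

private lemmas KD = dgiD[OF K]

private lemma KG: "a : K p ==> r : G q ==> p + q = n ==> a * r : K n"
 and GK: "a : K p ==> r : G q ==> q + p = n ==> r * a : K n"
 using KD(6,7) by auto

context
 assumes square_zero: "!!p q a b. a : K p ==> b : K q ==> a * b = 0"
begin

text \<open>Write \<partial> for the graded commutator with \<open>X\<close> or \<open>Y\<close> on
  the appropriate sides. The Bianchi type identity \<partial>c = m g and the homotopy
  \<open>v\<close> give m = \<partial>(c g' - m v), so adding m v - c g' to \<open>y\<close>
  corrects the curvature. The left inverse \<open>g''\<close> with its homotopy \<open>w\<close>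
  then removes the remaining defect of closedness.\<close>

lemma lift_equivalence:
 assumes deg: "degrees_ok y g g' v g'' w" and eq: "equivalence_mod K x y g g' v g'' w"
 obtains y' l where "y' - y : K 1" "l - g : K 0" "(D + y') * (D + y') = Z" "(D + y') * l = l * (D + x)"
proof -
 define X Y where "X = D + x" and "Y = D + y"
 define m c k l c3 where "m = Y * Y - Z" and "c = Y * g - g * X" and "k = g * g' - u - (Y * v + v * Y)"
  and "l = g'' * g - u - (X * w + w * X)" and "c3 = X * g'' - g'' * Y"
 define c2 where "c2 = X * g' - g' * Y"
 have G: "y : G 1" "g : G 0" "g' : G 0" "v : G (- 1)" "g'' : G 0" "w : G (- 1)"
  using deg by (auto simp: degrees_ok_def)
 have mem: "m : K 2" "c : K 1" "c2 : K 1" "k : K 0" "c3 : K 1" "l : K 0"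
  using eq by (auto simp: equivalence_mod_def m_def c_def c2_def k_def l_def c3_def X_def Y_def)
 have XX: "X * X = Z" using xMC by (simp add: X_def)
 have YY: "Y * Y = Z + m" by (simp add: m_def)
 have Yg: "Y * g = g * X + c" by (simp add: c_def)
 have g'Y: "g' * Y = X * g' - c2" by (simp add: c2_def)
 have g''Y: "g'' * Y = X * g'' - c3" by (simp add: c3_def)
 have Yv: "Y * v + v * Y = g * g' - u - k" by (simp add: k_def)
 have Xw: "X * w + w * X = g'' * g - u - l" by (simp add: l_def)
 have ZY: "Z * Y = Y * Z" using Z[OF G(1)] ZD by (simp add: Y_def algebra_simps)
 have Ym: "Y * m = m * Y" by (simp add: m_def algebra_simps ZY)
 have mG: "m * g : K 2" "m * v : K 1" using KG[OF mem(1) G(2)] KG[OF mem(1) G(4)] by simp_all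
 have mu: "m * u = m" by (rule ur[OF KD(1)[OF mem(1)]])
 have Yc: "Y * c + c * X = m * g"
 proof -
  have "Y * c + c * X = Y * Y * g - g * (X * X)" by (simp add: c_def algebra_simps)
  also have "... = m * g" using Z[OF G(2)] by (simp add: YY XX algebra_simps)
  finally show ?thesis .
 qed
 \<comment> \<open>The defect of closedness c + (m v - c g') g that remains after the first
   correction of \<open>y\<close>; it satisfies \<partial>q = 0.\<close>
 define q where "q = c - c * g' * g + m * v * g"
 have cg'g: "c * g' * g : K 1" "m * v * g : K 1"
  using KG[OF KG[OF mem(2) G(3) refl] G(2)] KG[OF mG(2) G(2)] by simp_all
 have qK: "q : K 1" unfolding q_def by (intro KD(5,8) mem(2) cg'g)
 \<comment> \<open>Subtracting the closed element q g'' does not affect the curvature and turns the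
   defect q into q - q g'' g, a coboundary by the homotopy \<open>w\<close>, which \<sigma>
   cancels.\<close>
 define \<kappa> \<sigma> where "\<kappa> = m * v - c * g' - q * g''" and "\<sigma> = - (q * w)"
 have \<kappa>K: "\<kappa> : K 1"
  unfolding \<kappa>_def using KG[OF mem(2) G(3)] KG[OF qK G(5)] by (intro KD(8) mG(2)) simp_all
 have \<sigma>K: "\<sigma> : K 0" unfolding \<sigma>_def using KG[OF qK G(6)] by (intro KD(3)) simp
 have cc: "c * c = 0" "c * c2 = 0" "c * g' * c = 0" "c * (c2 * g) = 0" "m * k = 0" "m * v * c = 0" "q * c3 = 0" "q * l = 0"
  "m * (k * g) = 0"
 proof -
  show "c * c = 0" "c * c2 = 0" "m * k = 0" "q * c3 = 0" "q * l = 0"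
   by (rule square_zero mem qK; rule mem qK)+
  show "c * g' * c = 0" by (rule square_zero[OF KG[OF mem(2) G(3) refl] mem(2)])
  show "m * v * c = 0" by (rule square_zero[OF mG(2) mem(2)])
  show "c * (c2 * g) = 0" by (rule square_zero[OF mem(2) KG[OF mem(3) G(2) refl]])
  show "m * (k * g) = 0" by (rule square_zero[OF mem(1) KG[OF mem(4) G(2) refl]])
 qed
 have Dcg': "Y * (c * g') + c * g' * Y = m * g * g'"
 proof -
  have "c * g' * Y = c * X * g'" using cc(2) by (simp add: mult.assoc g'Y algebra_simps)
  then have "Y * (c * g') + c * g' * Y = (Y * c + c * X) * g'" by (simp add: algebra_simps)
  then show ?thesis by (simp add: Yc)
 qed
 have Dmv: "Y * (m * v) + m * v * Y = m * g * g' - m"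
 proof -
  have "Y * (m * v) + m * v * Y = m * (Y * v + v * Y)" by (simp add: Ym mult.assoc[symmetric] distrib_left)
  then show ?thesis unfolding Yv using cc(5) mu by (simp add: algebra_simps)
 qed
 have Dcg'g: "Y * (c * g' * g) + c * g' * g * X = m * g * g' * g"
 proof -
  have "c * g' * g * X = c * g' * (Y * g) - c * g' * c" by (simp add: Yg algebra_simps)
  then have "Y * (c * g' * g) + c * g' * g * X = (Y * (c * g') + c * g' * Y) * g"
   unfolding cc(3) by (simp add: algebra_simps)
  then show ?thesis by (simp add: Dcg')
 qed
 have Dmvg: "Y * (m * v * g) + m * v * g * X = m * g * g' * g - m * g"
 proof -
  have "m * v * g * X = m * v * (Y * g) - m * v * c" by (simp add: Yg algebra_simps)
  then have "Y * (m * v * g) + m * v * g * X = (Y * (m * v) + m * v * Y) * g"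
   unfolding cc(6) by (simp add: algebra_simps)
  then show ?thesis unfolding Dmv by (simp add: left_diff_distrib)
 qed
 have Dq: "Y * q = - (q * X)"
 proof -
  have "Y * q + q * X = (Y * c + c * X) - (Y * (c * g' * g) + c * g' * g * X) + (Y * (m * v * g) + m * v * g * X)"
   by (simp add: q_def algebra_simps)
  also have "... = 0" unfolding Yc Dcg'g Dmvg by simp
  finally show ?thesis by (simp add: eq_neg_iff_add_eq_0)
 qed
 have Dqg'': "Y * (q * g'') + q * g'' * Y = 0"
 proof -
  have "q * g'' * Y = q * X * g''" using cc(7) by (simp add: mult.assoc g''Y algebra_simps)
  then show ?thesis using Dq by (simp add: mult.assoc[symmetric])
 qed
 have \<kappa>\<kappa>: "\<kappa> * \<kappa> = 0" and \<kappa>\<sigma>: "\<kappa> * \<sigma> = 0" using square_zero \<kappa>K \<sigma>K by blast+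
 have D\<kappa>: "Y * \<kappa> + \<kappa> * Y = - m"
 proof -
  have "Y * \<kappa> + \<kappa> * Y = (Y * (m * v) + m * v * Y) - (Y * (c * g') + c * g' * Y) - (Y * (q * g'') + q * g'' * Y)"
   by (simp add: \<kappa>_def algebra_simps)
  then show ?thesis unfolding Dmv Dcg' Dqg'' by simp
 qed
 have Y1: "(Y + \<kappa>) * (Y + \<kappa>) = Z"
 proof -
  have "(Y + \<kappa>) * (Y + \<kappa>) = Y * Y + (Y * \<kappa> + \<kappa> * Y) + \<kappa> * \<kappa>" by (simp add: algebra_simps)
  then show ?thesis unfolding D\<kappa> \<kappa>\<kappa> YY by simp
 qed
 have \<kappa>g: "\<kappa> * g = - c - q * (X * w + w * X)"
 proof -
  have "\<kappa> * g = q - c - q * (g'' * g)" by (simp add: \<kappa>_def q_def algebra_simps)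
  moreover have "q * (g'' * g) = q * (u + (X * w + w * X) + l)" by (simp add: Xw)
  moreover have "q * u = q" by (rule ur[OF KD(1)[OF qK]])
  ultimately show ?thesis using cc(8) by (simp add: distrib_left)
 qed
 have "(Y + \<kappa>) * (g + \<sigma>) - (g + \<sigma>) * X = c + \<kappa> * g + (Y * \<sigma> - \<sigma> * X) + \<kappa> * \<sigma>"
  by (simp add: c_def algebra_simps)
 also have "Y * \<sigma> - \<sigma> * X = q * (X * w + w * X)"
  using Dq by (simp add: \<sigma>_def mult.assoc[symmetric] distrib_left)
 finally have "(Y + \<kappa>) * (g + \<sigma>) = (g + \<sigma>) * X" unfolding \<kappa>g \<kappa>\<sigma> by simp
 then show thesis
  using that[of "y + \<kappa>" "g + \<sigma>"] \<kappa>K \<sigma>K Y1 by (simp add: X_def Y_def add.assoc)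
qed

text \<open>Now \<open>y\<close> and \<open>g\<close> are exact, and the defects satisfy \<partial>k
  = g c2. Multiplication by \<open>g''\<close>, which inverts \<open>g\<close> up to
  \<open>w\<close>, makes c2 a coboundary and yields a closed \<open>s\<close>. Its defect
  \<open>k1\<close> is closed with square zero and is removed by the factor 1 - k1 on the
  right.\<close>

lemma lift_right_inverse:
 assumes G: "y : G 1" "g : G 0" "g' : G 0" "v : G (- 1)" "g'' : G 0" "w : G (- 1)"
  and YY: "(D + y) * (D + y) = Z" and Yg: "(D + y) * g = g * (D + x)"
  and eq: "equivalence_mod K x y g g' v g'' w"
 obtains g1 v1 where "g1 - g' : K 0" "v1 - v : K (- 1)" "(D + x) * g1 = g1 * (D + y)"
  "g * g1 = u + ((D + y) * v1 + v1 * (D + y))"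
proof -
 define X Y where "X = D + x" and "Y = D + y"
 define c2 k l c3 where "c2 = X * g' - g' * Y" and "k = g * g' - u - (Y * v + v * Y)"
  and "l = g'' * g - u - (X * w + w * X)" and "c3 = X * g'' - g'' * Y"
 have mem: "c2 : K 1" "k : K 0" "c3 : K 1" "l : K 0"
  using eq by (auto simp: equivalence_mod_def c2_def k_def l_def c3_def X_def Y_def)
 have XX: "X * X = Z" and YY: "Y * Y = Z" and Yg: "Y * g = g * X" using xMC YY Yg by (simp_all add: X_def Y_def)
 have uY: "u * Y = Y" "Y * u = Y" using uD ul[OF G(1)] ur[OF G(1)] by (simp_all add: Y_def algebra_simps)
 have ZvY: "Z * v = v * Z" "Z * g' = g' * Z" by (rule Z[OF G(4)], rule Z[OF G(3)])
 have YYv: "Y * (Y * b) = Z * b" "X * (X * b) = Z * b" "Y * (g * b) = g * (X * b)" for b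
  by (simp_all add: mult.assoc[symmetric] YY XX Yg)
 have comm: "Y * (g * p - u - (Y * v + v * Y)) - (g * p - u - (Y * v + v * Y)) * Y = g * (X * p - p * Y)" for p
  by (simp add: algebra_simps YYv YY uY ZvY)
 have Yk: "Y * k - k * Y = g * c2" unfolding k_def c2_def by (rule comm)
 have Xc2: "X * c2 = - (c2 * Y)" by (simp add: c2_def algebra_simps YYv YY ZvY)
 \<comment> \<open>From X c2 = - c2 Y and g'' g = 1 + \<partial>w + l one obtains c2 =
   \<partial>(g'' k - w c2), which is subtracted from \<open>g'\<close> accordingly.\<close>
 define s where "s = g' - g'' * k + w * c2"
 have sK: "s - g' : K 0"
 proof -
  have "w * c2 : K 0" "g'' * k : K 0" using GK[OF mem(2) G(5)] GK[OF mem(1) G(6)] by simp_all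
  from KD(8)[OF this] show ?thesis by (simp add: s_def algebra_simps)
 qed
 have z: "c3 * k = 0" "l * c2 = 0" using square_zero mem by blast+
 have "X * s - s * Y = c2 - (X * g'' * k - g'' * k * Y) + (X * w * c2 - w * (c2 * Y))"
  by (simp add: s_def c2_def algebra_simps)
 also have "X * g'' * k - g'' * k * Y = g'' * (Y * k - k * Y) + c3 * k"
  by (simp add: c3_def algebra_simps)
 also have "... = (u + (X * w + w * X) + l) * c2"
  unfolding Yk z(1) by (simp add: l_def mult.assoc)
 also have "... = c2 + X * w * c2 + w * (X * c2)"
  using z(2) ul[OF KD(1)[OF mem(1)]] by (simp add: distrib_right mult.assoc)
 finally have Xs: "X * s = s * Y" unfolding Xc2 by simp
 define k1 where "k1 = g * s - u - (Y * v + v * Y)"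
 have "k1 = k + g * (s - g')" by (simp add: k1_def k_def algebra_simps)
 moreover have "g * (s - g') : K 0" using GK[OF sK G(2)] by simp
 ultimately have k1K: "k1 : K 0" using KD(5)[OF mem(2)] by simp
 have Yk1: "Y * k1 = k1 * Y" using comm[of s] by (simp add: k1_def Xs)
 have sG: "s : G 0" using G_add[OF KD(1)[OF sK] G(3)] by simp
 have k1u: "u * k1 = k1" by (rule ul[OF KD(1)[OF k1K]])
 have k1k1: "k1 * k1 = 0" by (rule square_zero[OF k1K k1K])
 have gs: "g * s = u + (Y * v + v * Y) + k1" by (simp add: k1_def)
 show thesis
 proof (rule that[of "s - s * k1" "v - v * k1"])
  have "s * k1 : K 0" using GK[OF k1K sG] by simp
  then have "(s - g') - s * k1 : K 0" by (rule KD(8)[OF sK])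
  then show "s - s * k1 - g' : K 0" by (simp add: algebra_simps)
  have "- (v * k1) : K (- 1)" using GK[OF k1K G(4)] by (intro KD(3)) simp
  then show "v - v * k1 - v : K (- 1)" by simp
  have "X * (s - s * k1) = (s - s * k1) * Y"
  proof -
   have "X * (s * k1) = s * k1 * Y" by (simp add: mult.assoc[symmetric] Xs) (simp add: mult.assoc Yk1)
   then show ?thesis by (simp add: right_diff_distrib left_diff_distrib Xs)
  qed
  then show "(D + x) * (s - s * k1) = (s - s * k1) * (D + y)" by (simp add: X_def Y_def)
  have "g * (s - s * k1) = g * s - g * s * k1" by (simp add: algebra_simps)
  also have "... = u + (Y * v + v * Y) - (Y * v + v * Y) * k1"
   unfolding gs using k1u k1k1 by (simp add: distrib_right)
  also have "... = u + (Y * (v - v * k1) + (v - v * k1) * Y)"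
   using Yk1 by (simp add: algebra_simps)
  finally show "g * (s - s * k1) = u + ((D + y) * (v - v * k1) + (v - v * k1) * (D + y))" by (simp add: Y_def)
 qed
qed

text \<open>The mirror image: \<partial>l = c3 g, multiplication by \<open>g'\<close> on the right
  makes c3 a coboundary, and the factor 1 - l1 stands on the left.\<close>

lemma lift_left_inverse:
 assumes G: "y : G 1" "g : G 0" "g' : G 0" "v : G (- 1)" "g'' : G 0" "w : G (- 1)"
  and YY: "(D + y) * (D + y) = Z" and Yg: "(D + y) * g = g * (D + x)"
  and eq: "equivalence_mod K x y g g' v g'' w"
 obtains g1 w1 where "g1 - g'' : K 0" "w1 - w : K (- 1)" "(D + x) * g1 = g1 * (D + y)"
  "g1 * g = u + ((D + x) * w1 + w1 * (D + x))"
proof -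
 define X Y where "X = D + x" and "Y = D + y"
 define c2 k l c3 where "c2 = X * g' - g' * Y" and "k = g * g' - u - (Y * v + v * Y)"
  and "l = g'' * g - u - (X * w + w * X)" and "c3 = X * g'' - g'' * Y"
 have mem: "c2 : K 1" "k : K 0" "c3 : K 1" "l : K 0"
  using eq by (auto simp: equivalence_mod_def c2_def k_def l_def c3_def X_def Y_def)
 have XX: "X * X = Z" and YY: "Y * Y = Z" and Yg: "Y * g = g * X" using xMC YY Yg by (simp_all add: X_def Y_def)
 have uX: "u * X = X" "X * u = X" using uD ul[OF x] ur[OF x] by (simp_all add: X_def algebra_simps)
 have Zw: "Z * w = w * Z" "Z * g'' = g'' * Z" by (rule Z[OF G(6)], rule Z[OF G(5)])
 have XXv: "X * (X * b) = Z * b" "Y * (Y * b) = Z * b" "Y * (g * b) = g * (X * b)" for b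
  by (simp_all add: mult.assoc[symmetric] YY XX Yg)
 have comm: "X * (p * g - u - (X * w + w * X)) - (p * g - u - (X * w + w * X)) * X = (X * p - p * Y) * g" for p
  by (simp add: algebra_simps XXv XX Yg uX Zw)
 have Xl: "X * l - l * X = c3 * g" unfolding l_def c3_def by (rule comm)
 have Xc3: "X * c3 = - (c3 * Y)" by (simp add: c3_def algebra_simps XXv YY Zw)
 define s where "s = g'' - l * g' - c3 * v"
 have "l * g' : K 0" "c3 * v : K 0" using KG[OF mem(4) G(3)] KG[OF mem(3) G(4)] by simp_all
 then have "- (l * g') - c3 * v : K 0" by (intro KD(8) KD(3))
 moreover have "s - g'' = - (l * g') - c3 * v" by (simp add: s_def)
 ultimately have sK: "s - g'' : K 0" by simp
 have z: "l * c2 = 0" "c3 * k = 0" using square_zero mem by blast+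
 have "X * s - s * Y = c3 - ((X * l - l * X) * g' + l * c2) - (X * c3 * v - c3 * (v * Y))"
  by (simp add: s_def c3_def c2_def algebra_simps)
 also have "(X * l - l * X) * g' + l * c2 = c3 * (u + (Y * v + v * Y) + k)"
  unfolding Xl z(1) by (simp add: k_def mult.assoc)
 also have "... = c3 + c3 * (Y * v) + c3 * (v * Y)"
  using z(2) ur[OF KD(1)[OF mem(3)]] by (simp add: distrib_left)
 finally have Xs: "X * s = s * Y" unfolding Xc3 by (simp add: algebra_simps)
 define l1 where "l1 = s * g - u - (X * w + w * X)"
 have "l1 = l + (s - g'') * g" by (simp add: l1_def l_def algebra_simps)
 moreover have "(s - g'') * g : K 0" using KG[OF sK G(2)] by simp
 ultimately have l1K: "l1 : K 0" using KD(5)[OF mem(4)] by simp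
 have Xl1: "X * l1 = l1 * X" using comm[of s] by (simp add: l1_def Xs)
 have sG: "s : G 0" using G_add[OF KD(1)[OF sK] G(5)] by simp
 have l1u: "l1 * u = l1" by (rule ur[OF KD(1)[OF l1K]])
 have l1l1: "l1 * l1 = 0" by (rule square_zero[OF l1K l1K])
 have sg: "s * g = u + (X * w + w * X) + l1" by (simp add: l1_def)
 show thesis
 proof (rule that[of "s - l1 * s" "w - l1 * w"])
  have "l1 * s : K 0" using KG[OF l1K sG] by simp
  then have "(s - g'') - l1 * s : K 0" by (rule KD(8)[OF sK])
  then show "s - l1 * s - g'' : K 0" by (simp add: algebra_simps)
  have "- (l1 * w) : K (- 1)" using KG[OF l1K G(6)] by (intro KD(3)) simp
  then show "w - l1 * w - w : K (- 1)" by simp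
  have "X * (l1 * s) = l1 * s * Y" by (simp add: mult.assoc[symmetric] Xl1) (simp add: mult.assoc Xs)
  then have "X * (s - l1 * s) = (s - l1 * s) * Y" by (simp add: right_diff_distrib left_diff_distrib Xs)
  then show "(D + x) * (s - l1 * s) = (s - l1 * s) * (D + y)" by (simp add: X_def Y_def)
  have "(s - l1 * s) * g = s * g - l1 * (s * g)" by (simp add: algebra_simps)
  also have "... = u + (X * w + w * X) - l1 * (X * w + w * X)"
   unfolding sg using l1u l1l1 by (simp add: distrib_left)
  also have "... = u + (X * (w - l1 * w) + (w - l1 * w) * X)"
  proof -
   have "X * (l1 * w) = l1 * (X * w)" by (simp add: mult.assoc[symmetric] Xl1)
   then show ?thesis by (simp add: algebra_simps)
  qed
  finally show "(s - l1 * s) * g = u + ((D + x) * (w - l1 * w) + (w - l1 * w) * (D + x))" by (simp add: X_def)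
 qed
qed

end

text \<open>After \<open>y\<close> and \<open>g\<close> are corrected by elements of
  \<open>K\<close>, the other data still form an equivalence modulo \<open>K\<close>, and the two
  inverses are corrected independently of each other.\<close>

lemma lift_square_zero:
 assumes sq: "!!p q a b. a : K p ==> b : K q ==> a * b = 0"
  and deg: "degrees_ok y g g' v g'' w" and eq: "equivalence_mod K x y g g' v g'' w"
 obtains y' l l' t l'' s where "lifted K x y g g' v g'' w y' l l' t l'' s"
proof -
 have G: "y : G 1" "g : G 0" "g' : G 0" "v : G (- 1)" "g'' : G 0" "w : G (- 1)"
  using deg by (auto simp: degrees_ok_def)
 obtain y' l where 1: "y' - y : K 1" "l - g : K 0" "(D + y') * (D + y') = Z" "(D + y') * l = l * (D + x)"
  by (rule lift_equivalence[OF sq deg eq])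
 have G': "y' : G 1" "l : G 0" using G_add[OF KD(1)[OF 1(1)] G(1)] G_add[OF KD(1)[OF 1(2)] G(2)] by simp_all
 define \<kappa> \<sigma> where "\<kappa> = y' - y" and "\<sigma> = l - g"
 have e: "y' = y + \<kappa>" "l = g + \<sigma>" by (simp_all add: \<kappa>_def \<sigma>_def)
 have kl: "\<kappa> : K 1" "\<sigma> : K 0" using 1(1,2) by (simp_all add: \<kappa>_def \<sigma>_def)
 note E = eq[unfolded equivalence_mod_def]
 have "g' * \<kappa> : K 1" "g'' * \<kappa> : K 1" "\<kappa> * v : K 0" "v * \<kappa> : K 0" "\<sigma> * g' : K 0" "g'' * \<sigma> : K 0"
  using GK[OF kl(1) G(3)] GK[OF kl(1) G(5)] KG[OF kl(1) G(4)] GK[OF kl(1) G(4)] KG[OF kl(2) G(3)] GK[OF kl(2) G(5)] by simp_all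
 note c = this
 have "(D + x) * g' - g' * (D + y) - g' * \<kappa> : K 1" "(D + x) * g'' - g'' * (D + y) - g'' * \<kappa> : K 1"
  "g * g' - u - ((D + y) * v + v * (D + y)) + (\<sigma> * g' - (\<kappa> * v + v * \<kappa>)) : K 0"
  "g'' * g - u - ((D + x) * w + w * (D + x)) + g'' * \<sigma> : K 0"
  using E c KD(5,8) by auto
 then have "equivalence_mod K x y' l g' v g'' w"
  unfolding equivalence_mod_def using 1(3,4) KD(2) by (simp add: e algebra_simps)
 note eq' = this
 obtain l' t where 2: "l' - g' : K 0" "t - v : K (- 1)" "(D + x) * l' = l' * (D + y')" "l * l' = u + ((D + y') * t + t * (D + y'))"
  by (rule lift_right_inverse[OF sq G'(1,2) G(3-6) 1(3,4) eq'])
 obtain l'' s where 3: "l'' - g'' : K 0" "s - w : K (- 1)" "(D + x) * l'' = l'' * (D + y')" "l'' * l = u + ((D + x) * s + s * (D + x))"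
  by (rule lift_left_inverse[OF sq G'(1,2) G(3-6) 1(3,4) eq'])
 show thesis
  by (rule that[of y' l l' t l'' s]) (simp add: lifted_def equivalence_mod_def 1 2 3)
qed

text \<open>Here \<open>e\<close> is a central idempotent commuting with \<open>D\<close>, so the
  situation splits into two factors. On the factor of \<open>e\<close> the data are replaced by y =
  x, g = g' = g'' = 1 and zero homotopies; on the other factor the defects, which lie in
  \<open>K\<close>, are already zero.\<close>

lemma lift_unital:
 assumes e: "e : K 0" "!!n z. z : K n ==> e * z = z & z * e = z"
  and deg: "degrees_ok y g g' v g'' w" and eq: "equivalence_mod K x y g g' v g'' w"
 obtains y' l l' t l'' s where "lifted K x y g g' v g'' w y' l l' t l'' s"
proof -
 define X Y where "X = D + x" and "Y = D + y"
 have G: "y : G 1" "g : G 0" "g' : G 0" "v : G (- 1)" "g'' : G 0" "w : G (- 1)"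
  using deg by (auto simp: degrees_ok_def)
 have eG: "e : G 0" by (rule KD(1)[OF e(1)])
 have ee: "e * e = e" using e by blast
 \<comment> \<open>\<open>K\<close> is an ideal with unit \<open>e\<close>, so both b e and e b are
   equal to e b e.\<close>
 have central: "b * e = e * b" if b: "b : G n" for b n
 proof -
  have "e * (b * e) = b * e" using e(2)[OF GK[OF e(1) b refl]] by blast
  moreover have "e * b * e = e * b" using e(2)[OF KG[OF e(1) b refl]] by blast
  ultimately show ?thesis by (simp add: mult.assoc)
 qed
 \<comment> \<open>The differential of \<open>e\<close> lies in \<open>K\<close>. Multiplying it by
   \<open>e\<close> on the left and on the right gives D e = e D e = e D.\<close>
 have eD: "D * e = e * D"
 proof -
  have "gd 0 e : K 1" using KD(4)[OF e(1)] by simp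
  then have "e * (D * e - e * D) = D * e - e * D" "(D * e - e * D) * e = D * e - e * D"
   using e(2) by (auto simp: gd_def)
  then have "e * (D * e) - e * e * D = D * e - e * D" "D * (e * e) - e * (D * e) = D * e - e * D"
   by (simp_all add: algebra_simps)
  then show ?thesis unfolding ee by (simp add: algebra_simps)
 qed
 have eX: "X * e = e * X" and eY: "Y * e = e * Y"
  using eD central[OF x] central[OF G(1)] by (simp_all add: X_def Y_def algebra_simps)
 have com: "X * e = e * X" "Y * e = e * Y" "g * e = e * g" "g' * e = e * g'" "v * e = e * v" "g'' * e = e * g''" "w * e = e * w" "u * e = e"
  by (rule eX, rule eY, (rule central, rule G)+, rule ul[OF eG])
 have com2: "X * (e * b) = e * (X * b)" "Y * (e * b) = e * (Y * b)" "g * (e * b) = e * (g * b)" "g' * (e * b) = e * (g' * b)"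
  "v * (e * b) = e * (v * b)" "g'' * (e * b) = e * (g'' * b)" "w * (e * b) = e * (w * b)" "e * (e * b) = e * b" for b
  by (simp_all add: mult.assoc[symmetric] com ee)
 define m c k l c3 c2 where "m = Y * Y - Z" and "c = Y * g - g * X" and "k = g * g' - u - (Y * v + v * Y)"
  and "l = g'' * g - u - (X * w + w * X)" and "c3 = X * g'' - g'' * Y" and "c2 = X * g' - g' * Y"
 have mem: "m : K 2" "c : K 1" "c2 : K 1" "k : K 0" "c3 : K 1" "l : K 0"
  using eq by (auto simp: equivalence_mod_def m_def c_def c2_def k_def l_def c3_def X_def Y_def)
 have em: "e * m = m" "e * c = c" "e * c2 = c2" "e * k = k" "e * c3 = c3" "e * l = l"
  using e(2) mem by blast+
 have XX: "X * X = Z" using xMC by (simp add: X_def)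
 have YY: "Y * Y = Z + m" and Yg: "Y * g = g * X + c" and Xg': "X * g' = g' * Y + c2" and Xg'': "X * g'' = g'' * Y + c3"
  and gg': "g * g' = u + (Y * v + v * Y) + k" and g''g: "g'' * g = u + (X * w + w * X) + l"
  by (simp_all add: m_def c_def c2_def c3_def k_def l_def)
 define Y1 where "Y1 = Y + e * (X - Y)"
 have eu: "e * u = e" by (rule ur[OF eG])
 have u2: "u * (e * b) = e * b" for b by (simp add: mult.assoc[symmetric] com)
 have eXY: "e * (X - Y) : K 1" using KG[OF e(1) G_diff[OF x G(1)]] by (simp add: X_def Y_def)
 \<comment> \<open>With \<open>e\<close> moved to the front of every monomial and the defects
   absorbing it, all identities follow by normalization.\<close>
 have key: "Y1 * Y1 = Z" "Y1 * (g + e * (u - g)) = (g + e * (u - g)) * X" "X * (g' + e * (u - g')) = (g' + e * (u - g')) * Y1"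
  "X * (g'' + e * (u - g'')) = (g'' + e * (u - g'')) * Y1"
  "(g + e * (u - g)) * (g' + e * (u - g')) = u + (Y1 * (v - e * v) + (v - e * v) * Y1)"
  "(g'' + e * (u - g'')) * (g + e * (u - g)) = u + (X * (w - e * w) + (w - e * w) * X)"
  by (simp_all add: Y1_def algebra_simps com com2 XX YY Yg Xg' Xg'' gg' g''g em eu u2 ee)
 have mem2: "e * (u - b) : K 0" if "b : G 0" for b using KG[OF e(1) G_diff[OF u that]] by simp
 have mem3: "- (e * b) : K (- 1)" if "b : G (- 1)" for b using KG[OF e(1) that] by (intro KD(3)) simp
 show thesis
 proof (rule that[of "y + e * (X - Y)" "g + e * (u - g)" "g' + e * (u - g')" "v - e * v" "g'' + e * (u - g'')" "w - e * w"])
  have Y1': "D + (y + e * (X - Y)) = Y1" by (simp add: Y1_def Y_def add.assoc)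
  show "lifted K x y g g' v g'' w (y + e * (X - Y)) (g + e * (u - g)) (g' + e * (u - g')) (v - e * v) (g'' + e * (u - g'')) (w - e * w)"
   unfolding lifted_def equivalence_mod_def Y1' X_def[symmetric] key using eXY mem2 mem3 G by simp
 qed
qed

end

end

section \<open>Representing quotients of curved algebras by operators\<close>

text \<open>The locale needs a ring that is a type, whereas a quotient algebra depends on
  \<open>A\<close> and \<open>J\<close>; this ring receives all of them. Entry \<open>n\<close> of a
  sequence stands for degree \<open>n\<close>, and additive maps suffice since the locale knows no
  scalars.\<close>

typedef (overloaded) ('x, 'k) endo =
 "{f :: (int => 'x => 'k::field) => int => 'x => 'k. ALL s t. f (s + t) = f s + f t}"
 morphisms op Op
 by (rule exI[of _ "%t. t"]) simp

lemma op_add: "op a (s + t) = op a s + op a t"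
 using op[of a] by simp

lemma op_Op: "(!!s t. f (s + t) = f s + f t) ==> op (Op f) = f"
 by (rule Op_inverse) simp

instantiation endo :: (type, field) ring_1
begin

definition "0 = Op (%t. 0)"
definition "1 = Op (%t. t)"
definition "a + b = Op (%t. op a t + op b t)"
definition "- a = Op (%t. - op a t)"
definition "a - b = Op (%t. op a t - op b t)"
definition "a * b = Op (%t. op a (op b t))"

lemma op_simps:
 "op (0 :: ('a, 'b) endo) = (%t. 0)" "op (1 :: ('a, 'b) endo) = (%t. t)"
 "op (a + b :: ('a, 'b) endo) = (%t. op a t + op b t)" "op (- a) = (%t. - op a t)"
 "op (a - b) = (%t. op a t - op b t)" "op (a * b) = (%t. op a (op b t))"
 unfolding zero_endo_def one_endo_def plus_endo_def uminus_endo_def minus_endo_def times_endo_def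
 by (rule op_Op; simp add: op_add)+

instance
proof
 fix a b c :: "('a, 'b) endo"
 have eqI: "a = b" if "!!t. op a t = op b t" for a b :: "('a, 'b) endo"
  using that by (simp add: op_inject[symmetric] fun_eq_iff)
 show "a * b * c = a * (b * c)" "a + b + c = a + (b + c)" "a + b = b + a" "0 + a = a" "- a + a = 0" "a - b = a + - b"
  "(a + b) * c = a * c + b * c" "a * (b + c) = a * b + a * c" "1 * a = a" "a * 1 = a"
  by (rule eqI; simp add: op_simps op_add add.assoc add.commute)+
 show "(0 :: ('a, 'b) endo) ~= 1"
 proof
  assume "(0 :: ('a, 'b) endo) = 1"
  then have "op (0 :: ('a, 'b) endo) (%_ _. 1) 0 undefined = op 1 (%_ _. 1) 0 undefined" by (rule arg_cong)
  then show False by (simp add: op_simps pointwise)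
 qed
qed

end

lemma endo_eqI: "(!!t n. op a t n = op b t n) ==> a = b"
 by (simp add: op_inject[symmetric] fun_eq_iff)

lemma op_apply:
 "op 0 t n = 0" "op (a + b) t n = op a t n + op b t n" "op (- a) t n = - op a t n"
 "op (a - b) t n = op a t n - op b t n" "op (a * b) t n = op a (op b t) n"
 by (simp_all add: op_simps pointwise)

section \<open>Differential ideals and the operators on the quotient\<close>

definition dg_ideal :: "('x, 'k::field) curved_alg => ('x, 'k) graded => bool" where
 "dg_ideal A J \<longleftrightarrow> (ALL n. kvs.subspace (J n) & J n \<subseteq> car A n & (ALL a:J n. dif A a : J (n + 1) &
   (ALL q. ALL r:car A q. mul A a r : J (n + q) & mul A r a : J (q + n))))"

lemma dg_idealI:
 assumes "!!n. kvs.subspace (J n)" "!!n a. a : J n ==> a : car A n" "!!n a. a : J n ==> dif A a : J (n + 1)"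
  "!!n q a r. a : J n ==> r : car A q ==> mul A a r : J (n + q)"
  "!!n q a r. a : J n ==> r : car A q ==> mul A r a : J (q + n)"
 shows "dg_ideal A J"
 using assms unfolding dg_ideal_def by blast

lemma dg_idealD:
 assumes "dg_ideal A J"
 shows "!!n. kvs.subspace (J n)" "!!n a. a : J n ==> a : car A n" "!!n a. a : J n ==> dif A a : J (n + 1)"
  "!!n q a r. a : J n ==> r : car A q ==> mul A a r : J (n + q)"
  "!!n q a r. a : J n ==> r : car A q ==> mul A r a : J (q + n)"
 using assms unfolding dg_ideal_def by blast+

text \<open>
 The operators act on sequences; \<open>\<sigma> n\<close> is a linear projection of the whole function space onto a
 complement of \<open>J n\<close> in the component of degree \<open>n\<close>, so \<open>left_op \<sigma> p a\<close> is left multiplication by \<open>a\<close>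
 on the quotient by \<open>J\<close>.
\<close>

definition left_op :: "('x, 'k::field) curved_alg => (int => ('x => 'k) => 'x => 'k) => int => ('x => 'k) => ('x, 'k) endo" where
 "left_op A \<sigma> p a = Op (%t n. \<sigma> n (mul A a (\<sigma> (n - p) (t (n - p)))))"

definition dif_op :: "('x, 'k::field) curved_alg => (int => ('x => 'k) => 'x => 'k) => ('x, 'k) endo" where
 "dif_op A \<sigma> = Op (%t n. \<sigma> n (dif A (\<sigma> (n - 1) (t (n - 1)))))"

text \<open>Minus right multiplication by the curvature. Since d^2 = [h, -], the square of the
  differential is left multiplication by \<open>cur A\<close> plus this operator, and right
  multiplications commute with left ones; so it is the element \<open>Z\<close> of the
  locale.\<close>

definition cur_op :: "('x, 'k::field) curved_alg => (int => ('x => 'k) => 'x => 'k) => ('x, 'k) endo" where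
 "cur_op A \<sigma> = Op (%t n. - \<sigma> n (mul A (\<sigma> (n - 2) (t (n - 2))) (cur A)))"

definition complement_projection :: "('x, 'k::field) curved_alg => ('x, 'k) graded => (int => ('x => 'k) => 'x => 'k) => bool" where
 "complement_projection A J \<sigma> \<longleftrightarrow> (ALL n v w c. \<sigma> n (v + w) = \<sigma> n v + \<sigma> n w & \<sigma> n (scl c v) = scl c (\<sigma> n v) & \<sigma> n v : car A n & \<sigma> n (\<sigma> n v) = \<sigma> n v &
   (v : J n --> \<sigma> n v = 0) & (v : car A n --> v - \<sigma> n v : J n))"

lemma complement_projection_exists:
 assumes A: "curved_algebra A" and J: "dg_ideal A J"
 obtains \<sigma> where "complement_projection A J \<sigma>"
proof -
 have "EX s. ALL v w c. s (v + w) = s v + s w & s (scl c v) = scl c (s v) & s v : car A n & s (s v) = s v &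
   (v : J n --> s v = 0) & (v : car A n --> v - s v : J n)" for n
 proof -
  obtain p where p: "!!v w. p (v + w) = p v + p w" "!!c v. p (scl c v) = scl c (p v)" "!!v. p v : car A n" "!!v. v : car A n ==> p v = v"
   by (rule projection_exists[OF curved_algebraD(13)[OF A, of n]]) (rule that)
  obtain q where q: "!!v w. q (v + w) = q v + q w" "!!c v. q (scl c v) = scl c (q v)" "!!v. q v : J n" "!!v. v : J n ==> q v = v"
   by (rule projection_exists[OF dg_idealD(1)[OF J, of n]]) (rule that)
  have J0: "0 : J n" by (rule subspaceD(1)[OF dg_idealD(1)[OF J]])
  show ?thesis
  \<comment> \<open>\<open>p\<close> projects to the component of \<open>A\<close> and
    \<open>q\<close> to \<open>J\<close>; thus p - q p is a projection of the component along
    \<open>J\<close>.\<close>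
  proof (intro exI[of _ "%v. p v - q (p v)"] allI conjI impI)
   fix v w c
   show "p (v + w) - q (p (v + w)) = p v - q (p v) + (p w - q (p w))" by (simp add: p q)
   show "p (scl c v) - q (p (scl c v)) = scl c (p v - q (p v))" by (simp add: p q kvs.scale_right_diff_distrib)
   show "p v - q (p v) : car A n" by (rule car_closed(5)[OF A p(3) dg_idealD(2)[OF J q(3)]])
   have "p (p v - q (p v)) = p v - q (p v)"
    by (rule p(4)[OF car_closed(5)[OF A p(3) dg_idealD(2)[OF J q(3)]]])
   moreover have "q (p v - q (p v)) = 0"
   proof -
    have "q 0 = 0" using q(4)[OF J0] .
    then have "q (x - y) = q x - q y" for x y using q(1)[of "x - y" y] by simp
    then show ?thesis by (simp add: q(4)[OF q(3)])
   qed
   ultimately show "p (p v - q (p v)) - q (p (p v - q (p v))) = p v - q (p v)" by simp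
   show "p v - q (p v) = 0" if "v : J n" using that p(4)[OF dg_idealD(2)[OF J that]] by (simp add: q)
   show "v - (p v - q (p v)) : J n" if "v : car A n" using p(4)[OF that] q(3)[of v] by simp
  qed
 qed
 then have "EX s. ALL n v w c. s n (v + w) = s n v + s n w & s n (scl c v) = scl c (s n v) & s n v : car A n & s n (s n v) = s n v &
   (v : J n --> s n v = 0) & (v : car A n --> v - s n v : J n)" by (rule choice[OF allI])
 then show thesis using that unfolding complement_projection_def by blast
qed

context
 fixes A :: "('x, 'k::field) curved_alg" and J and \<sigma>
 assumes A: "curved_algebra A" and J: "dg_ideal A J" and \<sigma>: "complement_projection A J \<sigma>"
begin

private abbreviation "\<rho> \<equiv> left_op A \<sigma>"
private abbreviation "\<delta> \<equiv> dif_op A \<sigma>"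
private abbreviation "\<zeta> \<equiv> cur_op A \<sigma>"

private lemma s_add: "\<sigma> n (v + w) = \<sigma> n v + \<sigma> n w" and s_scl: "\<sigma> n (scl c v) = scl c (\<sigma> n v)"
 and s_car [simp]: "\<sigma> n v : car A n" and s_s: "\<sigma> n (\<sigma> n v) = \<sigma> n v" and s_J: "v : J n ==> \<sigma> n v = 0" and s_diff_J: "v : car A n ==> v - \<sigma> n v : J n"
 using \<sigma> unfolding complement_projection_def by blast+

private lemma s_zero: "\<sigma> n 0 = 0" by (rule s_J[OF subspaceD(1)[OF dg_idealD(1)[OF J]]])

private lemma s_minus: "\<sigma> n (- v) = - \<sigma> n v"
 using s_add[of n v "- v"] by (simp add: s_zero eq_neg_iff_add_eq_0 add.commute)

private lemma s_diff: "\<sigma> n (v - w) = \<sigma> n v - \<sigma> n w"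
 using s_add[of n v "- w"] by (simp add: s_minus)

private lemma s_cong: "v - w : J n ==> \<sigma> n v = \<sigma> n w"
 using s_J[of "v - w" n] by (simp add: s_diff)

private lemma s_mul_left: "a : car A p ==> v : car A q ==> p + q = n ==> \<sigma> n (mul A a (\<sigma> q v)) = \<sigma> n (mul A a v)"
proof (rule s_cong)
 assume a: "a : car A p" and v: "v : car A q" and n: "p + q = n"
 have "mul A a (v - \<sigma> q v) : J n" using dg_idealD(5)[OF J s_diff_J[OF v] a] by (simp add: n)
 then have "- mul A a (v - \<sigma> q v) : J n" by (rule subspaceD(4)[OF dg_idealD(1)[OF J]])
 then show "mul A a (\<sigma> q v) - mul A a v : J n" by (simp add: mul_diff_right[OF A a v s_car])
qed

private lemma s_mul_right: "a : car A p ==> v : car A q ==> q + p = n ==> \<sigma> n (mul A (\<sigma> q v) a) = \<sigma> n (mul A v a)"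
proof (rule s_cong)
 assume a: "a : car A p" and v: "v : car A q" and n: "q + p = n"
 have "mul A (v - \<sigma> q v) a : J n" using dg_idealD(4)[OF J s_diff_J[OF v] a] by (simp add: n)
 then have "- mul A (v - \<sigma> q v) a : J n" by (rule subspaceD(4)[OF dg_idealD(1)[OF J]])
 then show "mul A (\<sigma> q v) a - mul A v a : J n" by (simp add: mul_diff_left[OF A v s_car a])
qed

private lemma s_dif: "v : car A q ==> q + 1 = n ==> \<sigma> n (dif A (\<sigma> q v)) = \<sigma> n (dif A v)"
proof (rule s_cong)
 assume v: "v : car A q" and n: "q + 1 = n"
 have "dif A (v - \<sigma> q v) : J n" using dg_idealD(3)[OF J s_diff_J[OF v]] by (simp add: n)
 then have "- dif A (v - \<sigma> q v) : J n" by (rule subspaceD(4)[OF dg_idealD(1)[OF J]])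
 then show "dif A (\<sigma> q v) - dif A v : J n" by (simp add: dif_diff[OF A v s_car])
qed

private lemma op_rho: "a : car A p ==> op (\<rho> p a) t n = \<sigma> n (mul A a (\<sigma> (n - p) (t (n - p))))"
 unfolding left_op_def by (subst op_Op) (auto simp: fun_eq_iff plus_fun_apply[of _ _ "_ :: int"] s_add mul_add_right[OF A _ s_car s_car])

private lemma op_dif: "op \<delta> t n = \<sigma> n (dif A (\<sigma> (n - 1) (t (n - 1))))"
 unfolding dif_op_def by (subst op_Op) (auto simp: fun_eq_iff plus_fun_apply[of _ _ "_ :: int"] s_add dif_add[OF A s_car s_car])

private lemma op_cur: "op \<zeta> t n = - \<sigma> n (mul A (\<sigma> (n - 2) (t (n - 2))) (cur A))"
 unfolding cur_op_def
 by (subst op_Op) (auto simp: fun_eq_iff plus_fun_apply[of _ _ "_ :: int"] s_add mul_add_left[OF A s_car s_car curved_algebraD(10)[OF A]])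

lemma left_op_add: "a : car A p ==> b : car A p ==> \<rho> p (a + b) = \<rho> p a + \<rho> p b"
 by (rule endo_eqI) (simp add: op_apply op_rho car_closed[OF A] mul_add_left[OF A _ _ s_car] s_add)

lemma left_op_uminus: "a : car A p ==> \<rho> p (- a) = - \<rho> p a"
proof -
 assume a: "a : car A p"
 have "mul A (- a) v = - mul A a v" if "v : car A q" for v q
  using mul_diff_left[OF A car_closed(1)[OF A] a that] mul_zero_left[OF A that] by simp
 from this[OF s_car] show ?thesis
  by (intro endo_eqI) (simp add: op_apply op_rho a car_closed[OF A] s_minus)
qed

lemma left_op_diff: "a : car A p ==> b : car A p ==> \<rho> p (a - b) = \<rho> p a - \<rho> p b"
 by (rule endo_eqI) (simp add: op_apply op_rho car_closed[OF A] mul_diff_left[OF A _ _ s_car] s_diff)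

lemma left_op_mul: "a : car A p ==> b : car A q ==> \<rho> p a * \<rho> q b = \<rho> (p + q) (mul A a b)"
proof (rule endo_eqI)
 fix t n
 assume a: "a : car A p" and b: "b : car A q"
 let ?v = "\<sigma> (n - p - q) (t (n - p - q))"
 have m: "mul A b ?v : car A (n - p)" using mul_closed[OF A b s_car[of "n - p - q"]] by simp
 have i: "n - (p + q) = n - p - q" by simp
 show "op (\<rho> p a * \<rho> q b) t n = op (\<rho> (p + q) (mul A a b)) t n"
  using s_mul_left[OF a m, of n]
  by (simp add: op_apply op_rho[OF a] op_rho[OF b] op_rho[OF mul_closed[OF A a b]] s_s i curved_algebraD(4)[OF A a b s_car])
qed

text \<open>Faithfulness on the quotient: the operator of \<open>a\<close> applied to the unit
  returns \<open>a\<close> modulo \<open>J\<close>.\<close>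

lemma left_op_eq_0_iff:
 assumes a: "a : car A p"
 shows "\<rho> p a = 0 \<longleftrightarrow> a : J p"
proof
 assume aJ: "a : J p"
 show "\<rho> p a = 0"
 proof (rule endo_eqI)
  fix t n
  have "mul A a (\<sigma> (n - p) (t (n - p))) : J n" using dg_idealD(4)[OF J aJ s_car[of "n - p"]] by simp
  then show "op (\<rho> p a) t n = op 0 t n" by (simp add: op_apply op_rho[OF a] s_J)
 qed
next
 assume "\<rho> p a = 0"
 then have "op (\<rho> p a) (%_. unt A) p = 0" by (simp add: op_apply)
 then have "\<sigma> p a = 0"
  using s_mul_left[OF a curved_algebraD(5)[OF A], of p] by (simp add: op_rho[OF a] curved_algebraD(7)[OF A a])
 then show "a : J p" using s_diff_J[OF a] by simp
qed

lemma dif_op_comm: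
 assumes a: "a : car A p"
 shows "\<delta> * \<rho> p a - ksign p (\<rho> p a * \<delta>) = \<rho> (p + 1) (dif A a)"
proof (rule endo_eqI)
 fix t n
 let ?v = "\<sigma> (n - 1 - p) (t (n - 1 - p))"
 have v: "?v : car A (n - 1 - p)" by simp
 have av: "mul A a ?v : car A (n - 1)" using mul_closed[OF A a v] by simp
 have dv: "dif A ?v : car A (n - p)" using dif_closed[OF A v] by simp
 have da: "dif A a : car A (p + 1)" by (rule dif_closed[OF A a])
 have i: "n - p - 1 = n - 1 - p" "n - (p + 1) = n - 1 - p" by simp_all
 have 1: "op (\<delta> * \<rho> p a) t n = \<sigma> n (dif A (mul A a ?v))"
  using s_dif[OF av, of n] by (simp add: op_apply op_dif op_rho[OF a] s_s)
 have 2: "op (\<rho> p a * \<delta>) t n = \<sigma> n (mul A a (dif A ?v))"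
  using s_mul_left[OF a dv, of n] by (simp add: op_apply op_dif op_rho[OF a] s_s i)
 have 3: "op (\<rho> (p + 1) (dif A a)) t n = \<sigma> n (mul A (dif A a) ?v)"
  by (simp add: op_rho[OF da] i)
 show "op (\<delta> * \<rho> p a - ksign p (\<rho> p a * \<delta>)) t n = op (\<rho> (p + 1) (dif A a)) t n"
  unfolding ksign_def using 1 2 3 by (simp add: op_apply curved_algebraD(9)[OF A a v] ksign_def s_add s_minus)
qed

text \<open>The unit of \<open>A\<close> acts as \<sigma>, in general not as the identity of the
  operator ring; this is the reason for a separate unit \<open>u\<close> in the locale.\<close>

lemma left_op_graded_ring:
 "graded_ring (%n. \<rho> n ` car A n) (\<rho> 0 (unt A)) \<delta> (\<rho> 2 (cur A)) \<zeta>"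
proof
 fix n p q a b
 note U = curved_algebraD(5)[OF A] and H = curved_algebraD(10)[OF A]
 have r0: "\<rho> n 0 = 0" using left_op_eq_0_iff[OF car_closed(1)[OF A]] subspaceD(1)[OF dg_idealD(1)[OF J]] by blast
 show "0 : \<rho> n ` car A n" using r0 car_closed(1)[OF A] by (metis imageI)
 show "a + b : \<rho> n ` car A n" if "a : \<rho> n ` car A n" "b : \<rho> n ` car A n"
  using that by (auto simp: left_op_add[symmetric] car_closed[OF A])
 show "- a : \<rho> n ` car A n" if "a : \<rho> n ` car A n"
  using that by (auto simp: left_op_uminus[symmetric] car_closed[OF A])
 show "a * b : \<rho> (p + q) ` car A (p + q)" if "a : \<rho> p ` car A p" "b : \<rho> q ` car A q"
  using that by (auto simp: left_op_mul mul_closed[OF A])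
 show "\<rho> 0 (unt A) : \<rho> 0 ` car A 0" "\<rho> 2 (cur A) : \<rho> 2 ` car A 2" using U H by blast+
 show "\<rho> 0 (unt A) * a = a" "a * \<rho> 0 (unt A) = a" if "a : \<rho> n ` car A n"
  using that by (auto simp: left_op_mul U curved_algebraD(6,7)[OF A])
 have op_u: "op (\<rho> 0 (unt A)) t n = \<sigma> n (t n)" for t n
  by (simp add: op_rho[OF U] curved_algebraD(6)[OF A s_car] s_s)
 show "\<rho> 0 (unt A) * \<delta> = \<delta>" "\<delta> * \<rho> 0 (unt A) = \<delta>"
  by (rule endo_eqI; simp add: op_apply op_dif op_u s_s)+
 show "\<delta> * a - a * \<delta> : \<rho> (n + 1) ` car A (n + 1)" if n: "even n" and a: "a : \<rho> n ` car A n"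
 proof -
  obtain c where c: "a = \<rho> n c" "c : car A n" using a by blast
  have "\<delta> * a - a * \<delta> = \<rho> (n + 1) (dif A c)" using dif_op_comm[OF c(2)] n by (simp add: c(1) ksign_def)
  then show ?thesis using dif_closed[OF A c(2)] by blast
 qed
 show "\<delta> * a + a * \<delta> : \<rho> (n + 1) ` car A (n + 1)" if n: "odd n" and a: "a : \<rho> n ` car A n"
 proof -
  obtain c where c: "a = \<rho> n c" "c : car A n" using a by blast
  have "\<delta> * a + a * \<delta> = \<rho> (n + 1) (dif A c)" using dif_op_comm[OF c(2)] n by (simp add: c(1) ksign_def)
  then show ?thesis using dif_closed[OF A c(2)] by blast
 qed
 have zeta_mul: "op \<zeta> t n = - \<sigma> n (mul A (t (n - 2)) (cur A))" if "t (n - 2) : car A (n - 2)" for t n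
  using s_mul_right[OF H that, of n] by (simp add: op_cur)
 show "\<zeta> * a = a * \<zeta>" if a: "a : \<rho> n ` car A n"
 proof -
  obtain c where c: "a = \<rho> n c" "c : car A n" using a by blast
  show ?thesis
  proof (rule endo_eqI)
   fix t m
   let ?v = "\<sigma> (m - 2 - n) (t (m - 2 - n))"
   have v: "?v : car A (m - 2 - n)" by simp
   have cv: "mul A c ?v : car A (m - 2)" using mul_closed[OF A c(2) v] by simp
   have vh: "mul A ?v (cur A) : car A (m - n)" using mul_closed[OF A v H] by simp
   have i: "m - n - 2 = m - 2 - n" by simp
   have "op (\<zeta> * a) t m = - \<sigma> m (mul A (mul A c ?v) (cur A))"
    using s_mul_right[OF H cv, of m] by (simp add: op_apply op_cur c op_rho s_s)
   also have "... = - \<sigma> m (mul A c (mul A ?v (cur A)))" by (simp add: curved_algebraD(4)[OF A c(2) v H])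
   also have "... = op (a * \<zeta>) t m"
   proof -
    have "mul A c (- \<sigma> (m - n) w) = - mul A c (\<sigma> (m - n) w)" for w
     using mul_diff_right[OF A c(2) car_closed(1)[OF A] s_car[of "m - n" w]] mul_zero_right[OF A c(2)] by simp
    then show ?thesis
     using s_mul_left[OF c(2) vh, of m] by (simp add: op_apply op_cur c op_rho s_minus s_s i)
   qed
   finally show "op (\<zeta> * a) t m = op (a * \<zeta>) t m" .
  qed
 qed
 show "\<delta> * \<delta> = \<rho> 2 (cur A) + \<zeta>"
 proof (rule endo_eqI)
  fix t m
  let ?v = "\<sigma> (m - 2) (t (m - 2))"
  have v: "?v : car A (m - 2)" by simp
  have dv: "dif A ?v : car A (m - 1)" using dif_closed[OF A v] by simp
  show "op (\<delta> * \<delta>) t m = op (\<rho> 2 (cur A) + \<zeta>) t m"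
   using s_dif[OF dv, of m] by (simp add: op_apply op_dif op_cur op_rho[OF H] s_s curved_algebraD(12)[OF A v] s_diff)
 qed
 show "\<zeta> * \<delta> = \<delta> * \<zeta>"
 proof (rule endo_eqI)
  fix t m
  let ?v = "\<sigma> (m - 3) (t (m - 3))"
  have v: "?v : car A (m - 3)" by simp
  have dv: "dif A ?v : car A (m - 2)" using dif_closed[OF A v] by simp
  have vh: "mul A ?v (cur A) : car A (m - 1)" using mul_closed[OF A v H] by simp
  have "dif A (- \<sigma> (m - 1) w) = - dif A (\<sigma> (m - 1) w)" for w
   using dif_diff[OF A car_closed(1)[OF A] s_car[of "m - 1" w]] dif_zero[OF A] by simp
  moreover have "dif A (mul A ?v (cur A)) = mul A (dif A ?v) (cur A)"
   by (simp add: curved_algebraD(9)[OF A v H] curved_algebraD(11)[OF A] mul_zero_right[OF A v] ksign_def)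
  ultimately show "op (\<zeta> * \<delta>) t m = op (\<delta> * \<zeta>) t m"
   using s_dif[OF vh, of m] s_mul_right[OF H dv, of m] by (simp add: op_apply op_dif op_cur s_s s_minus)
 qed
qed

end

text \<open>A vector of degree \<open>n\<close> in the span of all \<open>U m\<close> is a sum of
  homogeneous vectors, and directness leaves the summand of degree \<open>n\<close>. So the span of
  the union remembers each component, and its dimension can serve as total dimension.\<close>

lemma graded_span_Int:
 fixes V U :: "('x, 'k::field) graded"
 assumes V: "graded_space V" and U: "!!n. kvs.subspace (U n)" "!!n. U n \<subseteq> V n"
  and v: "v : V n" "v : kvs.span (\<Union>n. U n)"
 shows "v : U n"
proof -
 let ?S = "{\<Sum>m\<in>N. f m |N f. finite N & (ALL m. f m : U m) & (ALL m. m ~: N --> f m = 0)}"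
 have "kvs.subspace ?S"
 proof (rule kvs.subspaceI)
  show "0 : ?S" using subspaceD(1)[OF U(1)] by (auto intro!: exI[of _ "{}"] exI[of _ "%_. 0"])
  fix s t c assume s: "s : ?S"
  then obtain N f where f: "s = (\<Sum>m\<in>N. f m)" "finite N" "!!m. f m : U m" "!!m. m ~: N ==> f m = 0" by blast
  have "scl c s = (\<Sum>m\<in>N. scl c (f m))" by (simp add: f(1) kvs.scale_sum_right)
  then show "scl c s : ?S" using f subspaceD(3)[OF U(1)]
   by (auto intro!: exI[of _ N] exI[of _ "%m. scl c (f m)"])
  assume "t : ?S"
  then obtain N' f' where f': "t = (\<Sum>m\<in>N'. f' m)" "finite N'" "!!m. f' m : U m" "!!m. m ~: N' ==> f' m = 0" by blast
  have "s = (\<Sum>m\<in>N \<union> N'. f m)" "t = (\<Sum>m\<in>N \<union> N'. f' m)"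
   unfolding f(1) f'(1) using f(2,4) f'(2,4) by (intro sum.mono_neutral_left; auto)+
  then have "s + t = (\<Sum>m\<in>N \<union> N'. f m + f' m)" by (simp add: sum.distrib)
  then show "s + t : ?S" using f f' subspaceD(2)[OF U(1)]
   by (auto intro!: exI[of _ "N \<union> N'"] exI[of _ "%m. f m + f' m"])
 qed
 moreover have "(\<Union>n. U n) \<subseteq> ?S"
 proof safe
  fix x m assume x: "x : U m"
  show "EX N f. x = sum f N & finite N & (ALL m. f m : U m) & (ALL m. m ~: N --> f m = 0)"
   by (rule exI[of _ "{m}"], rule exI[of _ "%i. if i = m then x else 0"]) (use x subspaceD(1)[OF U(1)] in auto)
 qed
 ultimately have "v : ?S" using kvs.span_minimal v(2) by blast
 then obtain N f where f: "v = (\<Sum>m\<in>N. f m)" "finite N" "!!m. f m : U m" "!!m. m ~: N ==> f m = 0" by blast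
 let ?g = "%m. f m - (if m = n then v else 0)"
 have "(\<Sum>m\<in>insert n N. f m) = v" unfolding f(1) using f(2,4) by (intro sum.mono_neutral_right) auto
 then have "(\<Sum>m\<in>insert n N. ?g m) = 0" using f(2) by (simp add: sum_subtractf)
 moreover have "?g m : V m" for m
  using f(3)[of m] U(2)[of m] v(1) subspaceD(1,5)[OF graded_spaceD(1)[OF V, of m]] by auto
 ultimately have "ALL m:insert n N. ?g m = 0"
  using V[unfolded graded_space_def, THEN conjunct2, THEN spec, THEN spec, of "insert n N" ?g] f(2) by blast
 then show ?thesis using f(3)[of n] by simp
qed

text \<open>Strict monotonicity of the total dimension, which serves both as the length function of
  the dichotomy and for choosing a smallest subcoalgebra.\<close>

lemma graded_dim_less:
 fixes V U U' :: "('x, 'k::field) graded"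
 assumes V: "graded_space V" "finite_dim V" and U: "!!n. kvs.subspace (U n)" "!!n. U n \<subseteq> U' n" "!!n. U' n \<subseteq> V n"
  and v: "v : U' n" "v ~: U n"
 shows "kvs.dim (\<Union>n. U n) < kvs.dim (\<Union>n. U' n)"
proof -
 obtain S where S: "finite S" "!!n. V n \<subseteq> kvs.span S" using V(2) by (auto simp: finite_dim_def)
 have fin: "finite B" if "kvs.independent B" "B \<subseteq> (\<Union>n. U' n)" for B
 proof -
  have "B \<subseteq> kvs.span S" using that(2) U(3) S(2) by blast
  then show ?thesis using kvs.independent_span_bound[OF S(1) that(1)] by simp
 qed
 obtain B where B: "B \<subseteq> (\<Union>n. U n)" "kvs.independent B" "(\<Union>n. U n) \<subseteq> kvs.span B"
  by (rule kvs.maximal_independent_subset)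
 have "v ~: kvs.span (\<Union>n. U n)"
 proof
  assume "v : kvs.span (\<Union>n. U n)"
  then have "v : U n" by (rule graded_span_Int[OF V(1) U(1) subset_trans[OF U(2,3)] subsetD[OF U(3) v(1)]])
  then show False using v(2) by simp
 qed
 then have "v ~: kvs.span B" using kvs.span_mono[OF B(1)] by blast
 then have ins: "kvs.independent (insert v B)" using B(2) by (rule kvs.independent_insertI)
 have "insert v B \<subseteq> (\<Union>n. U' n)" using B(1) U(2) v(1) by blast
 then obtain B' where B': "insert v B \<subseteq> B'" "B' \<subseteq> (\<Union>n. U' n)" "kvs.independent B'" "(\<Union>n. U' n) \<subseteq> kvs.span B'"
  by (rule kvs.maximal_independent_subset_extend[OF _ ins])
 have "finite B'" by (rule fin[OF B'(3,2)])
 moreover have "v ~: B" using kvs.span_base[of v B] \<open>v ~: kvs.span B\<close> by blast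
 ultimately have "card B < card B'" using B'(1) by (intro psubset_card_mono) auto
 moreover have "kvs.dim (\<Union>n. U n) = card B" by (rule kvs.dim_unique[OF B(1,3,2) refl])
 moreover have "kvs.dim (\<Union>n. U' n) = card B'" by (rule kvs.dim_unique[OF B'(2,4,3) refl])
 ultimately show ?thesis by simp
qed

text \<open>The conditions of \<open>equivalence_mod\<close> with the commutators written out: (D +
  y)^2 - Z becomes h + dy + y^2, and the other commutators become differentials of the Maurer-Cartan
  dg category.\<close>

definition equiv_mod ::
 "('x, 'k::field) curved_alg => ('x, 'k) graded => ('x => 'k) => ('x => 'k) => ('x => 'k) => ('x => 'k) => ('x => 'k) =>
  ('x => 'k) => ('x => 'k) => bool" where
 "equiv_mod A K x y g g' v g'' w \<longleftrightarrow>
   y : car A 1 & g : car A 0 & g' : car A 0 & v : car A (- 1) & g'' : car A 0 & w : car A (- 1) &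
   cur A + dif A y + mul A y y : K 2 &
   dif A g + mul A y g - mul A g x : K 1 &
   dif A g' + mul A x g' - mul A g' y : K 1 &
   mul A g g' - unt A - (dif A v + mul A y v + mul A v y) : K 0 &
   dif A g'' + mul A x g'' - mul A g'' y : K 1 &
   mul A g'' g - unt A - (dif A w + mul A x w + mul A w x) : K 0"

lemma representation_kernel:
 assumes A: "curved_algebra A" and J: "dg_ideal A J" and \<sigma>: "complement_projection A J \<sigma>"
 shows "left_op A \<sigma> n ` J n = {0}"
proof -
 have "left_op A \<sigma> n a = 0" if "a : J n" for a
  using left_op_eq_0_iff[OF A J \<sigma> dg_idealD(2)[OF J that]] that by simp
 moreover have "0 : J n" by (rule subspaceD(1)[OF dg_idealD(1)[OF J]])
 ultimately show ?thesis by force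
qed

context
 fixes A :: "('x, 'k::field) curved_alg" and J K and \<sigma>
 assumes A: "curved_algebra A" and J: "dg_ideal A J" and K: "dg_ideal A K" and JK: "J <= K"
  and \<sigma>: "complement_projection A J \<sigma>"
begin

private abbreviation "\<pi> \<equiv> left_op A \<sigma>"
private abbreviation "\<Delta> \<equiv> dif_op A \<sigma>"

interpretation gr: graded_ring "%n. \<pi> n ` car A n" "\<pi> 0 (unt A)" \<Delta> "\<pi> 2 (cur A)" "cur_op A \<sigma>"
 by (rule left_op_graded_ring[OF A J \<sigma>])

private lemmas p_add = left_op_add[OF A J \<sigma>] and p_uminus = left_op_uminus[OF A J \<sigma>] and p_diff = left_op_diff[OF A J \<sigma>]
 and p_mul = left_op_mul[OF A J \<sigma>] and p_eq_0 = left_op_eq_0_iff[OF A J \<sigma>] and p_dif = dif_op_comm[OF A J \<sigma>]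

private lemma JKD: "a : J n ==> a : K n"
 using JK by (auto simp: le_fun_def)

private lemma gd_p: "a : car A n ==> gr.gd n (\<pi> n a) = \<pi> (n + 1) (dif A a)"
 using p_dif[of a n] by (auto simp: gr.gd_def ksign_def)

private lemma p_eq: "a : car A n ==> b : car A n ==> \<pi> n a = \<pi> n b \<longleftrightarrow> a - b : J n"
 using p_eq_0[OF car_closed(5)[OF A], of a n b] by (simp add: p_diff)

private lemma p_mem: "a : car A n ==> \<pi> n a : \<pi> n ` K n \<longleftrightarrow> a : K n"
proof
 assume a: "a : car A n" and "\<pi> n a : \<pi> n ` K n"
 then obtain b where b: "b : K n" "\<pi> n a = \<pi> n b" by blast
 have "a - b : J n" using b p_eq[OF a dg_idealD(2)[OF K b(1)]] by simp
 then have "(a - b) + b : K n" using subspaceD(2)[OF dg_idealD(1)[OF K] JKD b(1)] by blast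
 then show "a : K n" by simp
qed simp

private lemmas p_J = representation_kernel[OF A J \<sigma>]

private lemma dgi_image: "gr.dgi (%n. \<pi> n ` K n)"
proof (rule gr.dgiI)
 note KC = dg_idealD(2)[OF K]
 note KS = subspaceD[OF dg_idealD(1)[OF K]]
 fix n q a b r
 show "\<pi> n ` K n \<subseteq> \<pi> n ` car A n" using KC by blast
 show "0 : \<pi> n ` K n" using p_J[of n] JKD by blast
 show "- a : \<pi> n ` K n" if "a : \<pi> n ` K n" using that KS(4) by (auto simp: p_uminus[OF KC, symmetric])
 show "gr.gd n a : \<pi> (n + 1) ` K (n + 1)" if "a : \<pi> n ` K n" using that dg_idealD(3)[OF K] by (auto simp: gd_p[OF KC])
 show "a + b : \<pi> n ` K n" if "a : \<pi> n ` K n" "b : \<pi> n ` K n" using that KS(2) by (auto simp: p_add[OF KC KC, symmetric])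
 show "a * r : \<pi> (n + q) ` K (n + q)" if "a : \<pi> n ` K n" "r : \<pi> q ` car A q" using that dg_idealD(4)[OF K] by (auto simp: p_mul[OF KC])
 show "r * a : \<pi> (q + n) ` K (q + n)" if "a : \<pi> n ` K n" "r : \<pi> q ` car A q" using that dg_idealD(5)[OF K] by (auto simp: p_mul[OF _ KC])
qed

text \<open>Closure under scalars comes from multiplication by scalar multiples of the unit, which
  have degree 0; it is available on whichever side \<open>W\<close> is a module.\<close>

private lemma preimage_subspace:
 assumes W: "gr.left_or_right_module W"
 shows "kvs.subspace {a : K n. \<pi> n a : W n}"
proof (rule kvs.subspaceI)
 note KC = dg_idealD(2)[OF K]
 note KS = subspaceD[OF dg_idealD(1)[OF K]]
 have "\<pi> n 0 = 0" by (rule p_eq_0[THEN iffD2, OF KC[OF KS(1)] subspaceD(1)[OF dg_idealD(1)[OF J]]])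
 then show "0 : {a : K n. \<pi> n a : W n}" using W KS(1) by (simp add: gr.left_or_right_module_def)
 fix a b c assume a: "a : {a : K n. \<pi> n a : W n}"
 then have aK: "a : K n" and aC: "a : car A n" and aW: "\<pi> n a : W n" using KC by auto
 have c: "scl c (unt A) : car A 0" by (rule car_closed(3)[OF A curved_algebraD(5)[OF A]])
 have "\<pi> n (scl c a) = \<pi> 0 (scl c (unt A)) * \<pi> n a" "\<pi> n (scl c a) = \<pi> n a * \<pi> 0 (scl c (unt A))"
  by (simp_all add: p_mul[OF c aC] p_mul[OF aC c] mul_scl_left[OF A curved_algebraD(5)[OF A] aC]
    mul_scl_right[OF A aC curved_algebraD(5)[OF A]] curved_algebraD(6,7)[OF A aC])
 then have "\<pi> n (scl c a) : W n" using W c aW unfolding gr.left_or_right_module_def by (metis imageI)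
 then show "scl c a : {a : K n. \<pi> n a : W n}" using KS(3)[OF aK] by simp
 assume "b : {a : K n. \<pi> n a : W n}"
 then show "a + b : {a : K n. \<pi> n a : W n}"
  using aK aW W KS(2) p_add[OF aC KC] by (auto simp: gr.left_or_right_module_def)
qed

private lemma dgi_preimage:
 assumes X: "gr.dgi X" "!!n. X n \<subseteq> \<pi> n ` K n"
 shows "dg_ideal A (%n. {a : K n. \<pi> n a : X n})"
proof (rule dg_idealI)
 note XD = gr.dgiD[OF X(1)]
 note KC = dg_idealD(2)[OF K]
 fix n q a r
 have "gr.left_or_right_module X"
  unfolding gr.left_or_right_module_def using XD(2,5) XD(6)[of _ _ _ 0] by auto
 then show "kvs.subspace {a : K n. \<pi> n a : X n}" by (rule preimage_subspace)
 show "a : car A n" if "a : {a : K n. \<pi> n a : X n}" using that KC by auto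
 show "dif A a : {a : K (n + 1). \<pi> (n + 1) a : X (n + 1)}" if "a : {a : K n. \<pi> n a : X n}"
  using that dg_idealD(3)[OF K] XD(4)[of "\<pi> n a" n] gd_p[OF KC] by auto
 show "mul A a r : {a : K (n + q). \<pi> (n + q) a : X (n + q)}" if "a : {a : K n. \<pi> n a : X n}" "r : car A q"
  using that dg_idealD(4)[OF K] XD(6)[of "\<pi> n a" n "\<pi> q r" q] p_mul[OF KC] by auto
 show "mul A r a : {a : K (q + n). \<pi> (q + n) a : X (q + n)}" if "a : {a : K n. \<pi> n a : X n}" "r : car A q"
  using that dg_idealD(5)[OF K] XD(7)[of "\<pi> n a" n "\<pi> q r" q] p_mul[OF _ KC] by auto
qed

text \<open>Finite length comes from \<open>r\<close>: its kernel lies in \<open>J\<close>, so a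
  family \<open>W\<close> can be measured by the dimension of the image under \<open>r\<close> of
  its preimage in \<open>K\<close>, a graded subspace of the finite dimensional
  \<open>F\<close>.\<close>

lemma representation_dichotomy:
 fixes F :: "('z, 'k) graded"
 assumes min: "!!X. dg_ideal A X ==> J <= X ==> X <= K ==> X = J | X = K"
  and F: "graded_space F" "finite_dim F" and r: "!!n. linear_into (K n) (F n) r"
  and ker: "!!n a. a : K n ==> r a = 0 ==> a : J n"
 shows "(ALL p q. ALL a:K p. ALL b:K q. mul A a b : J (p + q)) |
  (EX e:K 0. ALL n. ALL z:K n. mul A e z - z : J n & mul A z e - z : J n)"
proof -
 note KC = dg_idealD(2)[OF K]
 let ?P = "%W n. r ` {a : K n. \<pi> n a : W n}"
 have "(ALL p q. ALL a:\<pi> p ` K p. ALL b:\<pi> q ` K q. a * b = 0) | (EX e:\<pi> 0 ` K 0. ALL n. ALL z:\<pi> n ` K n. e * z = z & z * e = z)"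
 proof (rule gr.minimal_ideal_dichotomy[OF dgi_image])
  fix X assume X: "gr.dgi X" "!!n. X n \<subseteq> \<pi> n ` K n"
  let ?X = "%n. {a : K n. \<pi> n a : X n}"
  have "J <= ?X"
   using JKD gr.dgiD(2)[OF X(1)] p_eq_0[OF dg_idealD(2)[OF J]] by (auto simp: le_fun_def)
  then have "?X = J | ?X = K"
   by (rule min[OF dgi_preimage[OF X]]) (auto simp: le_fun_def)
  then show "(ALL n. X n \<subseteq> {0}) | (ALL n. X n = \<pi> n ` K n)"
  proof
   assume "?X = J"
   then have e: "?X n = J n" for n by (rule fun_cong)
   have "X n \<subseteq> \<pi> n ` J n" for n using X(2)[of n] e[of n] by blast
   then show ?thesis unfolding p_J by blast
  next
   assume "?X = K"
   then have e: "?X n = K n" for n by (rule fun_cong)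
   have "X n = \<pi> n ` K n" for n using X(2)[of n] e[of n] by blast
   then show ?thesis by blast
  qed
 next
  fix W W'
  assume W: "gr.left_or_right_module W" and W': "gr.left_or_right_module W'" and sub: "!!n. W n \<subseteq> W' n"
   and W'K: "!!n. W' n \<subseteq> \<pi> n ` K n" and "W ~= W'"
  have "EX n. W n ~= W' n" using \<open>W ~= W'\<close> by blast
  then obtain n w where w: "w : W' n" "w ~: W n" using sub by blast
  then obtain a where a: "a : K n" "w = \<pi> n a" using W'K by blast
  show "kvs.dim (\<Union>n. ?P W n) < kvs.dim (\<Union>n. ?P W' n)"
  proof (rule graded_dim_less[OF F])
   show "kvs.subspace (?P W n)" for n
    by (rule linear_into_image_subspace[OF _ preimage_subspace[OF W], of _ "F n"])
     (use r[of n] in \<open>auto simp: linear_into_def\<close>)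
   show "?P W n \<subseteq> ?P W' n" for n using sub by blast
   show "?P W' n \<subseteq> F n" for n using linear_intoD(1)[OF r] by blast
   show "r a : ?P W' n" using a w by blast
   show "r a ~: ?P W n"
   proof
    assume "r a : ?P W n"
    then obtain b where b: "b : K n" "\<pi> n b : W n" "r a = r b" by blast
    have "r (a - b) = 0" using linear_into_simps(3)[OF r dg_idealD(1)[OF K] a(1) b(1)] b(3) by simp
    then have "a - b : J n" by (rule ker[OF subspaceD(5)[OF dg_idealD(1)[OF K] a(1) b(1)]])
    then have "\<pi> n a = \<pi> n b" using p_eq[OF KC[OF a(1)] KC[OF b(1)]] by simp
    then show False using a w b by simp
   qed
  qed
 qed
 then show ?thesis
 proof
  assume 0: "ALL p q. ALL a:\<pi> p ` K p. ALL b:\<pi> q ` K q. a * b = 0"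
  have "mul A a b : J (p + q)" if "a : K p" "b : K q" for a b p q
   using that 0 p_mul[OF KC KC, OF that] p_eq_0[OF mul_closed[OF A KC KC], OF that] by auto
  then show ?thesis by blast
 next
  assume "EX e:\<pi> 0 ` K 0. ALL n. ALL z:\<pi> n ` K n. e * z = z & z * e = z"
  then obtain e where e: "e : K 0" "!!n z. z : K n ==> \<pi> 0 e * \<pi> n z = \<pi> n z & \<pi> n z * \<pi> 0 e = \<pi> n z" by blast
  have "mul A e z - z : J n & mul A z e - z : J n" if z: "z : K n" for z n
   using e(2)[OF z] p_mul[OF KC[OF e(1)] KC[OF z]] p_mul[OF KC[OF z] KC[OF e(1)]]
    p_eq[OF mul_closed[OF A KC[OF e(1)] KC[OF z], simplified] KC[OF z]]
    p_eq[OF mul_closed[OF A KC[OF z] KC[OF e(1)], simplified] KC[OF z]] by simp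
  then show ?thesis using e(1) by blast
 qed
qed

text \<open>Each expression in the operators is the operator of the corresponding expression in
  \<open>A\<close>, and membership in \<open>K\<close> can be tested modulo \<open>J\<close> because
  \<open>K\<close> contains \<open>J\<close>.\<close>

lemma representation_equiv_mod:
 assumes x: "x : car A 1" and c: "y : car A 1" "g : car A 0" "g' : car A 0" "v : car A (- 1)" "g'' : car A 0" "w : car A (- 1)"
 shows "gr.equivalence_mod (%n. \<pi> n ` K n) (\<pi> 1 x) (\<pi> 1 y) (\<pi> 0 g) (\<pi> 0 g') (\<pi> (- 1) v) (\<pi> 0 g'') (\<pi> (- 1) w) \<longleftrightarrow>
  equiv_mod A K x y g g' v g'' w"
proof -
 note AC = car_closed[OF A]
 note d1 = dif_closed[OF A, of _ 1, simplified] and d0 = dif_closed[OF A, of _ 0, simplified] and dm = dif_closed[OF A, of _ "- 1", simplified]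
 note m11 = mul_closed[OF A, of _ 1 _ 1, simplified] and m10 = mul_closed[OF A, of _ 1 _ 0, simplified]
  and m01 = mul_closed[OF A, of _ 0 _ 1, simplified] and m00 = mul_closed[OF A, of _ 0 _ 0, simplified]
  and m1m = mul_closed[OF A, of _ 1 _ "- 1", simplified] and mm1 = mul_closed[OF A, of _ "- 1" _ 1, simplified]
 note H = curved_algebraD(10)[OF A] and U = curved_algebraD(5)[OF A]
 have s1: "(\<Delta> + \<pi> 1 a) * (\<Delta> + \<pi> 1 a) - cur_op A \<sigma> = \<pi> 2 (cur A + dif A a + mul A a a)" if a: "a : car A 1" for a
 proof -
  have "(\<Delta> + \<pi> 1 a) * (\<Delta> + \<pi> 1 a) - cur_op A \<sigma> = \<pi> 2 (cur A) + (\<Delta> * \<pi> 1 a + \<pi> 1 a * \<Delta>) + \<pi> 1 a * \<pi> 1 a"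
   using gr.DD by (simp add: algebra_simps)
  also have "\<Delta> * \<pi> 1 a + \<pi> 1 a * \<Delta> = \<pi> 2 (dif A a)" using p_dif[OF a] by (simp add: ksign_def)
  also have "\<pi> 1 a * \<pi> 1 a = \<pi> 2 (mul A a a)" using p_mul[OF a a] by simp
  finally show ?thesis using a by (simp add: p_add AC H d1 m11)
 qed
 have s2: "(\<Delta> + \<pi> 1 a) * \<pi> 0 f - \<pi> 0 f * (\<Delta> + \<pi> 1 b) = \<pi> 1 (dif A f + mul A a f - mul A f b)"
  if a: "a : car A 1" "b : car A 1" "f : car A 0" for a b f
 proof -
  have "(\<Delta> + \<pi> 1 a) * \<pi> 0 f - \<pi> 0 f * (\<Delta> + \<pi> 1 b) = (\<Delta> * \<pi> 0 f - \<pi> 0 f * \<Delta>) + \<pi> 1 a * \<pi> 0 f - \<pi> 0 f * \<pi> 1 b"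
   by (simp add: algebra_simps)
  also have "\<Delta> * \<pi> 0 f - \<pi> 0 f * \<Delta> = \<pi> 1 (dif A f)" using p_dif[OF a(3)] by (simp add: ksign_def)
  also have "\<pi> 1 a * \<pi> 0 f = \<pi> 1 (mul A a f)" using p_mul[OF a(1,3)] by simp
  also have "\<pi> 0 f * \<pi> 1 b = \<pi> 1 (mul A f b)" using p_mul[OF a(3,2)] by simp
  finally show ?thesis using a by (simp add: p_add p_diff AC d0 m10 m01)
 qed
 have s3: "\<pi> 0 f * \<pi> 0 f' - \<pi> 0 (unt A) - ((\<Delta> + \<pi> 1 a) * \<pi> (- 1) s + \<pi> (- 1) s * (\<Delta> + \<pi> 1 a)) =
   \<pi> 0 (mul A f f' - unt A - (dif A s + mul A a s + mul A s a))"
  if a: "a : car A 1" "f : car A 0" "f' : car A 0" "s : car A (- 1)" for a f f' s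
 proof -
  have "(\<Delta> + \<pi> 1 a) * \<pi> (- 1) s + \<pi> (- 1) s * (\<Delta> + \<pi> 1 a) =
    (\<Delta> * \<pi> (- 1) s + \<pi> (- 1) s * \<Delta>) + \<pi> 1 a * \<pi> (- 1) s + \<pi> (- 1) s * \<pi> 1 a"
   by (simp add: algebra_simps)
  also have "\<Delta> * \<pi> (- 1) s + \<pi> (- 1) s * \<Delta> = \<pi> 0 (dif A s)" using p_dif[OF a(4)] by (simp add: ksign_def)
  also have "\<pi> 1 a * \<pi> (- 1) s = \<pi> 0 (mul A a s)" using p_mul[OF a(1,4)] by simp
  also have "\<pi> (- 1) s * \<pi> 1 a = \<pi> 0 (mul A s a)" using p_mul[OF a(4,1)] by simp
  finally have e: "(\<Delta> + \<pi> 1 a) * \<pi> (- 1) s + \<pi> (- 1) s * (\<Delta> + \<pi> 1 a) = \<pi> 0 (dif A s) + \<pi> 0 (mul A a s) + \<pi> 0 (mul A s a)" .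
  have "\<pi> 0 f * \<pi> 0 f' = \<pi> 0 (mul A f f')" using p_mul[OF a(2,3)] by simp
  then show ?thesis unfolding e using a by (simp add: p_add p_diff AC dm m1m mm1 m00 U)
 qed
 show ?thesis
  unfolding gr.equivalence_mod_def equiv_mod_def s1[OF c(1)] s2[OF c(1) x c(2)] s2[OF x c(1) c(3)] s2[OF x c(1) c(5)]
   s3[OF c(1-4)] s3[OF x c(5,2,6)]
  using x c by (simp add: p_mem AC H U d0 d1 dm m00 m01 m10 m11 m1m mm1)
qed

lemma representation_lift:
 assumes sq: "(ALL p q. ALL a:K p. ALL b:K q. mul A a b : J (p + q)) |
  (EX e:K 0. ALL n. ALL z:K n. mul A e z - z : J n & mul A z e - z : J n)"
  and x: "x : MC A" and eq: "equiv_mod A K x y g g' v g'' w"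
 shows "EX y1 g1 g1' v1 g1'' w1. gr.lifted (%n. \<pi> n ` K n) (\<pi> 1 x) (\<pi> 1 y) (\<pi> 0 g) (\<pi> 0 g') (\<pi> (- 1) v) (\<pi> 0 g'') (\<pi> (- 1) w)
   y1 g1 g1' v1 g1'' w1"
proof -
 note KC = dg_idealD(2)[OF K]
 have xA: "x : car A 1" and x0: "cur A + dif A x + mul A x x = 0" using x by (auto simp: MC_def)
 have c: "y : car A 1" "g : car A 0" "g' : car A 0" "v : car A (- 1)" "g'' : car A 0" "w : car A (- 1)"
  using eq by (auto simp: equiv_mod_def)
 have deg: "gr.degrees_ok (\<pi> 1 y) (\<pi> 0 g) (\<pi> 0 g') (\<pi> (- 1) v) (\<pi> 0 g'') (\<pi> (- 1) w)"
  using c by (simp add: gr.degrees_ok_def)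
 have eq': "gr.equivalence_mod (%n. \<pi> n ` K n) (\<pi> 1 x) (\<pi> 1 y) (\<pi> 0 g) (\<pi> 0 g') (\<pi> (- 1) v) (\<pi> 0 g'') (\<pi> (- 1) w)"
  using representation_equiv_mod[OF xA c] eq by simp
 have xG: "\<pi> 1 x : \<pi> 1 ` car A 1" using xA by simp
 have xMC: "(\<Delta> + \<pi> 1 x) * (\<Delta> + \<pi> 1 x) = cur_op A \<sigma>"
 proof -
  have "(\<Delta> + \<pi> 1 x) * (\<Delta> + \<pi> 1 x) = cur_op A \<sigma> + (\<pi> 2 (cur A) + (\<Delta> * \<pi> 1 x + \<pi> 1 x * \<Delta>) + \<pi> 1 x * \<pi> 1 x)"
   using gr.DD by (simp add: algebra_simps)
  also have "\<Delta> * \<pi> 1 x + \<pi> 1 x * \<Delta> = \<pi> 2 (dif A x)" using p_dif[OF xA] by (simp add: ksign_def)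
  also have "\<pi> 1 x * \<pi> 1 x = \<pi> 2 (mul A x x)" using p_mul[OF xA xA] by simp
  also have "\<pi> 2 (cur A) + \<pi> 2 (dif A x) + \<pi> 2 (mul A x x) = \<pi> 2 (cur A + dif A x + mul A x x)"
   using dif_closed[OF A xA] mul_closed[OF A xA xA] curved_algebraD(10)[OF A] by (simp add: p_add car_closed[OF A])
  also have "... = 0"
   unfolding x0 by (rule p_eq_0[THEN iffD2, OF car_closed(1)[OF A] subspaceD(1)[OF dg_idealD(1)[OF J]]])
  finally show ?thesis by simp
 qed
 from sq show ?thesis
 proof
  assume 0: "ALL p q. ALL a:K p. ALL b:K q. mul A a b : J (p + q)"
  have "a * b = 0" if "a : \<pi> p ` K p" "b : \<pi> q ` K q" for a b p q
  proof -
   from that obtain a' b' where ab: "a = \<pi> p a'" "b = \<pi> q b'" "a' : K p" "b' : K q" by auto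
   then show ?thesis using 0 p_mul[OF KC KC] p_eq_0[OF mul_closed[OF A KC KC]] by simp
  qed
  then show ?thesis by (rule gr.lift_square_zero[OF dgi_image xG xMC _ deg eq']) blast+
 next
  assume "EX e:K 0. ALL n. ALL z:K n. mul A e z - z : J n & mul A z e - z : J n"
  then obtain e where e: "e : K 0" "!!n z. z : K n ==> mul A e z - z : J n" "!!n z. z : K n ==> mul A z e - z : J n" by blast
  have e0: "\<pi> 0 e : \<pi> 0 ` K 0" using e(1) by simp
  have "\<pi> 0 e * z = z & z * \<pi> 0 e = z" if z: "z : \<pi> n ` K n" for n z
  proof -
   obtain z' where z': "z = \<pi> n z'" "z' : K n" using z by blast
   show ?thesis
    using p_mul[OF KC[OF e(1)] KC[OF z'(2)]] p_mul[OF KC[OF z'(2)] KC[OF e(1)]]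
     p_eq[OF mul_closed[OF A KC[OF e(1)] KC[OF z'(2)], simplified] KC[OF z'(2)]]
     p_eq[OF mul_closed[OF A KC[OF z'(2)] KC[OF e(1)], simplified] KC[OF z'(2)]] e(2,3)[OF z'(2)] by (simp add: z'(1))
  qed
  then show ?thesis by (rule gr.lift_unital[OF dgi_image xG xMC e0 _ deg eq']) blast+
 qed
qed

end

lemma lift_equiv_mod:
 assumes A: "curved_algebra A" and J: "dg_ideal A J" and K: "dg_ideal A K" and JK: "J <= K"
  and sq: "(ALL p q. ALL a:K p. ALL b:K q. mul A a b : J (p + q)) |
   (EX e:K 0. ALL n. ALL z:K n. mul A e z - z : J n & mul A z e - z : J n)"
  and x: "x : MC A" and eq: "equiv_mod A K x y g g' v g'' w"
 obtains y1 g1 g1' v1 g1'' w1 where "equiv_mod A J x y1 g1 g1' v1 g1'' w1" "y1 - y : K 1" "g1 - g : K 0" "g1' - g' : K 0"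
  "v1 - v : K (- 1)" "g1'' - g'' : K 0" "w1 - w : K (- 1)"
proof -
 obtain \<sigma> where \<sigma>: "complement_projection A J \<sigma>" by (rule complement_projection_exists[OF A J])
 let ?p = "left_op A \<sigma>"
 interpret gr: graded_ring "%n. ?p n ` car A n" "?p 0 (unt A)" "dif_op A \<sigma>" "?p 2 (cur A)" "cur_op A \<sigma>"
  by (rule left_op_graded_ring[OF A J \<sigma>])
 have xA: "x : car A 1" using x by (simp add: MC_def)
 have c: "y : car A 1" "g : car A 0" "g' : car A 0" "v : car A (- 1)" "g'' : car A 0" "w : car A (- 1)"
  using eq by (auto simp: equiv_mod_def)
 have lift1: "EX b:car A n. E = ?p n b & b - a : K n" if a: "a : car A n" and E: "E - ?p n a : ?p n ` K n" for E a n
 proof -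
  obtain k where k: "k : K n" "E - ?p n a = ?p n k" using E by blast
  have kA: "k : car A n" by (rule dg_idealD(2)[OF K k(1)])
  have "E = ?p n a + ?p n k" unfolding k(2)[symmetric] by simp
  then show ?thesis using k(1) car_closed(2)[OF A a kA]
   by (intro bexI[of _ "a + k"]) (simp_all add: left_op_add[OF A J \<sigma>] a kA)
 qed
 obtain Y G G' V G'' W where l: "gr.lifted (%n. ?p n ` K n) (?p 1 x) (?p 1 y) (?p 0 g) (?p 0 g') (?p (- 1) v) (?p 0 g'') (?p (- 1) w)
   Y G G' V G'' W"
  using representation_lift[OF A J K JK \<sigma> sq x eq] by blast
 note L = l[unfolded gr.lifted_def]
 obtain y1 where y1: "y1 : car A 1" "Y = ?p 1 y1" "y1 - y : K 1" using lift1[OF c(1)] L by blast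
 obtain g1 where g1: "g1 : car A 0" "G = ?p 0 g1" "g1 - g : K 0" using lift1[OF c(2)] L by blast
 obtain g1' where g1': "g1' : car A 0" "G' = ?p 0 g1'" "g1' - g' : K 0" using lift1[OF c(3)] L by blast
 obtain v1 where v1: "v1 : car A (- 1)" "V = ?p (- 1) v1" "v1 - v : K (- 1)" using lift1[OF c(4)] L by blast
 obtain g1'' where g1'': "g1'' : car A 0" "G'' = ?p 0 g1''" "g1'' - g'' : K 0" using lift1[OF c(5)] L by blast
 obtain w1 where w1: "w1 : car A (- 1)" "W = ?p (- 1) w1" "w1 - w : K (- 1)" using lift1[OF c(6)] L by blast
 have "gr.equivalence_mod (%_. {0}) (?p 1 x) (?p 1 y1) (?p 0 g1) (?p 0 g1') (?p (- 1) v1) (?p 0 g1'') (?p (- 1) w1)"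
  using L unfolding y1(2) g1(2) g1'(2) v1(2) g1''(2) w1(2) by blast
 then have "gr.equivalence_mod (%n. ?p n ` J n) (?p 1 x) (?p 1 y1) (?p 0 g1) (?p 0 g1') (?p (- 1) v1) (?p 0 g1'') (?p (- 1) w1)"
  unfolding representation_kernel[OF A J \<sigma>] .
 then have "equiv_mod A J x y1 g1 g1' v1 g1'' w1"
  using representation_equiv_mod[OF A J J order_refl \<sigma> xA y1(1) g1(1) g1'(1) v1(1) g1''(1) w1(1)] by blast
 then show thesis using that y1(3) g1(3) g1'(3) v1(3) g1''(3) w1(3) by blast
qed

lemma dg_ideal_dichotomy:
 fixes F :: "('z, 'k::field) graded" and A :: "('x, 'k) curved_alg"
 assumes A: "curved_algebra A" and J: "dg_ideal A J" and K: "dg_ideal A K" and JK: "J <= K"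
  and min: "!!X. dg_ideal A X ==> J <= X ==> X <= K ==> X = J | X = K"
  and F: "graded_space F" "finite_dim F" and r: "!!n. linear_into (K n) (F n) r"
  and ker: "!!n a. a : K n ==> r a = 0 ==> a : J n"
 shows "(ALL p q. ALL a:K p. ALL b:K q. mul A a b : J (p + q)) |
  (EX e:K 0. ALL n. ALL z:K n. mul A e z - z : J n & mul A z e - z : J n)"
proof -
 obtain \<sigma> where "complement_projection A J \<sigma>" by (rule complement_projection_exists[OF A J])
 from representation_dichotomy[OF A J K JK this min F r ker] show ?thesis .
qed

section \<open>One step of the extension along subcoalgebras\<close>

context
 fixes C :: "('x, 'k::field) curved_coalg"
 assumes C: "curved_coalgebra C"
begin

private abbreviation "Vc \<equiv> ccar C"
private lemmas graded_Vc = curved_coalgebraD(1)[OF C]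

lemma ann_dg_ideal: "subcoalgebra C M ==> dg_ideal (dual_alg C) (ann Vc M)"
 by (rule dg_idealI) (use ann_ideal[OF C] in auto)

text \<open>\<open>D\<close> has least total dimension among the finite dimensional subcoalgebras
  not contained in \<open>M\<close>. A subcoalgebra X between M and M + D is M + (X \<inter> D), and
  X \<inter> D is contained in M or, by minimality, equal to D.\<close>

lemma minimal_step_exists:
 assumes M: "subcoalgebra C M" and ne: "M ~= Vc"
 obtains D where "D : fd_subcoalgs C" "\<not> D <= M"
  "!!X. subcoalgebra C X ==> M <= X ==> X <= gsum M D ==> X = M | X = gsum M D"
proof -
 have "EX D. D : fd_subcoalgs C & \<not> D <= M"
 proof -
  have "EX n. M n ~= Vc n" using ne by blast
  then obtain n c where c: "c : Vc n" "c ~: M n" using subcoalgebraD(2)[OF M] by blast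
  obtain D where "D : fd_subcoalgs C" "c : D n" by (rule fd_subcoalg_exists[OF C c(1)])
  then show ?thesis using c(2) by (auto simp: le_fun_def)
 qed
 then obtain D where D: "D : fd_subcoalgs C" "\<not> D <= M"
  and D_min: "!!E. E : fd_subcoalgs C ==> \<not> E <= M ==> kvs.dim (\<Union>n. D n) <= kvs.dim (\<Union>n. E n)"
  using ex_has_least_nat[of "%D. D : fd_subcoalgs C & \<not> D <= M" _ "%D. kvs.dim (\<Union>n. D n)"] by blast
 have DS: "subcoalgebra C D" and Dfd: "finite_dim D" using D(1) by (simp_all add: fd_subcoalgs_iff)
 show thesis
 proof (rule that[OF D])
  fix X assume X: "subcoalgebra C X" and MX: "M <= X" and XD: "X <= gsum M D"
  let ?E = "%n. X n \<inter> D n"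
  have E: "subcoalgebra C ?E" by (rule subcoalgebra_Int[OF C X DS])
  have "finite_dim ?E" using Dfd unfolding finite_dim_def by blast
  then have Efd: "?E : fd_subcoalgs C" using E by (simp add: fd_subcoalgs_iff)
  have split: "EX m d. c = m + d & m : M n & d : ?E n" if c: "c : X n" for c n
  proof -
   have "c : gsum M D n" using c XD by (auto simp: le_fun_def)
   then obtain m d where md: "c = m + d" "m : M n" "d : D n" by (auto simp: gsum_def)
   have "m : X n" using md(2) MX by (auto simp: le_fun_def)
   then have "c - m : X n" using subspaceD(5)[OF subcoalgebraD(1)[OF X] c] by blast
   then show ?thesis using md by auto
  qed
  show "X = M | X = gsum M D"
  proof (cases "?E <= M")
   case True
   have "X n \<subseteq> M n" for n
   proof
    fix c assume "c : X n"
    then obtain m d where md: "c = m + d" "m : M n" "d : ?E n" using split by blast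
    have "d : M n" using le_funD[OF True, of n] md(3) by blast
    then show "c : M n" using subspaceD(2)[OF subcoalgebraD(1)[OF M] md(2)] md(1) by simp
   qed
   then have "X <= M" by (simp add: le_fun_def)
   then show ?thesis using MX by simp
  next
   case False
   have "D <= X"
   proof (rule ccontr)
    assume "\<not> D <= X"
    then obtain n c where c: "c : D n" "c ~: ?E n" by (auto simp: le_fun_def)
    have "kvs.dim (\<Union>n. ?E n) < kvs.dim (\<Union>n. D n)"
     by (rule graded_dim_less[where U = ?E and U' = D and V = D, OF subcoalgebra_graded[OF C DS] Dfd]) (use subcoalgebraD(1)[OF E] c in auto)
    then show False using D_min[OF Efd False] by simp
   qed
   have "gsum M D n \<subseteq> X n" for n
    using le_funD[OF \<open>D <= X\<close>, of n] le_funD[OF MX, of n] subspaceD(2)[OF subcoalgebraD(1)[OF X, of n]] by (auto simp: gsum_def)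
   then show ?thesis using XD by (metis le_fun_def order_antisym)
  qed
 qed
qed

text \<open>What X annihilates lies between M and M + D, so it is one of them. If it is M, then X
  has to contain all functionals vanishing on M. In infinite dimension a space of functionals is not
  determined by what it annihilates, but after restriction to the finite dimensional D it is; the
  error vanishes on M + D and lies in X by assumption.\<close>

lemma ann_minimal:
 assumes M: "subcoalgebra C M" and D: "D : fd_subcoalgs C"
  and min: "!!X. subcoalgebra C X ==> M <= X ==> X <= gsum M D ==> X = M | X = gsum M D"
  and X: "dg_ideal (dual_alg C) X" "ann Vc (gsum M D) <= X" "X <= ann Vc M"
 shows "X = ann Vc (gsum M D) | X = ann Vc M"
proof -
 have DS: "subcoalgebra C D" and Dfd: "finite_dim D" using D by (simp_all add: fd_subcoalgs_iff)
 have M1: "subcoalgebra C (gsum M D)" by (rule subcoalgebra_sum[OF C M DS])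
 note XD = dg_idealD[OF X(1), unfolded dual_alg_simps]
 have Xd: "X n \<subseteq> dual Vc n" for n using XD(2) by blast
 have "subcoalgebra C (perp Vc X)"
  by (rule perp_subcoalgebra[OF C Xd XD(4,5,3)])
 moreover have "M <= perp Vc X"
 proof -
  have "M n \<subseteq> perp Vc X n" for n
   using X(3) subcoalgebraD(2)[OF M, of n] by (fastforce simp: perp_def ann_def le_fun_def)
  then show ?thesis by (simp add: le_fun_def)
 qed
 moreover have "perp Vc X <= gsum M D"
 proof -
  have "perp Vc X n \<subseteq> perp Vc (ann Vc (gsum M D)) n" for n
   using X(2) by (fastforce simp: perp_def le_fun_def)
  then show ?thesis unfolding perp_ann[OF C subcoalgebraD(1,2)[OF M1]] by (simp add: le_fun_def)
 qed
 ultimately have "perp Vc X = M | perp Vc X = gsum M D" by (rule min)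
 then show ?thesis
 proof
  assume p: "perp Vc X = gsum M D"
  have "X n \<subseteq> ann Vc (gsum M D) n" for n
   unfolding p[symmetric] using Xd by (auto simp: ann_def perp_def)
  then have "X <= ann Vc (gsum M D)" by (simp add: le_fun_def)
  then show ?thesis using X(2) by simp
 next
  assume p: "perp Vc X = M"
  have "ann Vc M n \<subseteq> X n" for n
  proof
   fix \<xi> assume \<xi>: "\<xi> : ann Vc M n"
   have \<xi>d: "\<xi> : dual Vc n" using \<xi> by (simp add: ann_def)
   note lr = linear_into_restr[OF graded_Vc subcoalgebraD(1,2)[OF DS]]
   let ?Y = "restr D ` X n"
   have Y: "kvs.subspace ?Y"
    by (rule linear_into_image_subspace[OF _ XD(1), of _ "dual D n"])
     (use lr[of n] Xd[of n] in \<open>auto simp: linear_into_def\<close>)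
   have gD: "graded_space D" by (rule subcoalgebra_graded[OF C DS])
   obtain S where S: "finite S" "!!n. dual D n \<subseteq> kvs.span S"
    using finite_dim_dual[OF gD Dfd] by (auto simp: finite_dim_def)
   have Yd: "?Y \<subseteq> dual D n" using linear_intoD(1)[OF lr] Xd by blast
   obtain Q where Q: "finite Q" "Q \<subseteq> ?Y" "kvs.independent Q" "kvs.span Q = ?Y"
    by (rule finite_basis[OF S(1) subset_trans[OF Yd S(2)] Y])
   have rd: "restr D \<xi> : dual D n" by (rule linear_intoD(1)[OF lr \<xi>d])
   have Qd: "q : dual D n" if "q : Q" for q using that Q(2) Yd by blast
   \<comment> \<open>\<open>functional_combination\<close> asks for linearity at every index
     \<open>q\<close>, also outside \<open>Q\<close>; the case distinction provides it.\<close>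
   have "EX r. ALL u:D (- n). restr D \<xi> u = (\<Sum>q\<in>Q. r q * (if q : dual D n then q u else 0))"
   proof (rule functional_combination[OF Q(1) subcoalgebraD(1)[OF DS]])
    fix q :: "('x => 'k) => 'k" and u v c assume u: "u : D (- n)"
    show "restr D \<xi> (scl c u) = c * restr D \<xi> u" by (rule dual_scl[OF gD rd u])
    show "restr D \<xi> (u + v) = restr D \<xi> u + restr D \<xi> v" if "v : D (- n)" by (rule dual_add[OF gD rd u that])
    show "(if q : dual D n then q (scl c u) else 0) = c * (if q : dual D n then q u else 0)"
     using dual_scl[OF gD _ u] by simp
    show "(if q : dual D n then q (u + v) else 0) = (if q : dual D n then q u else 0) + (if q : dual D n then q v else 0)"
     if "v : D (- n)" using dual_add[OF gD _ u that] by simp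
   next
    fix u assume u: "u : D (- n)" and z: "!!q. q : Q ==> (if q : dual D n then q u else 0) = 0"
    have "\<zeta> u = 0" if \<zeta>: "\<zeta> : X n" for \<zeta>
    proof -
     have zQ: "q u = 0" if "q : Q" for q using z[OF that] Qd[OF that] by simp
     have "restr D \<zeta> : kvs.span Q" using \<zeta> Q(4) by blast
     then have "restr D \<zeta> u = 0"
      by (rule kvs.span_induct) (auto simp: kvs.subspace_def scl_def pointwise zQ)
     then show ?thesis using restr_at[where D = D, OF u] by simp
    qed
    then have "u : perp Vc X (- n)" using subcoalgebraD(2)[OF DS] u by (auto simp: perp_def)
    then have "u : M (- n)" unfolding p .
    then show "restr D \<xi> u = 0" using \<xi> restr_at[where D = D, OF u] by (simp add: ann_def)
   qed
   then obtain r where r: "!!u. u : D (- n) ==> restr D \<xi> u = (\<Sum>q\<in>Q. r q * (if q : dual D n then q u else 0))" by blast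
   have "restr D \<xi> = (\<Sum>q\<in>Q. scl (r q) q)"
   proof
    fix u
    show "restr D \<xi> u = (\<Sum>q\<in>Q. scl (r q) q) u"
    proof (cases "u : D (- n)")
     case True
     then show ?thesis using r Qd by (simp add: sum_fun scl_def)
    next
     case False
     then have "q u = 0" if "q : Q" for q using that Q(2) Yd dual_outside[OF gD] by blast
     then have "(\<Sum>q\<in>Q. scl (r q) q) u = 0" unfolding sum_fun by (intro sum.neutral) (simp add: scl_def)
     then show ?thesis using dual_outside[OF gD rd False] by simp
    qed
   qed
   also have "... : ?Y" unfolding Q(4)[symmetric] by (intro kvs.span_sum kvs.span_scale kvs.span_base)
   finally obtain \<zeta> where \<zeta>: "\<zeta> : X n" "restr D \<xi> = restr D \<zeta>" by blast
   have \<zeta>M: "\<zeta> : ann Vc M n" using \<zeta>(1) X(3) by (auto simp: le_fun_def)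
   have \<zeta>d: "\<zeta> : dual Vc n" using \<zeta>M by (simp add: ann_def)
   have "(\<xi> - \<zeta>) c = 0" if c: "c : gsum M D (- n)" for c
   proof -
    obtain m d where md: "c = m + d" "m : M (- n)" "d : D (- n)" using c by (auto simp: gsum_def)
    have dV: "d : Vc (- n)" "m : Vc (- n)" using md subcoalgebraD(2)[OF DS] subcoalgebraD(2)[OF M] by blast+
    have "\<xi> d = \<zeta> d" using fun_cong[OF \<zeta>(2), of d] restr_at[where D = D, OF md(3)] by simp
    moreover have "\<xi> m = 0" "\<zeta> m = 0" using \<xi> \<zeta>M md(2) by (auto simp: ann_def)
    ultimately show ?thesis
     by (simp add: md(1) pointwise dual_add[OF graded_Vc \<xi>d dV(2,1)] dual_add[OF graded_Vc \<zeta>d dV(2,1)])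
   qed
   then have "\<xi> - \<zeta> : X n"
    using subspaceD(5)[OF dual_subspace[OF graded_Vc] \<xi>d \<zeta>d] X(2) by (auto simp: ann_def le_fun_def)
   from subspaceD(2)[OF XD(1) this \<zeta>(1)] show "\<xi> : X n" by simp
  qed
  then have "ann Vc M <= X" by (simp add: le_fun_def)
  then show ?thesis using X(3) by simp
 qed
qed

text \<open>The two ideals are the functionals vanishing on M and those vanishing on M + D. The map
  to a finite dimensional space is restriction to \<open>D\<close>, whose kernel on the first ideal
  is the second.\<close>

lemma ann_dichotomy:
 assumes M: "subcoalgebra C M" and ne: "M ~= Vc"
 obtains D where "D : fd_subcoalgs C" "\<not> D <= M"
  "(ALL p q. ALL \<xi>:ann Vc M p. ALL \<zeta>:ann Vc M q. mul (dual_alg C) \<xi> \<zeta> : ann Vc (gsum M D) (p + q)) |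
   (EX e:ann Vc M 0. ALL n. ALL \<xi>:ann Vc M n. mul (dual_alg C) e \<xi> - \<xi> : ann Vc (gsum M D) n &
    mul (dual_alg C) \<xi> e - \<xi> : ann Vc (gsum M D) n)"
proof -
 obtain D where D: "D : fd_subcoalgs C" "\<not> D <= M"
  and min: "!!X. subcoalgebra C X ==> M <= X ==> X <= gsum M D ==> X = M | X = gsum M D"
  by (rule minimal_step_exists[OF M ne]) (rule that)
 have DS: "subcoalgebra C D" and Dfd: "finite_dim D" using D by (simp_all add: fd_subcoalgs_iff)
 have M1: "subcoalgebra C (gsum M D)" by (rule subcoalgebra_sum[OF C M DS])
 have gD: "graded_space D" by (rule subcoalgebra_graded[OF C DS])
 have MM1: "M <= gsum M D" by (rule gsum_upper(1)[OF subcoalgebraD(1)[OF M] subcoalgebraD(1)[OF DS]])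
 have le: "ann Vc (gsum M D) <= ann Vc M"
  using MM1 by (auto simp: ann_def le_fun_def)
 show thesis
 proof (rule that[OF D], rule dg_ideal_dichotomy[OF curved_coalgebraD(6)[OF C] ann_dg_ideal[OF M1] ann_dg_ideal[OF M] le])
  show "X = ann Vc (gsum M D) | X = ann Vc M" if "dg_ideal (dual_alg C) X" "ann Vc (gsum M D) <= X" "X <= ann Vc M" for X
   by (rule ann_minimal[OF M D(1) min that])
  show "graded_space (dual D)" "finite_dim (dual D)" by (rule graded_space_dual[OF gD], rule finite_dim_dual[OF gD Dfd])
  show "linear_into (ann Vc M n) (dual D n) (restr D)" for n
   using linear_into_restr[OF graded_Vc subcoalgebraD(1,2)[OF DS], of n] by (auto simp: linear_into_def ann_def)
  show "a : ann Vc (gsum M D) n" if a: "a : ann Vc M n" "restr D a = 0" for a n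
  proof -
   have ad: "a : dual Vc n" using a by (simp add: ann_def)
   have "a c = 0" if c: "c : gsum M D (- n)" for c
   proof -
    obtain m d where md: "c = m + d" "m : M (- n)" "d : D (- n)" using c by (auto simp: gsum_def)
    have dV: "d : Vc (- n)" "m : Vc (- n)" using md subcoalgebraD(2)[OF DS] subcoalgebraD(2)[OF M] by blast+
    have "a d = 0" using fun_cong[OF a(2), of d] restr_at[where D = D, OF md(3)] by (simp add: pointwise)
    moreover have "a m = 0" using a(1) md(2) by (simp add: ann_def)
    ultimately show ?thesis by (simp add: md(1) dual_add[OF graded_Vc ad dV(2,1)])
   qed
   then show ?thesis using ad by (simp add: ann_def)
  qed
 qed
qed

end

section \<open>Convolution algebras along subcoalgebras\<close>

lemma graded_projection_exists:
 fixes S :: "('x, 'k::field) graded"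
 assumes S: "!!m. kvs.subspace (S m)"
 obtains r :: "int => ('x => 'k) => 'x => 'k"
 where "!!m v w. r m (v + w) = r m v + r m w" "!!m v c. r m (scl c v) = scl c (r m v)"
  "!!m v. r m v : S m" "!!m v. v : S m ==> r m v = v"
proof -
 have "EX r. ALL v w c. r (v + w) = r v + r w & r (scl c v) = scl c (r v) & r v : S m & (v : S m --> r v = v)" for m
 proof -
  obtain p where "!!v w. p (v + w) = p v + p w" "!!c v. p (scl c v) = scl c (p v)" "!!v. p v : S m" "!!v. v : S m ==> p v = v"
   by (rule projection_exists[OF S[of m]]) (rule that)
  then show ?thesis by blast
 qed
 then have "EX r. ALL m v w c. r m (v + w) = r m v + r m w & r m (scl c v) = scl c (r m v) & r m v : S m & (v : S m --> r m v = v)"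
  by (rule choice[OF allI])
 then show thesis using that by blast
qed

text \<open>Under \<open>ev\<close> these are the linear maps that factor through the quotient of
  \<open>C\<close> by \<open>M\<close>: the analogue of \<open>ann\<close> with coefficients in
  \<open>A\<close>.\<close>

definition vanish :: "('x, 'k::field) curved_coalg => ('a, 'k) curved_alg => ('x, 'k) graded =>
  (('x, 'k) graded \<times> (('x => 'k) \<times> 'a), 'k) graded" where
 "vanish C A M n = {F : car (conv_alg C A) n. ALL c:homogeneous M. ev C F c = 0}"

context
 fixes C :: "('x, 'k::field) curved_coalg" and A :: "('a, 'k) curved_alg"
 assumes C: "curved_coalgebra C" and A: "curved_algebra A"
begin

private abbreviation "Vd \<equiv> ccar C"
private abbreviation "Bd \<equiv> conv_alg C A"
private abbreviation "Kd \<equiv> vanish C A"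
private lemmas graded_Vd = curved_coalgebraD(1)[OF C]
private lemmas algebra_Bd = conv_algebra[OF C A]

lemma vanish_antimono: "M <= N ==> Kd N <= Kd M"
 using homogeneous_mono[of M N] by (auto simp: vanish_def le_fun_def[of "Kd N"])

lemma vanish_component:
 assumes F: "F : Kd M n" and D: "D : fd_subcoalgs C" "D <= M"
 shows "curry F D = 0"
proof -
 have FB: "F : car Bd n" using F by (simp add: vanish_def)
 have gD: "graded_space D" using D(1) subcoalgebra_graded[OF C] by (simp add: fd_subcoalgs_iff)
 have t: "curry F D : tensor (dual D) (car A) n" by (rule conv_carD(2)[OF C A FB D(1)])
 show ?thesis
 proof (rule tensor_dual_eqI[OF gD curved_algebraD(1)[OF A] t tensor_closed(1)])
  fix v assume v: "v : homogeneous D"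
  have "curry (curry F D) v = ev C F v" by (rule ev_eq[OF C A FB D(1) v, symmetric])
  also have "... = 0" using F homogeneous_mono[OF D(2) v] by (simp add: vanish_def)
  finally show "curry (curry F D) v = curry 0 v" by (simp add: fun_eq_iff pointwise)
 qed
qed

lemma vanish_dg_ideal:
 assumes M: "subcoalgebra C M"
 shows "dg_ideal Bd (Kd M)"
proof (rule dg_idealI)
 fix n q :: int and F G
 \<comment> \<open>An element \<open>c\<close> of \<open>M\<close> lies in the finite dimensional
   subcoalgebra D \<inter> M for any D containing it, so vanishing on \<open>M\<close> is detected
   by the components inside \<open>M\<close>, where products and differentials are computed.\<close>
 have comp: "ev C H c = 0"
  if H: "H : car Bd m" and z: "!!D. D : fd_subcoalgs C ==> D <= M ==> curry H D = 0" and c: "c : homogeneous M" for H m c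
 proof -
  obtain l where cl: "c : M l" using c by (rule homogeneousE)
  obtain D where D: "D : fd_subcoalgs C" "c : D l"
   by (rule fd_subcoalg_exists[OF C]) (use cl subcoalgebraD(2)[OF M] in auto)
  let ?E = "%n. D n \<inter> M n"
  have "subcoalgebra C ?E" using subcoalgebra_Int[OF C _ M] D(1) by (simp add: fd_subcoalgs_iff)
  moreover have "finite_dim ?E" using D(1) unfolding fd_subcoalgs_iff finite_dim_def by blast
  ultimately have E: "?E : fd_subcoalgs C" by (simp add: fd_subcoalgs_iff)
  have "c : ?E l" using D(2) cl by simp
  then have "c : homogeneous ?E" by (rule homogeneousI[where V = ?E])
  then have "ev C H c = curry (curry H ?E) c" by (rule ev_eq[OF C A H E])
  moreover have "curry H ?E = 0" by (rule z[OF E]) (auto simp: le_fun_def)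
  ultimately show ?thesis by (simp add: fun_eq_iff pointwise)
 qed
 note cl = car_closed[OF algebra_Bd]
 show "kvs.subspace (Kd M n)"
  using cl by (auto simp: kvs.subspace_def vanish_def ev_zero[OF C A] ev_plus[OF C A] ev_scl[OF C A])
 show "F : car Bd n" if "F : Kd M n" using that by (simp add: vanish_def)
 show "dif Bd F : Kd M (n + 1)" if F: "F : Kd M n"
 proof -
  have FB: "F : car Bd n" using F by (simp add: vanish_def)
  have "curry (dif Bd F) D = 0" if D: "D : fd_subcoalgs C" "D <= M" for D
   by (simp only: conv_dif_component[OF C A D(1)] vanish_component[OF F D] dif_zero[OF conv_part_algebra[OF C A D(1)]])
  then show ?thesis using comp[OF dif_closed[OF algebra_Bd FB]] dif_closed[OF algebra_Bd FB] by (simp add: vanish_def)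
 qed
 show "mul Bd F G : Kd M (n + q)" if F: "F : Kd M n" and G: "G : car Bd q"
 proof -
  have FB: "F : car Bd n" using F by (simp add: vanish_def)
  have "curry (mul Bd F G) D = 0" if D: "D : fd_subcoalgs C" "D <= M" for D
  proof -
   have "curry G D : car (conv_part C A D) q" unfolding car_conv_part[OF C A D(1)] by (rule conv_carD(2)[OF C A G D(1)])
   then show ?thesis
    by (simp only: conv_mul_component[OF C A D(1)] vanish_component[OF F D] mul_zero_left[OF conv_part_algebra[OF C A D(1)]])
  qed
  then show ?thesis using comp[OF mul_closed[OF algebra_Bd FB G]] mul_closed[OF algebra_Bd FB G] by (simp add: vanish_def)
 qed
 show "mul Bd G F : Kd M (q + n)" if F: "F : Kd M n" and G: "G : car Bd q"
 proof -
  have FB: "F : car Bd n" using F by (simp add: vanish_def)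
  have "curry (mul Bd G F) D = 0" if D: "D : fd_subcoalgs C" "D <= M" for D
  proof -
   have "curry G D : car (conv_part C A D) q" unfolding car_conv_part[OF C A D(1)] by (rule conv_carD(2)[OF C A G D(1)])
   then show ?thesis
    by (simp only: conv_mul_component[OF C A D(1)] vanish_component[OF F D] mul_zero_right[OF conv_part_algebra[OF C A D(1)]])
  qed
  then show ?thesis using comp[OF mul_closed[OF algebra_Bd G FB]] mul_closed[OF algebra_Bd G FB] by (simp add: vanish_def)
 qed
qed

lemma emb_vanish:
 assumes M: "subcoalgebra C M" and \<xi>: "\<xi> : ann Vd M p" and a: "a : car A q"
 shows "emb C \<xi> a : Kd M (p + q)"
proof -
 have \<xi>d: "\<xi> : dual Vd p" using \<xi> by (simp add: ann_def)
 have "ev C (emb C \<xi> a) c = 0" if c: "c : homogeneous M" for c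
 proof -
  obtain l where l: "c : M l" using c by (rule homogeneousE)
  have cV: "c : Vd l" using l subcoalgebraD(2)[OF M] by blast
  have "\<xi> c = 0"
  proof (cases "l = - p")
   case True
   then show ?thesis using \<xi> l by (simp add: ann_def)
  qed (rule dual_other[OF graded_Vd \<xi>d cV])
  then show ?thesis using ev_emb[OF C A \<xi>d a homogeneousI[where V = Vd, OF cV]] by simp
 qed
 then show ?thesis using emb_closed[OF C A \<xi>d a] by (simp add: vanish_def)
qed

text \<open>
 A linear map \<open>T\<close> vanishing on \<open>M\<close>, with \<open>c - T c : M\<close> on \<open>M + D\<close> and finite dimensional image,
 writes an element vanishing on \<open>M\<close> through a dual basis of that image.
\<close>

lemma vanish_decompose:
 assumes M: "subcoalgebra C M" and D: "D : fd_subcoalgs C" and F: "F : Kd M n"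
  and S: "kvs.subspace S" "Kd (gsum M D) n \<subseteq> S"
  and emb: "!!p q \<xi> a. p + q = n ==> \<xi> : ann Vd M p ==> a : car A q ==> emb C \<xi> a : S"
 shows "F : S"
proof -
 have DS: "subcoalgebra C D" and Dfd: "finite_dim D" using D by (simp_all add: fd_subcoalgs_iff)
 have M1: "subcoalgebra C (gsum M D)" by (rule subcoalgebra_sum[OF C M DS])
 note FB = dg_idealD(2)[OF vanish_dg_ideal[OF M] F]
 obtain r where r: "!!m v w. r m (v + w) = r m v + r m w" "!!m v c. r m (scl c v) = scl c (r m v)"
  "!!m v. r m v : M m" "!!m v. v : M m ==> r m v = v"
  by (rule graded_projection_exists[OF subcoalgebraD(1)[OF M]]) (rule that)
 obtain s where s: "!!m v w. s m (v + w) = s m v + s m w" "!!m v c. s m (scl c v) = scl c (s m v)"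
  "!!m v. s m v : gsum M D m" "!!m v. v : gsum M D m ==> s m v = v"
  by (rule graded_projection_exists[OF subcoalgebraD(1)[OF M1]]) (rule that)
 define f where "f m v = v - r m v" for m v
 have f: "f m (v + w) = f m v + f m w" "f m (scl c v) = scl c (f m v)" for m v w c
  by (simp_all add: f_def r kvs.scale_right_diff_distrib)
 have fM: "f m v = 0" if "v : M m" for m v using that by (simp add: f_def r)
 define N where "N m = f m ` D m" for m
 have Nsub: "kvs.subspace (N m)" for m
  unfolding N_def by (rule linear_into_image_subspace[OF _ subcoalgebraD(1)[OF DS], of _ UNIV]) (simp add: linear_into_def f)
 have NV: "N m \<subseteq> Vd m" for m
  using r(3)[of m] subcoalgebraD(2)[OF M, of m] subcoalgebraD(2)[OF DS, of m] subspaceD(5)[OF graded_spaceD(1)[OF graded_Vd]]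
  unfolding N_def f_def by blast
 have gN: "graded_space N" by (rule graded_space_sub[OF graded_Vd Nsub NV])
 have Nfd: "finite_dim N"
 proof (rule finite_dimI)
  have "{m. N m ~= {0}} \<subseteq> {m. D m ~= {0}}"
   using fM subspaceD(1)[OF subcoalgebraD(1)[OF M]] by (auto simp: N_def)
  then show "finite {m. N m ~= {0}}" using finite_degrees[OF subcoalgebra_graded[OF C DS] Dfd] finite_subset by blast
  fix m
  obtain T where T: "finite T" "D m \<subseteq> kvs.span T" using Dfd by (auto simp: finite_dim_def)
  have "f m v : kvs.span (f m ` T)" if "v : kvs.span T" for v
   using that
  proof (rule kvs.span_induct)
   have "f m 0 = 0" by (rule fM[OF subspaceD(1)[OF subcoalgebraD(1)[OF M]]])
   then show "kvs.subspace {v. f m v : kvs.span (f m ` T)}"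
    by (auto simp: kvs.subspace_def f intro: kvs.span_add kvs.span_scale kvs.span_zero)
  qed (simp add: kvs.span_base)
  then show "EX S. finite S & N m \<subseteq> kvs.span S" using T unfolding N_def by (intro exI[of _ "f m ` T"]) auto
 qed
 obtain P and e :: "int \<times> ('x => 'k) => ('x => 'k) => 'k" where P: "finite P" "!!m b. (m, b) : P ==> b : N m"
   "!!m b. (m, b) : P ==> e (m, b) : dual N (- m)"
   "!!m v. v : N m ==> v = (\<Sum>x\<in>{x:P. fst x = m}. scl (e x v) (snd x))"
  by (rule dual_basis[OF gN Nfd]) (rule that)
 \<comment> \<open>On M + D this is the projection along M onto the finite dimensional
   \<open>N\<close>; \<open>s\<close> makes it a total linear map.\<close>
 define T where "T m c = f m (s m c)" for m c
 have TN: "T m c : N m" for m c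
 proof -
  obtain \<mu> d where "s m c = \<mu> + d" "\<mu> : M m" "d : D m" using s(3)[of m c] by (auto simp: gsum_def)
  then show ?thesis using fM by (simp add: T_def N_def f)
 qed
 have T: "T m (v + w) = T m v + T m w" "T m (scl c v) = scl c (T m v)" for m v w c by (simp_all add: T_def s f)
 have MM1: "M m \<subseteq> gsum M D m" for m
  by (rule le_funD[OF gsum_upper(1)[where D = M and E = D, OF subcoalgebraD(1)[OF M] subcoalgebraD(1)[OF DS]]])
 have TM: "T m c = 0" if "c : M m" for m c
  using s(4)[OF subsetD[OF MM1 that]] fM[OF that] by (simp add: T_def)
 define \<xi> where "\<xi> x c = (if c : Vd (fst x) then e x (T (fst x) c) else 0)" for x c
 have \<xi>: "\<xi> x : ann Vd M (- fst x)" if x: "x : P" for x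
 proof -
  have ex: "e x : dual N (- fst x)" using P(3)[of "fst x" "snd x"] x by simp
  have "\<xi> x : dual Vd (- fst x)"
   using subspaceD[OF graded_spaceD(1)[OF graded_Vd]] dual_add[OF gN ex TN TN] dual_scl[OF gN ex TN]
   by (intro dualI[OF graded_Vd]) (simp_all add: \<xi>_def T)
  moreover have "\<xi> x c = 0" if "c : M (fst x)" for c
   using TM[OF that] dual_zero[OF gN ex] by (simp add: \<xi>_def)
  ultimately show ?thesis by (simp add: ann_def)
 qed
 \<comment> \<open>On M + D the sum is the composite of \<open>F\<close> with \<open>T\<close>,
   which agrees with \<open>F\<close> there because \<open>F\<close> vanishes on \<open>M\<close>.
   So the difference vanishes on M + D and lies in \<open>S\<close>.\<close>
 define H where "H = (\<Sum>x\<in>P. emb C (\<xi> x) (ev C F (snd x)))"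
 have aA: "ev C F (snd x) : car A (fst x + n)" if "x : P" for x
  using linear_intoD(1)[OF ev_linear[OF C A FB]] P(2)[of "fst x" "snd x"] NV that by auto
 have HS: "H : S"
  unfolding H_def by (rule kvs.subspace_sum[OF S(1)]) (rule emb[OF _ \<xi> aA]; simp)
 have HB: "H : car Bd n"
  unfolding H_def
 proof (rule kvs.subspace_sum[OF curved_algebraD(13)[OF algebra_Bd]])
  show "emb C (\<xi> x) (ev C F (snd x)) : car Bd n" if "x : P" for x
   using dg_idealD(2)[OF vanish_dg_ideal[OF M] emb_vanish[OF M \<xi>[OF that] aA[OF that]]] by simp
 qed
 have "ev C (F - H) c = 0" if c: "c : homogeneous (gsum M D)" for c
 proof -
  obtain m where m: "c : gsum M D m" using c by (rule homogeneousE)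
  have cV: "c : Vd m" using m subcoalgebraD(2)[OF M1] by blast
  have hV: "c : homogeneous Vd" by (rule homogeneousI[where V = Vd, OF cV])
  have "ev C H c = (\<Sum>x\<in>P. ev C (emb C (\<xi> x) (ev C F (snd x))) c)"
   unfolding H_def using P(1) by (induction P rule: finite_induct) (simp_all add: ev_zero[OF C A] ev_plus[OF C A])
  also have "... = (\<Sum>x\<in>P. scl (\<xi> x c) (ev C F (snd x)))"
  proof (rule sum.cong[OF refl])
   fix x assume x: "x : P"
   have "\<xi> x : dual Vd (- fst x)" using \<xi>[OF x] by (simp add: ann_def)
   then show "ev C (emb C (\<xi> x) (ev C F (snd x))) c = scl (\<xi> x c) (ev C F (snd x))"
    by (rule ev_emb[OF C A _ aA[OF x] hV])
  qed
  also have "... = (\<Sum>x\<in>{x:P. fst x = m}. scl (e x (T m c)) (ev C F (snd x)))"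
  proof (rule sum.mono_neutral_cong_right[OF P(1)])
   show "ALL x:P - {x : P. fst x = m}. scl (\<xi> x c) (ev C F (snd x)) = 0"
    using dual_other[OF graded_Vd _ cV] \<xi> by (fastforce simp: ann_def)
  qed (auto simp: \<xi>_def cV)
  also have "... = ev C F (\<Sum>x\<in>{x:P. fst x = m}. scl (e x (T m c)) (snd x))"
   using subsetD[OF NV P(2)] by (intro linear_into_sum[OF ev_linear[OF C A FB] graded_spaceD(1)[OF graded_Vd], symmetric, of _ _ m]) auto
  also have "... = ev C F (T m c)" using P(4)[OF TN] by simp
  also have "... = ev C F c"
  proof -
   have rM: "r m c : M m" by (rule r(3))
   have "T m c = c - r m c" using s(4)[OF m] by (simp add: T_def f_def)
   moreover have "ev C F (c - r m c) = ev C F c - ev C F (r m c)"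
    using linear_into_simps(3)[OF ev_linear[OF C A FB] graded_spaceD(1)[OF graded_Vd] cV] rM subcoalgebraD(2)[OF M] by blast
   moreover have "ev C F (r m c) = 0" using F homogeneousI[where V = M, OF rM] by (simp add: vanish_def)
   ultimately show ?thesis by simp
  qed
  finally show ?thesis by (simp add: ev_diff[OF C A])
 qed
 then have "F - H : S" using S(2) car_closed(5)[OF algebra_Bd FB HB] by (auto simp: vanish_def)
 from kvs.subspace_add[OF S(1) this HS] show ?thesis by simp
qed

text \<open>By \<open>vanish_decompose\<close> the identities need only be checked on the elements
  \<open>emb C \<xi> a\<close>, modulo maps vanishing on M + D, and there they are those of the dual
  algebra up to sign. The unit in the second case is \<open>emb C e (unt A)\<close>.\<close>

lemma vanish_dichotomy:
 assumes M: "subcoalgebra C M" and D: "D : fd_subcoalgs C"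
  and dich: "(ALL p q. ALL \<xi>:ann Vd M p. ALL \<zeta>:ann Vd M q. mul (dual_alg C) \<xi> \<zeta> : ann Vd (gsum M D) (p + q)) |
   (EX e:ann Vd M 0. ALL n. ALL \<xi>:ann Vd M n. mul (dual_alg C) e \<xi> - \<xi> : ann Vd (gsum M D) n &
    mul (dual_alg C) \<xi> e - \<xi> : ann Vd (gsum M D) n)"
 shows "(ALL p q. ALL F:Kd M p. ALL G:Kd M q. mul Bd F G : Kd (gsum M D) (p + q)) |
  (EX E:Kd M 0. ALL n. ALL F:Kd M n. mul Bd E F - F : Kd (gsum M D) n & mul Bd F E - F : Kd (gsum M D) n)"
 using dich
proof
 have DS: "subcoalgebra C D" using D by (simp add: fd_subcoalgs_iff)
 have M1: "subcoalgebra C (gsum M D)" by (rule subcoalgebra_sum[OF C M DS])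
 note K1 = dg_idealD[OF vanish_dg_ideal[OF M1]]
 note K0 = dg_idealD[OF vanish_dg_ideal[OF M]]
 note K1S = subspaceD[OF K1(1)]
 have annd: "\<xi> : dual Vd p" if "\<xi> : ann Vd N p" for \<xi> N p using that by (simp add: ann_def)
 {
  assume 0: "ALL p q. ALL \<xi>:ann Vd M p. ALL \<zeta>:ann Vd M q. mul (dual_alg C) \<xi> \<zeta> : ann Vd (gsum M D) (p + q)"
  \<comment> \<open>One factor is decomposed at a time: here the left one is elementary and the
    right one arbitrary.\<close>
  have 1: "mul Bd (emb C \<xi> a) G : Kd (gsum M D) (p + q + r)"
   if \<xi>: "\<xi> : ann Vd M p" and a: "a : car A q" and G: "G : Kd M r" for \<xi> a p q r G
  proof -
   have E: "emb C \<xi> a : car Bd (p + q)" by (rule emb_closed[OF C A annd[OF \<xi>] a])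
   let ?S = "{G : car Bd r. mul Bd (emb C \<xi> a) G : Kd (gsum M D) (p + q + r)}"
   have "G : ?S"
   proof (rule vanish_decompose[OF M D G])
    show "kvs.subspace ?S"
     using car_closed[OF algebra_Bd] K1S
     by (auto simp: kvs.subspace_def mul_zero_right[OF algebra_Bd E] mul_add_right[OF algebra_Bd E] mul_scl_right[OF algebra_Bd E])
    show "Kd (gsum M D) r \<subseteq> ?S" using K1(2) K1(5)[OF _ E] by auto
    fix p' q' \<zeta> a' assume pq: "p' + q' = r" and \<zeta>: "\<zeta> : ann Vd M p'" and a': "a' : car A q'"
    have "emb C (mul (dual_alg C) \<xi> \<zeta>) (mul A a a') : Kd (gsum M D) ((p + p') + (q + q'))"
     using 0 \<xi> \<zeta> by (intro emb_vanish[OF M1] mul_closed[OF A a a']) blast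
    then have "mul Bd (emb C \<xi> a) (emb C \<zeta> a') : Kd (gsum M D) ((p + p') + (q + q'))"
     unfolding emb_mul[OF C A annd[OF \<xi>] a annd[OF \<zeta>] a'] by (rule K1S(6))
    moreover have "(p + p') + (q + q') = p + q + r" using pq by simp
    ultimately show "emb C \<zeta> a' : ?S" using emb_closed[OF C A annd[OF \<zeta>] a'] pq by simp
   qed
   then show ?thesis by simp
  qed
  have "mul Bd F G : Kd (gsum M D) (p + q)" if F: "F : Kd M p" and G: "G : Kd M q" for p q F G
  proof -
   have GB: "G : car Bd q" by (rule K0(2)[OF G])
   let ?S = "{F : car Bd p. mul Bd F G : Kd (gsum M D) (p + q)}"
   have "F : ?S"
   proof (rule vanish_decompose[OF M D F])
    show "kvs.subspace ?S"
     using car_closed[OF algebra_Bd] K1S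
     by (auto simp: kvs.subspace_def mul_zero_left[OF algebra_Bd GB] mul_add_left[OF algebra_Bd _ _ GB] mul_scl_left[OF algebra_Bd _ GB])
    show "Kd (gsum M D) p \<subseteq> ?S" using K1(2) K1(4)[OF _ GB] by auto
    fix p' q' \<zeta> a' assume pq: "p' + q' = p" and \<zeta>: "\<zeta> : ann Vd M p'" and a': "a' : car A q'"
    show "emb C \<zeta> a' : ?S" using emb_closed[OF C A annd[OF \<zeta>] a'] 1[OF \<zeta> a' G] pq by simp
   qed
   then show ?thesis by simp
  qed
  then show ?thesis by blast
 }
 assume "EX e:ann Vd M 0. ALL n. ALL \<xi>:ann Vd M n. mul (dual_alg C) e \<xi> - \<xi> : ann Vd (gsum M D) n &
    mul (dual_alg C) \<xi> e - \<xi> : ann Vd (gsum M D) n"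
 then obtain e where e: "e : ann Vd M 0"
  "!!n \<xi>. \<xi> : ann Vd M n ==> mul (dual_alg C) e \<xi> - \<xi> : ann Vd (gsum M D) n & mul (dual_alg C) \<xi> e - \<xi> : ann Vd (gsum M D) n"
  by blast
 have U: "unt A : car A 0" by (rule curved_algebraD(5)[OF A])
 let ?E = "emb C e (unt A)"
 have EM: "?E : Kd M 0" using emb_vanish[OF M e(1) U] by simp
 have EB: "?E : car Bd 0" by (rule K0(2)[OF EM])
 have emb_diff: "emb C \<zeta> a - emb C \<xi> a : Kd (gsum M D) n"
  if z: "\<zeta> - \<xi> : ann Vd (gsum M D) p" "\<zeta> : dual Vd p" "\<xi> : dual Vd p" and a: "a : car A q" and n: "p + q = n" for \<zeta> \<xi> a p q n
 proof -
  have "emb C \<zeta> a - emb C \<xi> a : car Bd n"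
   using car_closed(5)[OF algebra_Bd emb_closed[OF C A z(2) a] emb_closed[OF C A z(3) a]] n by simp
  moreover have "ev C (emb C \<zeta> a - emb C \<xi> a) c = 0" if c: "c : homogeneous (gsum M D)" for c
  proof -
   obtain m where "c : gsum M D m" using c by (rule homogeneousE)
   then have "c : Vd m" using subcoalgebraD(2)[OF M1] by blast
   then have cV: "c : homogeneous Vd" by (rule homogeneousI[where V = Vd])
   have "ev C (emb C (\<zeta> - \<xi>) a) c = 0" using emb_vanish[OF M1 z(1) a] c by (simp add: vanish_def)
   then have "scl (\<zeta> c - \<xi> c) a = 0" using ev_emb[OF C A annd[OF z(1)] a cV] by (simp add: pointwise)
   then show ?thesis using ev_emb[OF C A z(2) a cV] ev_emb[OF C A z(3) a cV] by (simp add: ev_diff[OF C A] kvs.scale_left_diff_distrib)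
  qed
  ultimately show ?thesis by (simp add: vanish_def)
 qed
 have "mul Bd ?E F - F : Kd (gsum M D) n & mul Bd F ?E - F : Kd (gsum M D) n" if F: "F : Kd M n" for F n
 proof -
  let ?S = "{F : car Bd n. mul Bd ?E F - F : Kd (gsum M D) n & mul Bd F ?E - F : Kd (gsum M D) n}"
  have "F : ?S"
  proof (rule vanish_decompose[OF M D F])
   show "kvs.subspace ?S"
   proof (rule kvs.subspaceI)
    show "0 : ?S" using car_closed(1)[OF algebra_Bd] K1S(1)
     by (simp add: mul_zero_right[OF algebra_Bd EB] mul_zero_left[OF algebra_Bd EB])
    fix F G c assume F: "F : ?S"
    then have FB: "F : car Bd n" by simp
    have "scl c (mul Bd ?E F - F) : Kd (gsum M D) n" "scl c (mul Bd F ?E - F) : Kd (gsum M D) n"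
     by (rule K1S(3), use F in simp)+
    then show "scl c F : ?S" using car_closed(3)[OF algebra_Bd FB]
     unfolding kvs.scale_right_diff_distrib by (simp add: mul_scl_right[OF algebra_Bd EB FB] mul_scl_left[OF algebra_Bd FB EB])
    assume G: "G : ?S"
    then have GB: "G : car Bd n" by simp
    have "(mul Bd ?E F - F) + (mul Bd ?E G - G) : Kd (gsum M D) n" "(mul Bd F ?E - F) + (mul Bd G ?E - G) : Kd (gsum M D) n"
     using F G K1S(2) by auto
    then show "F + G : ?S" using car_closed(2)[OF algebra_Bd FB GB]
     by (simp add: mul_add_right[OF algebra_Bd EB FB GB] mul_add_left[OF algebra_Bd FB GB EB] algebra_simps)
   qed
   show "Kd (gsum M D) n \<subseteq> ?S"
   proof
    fix G assume G: "G : Kd (gsum M D) n"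
    show "G : ?S" using K1(2)[OF G] K1S(5)[OF _ G] K1(4)[OF G EB] K1(5)[OF G EB] by simp
   qed
   fix p q \<zeta> a assume pq: "p + q = n" and \<zeta>: "\<zeta> : ann Vd M p" and a: "a : car A q"
   have c: "mul (dual_alg C) e \<zeta> : dual Vd p" "mul (dual_alg C) \<zeta> e : dual Vd p"
    using mul_closed[OF curved_coalgebraD(6)[OF C], of e 0 \<zeta> p] mul_closed[OF curved_coalgebraD(6)[OF C], of \<zeta> p e 0] annd[OF \<zeta>] annd[OF e(1)] by simp_all
   show "emb C \<zeta> a : ?S"
    using emb_closed[OF C A annd[OF \<zeta>] a] pq emb_diff[OF _ c(1) annd[OF \<zeta>] a pq] emb_diff[OF _ c(2) annd[OF \<zeta>] a pq] e(2)[OF \<zeta>]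
    by (simp add: emb_mul[OF C A annd[OF e(1)] U annd[OF \<zeta>] a] emb_mul[OF C A annd[OF \<zeta>] a annd[OF e(1)] U] curved_algebraD(6,7)[OF A a])
  qed
  then show ?thesis by simp
 qed
 then show ?thesis using EM by blast
qed

lemma extend_equiv_mod:
 assumes M: "subcoalgebra C M" and ne: "M ~= Vd" and x: "x : MC Bd" and eq: "equiv_mod Bd (Kd M) x y g g' v g'' w"
 obtains N y1 g1 g1' v1 g1'' w1 where "subcoalgebra C N" "M <= N" "N ~= M" "equiv_mod Bd (Kd N) x y1 g1 g1' v1 g1'' w1"
  "y1 - y : Kd M 1" "g1 - g : Kd M 0" "g1' - g' : Kd M 0" "v1 - v : Kd M (- 1)" "g1'' - g'' : Kd M 0" "w1 - w : Kd M (- 1)"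
proof -
 obtain D where D: "D : fd_subcoalgs C" "\<not> D <= M" and
  dich: "(ALL p q. ALL \<xi>:ann Vd M p. ALL \<zeta>:ann Vd M q. mul (dual_alg C) \<xi> \<zeta> : ann Vd (gsum M D) (p + q)) |
   (EX e:ann Vd M 0. ALL n. ALL \<xi>:ann Vd M n. mul (dual_alg C) e \<xi> - \<xi> : ann Vd (gsum M D) n &
    mul (dual_alg C) \<xi> e - \<xi> : ann Vd (gsum M D) n)"
  by (rule ann_dichotomy[OF C M ne]) (rule that)
 have DS: "subcoalgebra C D" using D by (simp add: fd_subcoalgs_iff)
 have M1: "subcoalgebra C (gsum M D)" by (rule subcoalgebra_sum[OF C M DS])
 have up: "M <= gsum M D" "D <= gsum M D"
  using gsum_upper[where D = M and E = D, OF subcoalgebraD(1)[OF M] subcoalgebraD(1)[OF DS]] by blast+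
 have ne1: "gsum M D ~= M" using up(2) D(2) by metis
 show thesis
  by (rule lift_equiv_mod[OF algebra_Bd vanish_dg_ideal[OF M1] vanish_dg_ideal[OF M] vanish_antimono[OF up(1)]
    vanish_dichotomy[OF M D(1) dich] x eq]) (rule that[OF M1 up(1) ne1])
qed

end

section \<open>Transfinite lifting\<close>

text \<open>All operations respect congruence modulo the ideal \<open>K\<close>. So data on a
  subcoalgebra can be exchanged for other data with the same values on it.\<close>

lemma equiv_mod_cong:
 assumes A: "curved_algebra A" and K: "dg_ideal A K" and x: "x : car A 1" and eq: "equiv_mod A K x y g g' v g'' w"
  and c1: "y1 : car A 1" "g1 : car A 0" "g1' : car A 0" "v1 : car A (- 1)" "g1'' : car A 0" "w1 : car A (- 1)"
  and d: "y1 - y : K 1" "g1 - g : K 0" "g1' - g' : K 0" "v1 - v : K (- 1)" "g1'' - g'' : K 0" "w1 - w : K (- 1)"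
 shows "equiv_mod A K x y1 g1 g1' v1 g1'' w1"
proof -
 have c: "y : car A 1" "g : car A 0" "g' : car A 0" "v : car A (- 1)" "g'' : car A 0" "w : car A (- 1)"
  using eq by (auto simp: equiv_mod_def)
 note KS = subspaceD[OF dg_idealD(1)[OF K]]
 have mulc: "mul A a b - mul A a' b' : K (p + q)"
  if "a : car A p" "a' : car A p" "b : car A q" "b' : car A q" "a - a' : K p" "b - b' : K q" for a a' b b' p q
 proof -
  have "mul A (a - a') b : K (p + q)" "mul A a' (b - b') : K (p + q)"
   using dg_idealD(4)[OF K that(5) that(3)] dg_idealD(5)[OF K that(6) that(2)] by simp_all
  from KS(2)[OF this] show ?thesis
   by (simp add: mul_diff_left[OF A that(1,2,3)] mul_diff_right[OF A that(2,3,4)])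
 qed
 have difc: "dif A a - dif A a' : K (p + 1)" if "a : car A p" "a' : car A p" "a - a' : K p" for a a' p
  using dg_idealD(3)[OF K that(3)] by (simp add: dif_diff[OF A that(1,2)])
 have mv: "t1 : K n" if "t : K n" "t1 - t : K n" for t t1 n
  using KS(2)[OF that] by simp
 have xx: "x - x : K 1" using KS(1) by simp
 have ad: "(t1 + s1) - (t + s) : K n" "(t1 - s1) - (t - s) : K n" if "t1 - t : K n" "s1 - s : K n" for t t1 s s1 n
  using KS(2)[OF that] KS(5)[OF that] by (simp_all add: algebra_simps)
 have s1: "(cur A + dif A y1 + mul A y1 y1) - (cur A + dif A y + mul A y y) : K 2"
  using ad(1)[OF ad(1)[OF _ difc[OF c1(1) c(1) d(1)]] mulc[OF c1(1) c(1) c1(1) c(1) d(1) d(1)], of "cur A" "cur A"] KS(1) by simp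
 have s2: "(dif A f1 + mul A a1 f1 - mul A f1 b1) - (dif A f + mul A a f - mul A f b) : K 1"
  if "a1 : car A 1" "a : car A 1" "b1 : car A 1" "b : car A 1" "f1 : car A 0" "f : car A 0" "a1 - a : K 1" "b1 - b : K 1" "f1 - f : K 0"
  for a a1 b b1 f f1
  using ad(2)[OF ad(1)[OF difc[OF that(5,6,9), simplified] mulc[OF that(1,2,5,6,7,9), simplified]] mulc[OF that(5,6,3,4,9,8), simplified]] by simp
 have s3: "(mul A f1 e1 - unt A - (dif A r1 + mul A a1 r1 + mul A r1 a1)) - (mul A f e - unt A - (dif A r + mul A a r + mul A r a)) : K 0"
  if t: "a1 : car A 1" "a : car A 1" "f1 : car A 0" "f : car A 0" "e1 : car A 0" "e : car A 0" "r1 : car A (- 1)" "r : car A (- 1)"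
   "a1 - a : K 1" "f1 - f : K 0" "e1 - e : K 0" "r1 - r : K (- 1)"
  for a a1 e e1 f f1 r r1
 proof -
  have u: "unt A - unt A : K 0" using KS(1) by simp
  have m: "dif A r1 - dif A r : K 0" "mul A a1 r1 - mul A a r : K 0" "mul A r1 a1 - mul A r a : K 0" "mul A f1 e1 - mul A f e : K 0"
   using difc[OF t(7,8,12)] mulc[OF t(1,2,7,8,9,12)] mulc[OF t(7,8,1,2,12,9)] mulc[OF t(3,4,5,6,10,11)] by simp_all
  show ?thesis by (rule ad(2)[OF ad(2)[OF m(4) u] ad(1)[OF ad(1)[OF m(1,2)] m(3)]])
 qed
 note E = eq[unfolded equiv_mod_def]
 have "cur A + dif A y1 + mul A y1 y1 : K 2" using mv[OF _ s1] E by blast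
 moreover have "dif A g1 + mul A y1 g1 - mul A g1 x : K 1"
  using mv[OF _ s2[OF c1(1) c(1) x x c1(2) c(2) d(1) xx d(2)]] E by blast
 moreover have "dif A g1' + mul A x g1' - mul A g1' y1 : K 1"
  using mv[OF _ s2[OF x x c1(1) c(1) c1(3) c(3) xx d(1) d(3)]] E by blast
 moreover have "mul A g1 g1' - unt A - (dif A v1 + mul A y1 v1 + mul A v1 y1) : K 0"
  using mv[OF _ s3[OF c1(1) c(1) c1(2) c(2) c1(3) c(3) c1(4) c(4) d(1,2,3,4)]] E by blast
 moreover have "dif A g1'' + mul A x g1'' - mul A g1'' y1 : K 1"
  using mv[OF _ s2[OF x x c1(1) c(1) c1(5) c(5) xx d(1) d(5)]] E by blast
 moreover have "mul A g1'' g1 - unt A - (dif A w1 + mul A x w1 + mul A w1 x) : K 0"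
  using mv[OF _ s3[OF x x c1(5) c(5) c1(2) c(2) c1(6) c(6) xx d(5,2,6)]] E by blast
 ultimately show ?thesis unfolding equiv_mod_def using c1 by blast
qed

lemma graded_extend:
 fixes V M :: "('x, 'k::field) graded" and W :: "int => ('y => 'k) set"
 assumes V: "graded_space V" and M: "!!m. kvs.subspace (M m)" "!!m. M m \<subseteq> V m"
  and W: "!!m. linear_into (M m) (W m) t"
 obtains t' where "!!m. linear_into (V m) (W m) t'" "!!m c. c : M m ==> t' c = t c"
proof -
 obtain r where r: "!!m v w. r m (v + w) = r m v + r m w" "!!m v c. r m (scl c v) = scl c (r m v)"
  "!!m v. r m v : M m" "!!m v. v : M m ==> r m v = v"
  by (rule graded_projection_exists[OF M(1)]) (rule that)
 have r0: "r m 0 = 0" for m by (rule r(4)[OF subspaceD(1)[OF M(1)]])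
 \<comment> \<open>The degree is recovered from the vector, uniquely if the vector is nonzero; for
   the zero vector every projection gives 0.\<close>
 define t' where "t' c = t (r (SOME m. c : V m) c)" for c
 have t': "t' c = t (r m c)" if c: "c : V m" for c m
 proof (cases "c = 0")
  case True
  then show ?thesis by (simp add: t'_def r0)
 next
  case False
  have "c : V (SOME m. c : V m)" by (rule someI[of "%m. c : V m" m, OF c])
  then have "(SOME m. c : V m) = m" using graded_space_disjoint[OF V c] False by blast
  then show ?thesis by (simp add: t'_def)
 qed
 show thesis
 proof (rule that[of t'])
  note S = subspaceD[OF graded_spaceD(1)[OF V]]
  show "linear_into (V m) (W m) t'" for m
   by (rule linear_intoI)
    (simp_all add: t'[where m = m] S r linear_intoD[OF W r(3)])
  show "t' c = t c" if "c : M m" for c m using t'[of c m] M(2)[of m] that r(4) by auto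
 qed
qed

text \<open>The data \<open>y, g, g', v, g'', w\<close> of an equivalence modulo an ideal are indexed by \<open>0, ..., 5\<close>.\<close>

definition datum_deg :: "nat => int" where
 "datum_deg j = (if j = 0 then 1 else if j = 3 | j = 5 then - 1 else 0)"

context
 fixes C :: "('x, 'k::field) curved_coalg" and A :: "('a, 'k) curved_alg" and x
 assumes C: "curved_coalgebra C" and A: "curved_algebra A" and x: "x : MC (conv_alg C A)"
begin

private abbreviation "Ve \<equiv> ccar C"
private abbreviation "Be \<equiv> conv_alg C A"
private abbreviation "Ke \<equiv> vanish C A"
private lemmas graded_Ve = curved_coalgebraD(1)[OF C]
private lemmas algebra_Be = conv_algebra[OF C A]

private lemma xB: "x : car Be 1"
 using x by (simp add: MC_def)

text \<open>The data are elements of the full convolution algebra, and only the equations are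
  restricted to \<open>M\<close>. So all stages of the transfinite process live in one algebra, with
  arbitrary values off \<open>M\<close>.\<close>

definition partial_lift where
 "partial_lift M d \<longleftrightarrow> subcoalgebra C M & (ALL j. d j : car Be (datum_deg j)) &
   equiv_mod Be (Ke M) x (d 0) (d 1) (d 2) (d 3) (d 4) (d 5)"

lemma partial_lift_cong:
 assumes d: "partial_lift M d" and e: "!!j. e j : car Be (datum_deg j)" "!!j. e j - d j : Ke M (datum_deg j)"
 shows "partial_lift M e"
proof -
 have M: "subcoalgebra C M" and eq: "equiv_mod Be (Ke M) x (d 0) (d 1) (d 2) (d 3) (d 4) (d 5)"
  using d by (auto simp: partial_lift_def)
 have "equiv_mod Be (Ke M) x (e 0) (e 1) (e 2) (e 3) (e 4) (e 5)"
  by (rule equiv_mod_cong[OF algebra_Be vanish_dg_ideal[OF C A M] xB eq])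
   (use e(1)[of 0] e(1)[of 1] e(1)[of 2] e(1)[of 3] e(1)[of 4] e(1)[of 5] e(2)[of 0] e(2)[of 1] e(2)[of 2] e(2)[of 3] e(2)[of 4] e(2)[of 5]
    in \<open>simp_all add: datum_deg_def\<close>)
 then show ?thesis using M e(1) by (simp add: partial_lift_def)
qed

text \<open>The values of the members of the chain glue to graded linear maps on the union, which
  extend to all of \<open>C\<close>. The equations hold modulo the maps vanishing on each member,
  hence modulo the intersection of these ideals, the maps vanishing on the union.\<close>

lemma partial_lift_union:
 assumes ne: "S ~= {}" and S: "!!M d. (M, d) : S ==> partial_lift M d"
  and chain: "!!M d N e. (M, d) : S ==> (N, e) : S ==>
   (M <= N & (ALL j. ALL c:homogeneous M. ev C (e j) c = ev C (d j) c)) |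
   (N <= M & (ALL j. ALL c:homogeneous N. ev C (d j) c = ev C (e j) c))"
 obtains N e where "partial_lift N e" "!!M d. (M, d) : S ==> M <= N"
  "!!M d j c. (M, d) : S ==> c : homogeneous M ==> ev C (e j) c = ev C (d j) c"
proof -
 define N where "N n = (\<Union>(M, d)\<in>S. M n)" for n
 have sub: "subcoalgebra C M" and dB: "d j : car Be (datum_deg j)" if "(M, d) : S" for M d j
  using S[OF that] by (auto simp: partial_lift_def)
 have MN: "M <= N" if "(M, d) : S" for M d using that by (auto simp: N_def le_fun_def)
 have N_E: "EX M d. (M, d) : S & c : M n" if "c : N n" for c n using that by (auto simp: N_def)
 have N_E2: "EX M d. (M, d) : S & c : M n & c' : M n" if c: "c : N n" "c' : N n" for c c' n
 proof -
  obtain M d where 1: "(M, d) : S" "c : M n" using N_E[OF c(1)] by blast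
  obtain M' d' where 2: "(M', d') : S" "c' : M' n" using N_E[OF c(2)] by blast
  from chain[OF 1(1) 2(1)] show ?thesis using 1 2 by (meson le_funD subsetD)
 qed
 have N: "subcoalgebra C N"
  unfolding subcoalgebra_def
 proof (intro conjI allI ballI)
  fix n
  show "kvs.subspace (N n)"
  proof (rule kvs.subspaceI)
   obtain M d where "(M, d) : S" using ne by auto
   then show "0 : N n" using subspaceD(1)[OF subcoalgebraD(1)[OF sub]] MN by (meson le_funD subsetD)
   fix c c' r assume c: "c : N n"
   show "c + c' : N n" if c': "c' : N n"
   proof -
    obtain M d where "(M, d) : S" "c : M n" "c' : M n" using N_E2[OF c c'] by blast
    then show ?thesis using subspaceD(2)[OF subcoalgebraD(1)[OF sub]] MN by (meson le_funD subsetD)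
   qed
   obtain M d where "(M, d) : S" "c : M n" using N_E[OF c] by blast
   then show "scl r c : N n" using subspaceD(3)[OF subcoalgebraD(1)[OF sub]] MN by (meson le_funD subsetD)
  qed
  show "N n \<subseteq> Ve n" using subcoalgebraD(2)[OF sub] by (fastforce simp: N_def)
  fix c assume c: "c : N n"
  obtain M d where M: "(M, d) : S" "c : M n" using N_E[OF c] by blast
  show "comul C c : tensor N N n" using subcoalgebraD(3)[OF sub[OF M(1)] M(2)] tensor_mono[OF MN[OF M(1)] MN[OF M(1)]] by blast
  show "cdif C c : N (n + 1)" using subcoalgebraD(4)[OF sub[OF M(1)] M(2)] MN[OF M(1)] by (meson le_funD subsetD)
 qed
 have hN: "homogeneous N = (\<Union>(M, d)\<in>S. homogeneous M)"
  by (auto simp: homogeneous_def N_def)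
 define t where "t j c = ev C (snd (SOME s. s : S & c : homogeneous (fst s)) j) c" for j c
 have t: "t j c = ev C (d j) c" if s: "(M, d) : S" "c : homogeneous M" for M d j c
 proof -
  let ?s = "SOME s. s : S & c : homogeneous (fst s)"
  have "?s : S & c : homogeneous (fst ?s)" by (rule someI[of _ "(M, d)"]) (use s in simp)
  moreover obtain M' d' where e: "?s = (M', d')" by (cases ?s)
  ultimately have "(M', d') : S" "c : homogeneous M'" by simp_all
  then have "ev C (d' j) c = ev C (d j) c" using chain[OF s(1), of M' d'] s(2) by metis
  then show ?thesis unfolding t_def e by simp
 qed
 have "EX F:car Be (datum_deg j). ALL c:homogeneous N. ev C F c = t j c" for j
 proof -
  have lin: "linear_into (N m) (car A (m + datum_deg j)) (t j)" for m
  proof (rule linear_intoI)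
   fix c c' r assume c: "c : N m"
   obtain M d where M: "(M, d) : S" "c : M m" using N_E[OF c] by blast
   note lin = linear_intoD[OF ev_linear[OF C A dB[OF M(1)]]]
   have cV: "c : Ve m" using M subcoalgebraD(2)[OF sub] by blast
   have rM: "scl r c : M m" by (rule subspaceD(3)[OF subcoalgebraD(1)[OF sub[OF M(1)]] M(2)])
   have h: "c : homogeneous M" "scl r c : homogeneous M" by (rule homogeneousI[where V = M, OF M(2)], rule homogeneousI[where V = M, OF rM])
   show "t j c : car A (m + datum_deg j)" "t j (scl r c) = scl r (t j c)"
    using lin(1,2)[OF cV] by (simp_all add: t[OF M(1) h(1)] t[OF M(1) h(2)])
   assume c': "c' : N m"
   obtain M d where M: "(M, d) : S" "c : M m" "c' : M m" using N_E2[OF c c'] by blast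
   note lin = linear_intoD[OF ev_linear[OF C A dB[OF M(1)]]]
   have cV: "c : Ve m" "c' : Ve m" using M subcoalgebraD(2)[OF sub] by blast+
   have sM: "c + c' : M m" by (rule subspaceD(2)[OF subcoalgebraD(1)[OF sub[OF M(1)]] M(2,3)])
   note h = homogeneousI[where V = M, OF M(2)] homogeneousI[where V = M, OF M(3)] homogeneousI[where V = M, OF sM]
   show "t j (c + c') = t j c + t j c'"
    unfolding t[OF M(1) h(1)] t[OF M(1) h(2)] t[OF M(1) h(3)] by (rule lin(3)[OF cV])
  qed
  obtain t' where t': "!!m. linear_into (Ve m) (car A (m + datum_deg j)) t'" "!!m c. c : N m ==> t' c = t j c"
   by (rule graded_extend[OF graded_Ve subcoalgebraD(1,2)[OF N] lin]) (rule that)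
  obtain F where F: "F : car Be (datum_deg j)" "!!c. c : homogeneous Ve ==> ev C F c = t' c"
   by (rule conv_build[OF C A t'(1)]) (rule that)
  have "ev C F c = t j c" if c: "c : homogeneous N" for c
  proof -
   obtain m where m: "c : N m" using c by (rule homogeneousE)
   then have "c : Ve m" using subcoalgebraD(2)[OF N] by blast
   then show ?thesis using F(2)[OF homogeneousI[where V = Ve]] t'(2)[OF m] by simp
  qed
  then show ?thesis using F(1) by blast
 qed
 then have "EX e. ALL j. e j : car Be (datum_deg j) & (ALL c:homogeneous N. ev C (e j) c = t j c)" by metis
 then obtain e where e: "!!j. e j : car Be (datum_deg j)" "!!j c. c : homogeneous N ==> ev C (e j) c = t j c" by blast
 have agree: "ev C (e j) c = ev C (d j) c" if "(M, d) : S" "c : homogeneous M" for M d j c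
 proof -
  have "c : homogeneous N" using that hN by blast
  then show ?thesis using e(2) t[OF that] by simp
 qed
 have each: "equiv_mod Be (Ke M) x (e 0) (e 1) (e 2) (e 3) (e 4) (e 5)" if M: "(M, d) : S" for M d
 proof -
  have "e j - d j : Ke M (datum_deg j)" for j
   using car_closed(5)[OF algebra_Be e(1) dB[OF M]] agree[OF M] by (simp add: vanish_def ev_diff[OF C A])
  then show ?thesis using partial_lift_cong[OF S[OF M] e(1)] by (simp add: partial_lift_def)
 qed
 obtain M0 d0 where 0: "(M0, d0) : S" using ne by auto
 have inter: "X : Ke N n" if "!!M d. (M, d) : S ==> X : Ke M n" for X n
  using that[OF 0] that unfolding vanish_def hN by blast
 have "equiv_mod Be (Ke N) x (e 0) (e 1) (e 2) (e 3) (e 4) (e 5)"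
  unfolding equiv_mod_def using each[OF 0, unfolded equiv_mod_def] each[unfolded equiv_mod_def]
  by (intro conjI inter) blast+
 then have "partial_lift N e" using N e(1) by (simp add: partial_lift_def)
 then show thesis by (rule that[where N = N and e = e, OF _ MN]) (assumption | rule agree)+
qed

lemma full_lift:
 assumes M0: "subcoalgebra C M0" and eq: "equiv_mod Be (Ke M0) x y g g' v g'' w"
 obtains y1 g1 g1' v1 g1'' w1 where "equiv_mod Be (%_. {0}) x y1 g1 g1' v1 g1'' w1" "y1 - y : Ke M0 1" "g1 - g : Ke M0 0"
proof -
 define d0 where "d0 = (%_ :: nat. 0)(0 := y, 1 := g, 2 := g', 3 := v, 4 := g'', 5 := w)"
 have "d0 j : car Be (datum_deg j)" for j
  using eq car_closed(1)[OF algebra_Be] by (auto simp: d0_def datum_deg_def equiv_mod_def)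
 then have pl0: "partial_lift M0 d0"
  using M0 eq by (simp add: partial_lift_def) (simp add: d0_def)
 \<comment> \<open>The data are compared only on the smaller subcoalgebra. As values elsewhere are
   free, the relation is not antisymmetric, and a maximal chain takes the place of a maximal
   element.\<close>
 define le where "le s t \<longleftrightarrow> fst s <= fst t & (ALL j. ALL c:homogeneous (fst s). ev C (snd t j) c = ev C (snd s j) c)"
  for s t :: "('x, 'k) graded \<times> (nat => ('x, 'k) graded \<times> (('x => 'k) \<times> 'a) => 'k)"
 have le_refl: "le s s" for s by (simp add: le_def)
 have le_trans: "le s u" if st: "le s t" and tu: "le t u" for s t u
 proof -
  have "ev C (snd u j) c = ev C (snd s j) c" if "c : homogeneous (fst s)" for j c
   using st tu that homogeneous_mono[of "fst s" "fst t" c] by (simp add: le_def)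
  then show ?thesis using st tu by (auto simp: le_def)
 qed
 define P where "P = {s. partial_lift (fst s) (snd s) & le (M0, d0) s}"
 interpret po: pred_on P le .
 obtain S where mc: "po.maxchain S" using po.Hausdorff by (rule exE)
 have ch: "S \<subseteq> P" "ALL s:S. ALL t:S. sup le (=) s t | sup le (=) t s"
  using po.maxchain_imp_chain[OF mc] unfolding po.chain_def by (rule conjunct1, rule conjunct2)
 have tot: "le s t | le t s" if "s : S" "t : S" for s t
  using bspec[OF bspec[OF ch(2) that(1)] that(2)] le_refl[of s] by auto
 \<comment> \<open>An upper bound of the maximal chain belongs to it, since it could otherwise be
   added.\<close>
 have top: "s : S" if s: "s : P" "!!t. t : S ==> le t s" for s
 proof (rule ccontr)
  assume "s ~: S"
  then have "S \<subset> insert s S" by blast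
  moreover have "po.chain (insert s S)"
   unfolding po.chain_def by (intro conjI ballI) (use s ch in \<open>auto simp: le_refl\<close>)
  ultimately show False using mc unfolding po.maxchain_def by blast
 qed
 have PD: "partial_lift M d" "le (M0, d0) (M, d)" if "(M, d) : S" for M d
  using subsetD[OF ch(1) that] by (simp_all add: P_def)
 have Sne: "S ~= {}" using top[of "(M0, d0)"] pl0 le_refl by (auto simp: P_def)
 obtain M d where Md: "partial_lift M d" "!!s. s : S ==> le s (M, d)"
 proof (rule partial_lift_union[OF Sne PD(1)])
  show "(N <= N' & (ALL j. ALL c:homogeneous N. ev C (e' j) c = ev C (e j) c)) |
    (N' <= N & (ALL j. ALL c:homogeneous N'. ev C (e j) c = ev C (e' j) c))" if "(N, e) : S" "(N', e') : S" for N e N' e'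
   using tot[OF that] by (simp add: le_def)
  fix N e assume N: "partial_lift N e" "!!M d. (M, d) : S ==> M <= N"
   "!!M d j c. (M, d) : S ==> c : homogeneous M ==> ev C (e j) c = ev C (d j) c"
  have "le s (N, e)" if "s : S" for s using N(2,3)[of "fst s" "snd s"] that by (simp add: le_def)
  then show thesis by (rule that[OF N(1)])
 qed assumption
 have "le (M0, d0) (M, d)"
 proof -
  obtain N e where s: "(N, e) : S" using Sne by auto
  show ?thesis by (rule le_trans[OF PD(2)[OF s] Md(2)[OF s]])
 qed
 then have MP: "(M, d) : P" and M4: "!!j c. c : homogeneous M0 ==> ev C (d j) c = ev C (d0 j) c"
  using Md(1) by (simp_all add: le_def P_def)
 have Msub: "subcoalgebra C M" and dB: "!!j. d j : car Be (datum_deg j)" and dM: "equiv_mod Be (Ke M) x (d 0) (d 1) (d 2) (d 3) (d 4) (d 5)"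
  using Md(1) by (auto simp: partial_lift_def)
 \<comment> \<open>Otherwise the extension by one step would again be an upper bound of
   \<open>S\<close>, hence a member of \<open>S\<close> and below \<open>(M, d)\<close>, although
   its subcoalgebra is strictly larger.\<close>
 have MV: "M = Ve"
 proof (rule ccontr)
  assume "M ~= Ve"
  then obtain N y1 g1 g1' v1 g1'' w1 where N: "subcoalgebra C N" "M <= N" "N ~= M" "equiv_mod Be (Ke N) x y1 g1 g1' v1 g1'' w1"
   and df: "y1 - d 0 : Ke M 1" "g1 - d 1 : Ke M 0" "g1' - d 2 : Ke M 0" "v1 - d 3 : Ke M (- 1)" "g1'' - d 4 : Ke M 0" "w1 - d 5 : Ke M (- 1)"
   by (rule extend_equiv_mod[OF C A Msub _ x dM]) (rule that)
  define e where "e = d(0 := y1, 1 := g1, 2 := g1', 3 := v1, 4 := g1'', 5 := w1)"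
  have "e j - d j : Ke M (datum_deg j)" for j
   using df subspaceD(1)[OF dg_idealD(1)[OF vanish_dg_ideal[OF C A Msub]]] by (auto simp: e_def datum_deg_def)
  then have "le (M, d) (N, e)" using N(2) by (simp add: le_def vanish_def ev_diff[OF C A])
  moreover have "e j : car Be (datum_deg j)" for j using dB[of j] N(4) by (auto simp: e_def datum_deg_def equiv_mod_def)
  then have "partial_lift N e" using N(1,4) by (simp add: partial_lift_def) (simp add: e_def)
  ultimately have "(N, e) : S" using MP by (intro top) (auto simp: P_def intro: le_trans Md(2))
  from Md(2)[OF this] show False using N(2,3) by (simp add: le_def)
 qed
 have "Ke Ve n = {0}" for n
 proof -
  have "F = 0" if "F : Ke Ve n" for F
   using that by (intro conv_eqI[OF C A _ car_closed(1)[OF algebra_Be]]) (auto simp: vanish_def ev_zero[OF C A])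
  moreover have "0 : Ke Ve n" using car_closed(1)[OF algebra_Be] by (simp add: vanish_def ev_zero[OF C A])
  ultimately show ?thesis by blast
 qed
 then have "Ke Ve = (%_. {0})" by (rule ext)
 then have "equiv_mod Be (%_. {0}) x (d 0) (d 1) (d 2) (d 3) (d 4) (d 5)" using dM MV by simp
 moreover have diff: "d j - d0 j : Ke M0 (datum_deg j)" for j
 proof -
  have "d0 j : car Be (datum_deg j)" using pl0 by (simp add: partial_lift_def)
  then show ?thesis using car_closed(5)[OF algebra_Be dB] M4 by (simp add: vanish_def ev_diff[OF C A])
 qed
 have "d 0 - y : Ke M0 1" "d 1 - g : Ke M0 0" using diff[of 0] diff[of 1] by (simp_all add: d0_def datum_deg_def)
 ultimately show thesis using that by blast
qed

end

section \<open>Maurer-Cartan dg categories\<close>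

context
 fixes B :: "('x, 'k::field) curved_alg"
 assumes B: "curved_algebra B"
begin

private abbreviation "hdf x y n a \<equiv> dif B a + mul B y a - ksign n (mul B a x)"

private lemmas bc = car_closed[OF B]

private lemma mul_car: "a : car B p ==> b : car B q ==> n = p + q ==> mul B a b : car B n"
 using mul_closed[OF B] by simp

private lemma mul_minus: "a : car B p ==> b : car B q ==> mul B a (- b) = - mul B a b"
 "a : car B p ==> b : car B q ==> mul B (- a) b = - mul B a b"
 using mul_diff_right[OF B, of a p 0 q b] mul_diff_left[OF B, of 0 p a b q] mul_zero_left[OF B] mul_zero_right[OF B] bc(1) by simp_all

private lemma MC_D: "x : MC B ==> x : car B 1" "x : MC B ==> cur B + dif B x + mul B x x = 0"
 by (simp_all add: MC_def)

lemma MC_dif_closed: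
 assumes "x : car B 1" "y : car B 1" "a : car B n"
 shows "hdf x y n a : car B (n + 1)"
 using mul_car[OF assms(2,3) add.commute] mul_car[OF assms(3,1) refl] dif_closed[OF B assms(3)] bc by simp

lemma MC_dif_linear:
 assumes x: "x : car B 1" and y: "y : car B 1"
 shows "linear_into (car B n) (car B (n + 1)) (%a. hdf x y n a)"
proof (rule linear_intoI)
 fix a a' c assume a: "a : car B n"
 show "hdf x y n a : car B (n + 1)" by (rule MC_dif_closed[OF x y a])
 show "hdf x y n (scl c a) = scl c (hdf x y n a)"
  by (simp add: dif_scl[OF B a] mul_scl_right[OF B y a] mul_scl_left[OF B a x] kvs.scale_right_diff_distrib kvs.scale_right_distrib ksign_def)
 assume a': "a' : car B n"
 show "hdf x y n (a + a') = hdf x y n a + hdf x y n a'"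
  by (simp add: dif_add[OF B a a'] mul_add_right[OF B y a a'] mul_add_left[OF B a a' x] ksign_def)
qed

lemma MC_dif_dif:
 assumes x: "x : MC B" and y: "y : MC B" and a: "a : car B n"
 shows "hdf x y (n + 1) (hdf x y n a) = 0"
proof -
 note xc = MC_D(1)[OF x] and yc = MC_D(1)[OF y]
 note H = curved_algebraD(10)[OF B]
 have da: "dif B a : car B (n + 1)" by (rule dif_closed[OF B a])
 have ya: "mul B y a : car B (n + 1)" and ax: "mul B a x : car B (n + 1)" by (rule mul_car[OF yc a add.commute], rule mul_car[OF a xc refl])
 have dyya: "mul B (cur B + dif B y + mul B y y) a = mul B (cur B) a + mul B (dif B y) a + mul B y (mul B y a)"
  using H dif_closed[OF B yc] mul_car[OF yc yc, of 2] bc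
  by (simp add: mul_add_left[OF B _ _ a, of _ 2] curved_algebraD(4)[OF B yc yc a])
 have daxx: "mul B a (cur B + dif B x + mul B x x) = mul B a (cur B) + mul B a (dif B x) + mul B (mul B a x) x"
  using H dif_closed[OF B xc] mul_car[OF xc xc, of 2] bc
  by (simp add: mul_add_right[OF B a, of _ 2] curved_algebraD(4)[OF B a xc xc])
 have s: "ksign n t = (if even n then t else - t)" "ksign (n + 1) t = (if even n then - t else t)" "ksign 1 t = - t" for t :: "'x => 'k"
  by (simp_all add: ksign_def)
 have m: "mul B x (- t) = - mul B x t" "mul B y (- t) = - mul B y t" "mul B (- t) x = - mul B t x" "mul B (- t) y = - mul B t y" "dif B (- t) = - dif B t"
  if "t : car B (n + 1)" for t
  using mul_minus(1)[OF xc that] mul_minus(1)[OF yc that] mul_minus(2)[OF that xc] mul_minus(2)[OF that yc]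
   dif_diff[OF B bc(1) that] dif_zero[OF B] by simp_all
 have e: "hdf x y (n + 1) (hdf x y n a) = mul B (cur B + dif B y + mul B y y) a - mul B a (cur B + dif B x + mul B x x)"
  unfolding dyya daxx using da ya ax bc
  by (cases "even n") (simp_all add: s m dif_add[OF B, of _ "n + 1"] dif_diff[OF B, of _ "n + 1"]
    mul_add_right[OF B yc, of _ "n + 1"] mul_diff_right[OF B yc, of _ "n + 1"]
    mul_add_left[OF B _ _ xc, of _ "n + 1"] mul_diff_left[OF B _ _ xc, of _ "n + 1"] curved_algebraD(9)[OF B yc a] curved_algebraD(9)[OF B a xc]
    curved_algebraD(12)[OF B a] curved_algebraD(4)[OF B yc a xc])
 show ?thesis unfolding e MC_D(2)[OF x] MC_D(2)[OF y] by (simp add: mul_zero_left[OF B a] mul_zero_right[OF B a])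
qed

lemma MC_leibniz:
 assumes x: "x : car B 1" and y: "y : car B 1" and z: "z : car B 1" and b: "b : car B m" and a: "a : car B n"
 shows "hdf x z (m + n) (mul B b a) = mul B (hdf y z m b) a + ksign m (mul B b (hdf x y n a))"
proof -
 have d: "dif B b : car B (m + 1)" "dif B a : car B (n + 1)" using dif_closed[OF B] a b by blast+
 have c: "mul B z b : car B (m + 1)" "mul B b y : car B (m + 1)" "mul B y a : car B (n + 1)" "mul B a x : car B (n + 1)"
  by (rule mul_car[OF z b add.commute], rule mul_car[OF b y refl], rule mul_car[OF y a add.commute], rule mul_car[OF a x refl])
 have l: "mul B (hdf y z m b) a = mul B (dif B b) a + mul B z (mul B b a) - ksign m (mul B b (mul B y a))"
  using d c bc by (simp add: mul_diff_left[OF B _ _ a, of _ "m + 1"] mul_add_left[OF B _ _ a, of _ "m + 1"] mul_ksign_left[OF B _ a, of _ "m + 1"]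
   curved_algebraD(4)[OF B z b a] curved_algebraD(4)[OF B b y a])
 have r: "mul B b (hdf x y n a) = mul B b (dif B a) + mul B b (mul B y a) - ksign n (mul B (mul B b a) x)"
  using d c bc by (simp add: mul_diff_right[OF B b, of _ "n + 1"] mul_add_right[OF B b, of _ "n + 1"] mul_ksign_right[OF B b, of _ "n + 1"]
   curved_algebraD(4)[OF B b a x])
 show ?thesis unfolding l r curved_algebraD(9)[OF B b a] by (simp add: ksign_def)
qed

lemma dg_category_MC: "dg_category (MC_dg B)"
 unfolding dg_category_def MC_dg_def dgcat.simps
proof (intro conjI ballI allI)
 fix x y z w n m l a b c assume x: "x : MC B"
 note xc = MC_D(1)[OF x]
 note U = curved_algebraD(5)[OF B]
 show "unt B : car B 0" by (rule U)
 show "hdf x x 0 (unt B) = 0" by (simp add: dif_unit[OF B] curved_algebraD(6,7)[OF B xc])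
 show "graded_space (car B)" by (rule curved_algebraD(1)[OF B])
 show "mul B a (unt B) = a" "mul B (unt B) a = a" if "a : car B n" using that by (rule curved_algebraD[OF B])+
 show "mul B (mul B c b) a = mul B c (mul B b a)" if "c : car B l" "b : car B m" "a : car B n" using that by (rule curved_algebraD(4)[OF B])
 show "linear_into (car B n) (car B (m + n)) (%a. mul B b a)" if "b : car B m" by (rule curved_algebraD(2)[OF B that])
 show "linear_into (car B m) (car B (m + n)) (%b. mul B b a)" if "a : car B n" by (rule curved_algebraD(3)[OF B that])
 assume y: "y : MC B"
 show "linear_into (car B n) (car B (n + 1)) (%a. hdf x y n a)" by (rule MC_dif_linear[OF xc MC_D(1)[OF y]])
 show "hdf x y (n + 1) (hdf x y n a) = 0" if "a : car B n" by (rule MC_dif_dif[OF x y that])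
 assume z: "z : MC B"
 show "hdf x z (m + n) (mul B b a) = mul B (hdf y z m b) a + ksign m (mul B b (hdf x y n a))" if "b : car B m" "a : car B n"
  by (rule MC_leibniz[OF xc MC_D(1)[OF y] MC_D(1)[OF z] that])
qed

text \<open>The chain of homotopies g' g ~ g'' g g' g ~ g'' g ~ 1 adds up to w + g'' v g - w g' g.
  Here the two inverses that were kept apart for the lifting are merged into one.\<close>

lemma homotopy_inverse:
 assumes x: "x : MC B" and y: "y : MC B"
  and g: "g : car B 0" "hdf x y 0 g = 0" and g': "g' : car B 0" "hdf y x 0 g' = 0" and g'': "g'' : car B 0" "hdf y x 0 g'' = 0"
  and v: "v : car B (- 1)" "mul B g g' = unt B + hdf y y (- 1) v"
  and w: "w : car B (- 1)" "mul B g'' g = unt B + hdf x x (- 1) w"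
 shows "EX s:car B (- 1). mul B g' g = unt B + hdf x x (- 1) s"
proof
 note xc = MC_D(1)[OF x] and yc = MC_D(1)[OF y]
 note U = curved_algebraD(5)[OF B]
 have dv: "hdf y y (- 1) v : car B 0" and dw: "hdf x x (- 1) w : car B 0"
  using MC_dif_closed[OF yc yc v(1)] MC_dif_closed[OF xc xc w(1)] by simp_all
 have gg: "mul B g' g : car B 0" by (rule mul_car[OF g'(1) g(1)]) simp
 have vg: "mul B v g : car B (- 1)" by (rule mul_car[OF v(1) g(1)]) simp
 let ?p = "mul B g'' (mul B v g)" and ?q = "mul B w (mul B g' g)"
 have p: "?p : car B (- 1)" by (rule mul_car[OF g''(1) vg]) simp
 have q: "?q : car B (- 1)" by (rule mul_car[OF w(1) gg]) simp
 show "w + ?p - ?q : car B (- 1)" using w(1) p q bc by simp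
 have hvg: "hdf x y (- 1) (mul B v g) = mul B (hdf y y (- 1) v) g"
  using MC_leibniz[OF xc yc yc v(1) g(1)] g(2) mul_zero_right[OF B v(1)] by (simp add: ksign_def)
 have hp: "hdf x x (- 1) ?p = mul B g'' (mul B (hdf y y (- 1) v) g)"
  using MC_leibniz[OF xc yc xc g''(1) vg] g''(2) mul_zero_left[OF B vg] unfolding hvg by simp
 have hgg: "hdf x x 0 (mul B g' g) = 0"
  using MC_leibniz[OF xc yc xc g'(1) g(1)] g(2) g'(2) mul_zero_left[OF B g(1)] mul_zero_right[OF B g'(1)] by simp
 have hq: "hdf x x (- 1) ?q = mul B (hdf x x (- 1) w) (mul B g' g)"
  using MC_leibniz[OF xc xc xc w(1) gg] hgg mul_zero_right[OF B w(1)] by (simp add: ksign_def)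
 note lin = linear_intoD(3)[OF MC_dif_linear[OF xc xc, of "- 1"]] linear_into_simps(3)[OF MC_dif_linear[OF xc xc, of "- 1"] curved_algebraD(13)[OF B]]
 have hs: "hdf x x (- 1) (w + ?p - ?q) = hdf x x (- 1) w + hdf x x (- 1) ?p - hdf x x (- 1) ?q"
  using lin(2)[OF bc(2)[OF w(1) p] q] lin(1)[OF w(1) p] by simp
 have e1: "mul B (hdf x x (- 1) w) (mul B g' g) = mul B g'' (mul B g (mul B g' g)) - mul B g' g"
 proof -
  have "hdf x x (- 1) w = mul B g'' g - unt B" using w(2) by simp
  then show ?thesis
   using mul_car[OF g''(1) g(1), of 0] by (simp add: mul_diff_left[OF B _ U gg] curved_algebraD(6)[OF B gg] curved_algebraD(4)[OF B g''(1) g(1) gg])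
 qed
 have e2: "mul B g'' (mul B (hdf y y (- 1) v) g) = mul B g'' (mul B g (mul B g' g)) - mul B g'' g"
 proof -
  have ggg: "mul B (mul B g g') g : car B 0" using mul_car[OF mul_car[OF g(1) g'(1), of 0] g(1), of 0] by simp
  have "hdf y y (- 1) v = mul B g g' - unt B" using v(2) by simp
  then have "mul B (hdf y y (- 1) v) g = mul B (mul B g g') g - g"
   using mul_car[OF g(1) g'(1), of 0] by (simp add: mul_diff_left[OF B _ U g(1)] curved_algebraD(6)[OF B g(1)])
  then show ?thesis using ggg by (simp add: mul_diff_right[OF B g''(1) _ g(1)] curved_algebraD(4)[OF B g(1) g'(1) g(1)])
 qed
 show "mul B g' g = unt B + hdf x x (- 1) (w + ?p - ?q)"
  unfolding hs hp hq e1 e2 using w(2) by simp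
qed

section \<open>Cohomology classes and isomorphisms in degree 0\<close>

lemma h0_class_MC: "h0_class (MC_dg B) x y a = {a + hdf x y (- 1) u |u. u : car B (- 1)}"
 by (simp add: h0_class_def MC_dg_def)

lemma h0_class_self:
 assumes "x : car B 1" "y : car B 1"
 shows "a : h0_class (MC_dg B) x y a"
 unfolding h0_class_MC using linear_into_simps(1)[OF MC_dif_linear[OF assms, of "- 1"] curved_algebraD(13)[OF B]] bc(1)
 by (auto intro!: exI[of _ 0])

lemma h0_class_shift:
 assumes x: "x : car B 1" and y: "y : car B 1" and u: "u : car B (- 1)"
 shows "h0_class (MC_dg B) x y (a + hdf x y (- 1) u) = h0_class (MC_dg B) x y a"
proof -
 note lin = linear_intoD(3)[OF MC_dif_linear[OF x y, of "- 1"]] linear_into_simps(3)[OF MC_dif_linear[OF x y, of "- 1"] curved_algebraD(13)[OF B]]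
 have 1: "a + hdf x y (- 1) u + hdf x y (- 1) t = a + hdf x y (- 1) (u + t)" if "t : car B (- 1)" for t
  using lin(1)[OF u that] by (simp add: add.assoc)
 have 2: "a + hdf x y (- 1) t = a + hdf x y (- 1) u + hdf x y (- 1) (t - u)" if "t : car B (- 1)" for t
  using lin(2)[OF that u] by simp
 show ?thesis
  unfolding h0_class_MC
 proof (intro subset_antisym subsetI)
  fix z assume "z : {a + hdf x y (- 1) u + hdf x y (- 1) t |t. t : car B (- 1)}"
  then obtain t where t: "z = a + hdf x y (- 1) u + hdf x y (- 1) t" "t : car B (- 1)" by blast
  then show "z : {a + hdf x y (- 1) t |t. t : car B (- 1)}" using 1[OF t(2)] bc(2)[OF u t(2)] by auto
 next
  fix z assume "z : {a + hdf x y (- 1) t |t. t : car B (- 1)}"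
  then obtain t where t: "z = a + hdf x y (- 1) t" "t : car B (- 1)" by blast
  have "z = a + hdf x y (- 1) u + hdf x y (- 1) (t - u)" unfolding t(1) by (rule 2[OF t(2)])
  then show "z : {a + hdf x y (- 1) u + hdf x y (- 1) t |t. t : car B (- 1)}" using bc(5)[OF t(2) u] by blast
 qed
qed

text \<open>Composition in \<open>H0\<close> is a union over representatives. Changing a
  representative changes the product by a coboundary, so all members of the union are the same
  class.\<close>

lemma h0_comp:
 assumes x: "x : MC B" and y: "y : MC B" and z: "z : MC B"
  and a: "a : car B 0" "hdf x y 0 a = 0" and b: "b : car B 0" "hdf y z 0 b = 0"
 shows "ccomp (H0 (MC_dg B)) x y z (h0_class (MC_dg B) y z b) (h0_class (MC_dg B) x y a) = h0_class (MC_dg B) x z (mul B b a)"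
proof -
 note xc = MC_D(1)[OF x] and yc = MC_D(1)[OF y] and zc = MC_D(1)[OF z]
 have eq: "h0_class (MC_dg B) x z (mul B b' a') = h0_class (MC_dg B) x z (mul B b a)"
  if a': "a' : h0_class (MC_dg B) x y a" and b': "b' : h0_class (MC_dg B) y z b" for a' b'
 proof -
  obtain t where t: "a' = a + hdf x y (- 1) t" "t : car B (- 1)" using a' unfolding h0_class_MC by blast
  obtain s where s: "b' = b + hdf y z (- 1) s" "s : car B (- 1)" using b' unfolding h0_class_MC by blast
  have dt: "hdf x y (- 1) t : car B 0" and ds: "hdf y z (- 1) s : car B 0"
   using MC_dif_closed[OF xc yc t(2)] MC_dif_closed[OF yc zc s(2)] by simp_all
  have a'c: "a' : car B 0" unfolding t(1) by (rule bc(2)[OF a(1) dt])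
  have bt: "mul B b t : car B (- 1)" and sa: "mul B s a' : car B (- 1)"
   using mul_car[OF b(1) t(2), of "- 1"] mul_car[OF s(2) a'c, of "- 1"] by simp_all
  have "hdf x y 0 (hdf x y (- 1) t) = 0" using MC_dif_dif[OF x y t(2)] by simp
  then have a'0: "hdf x y 0 a' = 0"
   unfolding t(1) linear_intoD(3)[OF MC_dif_linear[OF xc yc, of 0] a(1) dt] a(2) by simp
  have 1: "mul B b (hdf x y (- 1) t) = hdf x z (- 1) (mul B b t)"
   using MC_leibniz[OF xc yc zc b(1) t(2)] b(2) mul_zero_left[OF B t(2)] by simp
  have 2: "mul B (hdf y z (- 1) s) a' = hdf x z (- 1) (mul B s a')"
   using MC_leibniz[OF xc yc zc s(2) a'c] a'0 mul_zero_right[OF B s(2)] by (simp add: ksign_def)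
  have "mul B b' a' = mul B b a' + mul B (hdf y z (- 1) s) a'"
   unfolding s(1) by (rule mul_add_left[OF B b(1) ds a'c])
  also have "mul B b a' = mul B b a + mul B b (hdf x y (- 1) t)" unfolding t(1) by (rule mul_add_right[OF B b(1) a(1) dt])
  finally have "mul B b' a' = mul B b a + hdf x z (- 1) (mul B b t) + hdf x z (- 1) (mul B s a')" unfolding 1 2 .
  then show ?thesis by (simp only: h0_class_shift[OF xc zc bt] h0_class_shift[OF xc zc sa])
 qed
 let ?L = "h0_class (MC_dg B) y z b" and ?K = "h0_class (MC_dg B) x y a" and ?X = "h0_class (MC_dg B) x z (mul B b a)"
 have comp: "comp (MC_dg B) x y z b' a' = mul B b' a'" for b' a' by (simp add: MC_dg_def)
 have "ccomp (H0 (MC_dg B)) x y z ?L ?K = (\<Union>b'\<in>?L. \<Union>a'\<in>?K. h0_class (MC_dg B) x z (mul B b' a'))"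
  by (simp add: H0_def comp)
 also have "... = (\<Union>b'\<in>?L. \<Union>a'\<in>?K. ?X)" by (intro SUP_cong refl) (rule eq)
 also have "... = ?X" using h0_class_self[OF xc yc, of a] h0_class_self[OF yc zc, of b] by blast
 finally show ?thesis .
qed

lemma iso_in_H0_MC_I:
 assumes x: "x : MC B" and y: "y : MC B"
  and g: "g : car B 0" "hdf x y 0 g = 0" and g': "g' : car B 0" "hdf y x 0 g' = 0"
  and v: "v : car B (- 1)" "mul B g g' = unt B + hdf y y (- 1) v"
  and w: "w : car B (- 1)" "mul B g' g = unt B + hdf x x (- 1) w"
 shows "iso_in (H0 (MC_dg B)) x y (h0_class (MC_dg B) x y g)"
 unfolding iso_in_def
proof (intro conjI bexI)
 note xc = MC_D(1)[OF x] and yc = MC_D(1)[OF y]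
 show "h0_class (MC_dg B) x y g : chom (H0 (MC_dg B)) x y" using g by (simp add: H0_def MC_dg_def)
 show "h0_class (MC_dg B) y x g' : chom (H0 (MC_dg B)) y x" using g' by (simp add: H0_def MC_dg_def)
 have id: "cident (H0 (MC_dg B)) z = h0_class (MC_dg B) z z (unt B)" for z by (simp add: H0_def MC_dg_def)
 show "ccomp (H0 (MC_dg B)) x y x (h0_class (MC_dg B) y x g') (h0_class (MC_dg B) x y g) = cident (H0 (MC_dg B)) x"
  unfolding h0_comp[OF x y x g g'] id w(2) by (rule h0_class_shift[OF xc xc w(1)])
 show "ccomp (H0 (MC_dg B)) y x y (h0_class (MC_dg B) x y g) (h0_class (MC_dg B) y x g') = cident (H0 (MC_dg B)) y"
  unfolding h0_comp[OF y x y g' g] id v(2) by (rule h0_class_shift[OF yc yc v(1)])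
qed

lemma iso_in_H0_MC_E:
 assumes x: "x : MC B" and y: "y : MC B" and iso: "iso_in (H0 (MC_dg B)) x y L"
 obtains g g' v w where "L = h0_class (MC_dg B) x y g" "g : car B 0" "hdf x y 0 g = 0" "g' : car B 0" "hdf y x 0 g' = 0"
  "v : car B (- 1)" "mul B g g' = unt B + hdf y y (- 1) v" "w : car B (- 1)" "mul B g' g = unt B + hdf x x (- 1) w"
proof -
 note xc = MC_D(1)[OF x] and yc = MC_D(1)[OF y]
 have hom: "EX g. L = h0_class (MC_dg B) z t g & g : car B 0 & hdf z t 0 g = 0" if "L : chom (H0 (MC_dg B)) z t" for L z t
  using that by (auto simp: H0_def MC_dg_def)
 have id: "cident (H0 (MC_dg B)) z = h0_class (MC_dg B) z z (unt B)" for z by (simp add: H0_def MC_dg_def)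
 obtain L' where L: "L : chom (H0 (MC_dg B)) x y" "L' : chom (H0 (MC_dg B)) y x"
   "ccomp (H0 (MC_dg B)) x y x L' L = cident (H0 (MC_dg B)) x" "ccomp (H0 (MC_dg B)) y x y L L' = cident (H0 (MC_dg B)) y"
  using iso unfolding iso_in_def by blast
 obtain g where g: "L = h0_class (MC_dg B) x y g" "g : car B 0" "hdf x y 0 g = 0" using hom[OF L(1)] by blast
 obtain g' where g': "L' = h0_class (MC_dg B) y x g'" "g' : car B 0" "hdf y x 0 g' = 0" using hom[OF L(2)] by blast
 have "mul B g' g : h0_class (MC_dg B) x x (unt B)"
  using L(3) h0_class_self[OF xc xc, of "mul B g' g"] unfolding g(1) g'(1) h0_comp[OF x y x g(2,3) g'(2,3)] id by simp
 then obtain w where w: "w : car B (- 1)" "mul B g' g = unt B + hdf x x (- 1) w" unfolding h0_class_MC by blast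
 have "mul B g g' : h0_class (MC_dg B) y y (unt B)"
  using L(4) h0_class_self[OF yc yc, of "mul B g g'"] unfolding g(1) g'(1) h0_comp[OF y x y g'(2,3) g(2,3)] id by simp
 then obtain v where v: "v : car B (- 1)" "mul B g g' = unt B + hdf y y (- 1) v" unfolding h0_class_MC by blast
 show thesis by (rule that[OF g g'(2,3) v w])
qed

end

section \<open>Functors induced by morphisms of curved algebras\<close>

context
 fixes A :: "('x, 'k::field) curved_alg" and B :: "('y, 'k) curved_alg" and f s
 assumes A: "curved_algebra A" and B: "curved_algebra B" and f: "curved_hom A B f s"
begin

private lemmas fD = curved_homD[OF f]
private lemmas bcl = car_closed[OF B]

private lemma f_add: "a : car A n ==> a' : car A n ==> f (a + a') = f a + f a'"
 and f_diff: "a : car A n ==> a' : car A n ==> f (a - a') = f a - f a'"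
 and f_ksign: "a : car A n ==> f (ksign m a) = ksign m (f a)"
 by (rule linear_intoD(3)[OF fD(1)], assumption+)
  (rule linear_into_simps(3,4)[OF fD(1) curved_algebraD(13)[OF A]], assumption+)+

lemma curved_hom_MC_equation:
 assumes x: "x : car A 1"
 shows "f (cur A + dif A x + mul A x x) = cur B + dif B (s + f x) + mul B (s + f x) (s + f x)"
proof -
 have fx: "f x : car B 1" by (rule fD(7)[OF x])
 have dx: "dif A x : car A 2" and xx: "mul A x x : car A 2" using dif_closed[OF A x] mul_closed[OF A x x] by simp_all
 note H = curved_algebraD(10)[OF A]
 have "f (cur A + dif A x + mul A x x) = f (cur A) + f (dif A x) + f (mul A x x)"
  using f_add[OF car_closed(2)[OF A H dx] xx] f_add[OF H dx] by simp
 also have "... = cur B + dif B (s + f x) + mul B (s + f x) (s + f x)"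
  unfolding fD(6) fD(5)[OF x] fD(2)[OF x x] dif_add[OF B fD(4) fx]
   mul_add_left[OF B fD(4) fx bcl(2)[OF fD(4) fx]] mul_add_right[OF B fD(4) fD(4) fx] mul_add_right[OF B fx fD(4) fx]
  by (simp add: ksign_def)
 finally show ?thesis .
qed

lemma curved_hom_MC_dif:
 assumes x: "x : car A 1" and y: "y : car A 1" and a: "a : car A n"
 shows "f (dif A a + mul A y a - ksign n (mul A a x)) = dif B (f a) + mul B (s + f y) (f a) - ksign n (mul B (f a) (s + f x))"
proof -
 have da: "dif A a : car A (n + 1)" by (rule dif_closed[OF A a])
 have ya: "mul A y a : car A (n + 1)" and ax: "mul A a x : car A (n + 1)"
  using mul_closed[OF A y a] mul_closed[OF A a x] by (simp_all add: add.commute)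
 note fx = fD(7)[OF x] and fy = fD(7)[OF y] and fa = fD(7)[OF a]
 have "f (dif A a + mul A y a - ksign n (mul A a x)) = f (dif A a) + f (mul A y a) - ksign n (f (mul A a x))"
  using f_diff[OF car_closed(2)[OF A da ya] car_closed(6)[OF A ax]] f_add[OF da ya] f_ksign[OF ax] by simp
 then show ?thesis
  unfolding fD(5)[OF a] fD(2)[OF y a] fD(2)[OF a x] mul_add_left[OF B fD(4) fy fa] mul_add_right[OF B fa fD(4) fx]
  by (simp add: ksign_def)
qed

lemma curved_hom_MC: "x : MC A ==> s + f x : MC B"
 using curved_hom_MC_equation[of x] bcl(2)[OF fD(4) fD(7), of x] linear_into_simps(1)[OF fD(1) curved_algebraD(13)[OF A]]
 by (simp add: MC_def)

lemma dg_functor_MC: "dg_functor (MC_dg A) (MC_dg B) (MC_obj_map f s) (MC_hom_map f)"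
 unfolding dg_functor_def
proof (intro conjI ballI allI)
 show "dg_category (MC_dg A)" "dg_category (MC_dg B)" by (rule dg_category_MC[OF A], rule dg_category_MC[OF B])
 fix x assume x: "x : obj (MC_dg A)"
 then show "MC_obj_map f s x : obj (MC_dg B)" by (simp add: MC_dg_def MC_obj_map_def curved_hom_MC)
 show "MC_hom_map f x x (ident (MC_dg A) x) = ident (MC_dg B) (MC_obj_map f s x)"
  by (simp add: MC_dg_def MC_hom_map_def fD(3))
 fix y assume y: "y : obj (MC_dg A)"
 show "graded_map (hom (MC_dg A) x y) (hom (MC_dg B) (MC_obj_map f s x) (MC_obj_map f s y)) 0 (MC_hom_map f x y)"
  using fD(1) by (simp add: MC_dg_def graded_map_def MC_hom_map_def[abs_def])
 have xc: "x : car A 1" "y : car A 1" using x y by (simp_all add: MC_dg_def MC_def)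
 fix n a assume "a : hom (MC_dg A) x y n"
 then have a: "a : car A n" by (simp add: MC_dg_def)
 show "MC_hom_map f x y (hdif (MC_dg A) x y n a) = hdif (MC_dg B) (MC_obj_map f s x) (MC_obj_map f s y) n (MC_hom_map f x y a)"
  using curved_hom_MC_dif[OF xc a] by (simp add: MC_dg_def MC_hom_map_def MC_obj_map_def)
next
 fix x y z m n a b assume "b : hom (MC_dg A) y z m" "a : hom (MC_dg A) x y n"
 then have "b : car A m" "a : car A n" by (simp_all add: MC_dg_def)
 then show "MC_hom_map f x z (comp (MC_dg A) x y z b a) =
   comp (MC_dg B) (MC_obj_map f s x) (MC_obj_map f s y) (MC_obj_map f s z) (MC_hom_map f y z b) (MC_hom_map f x y a)"
  by (simp add: MC_dg_def MC_hom_map_def fD(2))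
qed

text \<open>\<open>f\<close> intertwines the Maurer-Cartan expressions and the twisted
  differentials, so arbitrary lifts of exact data satisfy the equations up to the kernel of
  \<open>f\<close>. The given two-sided inverse serves at first both as left and as right
  inverse.\<close>

lemma equiv_mod_kernel:
 assumes x: "x : MC A" and y: "y : car A 1" "s + f y = yB" "yB : MC B"
  and c: "g : car A 0" "g' : car A 0" "v : car A (- 1)" "w : car A (- 1)"
  and e: "dif B (f g) + mul B yB (f g) - mul B (f g) (s + f x) = 0"
   "dif B (f g') + mul B (s + f x) (f g') - mul B (f g') yB = 0"
   "mul B (f g) (f g') = unt B + (dif B (f v) + mul B yB (f v) + mul B (f v) yB)"
   "mul B (f g') (f g) = unt B + (dif B (f w) + mul B (s + f x) (f w) + mul B (f w) (s + f x))"
  and K: "!!n a. a : car A n ==> f a = 0 ==> a : K n"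
 shows "equiv_mod A K x y g g' v g' w"
proof -
 have xc: "x : car A 1" using x by (simp add: MC_def)
 note AC = car_closed[OF A]
 note H = curved_algebraD(10)[OF A] and U = curved_algebraD(5)[OF A]
 have hd0: "dif A h + mul A b h - mul A h a : car A 1" if "a : car A 1" "b : car A 1" "h : car A 0" for a b h
  using MC_dif_closed[OF A that] by simp
 have hdm: "dif A h + mul A b h + mul A h b : car A 0" if "b : car A 1" "h : car A (- 1)" for b h
  using MC_dif_closed[OF A that(1,1,2)] by (simp add: ksign_def)
 have f0: "f (dif A h + mul A b h - mul A h a) = dif B (f h) + mul B (s + f b) (f h) - mul B (f h) (s + f a)"
  if "a : car A 1" "b : car A 1" "h : car A 0" for a b h
  using curved_hom_MC_dif[OF that] by simp
 have fm: "f (dif A h + mul A b h + mul A h b) = dif B (f h) + mul B (s + f b) (f h) + mul B (f h) (s + f b)"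
  if "b : car A 1" "h : car A (- 1)" for b h
  using curved_hom_MC_dif[OF that(1,1,2)] by (simp add: ksign_def)
 have "cur A + dif A y + mul A y y : K 2"
 proof (rule K)
  show "cur A + dif A y + mul A y y : car A 2"
   using H dif_closed[OF A y(1)] mul_closed[OF A y(1) y(1)] AC by simp
  show "f (cur A + dif A y + mul A y y) = 0" unfolding curved_hom_MC_equation[OF y(1)] y(2) using y(3) by (simp add: MC_def)
 qed
 moreover have "dif A g + mul A y g - mul A g x : K 1"
  by (rule K[OF hd0[OF xc y(1) c(1)]]) (use f0[OF xc y(1) c(1)] e(1) y(2) in simp)
 moreover have "dif A g' + mul A x g' - mul A g' y : K 1"
  by (rule K[OF hd0[OF y(1) xc c(2)]]) (use f0[OF y(1) xc c(2)] e(2) y(2) in simp)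
 moreover have "mul A g g' - unt A - (dif A v + mul A y v + mul A v y) : K 0"
 proof (rule K)
  have m: "mul A g g' : car A 0" using mul_closed[OF A c(1,2)] by simp
  show "mul A g g' - unt A - (dif A v + mul A y v + mul A v y) : car A 0" by (intro AC(5) m U hdm y(1) c)
  show "f (mul A g g' - unt A - (dif A v + mul A y v + mul A v y)) = 0"
   unfolding f_diff[OF AC(5)[OF m U] hdm[OF y(1) c(3)]] f_diff[OF m U] fm[OF y(1) c(3)] fD(2)[OF c(1,2)] fD(3) e(3) y(2) by simp
 qed
 moreover have "mul A g' g - unt A - (dif A w + mul A x w + mul A w x) : K 0"
 proof (rule K)
  have m: "mul A g' g : car A 0" using mul_closed[OF A c(2,1)] by simp
  show "mul A g' g - unt A - (dif A w + mul A x w + mul A w x) : car A 0" by (intro AC(5) m U hdm xc c)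
  show "f (mul A g' g - unt A - (dif A w + mul A x w + mul A w x)) = 0"
   unfolding f_diff[OF AC(5)[OF m U] hdm[OF xc c(4)]] f_diff[OF m U] fm[OF xc c(4)] fD(2)[OF c(2,1)] fD(3) e(4) by simp
 qed
 ultimately show ?thesis unfolding equiv_mod_def using y(1) c by blast
qed

end

lemma equiv_mod_zero_iso:
 assumes B: "curved_algebra B" and x: "x : MC B" and eq: "equiv_mod B (%_. {0}) x y g g' v g'' w"
 shows "y : MC B" "iso_in (H0 (MC_dg B)) x y (h0_class (MC_dg B) x y g)"
proof -
 note E = eq[unfolded equiv_mod_def singleton_iff]
 have yc: "y : car B 1" and g: "g : car B 0" "g' : car B 0" "v : car B (- 1)" "g'' : car B 0" "w : car B (- 1)" using E by blast+
 show y: "y : MC B" using E by (simp add: MC_def)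
 have z: "dif B g + mul B y g - ksign 0 (mul B g x) = 0" "dif B g' + mul B x g' - ksign 0 (mul B g' y) = 0"
  "dif B g'' + mul B x g'' - ksign 0 (mul B g'' y) = 0"
  using E by simp_all
 have k: "ksign (- 1) a = - a" for a :: "'a => 'b" by (simp add: ksign_def)
 have h: "mul B g g' = unt B + (dif B v + mul B y v - ksign (- 1) (mul B v y))"
  "mul B g'' g = unt B + (dif B w + mul B x w - ksign (- 1) (mul B w x))"
  using E by (simp_all add: k algebra_simps)
 obtain s where s: "s : car B (- 1)" "mul B g' g = unt B + (dif B s + mul B x s - ksign (- 1) (mul B s x))"
  using homotopy_inverse[OF B x y g(1) z(1) g(2) z(2) g(4) z(3) g(3) h(1) g(5) h(2)] by blast
 show "iso_in (H0 (MC_dg B)) x y (h0_class (MC_dg B) x y g)"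
  by (rule iso_in_H0_MC_I[OF B x y g(1) z(1) g(2) z(2) g(3) h(1) s])
qed

section \<open>Injections are strong cofibrations\<close>

context
 fixes C :: "('x, 'k::field) curved_coalg" and C' :: "('y, 'k) curved_coalg" and A :: "('a, 'k) curved_alg"
  and \<phi> b f
 assumes C: "curved_coalgebra C" and C': "curved_coalgebra C'" and A: "curved_algebra A"
  and hom: "curved_hom (dual_alg C') (dual_alg C) \<phi> b" and f: "underlying_map C C' \<phi> f"
begin

private abbreviation "\<Phi> \<equiv> conv_map C C' A \<phi>"
private abbreviation "B1 \<equiv> conv_alg C A"
private abbreviation "B2 \<equiv> conv_alg C' A"
private lemmas fl = underlying_mapD(1)[OF f]
private lemmas alg1 = conv_algebra[OF C A]
private lemmas alg2 = conv_algebra[OF C' A]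
private lemmas \<Phi>D = curved_homD[OF conv_map_hom[OF C C' A hom f]]

text \<open>The image is what the kernel of \<phi> annihilates. This kernel is a differential ideal,
  as the twist of the differential by \<open>b\<close> disappears where \<phi> vanishes, and so
  \<open>perp_subcoalgebra\<close> applies.\<close>

lemma image_subcoalgebra: "subcoalgebra C' (%m. f ` ccar C m)"
proof -
 let ?K = "%n. {\<xi> : dual (ccar C') n. \<phi> \<xi> = 0}"
 note hD = curved_homD[OF hom]
 note R = curved_coalgebraD(6)[OF C] and R' = curved_coalgebraD(6)[OF C']
 note gC' = curved_coalgebraD(1)[OF C'] and gC = curved_coalgebraD(1)[OF C]
 have "perp (ccar C') ?K m = f ` ccar C m" for m
 proof
  show "f ` ccar C m \<subseteq> perp (ccar C') ?K m"
  proof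
   fix d assume "d : f ` ccar C m"
   then obtain c where c: "d = f c" "c : ccar C m" by blast
   have "\<xi> d = 0" if "\<xi> : ?K (- m)" for \<xi>
   proof -
    have "\<phi> \<xi> c = \<xi> (f c)" using underlying_mapD(2)[OF f, of \<xi> "- m" c] that c(2) by simp
    then show ?thesis using that c(1) by (simp add: pointwise)
   qed
   then show "d : perp (ccar C') ?K m" using linear_intoD(1)[OF fl c(2)] c(1) by (simp add: perp_def)
  qed
  show "perp (ccar C') ?K m \<subseteq> f ` ccar C m"
  proof
   fix d assume d: "d : perp (ccar C') ?K m"
   show "d : f ` ccar C m"
   proof (rule ccontr)
    assume nd: "d ~: f ` ccar C m"
    have sub: "kvs.subspace (f ` ccar C m)" by (rule linear_into_image_subspace[OF fl graded_spaceD(1)[OF gC]])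
    have le: "f ` ccar C m \<subseteq> ccar C' m" using linear_intoD(1)[OF fl] by blast
    have dV: "d : ccar C' m" using d by (simp add: perp_def)
    obtain \<xi> where \<xi>: "\<xi> : dual (ccar C') (- m)" "!!e. e : f ` ccar C m ==> \<xi> e = 0" "\<xi> d = 1"
     by (rule dual_separates[OF gC' sub le dV nd]) (rule that)
    have \<phi>\<xi>: "\<phi> \<xi> : dual (ccar C) (- m)" using hD(7)[of \<xi> "- m"] \<xi>(1) by simp
    have "\<phi> \<xi> = 0"
    proof
     fix c
     show "\<phi> \<xi> c = 0 c"
     proof (cases "c : ccar C m")
      case True
      then show ?thesis using underlying_mapD(2)[OF f \<xi>(1), of c] \<xi>(2) by (simp add: pointwise)
     next
      case False
      then show ?thesis using dual_outside[OF gC \<phi>\<xi>, of c] by (simp add: pointwise)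
     qed
    qed
    then have "\<xi> d = 0" using d \<xi>(1) unfolding perp_def by blast
    then show False using \<xi>(3) by simp
   qed
  qed
 qed
 then have e: "(%m. f ` ccar C m) = perp (ccar C') ?K" by (simp add: fun_eq_iff)
 have dC: "dual (ccar C) n = car (dual_alg C) n" "dual (ccar C') n = car (dual_alg C') n" for n by simp_all
 show ?thesis
  unfolding e
 proof (rule perp_subcoalgebra[OF C'])
  fix p q :: int and \<xi> \<zeta>
  show "?K p \<subseteq> dual (ccar C') p" by blast
  show "mul (dual_alg C') \<xi> \<zeta> : ?K (p + q)" if "\<xi> : ?K p" "\<zeta> : dual (ccar C') q"
   using that mul_closed[OF R', of \<xi> p \<zeta> q] hD(2)[of \<xi> p \<zeta> q] mul_zero_left[OF R hD(7), of \<zeta> q] by simp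
  show "mul (dual_alg C') \<xi> \<zeta> : ?K (p + q)" if "\<xi> : dual (ccar C') p" "\<zeta> : ?K q"
   using that mul_closed[OF R', of \<xi> p \<zeta> q] hD(2)[of \<xi> p \<zeta> q] mul_zero_right[OF R hD(7), of \<xi> p] by simp
  show "dif (dual_alg C') \<xi> : ?K (p + 1)" if "\<xi> : ?K p"
   using that dif_closed[OF R', of \<xi> p] hD(5)[of \<xi> p] dif_zero[OF R] mul_zero_left[OF R hD(4)] mul_zero_right[OF R hD(4)] by simp
 qed
qed

lemma conv_map_kernel:
 assumes F: "F : car B2 n"
 shows "\<Phi> F = 0 \<longleftrightarrow> F : vanish C' A (%m. f ` ccar C m) n"
proof
 assume "\<Phi> F = 0"
 then have "ev C' F (f c) = 0" if "c : homogeneous (ccar C)" for c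
  using ev_conv_map[OF C C' A hom f F that] by (simp add: ev_zero[OF C A])
 then show "F : vanish C' A (%m. f ` ccar C m) n" using F by (fastforce simp: vanish_def homogeneous_def)
next
 assume F': "F : vanish C' A (%m. f ` ccar C m) n"
 show "\<Phi> F = 0"
 proof (rule conv_eqI[OF C A \<Phi>D(7)[OF F] car_closed(1)[OF alg1]])
  fix c assume c: "c : homogeneous (ccar C)"
  have "f c : homogeneous (%m. f ` ccar C m)" using c by (auto simp: homogeneous_def)
  then show "ev C (\<Phi> F) c = ev C 0 c"
   using F' ev_conv_map[OF C C' A hom f F c] by (simp add: vanish_def ev_zero[OF C A])
 qed
qed

context
 assumes inj: "!!n. inj_on f (ccar C n)"
begin

text \<open>A linear map on \<open>C\<close> is transported to the image of \<open>f\<close> by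
  injectivity and then extended linearly to \<open>C'\<close>.\<close>

lemma conv_map_surj: "\<Phi> ` car B2 n = car B1 n"
proof
 show "\<Phi> ` car B2 n \<subseteq> car B1 n" using \<Phi>D(7) by blast
 show "car B1 n \<subseteq> \<Phi> ` car B2 n"
 proof
  fix G assume G: "G : car B1 n"
  note gC = curved_coalgebraD(1)[OF C] and gC' = curved_coalgebraD(1)[OF C']
  note S = subspaceD[OF graded_spaceD(1)[OF gC]]
  \<comment> \<open>The choice admits preimages of any degree. Two preimages of a vector have the
    same degree or are both zero, so injectivity in each degree makes the choice unique.\<close>
  define t where "t d = ev C G (SOME c. (EX m. c : ccar C m) & f c = d)" for d
  have f0: "f 0 = 0" by (rule linear_into_simps(1)[OF fl graded_spaceD(1)[OF gC, of 0]])
  have t: "t (f c) = ev C G c" if c: "c : ccar C m" for c m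
  proof -
   let ?c = "SOME c'. (EX m. c' : ccar C m) & f c' = f c"
   have "(EX m. ?c : ccar C m) & f ?c = f c" by (rule someI[of "%c'. (EX m. c' : ccar C m) & f c' = f c" c]) (use c in blast)
   then obtain m' where m': "?c : ccar C m'" "f ?c = f c" by blast
   have "?c = c"
   proof (cases "m' = m")
    case True
    then show ?thesis using inj[of m, THEN inj_onD, OF m'(2)] m'(1) c by blast
   next
    case False
    have "f c = 0"
     using graded_space_disjoint[OF gC' linear_intoD(1)[OF fl c] _ False[symmetric]] linear_intoD(1)[OF fl m'(1)] m'(2) by simp
    then have "c = 0" "?c = 0"
     using inj[of m, THEN inj_onD, of c 0] inj[of m', THEN inj_onD, of ?c 0] f0 c m' S(1) by auto
    then show ?thesis by simp
   qed
   then show ?thesis by (simp add: t_def)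
  qed
  have lin: "linear_into (f ` ccar C m) (car A (m + n)) t" for m
  proof (rule linear_intoI)
   fix d d' r assume "d : f ` ccar C m"
   then obtain c where c: "d = f c" "c : ccar C m" by blast
   note l = linear_intoD[OF ev_linear[OF C A G]]
   show "t d : car A (m + n)" using l(1)[OF c(2)] t[OF c(2)] c(1) by simp
   show "t (scl r d) = scl r (t d)"
    using l(2)[OF c(2)] t[OF c(2)] t[OF S(3)[OF c(2)]] c(1) linear_intoD(2)[OF fl c(2)] by simp
   assume "d' : f ` ccar C m"
   then obtain c' where c': "d' = f c'" "c' : ccar C m" by blast
   show "t (d + d') = t d + t d'"
    using l(3)[OF c(2) c'(2)] t[OF c(2)] t[OF c'(2)] t[OF S(2)[OF c(2) c'(2)]] c(1) c'(1) linear_intoD(3)[OF fl c(2) c'(2)] by simp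
  qed
  obtain t' where t': "!!m. linear_into (ccar C' m) (car A (m + n)) t'" "!!m c. c : f ` ccar C m ==> t' c = t c"
   by (rule graded_extend[OF gC' subcoalgebraD(1,2)[OF image_subcoalgebra] lin]) (rule that)
  obtain F where F: "F : car B2 n" "!!c. c : homogeneous (ccar C') ==> ev C' F c = t' c"
   by (rule conv_build[OF C' A t'(1)]) (rule that)
  have "\<Phi> F = G"
  proof (rule conv_eqI[OF C A \<Phi>D(7)[OF F(1)] G])
   fix c assume c: "c : homogeneous (ccar C)"
   then obtain m where m: "c : ccar C m" by (rule homogeneousE)
   have "ev C (\<Phi> F) c = t' (f c)"
    using ev_conv_map[OF C C' A hom f F(1) c] F(2)[OF homogeneousI[where V = "ccar C'", OF linear_intoD(1)[OF fl m]]] by simp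
   also have "... = ev C G c" using t'(2)[of "f c" m] t[OF m] m by simp
   finally show "ev C (\<Phi> F) c = ev C G c" .
  qed
  then show "G : \<Phi> ` car B2 n" using F(1) by blast
 qed
qed

text \<open>\<open>full_lift\<close> changes the lifted data only by maps vanishing on the image of
  \<open>f\<close>, so the corrected object and morphism still map exactly to the given ones, as
  strictness on objects demands.\<close>

lemma conv_map_isofibration:
 "isofibration (H0 (MC_dg B2)) (H0 (MC_dg B1)) (MC_obj_map \<Phi> (conv_shift C A b))
  (H0_map (MC_dg B1) (MC_obj_map \<Phi> (conv_shift C A b)) (MC_hom_map \<Phi>))"
 unfolding isofibration_def
proof (intro ballI allI impI)
 let ?s = "conv_shift C A b"
 let ?Fo = "MC_obj_map \<Phi> ?s"
 fix x y L assume "x : cobj (H0 (MC_dg B2))" "y : cobj (H0 (MC_dg B1))" and iso: "iso_in (H0 (MC_dg B1)) (?Fo x) y L"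
 then have x: "x : MC B2" and y: "y : MC B1" by (simp_all add: H0_def MC_dg_def)
 have xc: "x : car B2 1" and yc: "y : car B1 1" using x y by (simp_all add: MC_def)
 have Fx: "?Fo x : MC B1" unfolding MC_obj_map_def by (rule curved_hom_MC[OF alg2 alg1 conv_map_hom[OF C C' A hom f] x])
 have Fxc: "?Fo x : car B1 1" using Fx by (simp add: MC_def)
 obtain g g' v w where g: "L = h0_class (MC_dg B1) (?Fo x) y g" "g : car B1 0" "dif B1 g + mul B1 y g - ksign 0 (mul B1 g (?Fo x)) = 0"
   "g' : car B1 0" "dif B1 g' + mul B1 (?Fo x) g' - ksign 0 (mul B1 g' y) = 0"
   "v : car B1 (- 1)" "mul B1 g g' = unt B1 + (dif B1 v + mul B1 y v - ksign (- 1) (mul B1 v y))"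
   "w : car B1 (- 1)" "mul B1 g' g = unt B1 + (dif B1 w + mul B1 (?Fo x) w - ksign (- 1) (mul B1 w (?Fo x)))"
  by (rule iso_in_H0_MC_E[OF alg1 Fx y iso]) (rule that)
 have lift: "EX F:car B2 n. \<Phi> F = G" if "G : car B1 n" for G n
 proof -
  have "G : \<Phi> ` car B2 n" unfolding conv_map_surj by (rule that)
  then show ?thesis by (rule imageE) blast
 qed
 \<comment> \<open>The functor adds the shift to objects, so it is the difference that has to be
   lifted.\<close>
 have "y - ?s : car B1 1" by (rule car_closed(5)[OF alg1 yc \<Phi>D(4)])
 then obtain y0 where y0: "y0 : car B2 1" "\<Phi> y0 = y - ?s" using lift by blast
 obtain g0 where g0: "g0 : car B2 0" "\<Phi> g0 = g" using lift[OF g(2)] by blast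
 obtain g0' where g0': "g0' : car B2 0" "\<Phi> g0' = g'" using lift[OF g(4)] by blast
 obtain v0 where v0: "v0 : car B2 (- 1)" "\<Phi> v0 = v" using lift[OF g(6)] by blast
 obtain w0 where w0: "w0 : car B2 (- 1)" "\<Phi> w0 = w" using lift[OF g(8)] by blast
 have k: "ksign (- 1) a = - a" for a :: "('x, 'k) graded \<times> (('x => 'k) \<times> 'a) => 'k" by (simp add: ksign_def)
 let ?M = "%m. f ` ccar C m"
 have "equiv_mod B2 (vanish C' A ?M) x y0 g0 g0' v0 g0' w0"
 proof (rule equiv_mod_kernel[OF alg2 alg1 conv_map_hom[OF C C' A hom f] x y0(1) _ y g0(1) g0'(1) v0(1) w0(1)])
  show "?s + \<Phi> y0 = y" by (simp add: y0(2))
  show "F : vanish C' A ?M n" if "F : car B2 n" "\<Phi> F = 0" for F n using conv_map_kernel[OF that(1)] that(2) by blast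
 qed (use g(3,5,7,9) g0(2) g0'(2) v0(2) w0(2) in \<open>simp_all add: k MC_obj_map_def\<close>)
 then obtain y1 g1 g1' v1 g1'' w1 where l: "equiv_mod B2 (%_. {0}) x y1 g1 g1' v1 g1'' w1"
   and d: "y1 - y0 : vanish C' A ?M 1" "g1 - g0 : vanish C' A ?M 0"
  by (rule full_lift[OF C' A x image_subcoalgebra]) (rule that)
 have c1: "y1 : car B2 1" "g1 : car B2 0" using l by (auto simp: equiv_mod_def)
 have same: "\<Phi> F = \<Phi> G" if "F : car B2 n" "G : car B2 n" "F - G : vanish C' A ?M n" for F G n
 proof -
  have "\<Phi> (F - G) = 0" using conv_map_kernel[OF car_closed(5)[OF alg2 that(1,2)]] that(3) by blast
  then show ?thesis using linear_into_simps(3)[OF \<Phi>D(1) curved_algebraD(13)[OF alg2] that(1,2)] by simp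
 qed
 have py: "?Fo y1 = y" using same[OF c1(1) y0(1) d(1)] y0(2) by (simp add: MC_obj_map_def)
 have pg: "\<Phi> g1 = g" using same[OF c1(2) g0(1) d(2)] g0(2) by simp
 note e = equiv_mod_zero_iso[OF alg2 x l]
 show "EX x':cobj (H0 (MC_dg B2)). EX g'. iso_in (H0 (MC_dg B2)) x x' g' & ?Fo x' = y & H0_map (MC_dg B1) ?Fo (MC_hom_map \<Phi>) x x' g' = L"
 proof (intro bexI exI conjI)
  show "iso_in (H0 (MC_dg B2)) x y1 (h0_class (MC_dg B2) x y1 g1)" by (rule e(2))
  show "y1 : cobj (H0 (MC_dg B2))" using e(1) by (simp add: H0_def MC_dg_def)
  show "?Fo y1 = y" by (rule py)
  \<comment> \<open>The map on \<open>H0\<close> is a union over representatives; each of them is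
    sent to a representative of \<open>L\<close>.\<close>
  have cls: "h0_class (MC_dg B1) (?Fo x) y (\<Phi> a) = L" if a: "a : h0_class (MC_dg B2) x y1 g1" for a
  proof -
   obtain t where t: "a = g1 + (dif B2 t + mul B2 y1 t - ksign (- 1) (mul B2 t x))" "t : car B2 (- 1)"
    using a unfolding h0_class_MC[OF alg2] by blast
   have "dif B2 t + mul B2 y1 t - ksign (- 1) (mul B2 t x) : car B2 0" using MC_dif_closed[OF alg2 xc c1(1) t(2)] by simp
   then have "\<Phi> a = g + (dif B1 (\<Phi> t) + mul B1 y (\<Phi> t) - ksign (- 1) (mul B1 (\<Phi> t) (?Fo x)))"
    using curved_hom_MC_dif[OF alg2 alg1 conv_map_hom[OF C C' A hom f] xc c1(1) t(2)] linear_intoD(3)[OF \<Phi>D(1) c1(2)] pg py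
    unfolding t(1) MC_obj_map_def by simp
   then show ?thesis using h0_class_shift[OF alg1 Fxc yc \<Phi>D(7)[OF t(2)]] g(1) by simp
  qed
  have "g1 : h0_class (MC_dg B2) x y1 g1" by (rule h0_class_self[OF alg2 xc c1(1)])
  then show "H0_map (MC_dg B1) ?Fo (MC_hom_map \<Phi>) x y1 (h0_class (MC_dg B2) x y1 g1) = L"
   using cls unfolding H0_map_def MC_hom_map_def py by blast
 qed
qed

lemma injection_fibration:
 "dg_fibration (MC_dg B2) (MC_dg B1) (MC_obj_map \<Phi> (conv_shift C A b)) (MC_hom_map \<Phi>)"
 unfolding dg_fibration_def
proof (intro conjI ballI allI)
 show "dg_functor (MC_dg B2) (MC_dg B1) (MC_obj_map \<Phi> (conv_shift C A b)) (MC_hom_map \<Phi>)"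
  by (rule dg_functor_MC[OF alg2 alg1 conv_map_hom[OF C C' A hom f]])
 show "MC_hom_map \<Phi> x y ` hom (MC_dg B2) x y n = hom (MC_dg B1) (MC_obj_map \<Phi> (conv_shift C A b) x) (MC_obj_map \<Phi> (conv_shift C A b) y) n" for x y n
  using conv_map_surj[of n] by (simp add: MC_dg_def MC_hom_map_def image_def)
qed (rule conv_map_isofibration)

end

end

section \<open>Strong cofibrations are injections\<close>

text \<open>The algebra \<open>k[s]/s\<^sup>2\<close> with \<open>s\<close> of degree \<open>- 1\<close> and \<open>d s = 1\<close>; the indicator functions of \<open>i\<close> and \<open>j\<close> are \<open>1\<close> and \<open>s\<close>.\<close>

definition cone_unit_alg :: "'a => 'a => ('a, 'k::field) curved_alg" where
 "cone_unit_alg i j =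
   \<lparr> car = (%n. {a. (n = 0 | a i = 0) & (n = - 1 | a j = 0) & (ALL l. l ~= i & l ~= j --> a l = 0)}),
    mul = (%a b l. if l = i then a i * b i else if l = j then a i * b j + a j * b i else 0),
    unt = (%l. if l = i then 1 else 0),
    dif = (%a l. if l = i then a j else 0),
    cur = 0 \<rparr>"

lemma curved_algebra_cone_unit:
 assumes ij: "i ~= j"
 shows "curved_algebra (cone_unit_alg i j :: ('a, 'k::field) curved_alg)"
proof -
 let ?A = "cone_unit_alg i j :: ('a, 'k) curved_alg"
 have sub: "kvs.subspace (car ?A n)" for n
  by (auto simp: cone_unit_alg_def kvs.subspace_def scl_def pointwise)
 have gr: "graded_space (car ?A)"
  unfolding graded_space_def
 proof (intro conjI allI impI ballI sub)
  fix N :: "int set" and v n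
  assume *: "finite N & (ALL n:N. v n : car ?A n) & (\<Sum>n\<in>N. v n) = 0" and n: "n : N"
  have s: "(\<Sum>n\<in>N. v n l) = 0" for l
  proof -
   have "(\<Sum>n\<in>N. v n) l = 0" using * by (simp add: pointwise)
   then show ?thesis by (simp only: sum_fun)
  qed
  have "(\<Sum>n\<in>N. v n i) = (\<Sum>n\<in>N. if n = 0 then v 0 i else 0)" "(\<Sum>n\<in>N. v n j) = (\<Sum>n\<in>N. if n = - 1 then v (- 1) j else 0)"
   using * by (intro sum.cong; force simp: cone_unit_alg_def)+
  then have "0 : N ==> v 0 i = 0" "- 1 : N ==> v (- 1) j = 0" using s * by (simp_all add: sum.delta)
  moreover have "v n : car ?A n" using * n by blast
  ultimately have "v n l = 0" for l
   using n by (cases "l = i"; cases "l = j") (auto simp: cone_unit_alg_def)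
  then show "v n = 0" by (simp add: fun_eq_iff pointwise)
 qed
 show ?thesis
  by (rule curved_algebraI[OF gr])
   (use ij in \<open>auto simp: linear_into_def cone_unit_alg_def fun_eq_iff scl_def pointwise algebra_simps ksign_def\<close>)
qed

text \<open>If \<open>f c\<close> is zero, a preimage of \<xi> tensored with the unit takes the
  value 0 at \<open>f c\<close>, and this value is \<open>\<xi> c\<close> times the unit; so every
  functional kills \<open>c\<close>. Surjectivity on homs is at hand because the source has an
  object.\<close>

lemma fibration_injection:
 fixes C :: "('c, 'k::field) curved_coalg" and C' :: "('d, 'k) curved_coalg"
 assumes C: "curved_coalgebra C" and C': "curved_coalgebra C'"
  and hom: "curved_hom (dual_alg C') (dual_alg C) \<phi> b" and f: "underlying_map C C' \<phi> f" and ij: "i ~= (j :: 'a)"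
  and fib: "dg_fibration (MC_dg (conv_alg C' (cone_unit_alg i j :: ('a, 'k) curved_alg))) (MC_dg (conv_alg C (cone_unit_alg i j)))
   (MC_obj_map (conv_map C C' (cone_unit_alg i j) \<phi>) (conv_shift C (cone_unit_alg i j) b)) (MC_hom_map (conv_map C C' (cone_unit_alg i j) \<phi>))"
 shows "inj_on f (ccar C n)"
proof -
 let ?A = "cone_unit_alg i j :: ('a, 'k) curved_alg"
 let ?B = "conv_alg C' ?A"
 have A: "curved_algebra ?A" by (rule curved_algebra_cone_unit[OF ij])
 note B = conv_algebra[OF C' A]
 note R' = curved_coalgebraD(6)[OF C']
 define \<epsilon> where "\<epsilon> = (%l. if l = j then 1 else 0 :: 'k)"
 have \<epsilon>: "\<epsilon> : car ?A (- 1)" "dif ?A \<epsilon> = unt ?A" "mul ?A \<epsilon> \<epsilon> = 0" "cur ?A = 0"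
  using ij by (auto simp: cone_unit_alg_def \<epsilon>_def fun_eq_iff pointwise)
 note U = curved_algebraD(5)[OF A]
 have h: "ccur C' : dual (ccar C') 2" "counit C' : dual (ccar C') 0" by (rule curved_coalgebraD[OF C'])+
 let ?x = "- emb C' (ccur C') \<epsilon>"
 have e0: "emb C' \<xi> (0 :: 'a => 'k) = 0" for \<xi> by (auto simp: emb_def family_def tens_def fun_eq_iff pointwise)
 have e0': "emb C' 0 a = 0" for a :: "'a => 'k" by (auto simp: emb_def family_def tens_def restr_def fun_eq_iff pointwise)
 have E: "emb C' (ccur C') \<epsilon> : car ?B 1" using emb_closed[OF C' A h(1) \<epsilon>(1)] by simp
 \<comment> \<open>The curvature is h \<otimes> 1. As dh = 0, ds = 1 and h has even degree, d(h
   \<otimes> s) = h \<otimes> 1, and the square of h \<otimes> s vanishes with s^2.\<close>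
 have "?x : MC ?B"
 proof -
  have "mul ?B (emb C' (ccur C') \<epsilon>) (emb C' (ccur C') \<epsilon>) = 0"
   unfolding emb_mul[OF C' A h(1) \<epsilon>(1) h(1) \<epsilon>(1)] \<epsilon>(3) e0 by simp
  moreover have "mul ?B (- X) (- X) = mul ?B X X" if "X : car ?B 1" for X
   using mul_diff_left[OF B car_closed(1)[OF B] that car_closed(4)[OF B that]] mul_zero_left[OF B car_closed(4)[OF B that]]
    mul_diff_right[OF B that car_closed(1)[OF B] that] mul_zero_right[OF B that] by simp
  moreover have "dif ?B ?x = - emb C' (ccur C') (unt ?A)"
  proof -
   have "dif ?B (emb C' (ccur C') \<epsilon>) = emb C' (ccur C') (unt ?A)"
    using emb_dif[OF C' A h(1) \<epsilon>(1)] curved_algebraD(11)[OF R'] e0' by (simp add: \<epsilon>(2))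
   then show ?thesis using dif_diff[OF B car_closed(1)[OF B] E] dif_zero[OF B] by simp
  qed
  moreover have "cur ?B = emb C' (ccur C') (unt ?A)" using emb_cur[OF C' A] e0 by (simp add: \<epsilon>(4))
  ultimately show ?thesis using E car_closed(4)[OF B E] by (simp add: MC_def)
 qed
 then have surj: "conv_map C C' ?A \<phi> ` car ?B m = car (conv_alg C ?A) m" for m
  using fib unfolding dg_fibration_def by (auto simp: MC_dg_def MC_hom_map_def image_def)
 note gC = curved_coalgebraD(1)[OF C] and fl = underlying_mapD(1)[OF f]
 have ker: "c = 0" if c: "c : ccar C n" and fc: "f c = 0" for c
 proof (rule dual_separates_zero[OF gC c])
  fix \<xi> assume \<xi>: "\<xi> : dual (ccar C) (- n)"
  have hc: "c : homogeneous (ccar C)" by (rule homogeneousI[where V = "ccar C", OF c])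
  have "emb C \<xi> (unt ?A) : car (conv_alg C ?A) (- n)" using emb_closed[OF C A \<xi> U] by simp
  then have "emb C \<xi> (unt ?A) : conv_map C C' ?A \<phi> ` car ?B (- n)" unfolding surj .
  then obtain F where F: "F : car ?B (- n)" "emb C \<xi> (unt ?A) = conv_map C C' ?A \<phi> F" by (rule imageE)
  have "scl (\<xi> c) (unt ?A) = ev C' F (f c)"
   using ev_conv_map[OF C C' A hom f F(1) hc] ev_emb[OF C A \<xi> U hc] F(2) by simp
  also have "... = 0"
   unfolding fc by (rule linear_into_simps(1)[OF ev_linear[OF C' A F(1)] graded_spaceD(1)[OF curved_coalgebraD(1)[OF C'], of 0]])
  finally have "scl (\<xi> c) (unt ?A) = 0" .
  from fun_cong[OF this, of i] show "\<xi> c = 0" by (simp add: scl_def cone_unit_alg_def pointwise)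
 qed
 show ?thesis
 proof (rule inj_onI)
  fix c c' assume c: "c : ccar C n" "c' : ccar C n" "f c = f c'"
  have "c - c' = 0"
   by (rule ker) (use c subspaceD(5)[OF graded_spaceD(1)[OF gC]] linear_into_simps(3)[OF fl graded_spaceD(1)[OF gC]] in auto)
  then show "c = c'" by simp
 qed
qed

theorem theorem10p6:
  fixes C :: "('c, 'k::field) curved_coalg"
    and C' :: "('d, 'k) curved_coalg"
    and \<phi> :: "(('d \<Rightarrow> 'k) \<Rightarrow> 'k) \<Rightarrow> (('c \<Rightarrow> 'k) \<Rightarrow> 'k)"
    and b :: "('c \<Rightarrow> 'k) \<Rightarrow> 'k"
  assumes perfect: "perfect_field TYPE('k)"
    and C: "curved_coalgebra C" and C': "curved_coalgebra C'"
    and hom: "curved_coalgebra_hom C C' \<phi> b"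
    and universe_infinite: "infinite (UNIV :: 'a set)"
    and universe_large: "\<exists>e :: 'd \<Rightarrow> 'a. inj e"
  shows "curved_coalgebra_injection C C' \<phi> \<longleftrightarrow>
           (\<forall>A :: ('a, 'k) curved_alg. curved_algebra A \<longrightarrow>
              dg_fibration (MC_dg (conv_alg C' A)) (MC_dg (conv_alg C A))
                (MC_obj_map (conv_map C C' A \<phi>) (conv_shift C A b))
                (MC_hom_map (conv_map C C' A \<phi>)))"
proof
 have h: "curved_hom (dual_alg C') (dual_alg C) \<phi> b"
  using hom by (simp add: curved_coalgebra_hom_def pseudocompact_curved_hom_def)
 {
  assume "curved_coalgebra_injection C C' \<phi>"
  then obtain f where "underlying_map C C' \<phi> f" "!!n. inj_on f (ccar C n)" unfolding curved_coalgebra_injection_def by blast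
  then show "ALL A :: ('a, 'k) curved_alg. curved_algebra A -->
       dg_fibration (MC_dg (conv_alg C' A)) (MC_dg (conv_alg C A))
        (MC_obj_map (conv_map C C' A \<phi>) (conv_shift C A b))
        (MC_hom_map (conv_map C C' A \<phi>))"
   using injection_fibration[OF C C' _ h] by blast
 }
 assume fib: "ALL A :: ('a, 'k) curved_alg. curved_algebra A -->
       dg_fibration (MC_dg (conv_alg C' A)) (MC_dg (conv_alg C A))
        (MC_obj_map (conv_map C C' A \<phi>) (conv_shift C A b))
        (MC_hom_map (conv_map C C' A \<phi>))"
 \<comment> \<open>Two points of the universe carry the basis 1, s of the test algebra.\<close>
 obtain i j :: 'a where ij: "i ~= j"
  using universe_infinite by (metis (full_types) finite.emptyI finite_insert UNIV_I finite_subset insertI1 subsetI)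
 obtain f where f: "underlying_map C C' \<phi> f" by (rule underlying_map_exists[OF C C' hom])
 have "inj_on f (ccar C n)" for n
  by (rule fibration_injection[OF C C' h f ij fib[rule_format, OF curved_algebra_cone_unit[OF ij]]])
 then show "curved_coalgebra_injection C C' \<phi>" unfolding curved_coalgebra_injection_def using f by blast
qed

end
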